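(* As $\delta\to0$ (possibly along a subsequence), there is a function $u$ defined on $\Omega_T$ such that, for every fixed $t_0\in(0,T)$, $u_\delta\to u$ strongly in $L^2(\Omega^2_T)$, $\nabla(bu_\delta)\rightharpoonup\nabla(bu)$ weakly in $L^2(\Omega^2_T)$, $\partial_tu_\delta\rightharpoonup\partial_tu$ weakly in $L^2(\Omega^2\times(t_0,T))$, and $u_\delta\rightharpoonup u$ weakly in $L^2(0,T;L^2_{loc}(\Omega^1))$. Moreover: (i) on $\Omega^2$, $u$ is a weak solution of $\partial_tu-\Delta(bu)=f$ in $\Omega^2_T$, $\partial_\nu(bu)=0$ on $\partial\Omega\times(0,T)$, $bu=0$ on $\Gamma\times(0,T)$, $u(\cdot,0)=\bar u$ in $\Omega^2$; that is, $bu\in L^2(0,T;H^1(\Omega^2))$ with $bu=0$ on $\Gamma\times(0,T)$ and $\int_{\Omega^2_T}[-u\,\partial_t\varphi+\nabla(bu)\cdot\nabla\varphi]\,dx\,dt=\int_{\Omega^2}\bar u\varphi(\cdot,0)\,dx+\int_{\Omega^2_T}f\varphi\,dx\,dt$ for all $\varphi\in H^1(\Omega^2_T)$ with $\varphi=0$ on $\Gamma\times(0,T)$ and at $t=T$; (ii) on $\Omega^1$, $u$ solves $\partial_tu=f$ in $\Omega^1_T$ with $u(\cdot,0)=\bar u$, i.e. $u=F$ in $\Omega^1_T$, where $F(x,t)=\bar u(x)+\int_0^tf(x,\tau)\,d\tau$.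
   Context: Let $n\ge2$, $\Omega\subset\mathbb R^n$ a smooth bounded open set, $T>0$, $\Omega_T=\Omega\times(0,T)$, and for a set $G$, $G_T=G\times(0,T)$. Let $\Omega^1$ be a smooth bounded open set with $\overline{\Omega^1}\subset\Omega$, $\Omega^2=\Omega\setminus\overline{\Omega^1}$, $\Gamma=\partial\Omega^1$. Let $b\in L^\infty(\Omega)$ (independent of time) with $b\ge C>0$, and for $0<\delta\le1$ let $b_\delta=\delta b$ on $\Omega^1$, $b_\delta=b$ on $\Omega^2$. Let $f\in L^2(\Omega_T)$, $\bar u\in L^2(\Omega)$. $u_\delta$ denotes the weak solution of $\partial_tu-\Delta(b_\delta u)=f$ in $\Omega_T$, $\partial_\nu(b_\delta u)=0$ on $\partial\Omega\times(0,T)$, $u(\cdot,0)=\bar u$, i.e. $u_\delta\in H^1(t_0,T;L^2(\Omega))\cap C([0,T];L^2(\Omega))$ for all $0<t_0<T$, $b_\delta u_\delta\in L^2(0,T;H^1(\Omega))$, $\int_{\Omega_T}[\partial_tu_\delta\varphi+\nabla(b_\delta u_\delta)\cdot\nabla\varphi]=\int_{\Omega_T}f\varphi$ for all $\varphi\in L^2(0,T;H^1(\Omega))$ with support bounded away from $t=0$, and $u_\delta(\cdot,0)=\bar u$ in $L^2$. *)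

theory Defs
  imports "HOL-Analysis.Analysis"
begin

fun Ck_on :: "nat \<Rightarrow> 'b::euclidean_space set \<Rightarrow> ('b \<Rightarrow> real) \<Rightarrow> bool" where
  "Ck_on 0 S f = continuous_on S f"
| "Ck_on (Suc k) S f =
     ((\<forall>x\<in>S. f differentiable (at x)) \<and>
      (\<forall>v. Ck_on k S (\<lambda>x. frechet_derivative f (at x) v)))"

definition smooth_on :: "'b::euclidean_space set \<Rightarrow> ('b \<Rightarrow> real) \<Rightarrow> bool" where
  "smooth_on S f = (\<forall>k. Ck_on k S f)"

definition smooth_bounded_domain :: "'b::euclidean_space set \<Rightarrow> bool" where
  "smooth_bounded_domain D =
     (open D \<and> bounded D \<and>
      (\<exists>\<rho>. smooth_on UNIV \<rho> \<and> D = {x. \<rho> x < 0} \<and>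
           (\<forall>x. \<rho> x = 0 \<longrightarrow> frechet_derivative \<rho> (at x) \<noteq> (\<lambda>v. 0))))"

definition test_fun :: "'b::euclidean_space set \<Rightarrow> ('b \<Rightarrow> real) \<Rightarrow> bool" where
  "test_fun Q \<psi> = (smooth_on UNIV \<psi> \<and> compact (closure {z. \<psi> z \<noteq> 0})
                    \<and> closure {z. \<psi> z \<noteq> 0} \<subseteq> Q)"

definition grad_x :: "('a::euclidean_space \<times> real \<Rightarrow> real) \<Rightarrow> 'a \<times> real \<Rightarrow> 'a" where
  "grad_x \<psi> z = (\<Sum>i\<in>Basis. frechet_derivative \<psi> (at z) (i, 0) *\<^sub>R i)"

definition d_t :: "('a::euclidean_space \<times> real \<Rightarrow> real) \<Rightarrow> 'a \<times> real \<Rightarrow> real" where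
  "d_t \<psi> z = frechet_derivative \<psi> (at z) (0, 1)"

definition L2 :: "'b::euclidean_space set \<Rightarrow> ('b \<Rightarrow> real) \<Rightarrow> bool" where
  "L2 S v = (v \<in> borel_measurable (lebesgue_on S) \<and> integrable (lebesgue_on S) (\<lambda>z. (v z)\<^sup>2))"

definition L2v :: "'b::euclidean_space set \<Rightarrow> ('b \<Rightarrow> 'a::euclidean_space) \<Rightarrow> bool" where
  "L2v S G = (G \<in> borel_measurable (lebesgue_on S) \<and> integrable (lebesgue_on S) (\<lambda>z. (norm (G z))\<^sup>2))"

definition weak_grad_x :: "('a::euclidean_space \<times> real) set \<Rightarrow> ('a \<times> real \<Rightarrow> real) \<Rightarrow> ('a \<times> real \<Rightarrow> 'a) \<Rightarrow> bool" where
  "weak_grad_x Q v G =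
     (\<forall>\<psi>. test_fun Q \<psi> \<longrightarrow> (\<forall>i\<in>Basis.
        integral\<^sup>L (lebesgue_on Q) (\<lambda>z. v z * (grad_x \<psi> z \<bullet> i))
        = - integral\<^sup>L (lebesgue_on Q) (\<lambda>z. (G z \<bullet> i) * \<psi> z)))"

definition weak_dt :: "('a::euclidean_space \<times> real) set \<Rightarrow> ('a \<times> real \<Rightarrow> real) \<Rightarrow> ('a \<times> real \<Rightarrow> real) \<Rightarrow> bool" where
  "weak_dt Q v w =
     (\<forall>\<psi>. test_fun Q \<psi> \<longrightarrow>
        integral\<^sup>L (lebesgue_on Q) (\<lambda>z. v z * d_t \<psi> z)
        = - integral\<^sup>L (lebesgue_on Q) (\<lambda>z. w z * \<psi> z))"

definition cyl :: "'a set \<Rightarrow> real \<Rightarrow> real \<Rightarrow> ('a \<times> real) set" where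
  "cyl U a b = U \<times> {a<..<b}"

definition L2H1x :: "'a::euclidean_space set \<Rightarrow> real \<Rightarrow> real \<Rightarrow> ('a \<times> real \<Rightarrow> real) \<Rightarrow> ('a \<times> real \<Rightarrow> 'a) \<Rightarrow> bool" where
  "L2H1x U a b v G = (L2 (cyl U a b) v \<and> L2v (cyl U a b) G \<and> weak_grad_x (cyl U a b) v G)"

text \<open>v (this representative) belongs to C([0,T];L^2(U)).\<close>
definition cont_L2_time :: "'a::euclidean_space set \<Rightarrow> real \<Rightarrow> ('a \<times> real \<Rightarrow> real) \<Rightarrow> bool" where
  "cont_L2_time U T v =
     ((\<forall>t\<in>{0..T}. L2 U (\<lambda>x. v (x, t))) \<and>
      (\<forall>t\<in>{0..T}. ((\<lambda>s. integral\<^sup>L (lebesgue_on U) (\<lambda>x. (v (x, s) - v (x, t))\<^sup>2)) \<longlongrightarrow> 0)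
                     (at t within {0..T})))"

definition bdelta :: "'a set \<Rightarrow> ('a \<Rightarrow> real) \<Rightarrow> real \<Rightarrow> 'a \<Rightarrow> real" where
  "bdelta \<Omega>1 b \<delta> x = (if x \<in> \<Omega>1 then \<delta> * b x else b x)"

text \<open>Weak solution of  u_t - Laplace(bd u) = f in Omega_T, d_nu(bd u)=0, u(0)=ubar.\<close>
definition weak_sol ::
  "'a::euclidean_space set \<Rightarrow> real \<Rightarrow> ('a \<Rightarrow> real) \<Rightarrow> ('a \<times> real \<Rightarrow> real) \<Rightarrow> ('a \<Rightarrow> real)
   \<Rightarrow> ('a \<times> real \<Rightarrow> real) \<Rightarrow> bool" where
  "weak_sol \<Omega> T bd f ubar u =
     (\<exists>Dt G.
        (\<forall>t0. 0 < t0 \<and> t0 < T \<longrightarrow>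
            L2 (cyl \<Omega> t0 T) u \<and> L2 (cyl \<Omega> t0 T) Dt \<and> weak_dt (cyl \<Omega> t0 T) u Dt)
      \<and> cont_L2_time \<Omega> T u
      \<and> L2H1x \<Omega> 0 T (\<lambda>z. bd (fst z) * u z) G
      \<and> (\<forall>\<phi> G\<phi>. L2H1x \<Omega> 0 T \<phi> G\<phi> \<and> (\<exists>t0>0. \<forall>z\<in>cyl \<Omega> 0 T. snd z < t0 \<longrightarrow> \<phi> z = 0) \<longrightarrow>
            integral\<^sup>L (lebesgue_on (cyl \<Omega> 0 T)) (\<lambda>z. Dt z * \<phi> z + G z \<bullet> G\<phi> z)
            = integral\<^sup>L (lebesgue_on (cyl \<Omega> 0 T)) (\<lambda>z. f z * \<phi> z))
      \<and> integral\<^sup>L (lebesgue_on \<Omega>) (\<lambda>x. (u (x, 0) - ubar x)\<^sup>2) = 0)"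

end

(* Testing with a function Psi and its backward time integral Phi(t) = int_t^T Psi removes the time
derivative: <u,Psi> - <ubar,Psi> + <grad(b_delta u), grad Phi> = <f,Phi>. Backward integration is a
positive operator, so the choice Psi = b_delta u bounds b_delta u and its gradient uniformly in delta,
and difference quotients in time bound t d_t u on Omega^2 although b is only bounded. Since b_delta u
is of order sqrt(delta) in L^2(Omega^1), its weak limit vanishes there: this is the condition bu = 0
on Gamma. Strong convergence on Omega^2 comes from Psi = b_delta u once more, now using positivity for
the difference of the gradient and its limit. In the interior of Omega^1 a localised energy estimate
bounds u_delta; the diffusion term disappears in the limit, which leaves u = F. *)

theory Submission
 imports Defs "HOL-Library.Diagonal_Subsequence"
begin

text \<open>The weak formulation admits only test functions that vanish near t = 0, and the time
  derivative is square integrable only away from 0, whereas a backward integral Phi does not vanish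
  at 0. Cutoffs eta_n bridge the gap; their error is the pairing of u - ubar with eta_n' Phi. The
  mass of eta_n' concentrates at 0, where the slices of u - ubar are small in L^2, while Phi is
  bounded in time on almost every line x = const, so Cauchy-Schwarz with the weight eta_n' removes
  the error. As b is merely bounded, u need not have a weak gradient, and only w = b_delta u can
  serve for testing; strong convergence of u therefore rests on a Minty-type argument, not on a
  compact embedding. The bound on the gradient itself, not on its time integral, comes from Psi =
  (w(t) - w(t+h))/h, whose backward integral is the average of w over (t, t+h). Weak gradients are
  tested with products p(x) q(t), where q is only in L^2: time kernels, shifts and cutoffs can then
  be moved onto q. In the interior estimate both w and the localised gradient are of order
  sqrt(delta), so their product is of order delta, and this factor cancels against the
  coercivity.\<close>

abbreviation (input) BM :: "('a::topological_space => 'b::topological_space) set" where "BM \<equiv> borel_measurable borel"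

abbreviation (input) fder :: "('a::real_normed_vector => real) => 'a => 'a => real" where
 "fder p x \<equiv> frechet_derivative p (at x)"

abbreviation (input) tensor (infixr "\<otimes>" 75) where "p \<otimes> q \<equiv> \<lambda>z. p (fst z) * (q (snd z) :: real)"

abbreviation (input) LIM (infix "~~>" 60) where "X ~~> L \<equiv> (X \<longlongrightarrow> L) sequentially"

abbreviation (input) ind :: "'a set => 'a => real" where "ind \<equiv> indicat_real"

lemmas int_cong = Bochner_Integration.integral_cong[OF refl]

subsection \<open>Square-integrable functions\<close>

text \<open>Domains enter only through extension by zero: every function is Borel on the whole
  space, so one measure and one pairing serve all cylinders, and time kernels and shifts can be
  applied without leaving the domain of definition.\<close>

definition sqi :: "('b::euclidean_space => 'c::euclidean_space) => bool" where
 "sqi f \<longleftrightarrow> f \<in> BM \<and> integrable lborel (%z. (norm (f z))\<^sup>2)"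

definition ip :: "('b::euclidean_space => 'c::euclidean_space) => ('b => 'c) => real" where
 "ip f g = (LBINT z. f z \<bullet> g z)"

lemma sqi_meas [measurable_dest]: "sqi f ==> f \<in> BM"
 by (simp add: sqi_def)

lemma sqi_int: "sqi f ==> integrable lborel (%z. (norm (f z))\<^sup>2)"
 by (simp add: sqi_def)

lemma sqi_dominated:
 assumes "h \<in> BM" "integrable lborel g" "!!z. (norm (h z))\<^sup>2 <= g z"
 shows "sqi h"
proof -
 have "integrable lborel (%z. (norm (h z))\<^sup>2)"
  by (rule Bochner_Integration.integrable_bound[OF assms(2)]) (use assms in \<open>auto intro!: AE_I2 order.trans[OF _ abs_ge_self]\<close>)
 then show ?thesis using assms by (simp add: sqi_def)
qed

lemma sqi_bound:
 assumes "sqi f" "h \<in> BM" "!!z. norm (h z) <= c * norm (f z)"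
 shows "sqi h"
proof (rule sqi_dominated[OF assms(2)])
 show "integrable lborel (%z. c\<^sup>2 * (norm (f z))\<^sup>2)" using sqi_int[OF assms(1)] by simp
 show "(norm (h z))\<^sup>2 <= c\<^sup>2 * (norm (f z))\<^sup>2" for z
  using power_mono[OF assms(3) norm_ge_zero, of z 2] by (simp add: power_mult_distrib)
qed

lemma norm_add_sq_le: "(norm (a + b))\<^sup>2 <= 2 * (norm a)\<^sup>2 + 2 * (norm (b::'c::real_inner))\<^sup>2"
proof -
 have "0 <= (norm (a - b))\<^sup>2" by simp
 moreover have "(norm (a - b))\<^sup>2 + (norm (a + b))\<^sup>2 = 2 * (norm a)\<^sup>2 + 2 * (norm b)\<^sup>2"
  by (simp add: power2_norm_eq_inner inner_simps inner_commute)
 ultimately show ?thesis by linarith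
qed

lemma sqi_add [intro]:
 assumes "sqi f" "sqi g" shows "sqi (%z. f z + g z)"
proof (rule sqi_dominated)
 show "integrable lborel (%z. 2 * (norm (f z))\<^sup>2 + 2 * (norm (g z))\<^sup>2)"
  using sqi_int[OF assms(1)] sqi_int[OF assms(2)] by simp
 show "(norm (f z + g z))\<^sup>2 <= 2 * (norm (f z))\<^sup>2 + 2 * (norm (g z))\<^sup>2" for z
  by (rule norm_add_sq_le)
qed (use assms in measurable)

lemma sqi_bmult:
 assumes "sqi f" "m \<in> BM" "!!z. \<bar>m z\<bar> <= c"
 shows "sqi (%z. m z *\<^sub>R f z)"
proof (rule sqi_bound[OF assms(1), where c=c])
 have [measurable]: "f \<in> BM" using assms(1) by (simp add: sqi_def)
 note assms(2)[measurable]
 show "(%z. m z *\<^sub>R f z) \<in> BM" by measurable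
 show "norm (m z *\<^sub>R f z) <= c * norm (f z)" for z
  using mult_right_mono[OF assms(3)[of z] norm_ge_zero[of "f z"]] by simp
qed

lemma sqi_scaleR [intro]: "sqi f ==> sqi (%z. c *\<^sub>R f z)"
 by (rule sqi_bmult[where c="\<bar>c\<bar>"]) simp_all

lemma sqi_cmult [intro]: "sqi f ==> sqi (%z. c * f z)" for f :: "_ => real"
 using sqi_scaleR[of f c] by simp

lemma sqi_minus [intro]: "sqi f ==> sqi (%z. - f z)"
 using sqi_scaleR[of f "-1"] by simp

lemma sqi_diff [intro]:
 assumes "sqi f" "sqi g" shows "sqi (%z. f z - g z)"
 using sqi_add[OF assms(1) sqi_minus[OF assms(2)]] by simp

lemma sqi_zero [simp, intro]: "sqi (%z. 0)"
 by (simp add: sqi_def)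

lemma sqi_bmult_real:
 fixes f :: "_ => real"
 assumes "sqi f" "m \<in> BM" "!!z. \<bar>m z\<bar> <= c"
 shows "sqi (%z. m z * f z)"
 using sqi_bmult[OF assms] by simp

lemma sqi_inner_bounded:
 assumes "sqi f" "m \<in> BM" "!!z. norm (m z) <= c"
 shows "sqi (%z. f z \<bullet> m z)"
proof (rule sqi_bound[OF assms(1), where c=c])
 show "norm (f z \<bullet> m z) <= c * norm (f z)" for z
  using Cauchy_Schwarz_ineq2[of "f z" "m z"] mult_left_mono[OF assms(3)[of z] norm_ge_zero[of "f z"]]
  by (simp add: mult.commute)
 have [measurable]: "f \<in> BM" using assms(1) by (simp add: sqi_def)
 note assms(2)[measurable]
 show "(%z. f z \<bullet> m z) \<in> BM" by measurable
qed

lemma sqi_scal_vec: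
 fixes f :: "_ => real"
 assumes "sqi f" "m \<in> BM" "!!z. norm (m z) <= c"
 shows "sqi (%z. f z *\<^sub>R m z)"
proof (rule sqi_bound[OF assms(1), where c=c])
 show "norm (f z *\<^sub>R m z) <= c * norm (f z)" for z
  using mult_left_mono[OF assms(3)[of z] norm_ge_zero[of "f z"]] by (simp add: mult.commute)
 have [measurable]: "f \<in> BM" using assms(1) by (simp add: sqi_def)
 note assms(2)[measurable]
 show "(%z. f z *\<^sub>R m z) \<in> BM" by measurable
qed

lemma sqi_comp [intro]: "sqi f ==> sqi (%z. f z \<bullet> i)"
 by (rule sqi_inner_bounded[where c="norm i"]) simp_all

lemma sqi_indicator:
 assumes "sqi f" "A \<in> sets borel" shows "sqi (%z. ind A z *\<^sub>R f z)"
 by (rule sqi_bmult[OF assms(1), where c=1]) (use assms in \<open>simp_all add: indicator_def\<close>)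

lemma sqi_sum [intro]:
 assumes "!!i. i \<in> I ==> sqi (f i)" shows "sqi (%z. \<Sum>i\<in>I. f i z)"
 using assms by (induction I rule: infinite_finite_induct) auto

lemma ip_integrable [intro]:
 assumes "sqi f" "sqi g" shows "integrable lborel (%z. f z \<bullet> g z)"
proof (rule Bochner_Integration.integrable_bound)
 show "integrable lborel (%z. (norm (f z))\<^sup>2 + (norm (g z))\<^sup>2)"
  using sqi_int[OF assms(1)] sqi_int[OF assms(2)] by simp
 have "\<bar>f z \<bullet> g z\<bar> <= (norm (f z))\<^sup>2 + (norm (g z))\<^sup>2" for z
 proof -
  have "\<bar>f z \<bullet> g z\<bar> <= norm (f z) * norm (g z)" by (rule Cauchy_Schwarz_ineq2)
  also have "\<dots> <= (norm (f z))\<^sup>2 + (norm (g z))\<^sup>2"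
   using sum_squares_bound[of "norm (f z)" "norm (g z)"] mult_nonneg_nonneg[OF norm_ge_zero[of "f z"] norm_ge_zero[of "g z"]]
   by (simp only: mult.assoc)
  finally show ?thesis .
 qed
 then show "AE z in lborel. norm (f z \<bullet> g z) <= norm ((norm (f z))\<^sup>2 + (norm (g z))\<^sup>2)"
  by (auto intro!: AE_I2)
 have [measurable]: "f \<in> BM" "g \<in> BM"
  using assms by (simp_all add: sqi_def)
 show "(%z. f z \<bullet> g z) \<in> borel_measurable lborel" by measurable
qed

lemma ip_integrable_real [intro]:
 assumes "sqi f" "sqi g" shows "integrable lborel (%z. f z * (g z::real))"
 using ip_integrable[OF assms] by simp

lemma ip_commute: "ip f g = ip g f"
 by (simp add: ip_def inner_commute)

lemma ip_add_left: "sqi f ==> sqi g ==> sqi h ==> ip (%z. f z + g z) h = ip f h + ip g h"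
 unfolding ip_def inner_add_left by (intro Bochner_Integration.integral_add ip_integrable)

lemma ip_diff_left: "sqi f ==> sqi g ==> sqi h ==> ip (%z. f z - g z) h = ip f h - ip g h"
 unfolding ip_def inner_diff_left by (intro Bochner_Integration.integral_diff ip_integrable)

lemma ip_add_right: "sqi f ==> sqi g ==> sqi h ==> ip h (%z. f z + g z) = ip h f + ip h g"
 by (subst (1 2 3) ip_commute) (rule ip_add_left)

lemma ip_diff_right: "sqi f ==> sqi g ==> sqi h ==> ip h (%z. f z - g z) = ip h f - ip h g"
 by (subst (1 2 3) ip_commute) (rule ip_diff_left)

lemma ip_scaleR_left: "ip (%z. c *\<^sub>R f z) h = c * ip f h"
 by (simp add: ip_def)

lemma ip_scaleR_right: "ip h (%z. c *\<^sub>R f z) = c * ip h f"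
 by (simp add: ip_def)

lemma ip_cmult_left: "ip (%z. c * f z) h = c * ip f (h::_=>real)"
 by (simp add: ip_def mult.assoc)

lemma ip_cmult_right: "ip h (%z. c * f z) = c * ip h (f::_=>real)"
 by (subst (1 2) ip_commute) (rule ip_cmult_left)

lemma ip_minus_right: "ip h (%z. - f z) = - ip h f"
 by (simp add: ip_def)

lemma ip_zero_left [simp]: "ip (%z. 0) h = 0" by (simp add: ip_def)
lemma ip_zero_right [simp]: "ip h (%z. 0) = 0" by (simp add: ip_def)

lemma ip_nonneg: "0 <= ip f f"
 by (simp add: ip_def)

lemma ip_sum_right:
 assumes "!!i. i \<in> I ==> sqi (g i)" "sqi f"
 shows "ip f (%z. \<Sum>i\<in>I. g i z) = (\<Sum>i\<in>I. ip f (g i))"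
 unfolding ip_def inner_sum_right
 by (rule Bochner_Integration.integral_sum) (rule ip_integrable[OF assms(2,1)])

lemma ip_cong_AE:
 assumes "f \<in> BM" "g \<in> BM"
  "f' \<in> BM" "g' \<in> BM"
  "AE z in lborel. f z \<bullet> g z = f' z \<bullet> g' z"
 shows "ip f g = ip f' g'"
proof -
 note assms(1-4)[measurable]
 show ?thesis unfolding ip_def by (rule integral_cong_AE) (measurable, rule assms(5))
qed

text \<open>Expand the nonnegative square of \<open>c f - s g\<close> and divide by
  \<open>c\<close>; the choices \<open>s = 1\<close> and \<open>s = -1\<close> together give the
  absolute value.\<close>

lemma ip_young:
 assumes "sqi f" "sqi g" "0 < c"
 shows "2 * \<bar>ip f g\<bar> <= c * ip f f + ip g g / c"
proof -
 have *: "2 * s * ip f g <= c * ip f f + s\<^sup>2 * ip g g / c" for s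
 proof -
  let ?h = "%z. c *\<^sub>R f z - s *\<^sub>R g z"
  have "0 <= ip ?h ?h" by (rule ip_nonneg)
  also have "ip ?h ?h = c\<^sup>2 * ip f f - 2 * c * s * ip f g + s\<^sup>2 * ip g g"
  proof -
   have "sqi (%z. c *\<^sub>R f z)" "sqi (%z. s *\<^sub>R g z)" "sqi ?h" "sqi f" "sqi g" using assms(1,2) by auto
   then have "ip ?h ?h = c * (c * ip f f) - s * (c * ip f g) - (c * (s * ip g f) - s * (s * ip g g))"
    by (simp only: ip_diff_left ip_diff_right ip_scaleR_left ip_scaleR_right) (simp add: algebra_simps)
   then show ?thesis by (simp only: ip_commute[of g f]) (simp add: algebra_simps power2_eq_square)
  qed
  finally have "2 * c * s * ip f g <= c\<^sup>2 * ip f f + s\<^sup>2 * ip g g" by simp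
  then have "(2 * c * s * ip f g) / c <= (c\<^sup>2 * ip f f + s\<^sup>2 * ip g g) / c"
   using assms(3) by (intro divide_right_mono) auto
  then show ?thesis using assms(3) by (simp add: add_divide_distrib power2_eq_square)
 qed
 show ?thesis using *[of 1] *[of "-1"] by (auto simp: abs_if)
qed

text \<open>Young's inequality with the ratio of the two norms as its weight. Since either norm may
  vanish, the ratio is regularised by \<open>d > 0\<close>, and \<open>d\<close> is so small that
  the resulting error stays below \<open>e\<close>.\<close>

lemma ip_cauchy_schwarz:
 assumes "sqi f" "sqi g"
 shows "\<bar>ip f g\<bar> <= sqrt (ip f f) * sqrt (ip g g)"
proof -
 have *: "\<bar>ip f g\<bar> <= sqrt (ip f f) * sqrt (ip g g) + e" if "e > 0" for e
 proof -
  define A where "A = ip f f" define B where "B = ip g g"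
  have AB: "A \<ge> 0" "B \<ge> 0" by (auto simp: A_def B_def ip_nonneg)
  define a where "a = sqrt A" define b where "b = sqrt B"
  have ab: "a \<ge> 0" "b \<ge> 0" "A = a\<^sup>2" "B = b\<^sup>2" using AB by (auto simp: a_def b_def)
  define d where "d = e / (a + b + 1)"
  have d: "d > 0" using that ab by (auto simp: d_def)
  define c where "c = (b + d) / (a + d)"
  have c: "c > 0" using ab d by (simp add: c_def)
  have "2 * \<bar>ip f g\<bar> <= c * A + B / c" unfolding A_def B_def by (rule ip_young[OF assms c])
  also have "c * A <= (b + d) * a"
  proof -
   have "c * A = (b + d) * a * (a / (a + d))" by (simp add: c_def ab power2_eq_square)
   also have "\<dots> <= (b + d) * a * 1" using ab d by (intro mult_left_mono) auto
   finally show ?thesis by simp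
  qed
  also have "B / c <= (a + d) * b"
  proof -
   have "B / c = (a + d) * b * (b / (b + d))" using ab d by (simp add: c_def ab power2_eq_square)
   also have "\<dots> <= (a + d) * b * 1" using ab d by (intro mult_left_mono) auto
   finally show ?thesis by simp
  qed
  finally have "2 * \<bar>ip f g\<bar> <= (b + d) * a + (a + d) * b" by simp
  also have "\<dots> = 2 * (a * b) + d * (a + b)" by (simp add: algebra_simps)
  also have "d * (a + b) <= e"
  proof -
   have "d * (a + b) = e * ((a + b) / (a + b + 1))" by (simp add: d_def)
   also have "\<dots> <= e * 1" using ab that by (intro mult_left_mono) auto
   finally show ?thesis by simp
  qed
  finally have "2 * \<bar>ip f g\<bar> <= 2 * (a * b) + e" by simp
  then show ?thesis unfolding a_def b_def A_def B_def using that by linarith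
 qed
 show ?thesis by (rule field_le_epsilon[OF *])
qed

lemma ip_self_zero_iff:
 assumes "sqi f" shows "ip f f = 0 \<longleftrightarrow> (AE z in lborel. f z = 0)"
 using integral_nonneg_eq_0_iff_AE[OF sqi_int[OF assms]]
 by (simp add: ip_def power2_norm_eq_inner)

lemma ip_norm: "ip f f = (LBINT z. (norm (f z))\<^sup>2)"
 by (simp add: ip_def power2_norm_eq_inner)

lemma ip_mono:
 assumes "sqi f" "g \<in> BM" "!!z. norm (g z) <= norm (f z)"
 shows "ip g g <= ip f f"
proof -
 have "sqi g" by (rule sqi_bound[OF assms(1,2), where c=1]) (use assms in auto)
 then show ?thesis unfolding ip_norm
  by (intro integral_mono sqi_int assms power_mono) auto
qed

lemma ip_mono_scaled:
 assumes "sqi f" "g \<in> BM" "!!z. norm (g z) <= c * norm (f z)" "0 <= c"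
 shows "ip g g <= c\<^sup>2 * ip f f"
proof -
 have "ip g g <= ip (%z. c *\<^sub>R f z) (%z. c *\<^sub>R f z)"
  by (rule ip_mono) (use assms in auto)
 then show ?thesis by (simp add: ip_scaleR_left ip_scaleR_right power2_eq_square mult.assoc)
qed

lemma L2_dominated_convergence:
 assumes "!!n. F n \<in> BM" "f \<in> BM" "sqi G"
  "!!n z. norm (F n z - f z) <= norm (G z)"
  "!!z. (%n. F n z) ~~> f z"
 shows "(%n. ip (%z. F n z - f z) (%z. F n z - f z)) ~~> 0"
proof -
 have "(%n. LBINT z. (norm (F n z - f z))\<^sup>2) ~~> (\<integral>z. 0 \<partial>(lborel::'a measure))"
 proof (rule integral_dominated_convergence[where w="%z. (norm (G z))\<^sup>2"])
  show "integrable lborel (%z. (norm (G z))\<^sup>2)" by (rule sqi_int[OF assms(3)])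
  show "AE z in lborel. (%n. (norm (F n z - f z))\<^sup>2) ~~> 0"
   using assms(5) by (auto intro!: AE_I2 tendsto_eq_intros simp: LIM_zero_iff)
  show "AE z in lborel. norm ((norm (F n z - f z))\<^sup>2) <= (norm (G z))\<^sup>2" for n
   using assms(4) by (auto intro!: AE_I2 power_mono)
 qed (use assms in measurable)
 then show ?thesis by (simp add: ip_norm)
qed

lemma ip_tendsto_strong:
 assumes "!!n. sqi (F n)" "sqi f" "sqi g"
  "(%n. ip (%z. F n z - f z) (%z. F n z - f z)) ~~> 0"
 shows "(%n. ip g (F n)) ~~> ip g f"
proof (rule Lim_null[THEN iffD2], rule Lim_null_comparison)
 have "norm (ip g (F n) - ip g f) <= sqrt (ip g g) * sqrt (ip (%z. F n z - f z) (%z. F n z - f z))" for n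
  using ip_cauchy_schwarz[of g "%z. F n z - f z"] assms(1-3) by (simp add: ip_diff_right sqi_diff)
 then show "\<forall>\<^sub>F n in sequentially. norm (ip g (F n) - ip g f)
   <= sqrt (ip g g) * sqrt (ip (%z. F n z - f z) (%z. F n z - f z))" by simp
 show "(%n. sqrt (ip g g) * sqrt (ip (%z. F n z - f z) (%z. F n z - f z))) ~~> 0"
  using tendsto_mult[OF tendsto_const tendsto_real_sqrt[OF assms(4)], of "sqrt (ip g g)"] by simp
qed

lemma indicator_sqi:
 assumes "A \<in> sets borel" "emeasure lborel A < \<infinity>"
 shows "sqi (ind A)"
proof -
 have "(%z. (norm (ind A z))\<^sup>2) = ind A"
  by (auto simp: indicator_def)
 then show ?thesis using assms by (auto simp: sqi_def integrable_indicator_iff)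
qed

subsection \<open>Density of box indicators\<close>

text \<open>Requiring the closed boxes to lie in \<open>Q\<close> is what later places smooth bumps
  with compact support inside \<open>Q\<close>. Countability comes from the Lindeloef
  property.\<close>

lemma inner_box_cover:
 fixes Q :: "'b::euclidean_space set"
 assumes "open Q"
 shows "\<exists>A B :: nat => 'b. (\<forall>n. cbox (A n) (B n) \<subseteq> Q) \<and> Q \<subseteq> (\<Union>n. box (A n) (B n))"
proof -
 define \<F> where "\<F> = {box a b |a b. cbox a b \<subseteq> Q}"
 have sub: "S \<subseteq> Q" if "S \<in> \<F>" for S
  using that box_subset_cbox unfolding \<F>_def by fast
 have mem: "\<exists>S\<in>\<F>. x \<in> S" if "x \<in> Q" for x
 proof -
  obtain e where e: "e > 0" "cball x e \<subseteq> Q" using assms open_contains_cball \<open>x \<in> Q\<close> by meson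
  obtain a b where ab: "x \<in> box a b" "box a b \<subseteq> ball x e" using rational_boxes[OF e(1)] by metis
  have "box a b \<noteq> {}" using ab(1) by blast
  then have "cbox a b = closure (box a b)" by (rule closure_box[symmetric])
  also have "\<dots> \<subseteq> cball x e" using closure_mono[OF ab(2)] e(1) by (simp add: closure_ball)
  finally have "cbox a b \<subseteq> Q" using e(2) by (rule subset_trans)
  then show ?thesis using ab(1) unfolding \<F>_def by blast
 qed
 have op: "open S" if "S \<in> \<F>" for S using that unfolding \<F>_def by fastforce
 obtain \<G> where \<G>: "\<G> \<subseteq> \<F>" "countable \<G>" "\<Union>\<G> = \<Union>\<F>"
  by (rule Lindelof[OF op])
 show ?thesis
 proof (cases "\<G> = {}")
  case True
  then have "Q = {}" using \<G>(3) mem by blast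
  moreover have "cbox (One::'b) 0 = {}" using nonempty_Basis by (simp add: box_eq_empty ex_in_conv)
  ultimately show ?thesis by (intro exI[of _ "%_. One"] exI[of _ "%_. 0"]) simp
 next
  case False
  define g where "g = from_nat_into \<G>"
  have g: "range g = \<G>" unfolding g_def using False \<G>(2) by (rule range_from_nat_into)
  have "\<exists>a b. g n = box a b \<and> cbox a b \<subseteq> Q" for n
  proof -
   have "g n \<in> \<F>" using g \<G>(1) by blast
   then show ?thesis unfolding \<F>_def by blast
  qed
  then obtain A B where AB: "!!n. g n = box (A n) (B n)" "!!n. cbox (A n) (B n) \<subseteq> Q" by metis
  have "Q \<subseteq> (\<Union>n. g n)"
  proof
   fix x assume "x \<in> Q"
   then have "x \<in> \<Union>\<G>" using mem \<G>(3) by blast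
   then show "x \<in> (\<Union>n. g n)" using g by blast
  qed
  then have "Q \<subseteq> (\<Union>n. box (A n) (B n))" by (simp only: AB(1))
  then show ?thesis using AB(2) by (intro exI[of _ A] exI[of _ B]) simp
 qed
qed

text \<open>Measure-theoretic induction in L^2: the property passes from boxes to Borel subsets of a
  box by Dynkin's theorem, then to Borel subsets of finite unions of boxes, and finally to
  \<open>h\<close> through simple functions that are cut off to these unions.\<close>

lemma L2_induct:
 fixes P :: "('b::euclidean_space => real) => bool"
 assumes Q: "open Q" and h: "sqi h" "!!z. z \<notin> Q ==> h z = 0"
  and box: "!!a b. cbox a b \<subseteq> Q ==> P (ind (box a b))"
  and add: "!!f g. sqi f ==> sqi g ==> P f ==> P g ==> P (%z. f z + g z)"
  and scale: "!!f c. sqi f ==> P f ==> P (%z. c * f z)"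
  and lim: "!!F f. (!!n::nat. sqi (F n)) ==> (!!n. P (F n)) ==> sqi f ==>
    (%n. ip (%z. F n z - f z) (%z. F n z - f z)) ~~> 0 ==> P f"
 shows "P h"
proof -
 have zero: "P (%z. 0)"
 proof -
  have e: "cbox (One::'b) 0 = {}" using nonempty_Basis by (simp add: box_eq_empty ex_in_conv)
  have "P (ind (box (One::'b) 0))" by (rule box) (use e in auto)
  moreover have "box (One::'b) 0 = {}" using e box_subset_cbox by blast
  ultimately have "P (%z. 0)" by (simp add: indicator_def[abs_def])
  then show ?thesis .
 qed
 have fin: "emeasure lborel A < \<infinity>" if "A \<subseteq> box a b" for A and a b :: 'b
 proof -
  have "emeasure lborel A <= emeasure lborel (box a b)" by (rule emeasure_mono) (use that in auto)
  also have "\<dots> < \<infinity>" by (rule emeasure_lborel_box_finite)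
  finally show ?thesis .
 qed
 have sqI: "sqi (ind (A \<inter> box a b))" if "A \<in> sets borel" for A and a b :: 'b
  by (rule indicator_sqi[OF _ fin[OF Int_lower2]]) (use that in simp)
 have step1: "P (ind (A \<inter> box a b))" if ab: "cbox a b \<subseteq> Q" and A: "A \<in> sets borel" for a b A
 proof -
  have I: "Int_stable (range (%(a, b). box a b :: 'b set))"
   by (auto simp: Int_stable_def box_Int_box)
  have G: "(range (%(a, b). box a b :: 'b set)) \<subseteq> Pow UNIV"
   by auto
  have m: "A \<in> sigma_sets UNIV (range (%(a, b). box a b))" if "A \<in> sets borel" for A :: "'b set"
    using that unfolding borel_eq_box by simp
  \<comment> \<open>Boxes are stable under intersection and generate the Borel sets, so only
    complements and disjoint countable unions remain.\<close>
  from I G m[OF A] show ?thesis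
  proof (induction rule: sigma_sets_induct_disjoint)
   case (basic A)
   then obtain c d where A: "A = box c d" by auto
   define l where "l = (\<Sum>i\<in>Basis. max (c \<bullet> i) (a \<bullet> i) *\<^sub>R i)"
   define u where "u = (\<Sum>i\<in>Basis. min (d \<bullet> i) (b \<bullet> i) *\<^sub>R i)"
   have eq: "A \<inter> box a b = box l u" unfolding A l_def u_def by (rule box_Int_box)
   show ?case
   proof (cases "box l u = {}")
    case True then show ?thesis using zero eq by (simp add: indicator_def[abs_def])
   next
    case False
    have "cbox l u = closure (box l u)" using closure_box False by blast
    also have "\<dots> \<subseteq> cbox a b" using eq by (metis Int_lower2 box_subset_cbox closed_cbox closure_minimal subset_trans)
    finally show ?thesis using box[of l u] ab eq by auto
   qed
  next
   case empty then show ?case using zero by (simp add: indicator_def[abs_def])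
  next
   case (compl A)
   then have A: "A \<in> sets borel" by (simp add: borel_eq_box)
   have "P (%z. ind (UNIV \<inter> box a b) z + (-1) * ind (A \<inter> box a b) z)"
    by (intro add scale sqI sqi_cmult compl) (use A box[OF ab] in auto)
   moreover have "(%z. ind (UNIV \<inter> box a b) z + (-1) * ind (A \<inter> box a b) z)
     = ind ((UNIV - A) \<inter> box a b)"
    by (auto simp: indicator_def)
   ultimately show ?case by simp
  next
   case (union A)
   have A: "A i \<in> sets borel" for i using union(2) by (auto simp: borel_eq_box)
   define F where "F n = (\<Union>i<n. A i)" for n
   have FP: "P (ind (F n \<inter> box a b))" for n
   proof (induction n)
    case 0 then show ?case using zero by (simp add: F_def indicator_def[abs_def])
   next
    case (Suc n)
    have d: "F n \<inter> A n = {}"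
    proof -
     have "A i \<inter> A n = {}" if "i < n" for i
      using disjoint_family_onD[OF union(1), of i n] that by simp
     then show ?thesis unfolding F_def by blast
    qed
    have "P (%z. ind (F n \<inter> box a b) z + ind (A n \<inter> box a b) z)"
     by (intro add Suc union sqI) (auto simp: F_def A)
    moreover have "(%z. ind (F n \<inter> box a b) z + ind (A n \<inter> box a b) z)
      = ind (F (Suc n) \<inter> box a b)"
    proof
     fix z
     have "F (Suc n) = F n \<union> A n" unfolding F_def lessThan_Suc by blast
     moreover have "z \<notin> F n \<or> z \<notin> A n" using d by blast
     ultimately show "ind (F n \<inter> box a b) z + ind (A n \<inter> box a b) z
      = ind (F (Suc n) \<inter> box a b) z" by (auto simp: indicator_def)
    qed
    ultimately show ?case by simp
   qed
   show ?case
   proof (rule lim[where F="%n. ind (F n \<inter> box a b)"])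
    show "P (ind (F n \<inter> box a b))" for n by (rule FP)
    show "sqi (ind (F n \<inter> box a b))" for n by (rule sqI) (auto simp: F_def A)
    show "sqi (ind (\<Union> (range A) \<inter> box a b))" by (rule sqI) (auto simp: A)
    show "(%n. ip (%z. ind (F n \<inter> box a b) z - ind (\<Union> (range A) \<inter> box a b) z)
          (%z. ind (F n \<inter> box a b) z - ind (\<Union> (range A) \<inter> box a b) z)) ~~> 0"
    proof (rule L2_dominated_convergence[where G="ind (UNIV \<inter> box a b)"])
     show "sqi (ind (UNIV \<inter> box a b))" by (rule sqI) auto
     show "norm (ind (F n \<inter> box a b) z - ind (\<Union> (range A) \<inter> box a b) z)
      <= norm (ind (UNIV \<inter> box a b) z)" for n z by (auto simp: indicator_def F_def)
     show "(%n. ind (F n \<inter> box a b) z) ~~> ind (\<Union> (range A) \<inter> box a b) z" for z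
     proof (cases "\<exists>i. z \<in> A i")
      case True
      then obtain i where "z \<in> A i" by auto
      then have "\<forall>n\<ge>Suc i. z \<in> F n" by (auto simp: F_def)
      then have "\<forall>\<^sub>F n in sequentially. ind (F n \<inter> box a b) z = ind (\<Union> (range A) \<inter> box a b) z"
       using True by (intro eventually_sequentiallyI[of "Suc i"]) (auto simp: indicator_def)
      then show ?thesis by (rule tendsto_eventually)
     next
      case False then show ?thesis by (simp add: F_def indicator_def)
     qed
    qed (use A in \<open>auto simp: F_def intro!: borel_measurable_indicator sets.Int sets.countable_UN\<close>)
   qed
  qed
 qed
 obtain a b :: "nat => 'b" where ab: "!!n. cbox (a n) (b n) \<subseteq> Q" "Q \<subseteq> (\<Union>n. box (a n) (b n))"
  using inner_box_cover[OF Q] by metis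
 define V where "V n = (\<Union>i<n. box (a i) (b i))" for n :: nat
 have Vm [measurable]: "V n \<in> sets borel" for n by (auto simp: V_def)
 have Vfin: "emeasure lborel (A \<inter> V n) < \<infinity>" for n A
 proof -
  have "bounded (V n)" unfolding V_def by (intro bounded_UN) auto
  then have *: "emeasure lborel (V n) < \<infinity>" by (rule emeasure_bounded_finite)
  have "emeasure lborel (A \<inter> V n) <= emeasure lborel (V n)" by (rule emeasure_mono) auto
  also note *
  finally show ?thesis .
 qed
 have sqV: "sqi (ind (A \<inter> V n))" if "A \<in> sets borel" for A n
  by (rule indicator_sqi[OF _ Vfin]) (use that in simp)
 have step2: "P (ind (A \<inter> V n))" if "A \<in> sets borel" for A n
  using that
 proof (induction n arbitrary: A)
  case 0 then show ?case using zero by (simp add: V_def indicator_def[abs_def])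
 next
  case (Suc n)
  have "P (%z. ind (A \<inter> V n) z + ind ((A - V n) \<inter> box (a n) (b n)) z)"
   by (intro add Suc step1 sqI sqV ab) (use Suc.prems in auto)
  moreover have "(%z. ind (A \<inter> V n) z + ind ((A - V n) \<inter> box (a n) (b n)) z)
    = ind (A \<inter> V (Suc n))"
  proof
   fix z
   have "V (Suc n) = V n \<union> box (a n) (b n)" unfolding V_def lessThan_Suc by blast
   then show "ind (A \<inter> V n) z + ind ((A - V n) \<inter> box (a n) (b n)) z
    = ind (A \<inter> V (Suc n)) z" by (simp add: indicator_def)
  qed
  ultimately show ?case by simp
 qed
 have [measurable]: "h \<in> BM" using h by auto
 obtain F where F: "!!i. simple_function borel (F i)" "!!x. (%i. F i x) ~~> h x"
  "!!i x. dist (F i x) 0 <= 2 * dist (h x) 0"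
  using borel_measurable_implies_sequence_metric[of h borel 0] by auto
 have Fm [measurable]: "F n \<in> BM" for n using F(1) borel_measurable_simple_function by blast
 define H where "H n z = F n z * ind (V n) z" for n z
 have Hsum: "H n = (%z. \<Sum>y\<in>range (F n). y * ind (F n -` {y} \<inter> V n) z)" for n
 proof
  fix z
  have fr: "finite (range (F n))" using F(1)[of n] by (simp add: simple_function_def)
  have "(\<Sum>y\<in>range (F n). y * ind (F n -` {y} \<inter> V n) z)
    = (\<Sum>y\<in>range (F n). if y = F n z then F n z * ind (V n) z else 0)"
   by (rule sum.cong) (auto simp: indicator_def)
  also have "\<dots> = H n z" using fr by (simp add: H_def)
  finally show "H n z = (\<Sum>y\<in>range (F n). y * ind (F n -` {y} \<inter> V n) z)" by simp
 qed
 have PS: "P (%z. \<Sum>y\<in>I. y * ind (F n -` {y} \<inter> V n) z)" if "finite I" for I n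
  using that
 proof (induction I)
  case empty then show ?case using zero by simp
 next
  case (insert y I)
  have m: "F n -` {y} \<in> sets borel" for y using measurable_sets[OF Fm[of n], of "{y}"] by simp
  have "P (%z. y * ind (F n -` {y} \<inter> V n) z + (\<Sum>y\<in>I. y * ind (F n -` {y} \<inter> V n) z))"
   by (intro add scale step2 sqi_cmult sqi_sum sqV insert m)
  then show ?case by (simp only: sum.insert[OF insert(1,2)])
 qed
 show ?thesis
 proof (rule lim[where F=H])
  show "P (H n)" for n unfolding Hsum by (rule PS) (use F(1)[of n] in \<open>simp add: simple_function_def\<close>)
  show "sqi (H n)" for n
  proof (rule sqi_bound[OF h(1), where c=2])
   show "H n \<in> BM" unfolding H_def[abs_def] by measurable
   show "norm (H n z) <= 2 * norm (h z)" for z using F(3)[of n z] by (simp add: H_def indicator_def)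
  qed
  show "(%n. ip (%z. H n z - h z) (%z. H n z - h z)) ~~> 0"
  \<comment> \<open>The simple functions satisfy \<open>|F n| \<le> 2 |h|\<close>, hence the
    majorant \<open>3 h\<close> for the difference to \<open>h\<close>.\<close>
  proof (rule L2_dominated_convergence[where G="%z. 3 * h z"])
   show "sqi (%z. 3 * h z)" using h by auto
   show "norm (H n z - h z) <= norm (3 * h z)" for n z
    using F(3)[of n z] by (auto simp: H_def indicator_def)
   show "(%n. H n z) ~~> h z" for z
   proof (cases "z \<in> Q")
    case True
    then obtain i where "z \<in> box (a i) (b i)" using ab by auto
    then have "\<forall>n\<ge>Suc i. z \<in> V n" by (auto simp: V_def)
    then have "\<forall>\<^sub>F n in sequentially. F n z = H n z"
     by (intro eventually_sequentiallyI[of "Suc i"]) (auto simp: H_def indicator_def)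
    then show ?thesis by (rule Lim_transform_eventually[OF F(2)])
   next
    case False
    then have "h z = 0" using h by auto
    then have "H n z = 0" for n using F(3)[of n z] by (simp add: H_def)
    then show ?thesis using \<open>h z = 0\<close> by simp
   qed
   show "H n \<in> BM" for n unfolding H_def[abs_def] by measurable
   show "h \<in> BM" by measurable
  qed
 qed (rule h)
qed

subsection \<open>Smooth functions\<close>

lemma Ck_on_SucD:
 "Ck_on (Suc k) S f ==> x \<in> S ==> f differentiable (at x)"
 "Ck_on (Suc k) S f ==> Ck_on k S (%x. fder f x v)"
 by auto

lemma Ck_on_continuous: "Ck_on k S f ==> continuous_on S f"
proof (cases k)
 case (Suc n)
 assume "Ck_on k S f"
 then show ?thesis unfolding Suc
  by (intro continuous_at_imp_continuous_on ballI differentiable_imp_continuous_within) auto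
qed auto

lemma Ck_on_mono: "Ck_on (Suc k) S f ==> Ck_on k S f"
proof (induction k arbitrary: f)
 case 0 then show ?case using Ck_on_continuous[OF 0] by simp
next
 case (Suc k)
 have "Ck_on k S (%x. fder f x v)" for v
  by (rule Suc.IH) (rule Ck_on_SucD(2)[OF Suc.prems])
 then show ?case using Ck_on_SucD(1)[OF Suc.prems] by simp
qed

lemma frechet_derivative_eqI: "(f has_derivative D) (at x) ==> fder f x = D"
 by (rule frechet_derivative_at[symmetric])

lemma Ck_on_SucI:
 assumes "!!x. (f has_derivative D x) (at x)" "!!v. Ck_on k UNIV (%x. D x v)"
 shows "Ck_on (Suc k) UNIV f"
proof -
 have "fder f x = D x" for x by (rule frechet_derivative_eqI[OF assms(1)])
 then show ?thesis using assms by (auto simp: differentiable_def)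
qed

lemma differentiable_has_frechet: "f differentiable at x ==> (f has_derivative fder f x) (at x)"
 by (rule frechet_derivative_works[THEN iffD1])

lemma Ck_on_const: "Ck_on k UNIV (%x. c)"
proof (induction k arbitrary: c)
 case (Suc k) show ?case by (rule Ck_on_SucI[where D="%x v. 0"]) (auto intro: Suc)
qed auto

lemma Ck_on_add:
 assumes "Ck_on k UNIV f" "Ck_on k UNIV g" shows "Ck_on k UNIV (%x. f x + g x)"
 using assms
proof (induction k arbitrary: f g)
 case (Suc k)
 show ?case
 proof (rule Ck_on_SucI)
  show "((%x. f x + g x) has_derivative (%v. fder f x v + fder g x v)) (at x)" for x
   by (intro has_derivative_add differentiable_has_frechet Ck_on_SucD(1)[OF Suc.prems(1)] Ck_on_SucD(1)[OF Suc.prems(2)] UNIV_I)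
  show "Ck_on k UNIV (%x. fder f x v + fder g x v)" for v
   by (intro Suc.IH Ck_on_SucD(2)[OF Suc.prems(1)] Ck_on_SucD(2)[OF Suc.prems(2)])
 qed
qed (auto intro: continuous_on_add)

lemma Ck_on_mult:
 assumes "Ck_on k UNIV f" "Ck_on k UNIV g" shows "Ck_on k UNIV (%x. f x * g x)"
 using assms
proof (induction k arbitrary: f g)
 case (Suc k)
 show ?case
 proof (rule Ck_on_SucI)
  show "((%x. f x * g x) has_derivative (%v. f x * fder g x v + fder f x v * g x)) (at x)" for x
   by (intro has_derivative_mult differentiable_has_frechet Ck_on_SucD(1)[OF Suc.prems(1)] Ck_on_SucD(1)[OF Suc.prems(2)] UNIV_I)
  show "Ck_on k UNIV (%x. f x * fder g x v + fder f x v * g x)" for v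
   by (intro Ck_on_add Suc.IH Ck_on_SucD(2)[OF Suc.prems(1)] Ck_on_SucD(2)[OF Suc.prems(2)]
      Ck_on_mono[OF Suc.prems(1)] Ck_on_mono[OF Suc.prems(2)])
 qed
qed (auto intro: continuous_on_mult)

lemma Ck_on_affine_comp:
 fixes L :: "'b::euclidean_space => 'c::euclidean_space"
 assumes "Ck_on k UNIV f" "linear L" shows "Ck_on k UNIV (%x. f (L x + a))"
 using assms(1)
proof (induction k arbitrary: f)
 case 0
 have "continuous_on UNIV (%x. L x + a)"
  by (intro continuous_on_add linear_continuous_on linear_conv_bounded_linear[THEN iffD1] assms(2) continuous_on_const)
 then show ?case using 0 by (auto intro: continuous_on_compose2[of UNIV f])
next
 case (Suc k)
 show ?case
 proof (rule Ck_on_SucI)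
  show "((%x. f (L x + a)) has_derivative (%v. fder f (L x + a) (L v))) (at x)" for x
  proof -
   have "((%x. L x + a) has_derivative (%v. L v + 0)) (at x)"
    by (intro has_derivative_add bounded_linear_imp_has_derivative has_derivative_const linear_conv_bounded_linear[THEN iffD1] assms(2))
   then have "((%x. L x + a) has_derivative L) (at x)" by simp
   from has_derivative_compose[OF this differentiable_has_frechet[OF Ck_on_SucD(1)[OF Suc.prems UNIV_I]]]
   show ?thesis .
  qed
  show "Ck_on k UNIV (%x. fder f (L x + a) (L v))" for v
   by (rule Suc.IH[OF Ck_on_SucD(2)[OF Suc.prems]])
 qed
qed

lemma smooth_on_const: "smooth_on UNIV (%x. c)"
 by (simp add: smooth_on_def Ck_on_const)

lemma smooth_on_add: "smooth_on UNIV f ==> smooth_on UNIV g ==> smooth_on UNIV (%x. f x + g x)"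
 by (simp add: smooth_on_def Ck_on_add)

lemma smooth_on_mult: "smooth_on UNIV f ==> smooth_on UNIV g ==> smooth_on UNIV (%x. f x * g x)"
 by (simp add: smooth_on_def Ck_on_mult)

lemma smooth_on_prod: "(!!i. i \<in> I ==> smooth_on UNIV (f i)) ==> smooth_on UNIV (%x. \<Prod>i\<in>I. f i x)"
 by (induction I rule: infinite_finite_induct) (auto intro: smooth_on_const smooth_on_mult)

lemma smooth_on_sum: "(!!i. i \<in> I ==> smooth_on UNIV (f i)) ==> smooth_on UNIV (%x. \<Sum>i\<in>I. f i x)"
 by (induction I rule: infinite_finite_induct) (auto intro: smooth_on_const smooth_on_add)

lemma smooth_on_affine_comp:
 "smooth_on UNIV f ==> linear L ==> smooth_on UNIV (%x. f (L x + a))"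
 by (simp add: smooth_on_def Ck_on_affine_comp)

lemma smooth_on_differentiable: "smooth_on UNIV f ==> f differentiable at x"
 using Ck_on_SucD(1)[of 0 UNIV f x] by (simp add: smooth_on_def del: Ck_on.simps)

lemma smooth_on_has_derivative: "smooth_on UNIV f ==> (f has_derivative fder f x) (at x)"
 by (rule differentiable_has_frechet[OF smooth_on_differentiable])

lemma smooth_on_frechet: "smooth_on UNIV f ==> smooth_on UNIV (%x. fder f x v)"
 unfolding smooth_on_def using Ck_on_SucD(2) by blast

lemma smooth_on_continuous: "smooth_on UNIV f ==> continuous_on UNIV f"
 unfolding smooth_on_def using Ck_on_continuous by blast

lemma smooth_on_real_derivI:
 fixes f :: "real => real"
 assumes "!!t. (f has_real_derivative g t) (at t)" "smooth_on UNIV g"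
 shows "smooth_on UNIV f"
 unfolding smooth_on_def
proof
 fix k
 have "Ck_on (Suc k) UNIV f"
 proof (rule Ck_on_SucI)
  show "(f has_derivative (*) (g t)) (at t)" for t
   using assms(1) by (simp add: has_field_derivative_def)
  show "Ck_on k UNIV (%t. g t * v)" for v
   by (intro Ck_on_mult Ck_on_const) (use assms(2) in \<open>simp add: smooth_on_def\<close>)
 qed
 then show "Ck_on k UNIV f" by (rule Ck_on_mono)
qed

lemma smooth_on_real_has_deriv:
 fixes f :: "real => real"
 assumes "smooth_on UNIV f"
 shows "(f has_real_derivative fder f t 1) (at t)"
proof -
 have D: "(f has_derivative fder f t) (at t)" by (rule smooth_on_has_derivative[OF assms])
 have "fder f t = (*) (fder f t 1)"
 proof
  fix s :: real
  have "linear (fder f t)" using D has_derivative_linear by blast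
  then have "fder f t (s *\<^sub>R 1) = s *\<^sub>R fder f t 1"
   by (rule linear_scale)
  then show "fder f t s = fder f t 1 * s" by (simp add: mult.commute)
 qed
 then show ?thesis using D by (simp add: has_field_derivative_def)
qed

subsection \<open>Bump functions\<close>

text \<open>This is e^(-1/t) t^(-n), extended by 0 to t \<le> 0. The family is closed under
  differentiation up to linear combinations, so smoothness of all members follows from one induction
  on the order with \<open>n\<close> arbitrary.\<close>

definition hexp :: "nat => real => real" where
 "hexp n t = (if t <= 0 then 0 else exp (- inverse t) * inverse t ^ n)"

lemma hexp_tendsto_0: "(hexp n \<longlongrightarrow> 0) (at 0)"
proof -
 have *: "((%t::real. exp (- inverse t) * inverse t ^ n) \<longlongrightarrow> 0) (at_right 0)"
 proof -
  have "((%s::real. s ^ n / exp s) \<longlongrightarrow> 0) at_top" by (rule tendsto_power_div_exp_0)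
  then have "((%t. (inverse t) ^ n / exp (inverse t)) \<longlongrightarrow> 0) (at_right (0::real))"
   using filterlim_compose[OF _ filterlim_inverse_at_top_right] by fastforce
  then show ?thesis by (simp add: exp_minus field_simps)
 qed
 have "(hexp n \<longlongrightarrow> 0) (at_right 0)"
  by (rule Lim_transform_eventually[OF *]) (auto simp: hexp_def eventually_at_filter)
 moreover have "(hexp n \<longlongrightarrow> 0) (at_left 0)"
  by (rule Lim_transform_eventually[OF tendsto_const]) (auto simp: hexp_def eventually_at_filter)
 ultimately show ?thesis by (simp add: filterlim_split_at)
qed

lemma hexp_deriv: "(hexp n has_real_derivative (hexp (n + 2) t - real n * hexp (n + 1) t)) (at t)"
proof -
 consider "t < 0" | "t = 0" | "t > 0" by linarith
 then show ?thesis
 proof cases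
  case 1
  have "((%t. 0) has_real_derivative 0) (at t)" by simp
  then have "(hexp n has_real_derivative 0) (at t)"
   by (rule has_field_derivative_transform_within_open[of _ _ _ "{..<0}"]) (use 1 in \<open>auto simp: hexp_def\<close>)
  then show ?thesis using 1 by (simp add: hexp_def)
 next
  case 2
  \<comment> \<open>At 0 the difference quotient of \<open>hexp n\<close> is
    \<open>hexp (n + 1)\<close> itself.\<close>
  have "((%h. (hexp n (0 + h) - hexp n 0) / h) \<longlongrightarrow> 0) (at 0)"
   by (rule Lim_transform_eventually[OF hexp_tendsto_0[of "n + 1"]])
     (auto simp: eventually_at_filter hexp_def divide_inverse)
  then show ?thesis using 2 by (simp add: DERIV_def hexp_def)
 next
  case 3
  have "((%t. exp (- inverse t) * inverse t ^ n) has_real_derivative (hexp (n + 2) t - real n * hexp (n + 1) t)) (at t)"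
  proof -
   have t0: "t \<noteq> 0" using 3 by simp
   have i: "(inverse has_real_derivative - (inverse t * inverse t)) (at t)"
    using DERIV_inverse[OF t0] by (simp add: power2_eq_square)
   have e: "((%t. exp (- inverse t)) has_real_derivative exp (- inverse t) * (inverse t * inverse t)) (at t)"
    using DERIV_chain2[OF DERIV_exp DERIV_minus[OF i]] by simp
   have q: "exp (- inverse t) * (inverse t * inverse t) * inverse t ^ n
     + of_nat n * (- (inverse t * inverse t) * inverse t ^ (n - Suc 0)) * exp (- inverse t)
     = hexp (n + 2) t - real n * hexp (n + 1) t"
    using 3 by (cases n) (simp_all add: hexp_def algebra_simps)
   show ?thesis unfolding q[symmetric] by (rule DERIV_mult[OF e DERIV_power[OF i]])
  qed
  then show ?thesis
   by (rule has_field_derivative_transform_within_open[of _ _ _ "{0<..}"]) (use 3 in \<open>auto simp: hexp_def\<close>)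
 qed
qed

lemma smooth_hexp: "smooth_on UNIV (hexp n)"
 unfolding smooth_on_def
proof
 fix k show "Ck_on k UNIV (hexp n)"
 proof (induction k arbitrary: n)
  case 0
  have "continuous_on UNIV (hexp n)"
   by (rule DERIV_continuous_on[OF has_field_derivative_at_within[OF hexp_deriv]])
  then show ?case by simp
 next
  case (Suc k)
  show ?case
  proof (rule Ck_on_SucI)
   show "(hexp n has_derivative (*) (hexp (n + 2) t + (- real n) * hexp (n + 1) t)) (at t)" for t
    using hexp_deriv[of n t] by (simp add: has_field_derivative_def)
   show "Ck_on k UNIV (%t. (hexp (n + 2) t + (- real n) * hexp (n + 1) t) * v)" for v
    by (intro Ck_on_mult Ck_on_add Ck_on_const Suc)
  qed
 qed
qed

abbreviation "bexp \<equiv> hexp 0"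

lemma bexp_bounds: "0 <= bexp t" "bexp t <= 1" "bexp t = 0 \<longleftrightarrow> t <= 0"
 by (auto simp: hexp_def)

lemma bexp_scaled_tendsto:
 "t > 0 ==> (%n. bexp (real (Suc n) * t)) ~~> 1"
proof -
 assume t: "t > 0"
 have "(%n. exp (- (inverse (real (Suc n)) * inverse t))) ~~> exp (- (0 * inverse t))"
  by (intro tendsto_intros LIMSEQ_inverse_real_of_nat)
 moreover have "bexp (real (Suc n) * t) = exp (- (inverse (real (Suc n)) * inverse t))" for n
 proof -
  have "\<not> real (Suc n) * t <= 0" using t by (simp add: not_le)
  then show ?thesis by (simp add: hexp_def)
 qed
 ultimately show ?thesis by simp
qed

text \<open>Nonzero exactly on the open box, for every \<open>n\<close>, and convergent to its
  indicator because exp (-1/(N t)) tends to 1 for t > 0. The support thus stays in one closed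
  box.\<close>

definition boxbump :: "nat => 'b::euclidean_space => 'b => 'b => real" where
 "boxbump n a b x = (\<Prod>i\<in>Basis. bexp (real (Suc n) * ((x - a) \<bullet> i)) * bexp (real (Suc n) * ((b - x) \<bullet> i)))"

lemma smooth_boxbump: "smooth_on UNIV (boxbump n a b)"
proof -
 have 1: "smooth_on UNIV (%x. bexp (real (Suc n) * (x \<bullet> i) + (- real (Suc n) * (a \<bullet> i))))" for i :: 'a
  by (rule smooth_on_affine_comp[OF smooth_hexp]) (auto intro!: linearI simp: inner_simps algebra_simps)
 have 2: "smooth_on UNIV (%x. bexp (- real (Suc n) * (x \<bullet> i) + real (Suc n) * (b \<bullet> i)))" for i :: 'a
  by (rule smooth_on_affine_comp[OF smooth_hexp]) (auto intro!: linearI simp: inner_simps algebra_simps)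
 have "boxbump n a b = (%x. \<Prod>i\<in>Basis. bexp (real (Suc n) * (x \<bullet> i) + (- real (Suc n) * (a \<bullet> i)))
   * bexp (- real (Suc n) * (x \<bullet> i) + real (Suc n) * (b \<bullet> i)))"
  by (rule ext) (simp add: boxbump_def inner_diff_left right_diff_distrib algebra_simps)
 then show ?thesis by (simp only:) (intro smooth_on_prod smooth_on_mult 1 2)
qed

lemma boxbump_bounds: "0 <= boxbump n a b x" "boxbump n a b x <= 1"
 unfolding boxbump_def by (auto intro!: prod_nonneg prod_le_1 mult_nonneg_nonneg mult_le_one simp: bexp_bounds)

lemma boxbump_eq_0_iff: "boxbump n a b x = 0 \<longleftrightarrow> x \<notin> box a b"
 by (auto simp: boxbump_def bexp_bounds mem_box inner_diff_left not_less mult_le_0_iff)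

lemma boxbump_tendsto: "(%n. boxbump n a b x) ~~> ind (box a b) x"
proof (cases "x \<in> box a b")
 case True
 have "(%n. boxbump n a b x) ~~> (\<Prod>i::'a\<in>Basis. 1 * 1)"
  unfolding boxbump_def
  by (intro tendsto_prod tendsto_mult bexp_scaled_tendsto) (use True in \<open>auto simp: mem_box inner_diff_left\<close>)
 then show ?thesis using True by simp
next
 case False
 then have "boxbump n a b x = 0" for n by (simp add: boxbump_eq_0_iff)
 then show ?thesis using False by simp
qed

subsection \<open>Test functions\<close>

lemma test_fun_smooth: "test_fun Q p ==> smooth_on UNIV p"
 by (simp add: test_fun_def)

lemma test_fun_mono: "test_fun Q p ==> Q \<subseteq> R ==> test_fun R p"
 by (auto simp: test_fun_def)

lemma test_fun_outside: "test_fun Q p ==> x \<notin> Q ==> p x = 0"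
 using closure_subset[of "{z. p z \<noteq> 0}"] by (auto simp: test_fun_def)

lemma test_funI:
 assumes "smooth_on UNIV p" "compact K" "K \<subseteq> Q" "!!x. p x \<noteq> 0 ==> x \<in> K"
 shows "test_fun Q p"
proof -
 have "closure {z. p z \<noteq> 0} \<subseteq> K"
  by (rule closure_minimal) (use assms in \<open>auto intro: compact_imp_closed\<close>)
 moreover from this have "compact (closure {z. p z \<noteq> 0})"
  using assms(2) by (metis closed_closure compact_Int_closed inf.absorb_iff2)
 ultimately show ?thesis using assms by (auto simp: test_fun_def)
qed

lemma test_fun_boxbump: "cbox a b \<subseteq> Q ==> test_fun Q (boxbump n a b)"
 by (rule test_funI[OF smooth_boxbump compact_cbox])
   (use box_subset_cbox in \<open>auto simp: boxbump_eq_0_iff\<close>)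

lemma test_fun_mult:
 assumes "test_fun Q p" "smooth_on UNIV g" shows "test_fun Q (%x. g x * p x)"
proof (rule test_funI)
 show "smooth_on UNIV (%x. g x * p x)" by (rule smooth_on_mult[OF assms(2) test_fun_smooth[OF assms(1)]])
 show "compact (closure {z. p z \<noteq> 0})" "closure {z. p z \<noteq> 0} \<subseteq> Q" using assms by (auto simp: test_fun_def)
 show "g x * p x \<noteq> 0 ==> x \<in> closure {z. p z \<noteq> 0}" for x using closure_subset[of "{z. p z \<noteq> 0}"] by auto
qed

lemma frechet_zero_outside:
 assumes "x \<notin> closure {z. p z \<noteq> 0}" shows "fder p x = (%v. 0)"
proof (rule frechet_derivative_eqI)
 have "((%x. 0) has_derivative (%v. 0)) (at x)" by simp
 then show "(p has_derivative (%v. 0)) (at x)"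
  by (rule has_derivative_transform_within_open[of _ _ _ _ "- closure {z. p z \<noteq> 0}"])
    (use assms closure_subset[of "{z. p z \<noteq> 0}"] in auto)
qed

lemma test_fun_frechet:
 assumes "test_fun Q p" shows "test_fun Q (%x. fder p x v)"
proof (rule test_funI)
 show "smooth_on UNIV (%x. fder p x v)" by (rule smooth_on_frechet[OF test_fun_smooth[OF assms]])
 show "compact (closure {z. p z \<noteq> 0})" "closure {z. p z \<noteq> 0} \<subseteq> Q" using assms by (auto simp: test_fun_def)
 show "fder p x v \<noteq> 0 ==> x \<in> closure {z. p z \<noteq> 0}" for x
  by (rule ccontr) (simp add: frechet_zero_outside)
qed

lemma test_fun_meas: "test_fun Q p ==> p \<in> BM"
 using smooth_on_continuous[OF test_fun_smooth] by (rule borel_measurable_continuous_onI)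

lemma test_fun_bounded:
 assumes "test_fun Q p" obtains B where "B > 0" "!!x. \<bar>p x\<bar> <= B"
proof -
 let ?K = "closure {z. p z \<noteq> 0}"
 have "compact (p ` ?K)" using assms smooth_on_continuous[OF test_fun_smooth[OF assms]]
  by (intro compact_continuous_image) (auto simp: test_fun_def intro: continuous_on_subset)
 then obtain B where B: "B > 0" "\<forall>y\<in>p ` ?K. norm y <= B" using compact_imp_bounded bounded_pos by meson
 have "\<bar>p x\<bar> <= B" for x
 proof (cases "p x = 0")
  case False then have "x \<in> ?K" using closure_subset[of "{z. p z \<noteq> 0}"] by auto
  then show ?thesis using B by auto
 qed (use B in auto)
 then show ?thesis using B that by blast
qed

lemma bounded_support_sqi:
 fixes p :: "'b::euclidean_space => 'c::euclidean_space"
 assumes "p \<in> BM" "!!x. norm (p x) <= B" "bounded S" "!!x. p x \<noteq> 0 ==> x \<in> S"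
 shows "sqi p"
proof -
 obtain a :: 'b where a: "S \<subseteq> cbox (-a) a" using bounded_subset_cbox_symmetric[OF assms(3)] by blast
 have "sqi (ind (cbox (-a) a))" by (rule indicator_sqi) (auto simp: emeasure_lborel_cbox_eq)
 then show ?thesis
  by (rule sqi_bound[where c=B]) (use assms(1,2) a assms(4) in \<open>fastforce simp: indicator_def\<close>)+
qed

lemma test_fun_sqi: "test_fun Q p ==> sqi p"
proof -
 assume p: "test_fun Q p"
 obtain B where "!!x. \<bar>p x\<bar> <= B" using test_fun_bounded[OF p] by blast
 then show ?thesis
  by (intro bounded_support_sqi[OF test_fun_meas[OF p], where S="closure {z. p z \<noteq> 0}"])
    (use p closure_subset[of "{z. p z \<noteq> 0}"] in \<open>auto simp: test_fun_def compact_imp_bounded\<close>)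
qed

lemma test_fun_pair:
 fixes V :: "'a::euclidean_space set" and W :: "'d::euclidean_space set"
 assumes "test_fun V p" "test_fun W q"
 shows "test_fun (V \<times> W) (p \<otimes> q)"
proof (rule test_funI)
 have 1: "smooth_on UNIV (%z::'a\<times>'d. p (fst z + 0))"
  by (rule smooth_on_affine_comp[OF test_fun_smooth[OF assms(1)]]) (rule linear_fst)
 have 2: "smooth_on UNIV (%z::'a\<times>'d. q (snd z + 0))"
  by (rule smooth_on_affine_comp[OF test_fun_smooth[OF assms(2)]]) (rule linear_snd)
 show "smooth_on UNIV (%z::'a\<times>'d. p (fst z) * q (snd z))" using smooth_on_mult[OF 1 2] by simp
 show "compact (closure {z. p z \<noteq> 0} \<times> closure {z. q z \<noteq> 0})" using assms by (auto simp: test_fun_def intro: compact_Times)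
 show "closure {z. p z \<noteq> 0} \<times> closure {z. q z \<noteq> 0} \<subseteq> V \<times> W" using assms by (auto simp: test_fun_def)
 show "p (fst z) * q (snd z) \<noteq> 0 ==> z \<in> closure {z. p z \<noteq> 0} \<times> closure {z. q z \<noteq> 0}" for z
  using closure_subset[of "{z. p z \<noteq> 0}"] closure_subset[of "{z. q z \<noteq> 0}"] by (cases z) auto
qed

lemma frechet_pair:
 assumes "smooth_on UNIV p" "smooth_on UNIV q"
 shows "fder (p \<otimes> q) z v
   = p (fst z) * fder q (snd z) (snd v) + fder p (fst z) (fst v) * q (snd z)"
proof -
 have 1: "((%z. p (fst z)) has_derivative (%v. fder p (fst z) (fst v))) (at z)"
  by (rule has_derivative_compose[OF bounded_linear_imp_has_derivative[OF bounded_linear_fst] smooth_on_has_derivative[OF assms(1)]])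
 have 2: "((%z. q (snd z)) has_derivative (%v. fder q (snd z) (snd v))) (at z)"
  by (rule has_derivative_compose[OF bounded_linear_imp_has_derivative[OF bounded_linear_snd] smooth_on_has_derivative[OF assms(2)]])
 show ?thesis using frechet_derivative_eqI[OF has_derivative_mult[OF 1 2]] by simp
qed

definition gradv :: "('a::euclidean_space => real) => 'a => 'a" where
 "gradv p x = (\<Sum>i\<in>Basis. fder p x i *\<^sub>R i)"

lemma gradv_inner [simp]: "i \<in> Basis ==> gradv p x \<bullet> i = fder p x i"
 by (simp add: gradv_def inner_sum_left inner_Basis if_distrib[of "%x. _ * x"] cong: if_cong)

lemma gradv_mult:
 assumes "smooth_on UNIV p" "smooth_on UNIV q"
 shows "gradv (%x. p x * q x) x = p x *\<^sub>R gradv q x + q x *\<^sub>R gradv p x"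
proof (rule euclidean_eqI)
 fix i :: 'a assume "i \<in> Basis"
 then show "gradv (%x. p x * q x) x \<bullet> i = (p x *\<^sub>R gradv q x + q x *\<^sub>R gradv p x) \<bullet> i"
  using frechet_derivative_eqI[OF has_derivative_mult[OF smooth_on_has_derivative[OF assms(1)] smooth_on_has_derivative[OF assms(2)]], of x]
  by (simp add: inner_simps)
qed

lemma gradv_meas: "test_fun Q p ==> gradv p \<in> BM"
 unfolding gradv_def[abs_def]
 by (intro borel_measurable_sum borel_measurable_scaleR borel_measurable_const test_fun_meas[OF test_fun_frechet])

lemma gradv_bounded:
 assumes "test_fun Q p" obtains B where "B > 0" "!!x. norm (gradv p x) <= B"
proof -
 have "\<forall>i. \<exists>B>0. \<forall>x. \<bar>fder p x i\<bar> <= B"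
  using test_fun_bounded[OF test_fun_frechet[OF assms]] by metis
 then obtain B where B: "!!i. B i > 0" "!!i x. \<bar>fder p x i\<bar> <= B i" by metis
 have "norm (gradv p x) <= (\<Sum>i\<in>Basis. B i)" for x
  unfolding gradv_def by (rule sum_norm_le) (use B(2) in simp)
 moreover have "(\<Sum>i\<in>Basis. B i) > 0" by (rule sum_pos) (auto simp: B)
 ultimately show ?thesis using that by blast
qed

text \<open>A finite sum of bumps that cover \<open>K\<close>; its minimum over \<open>K\<close> is
  positive by compactness. A positive lower bound is what allows division by the cutoff in
  \<open>interior_weak\<close>.\<close>

lemma compact_cutoff:
 fixes K :: "'b::euclidean_space set"
 assumes "compact K" "open V" "K \<subseteq> V"
 obtains ch c where "test_fun V ch" "c > 0" "!!x. 0 <= ch x" "!!x. x \<in> K ==> c <= ch x"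
proof -
 obtain A B :: "nat => 'b" where AB: "!!n. cbox (A n) (B n) \<subseteq> V" "V \<subseteq> (\<Union>n. box (A n) (B n))"
  using inner_box_cover[OF assms(2)] by metis
 obtain I where I: "finite I" "K \<subseteq> (\<Union>n\<in>I. box (A n) (B n))"
  by (rule compactE_image[OF assms(1), of UNIV "%n. box (A n) (B n)"]) (use AB assms(3) in auto)
 define ch where "ch x = (\<Sum>n\<in>I. boxbump 0 (A n) (B n) x)" for x
 have nn: "0 <= ch x" for x unfolding ch_def by (intro sum_nonneg boxbump_bounds)
 have sm: "smooth_on UNIV ch" unfolding ch_def[abs_def] by (intro smooth_on_sum smooth_boxbump)
 have tf: "test_fun V ch"
 proof (rule test_funI[OF sm])
  show "compact (\<Union>n\<in>I. cbox (A n) (B n))" using I by (intro compact_UN) auto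
  show "(\<Union>n\<in>I. cbox (A n) (B n)) \<subseteq> V" using AB by blast
  fix x assume "ch x \<noteq> 0"
  then obtain n where "n \<in> I" "boxbump 0 (A n) (B n) x \<noteq> 0" unfolding ch_def by (meson sum.neutral)
  then show "x \<in> (\<Union>n\<in>I. cbox (A n) (B n))" using box_subset_cbox by (auto simp: boxbump_eq_0_iff)
 qed
 have pos: "ch x > 0" if "x \<in> K" for x
 proof -
  obtain n where n: "n \<in> I" "x \<in> box (A n) (B n)" using I(2) \<open>x \<in> K\<close> by blast
  have "0 < boxbump 0 (A n) (B n) x" using n boxbump_eq_0_iff[of 0 "A n" "B n" x] boxbump_bounds(1)[of 0 "A n" "B n" x]
   by (simp add: less_le)
  also have "\<dots> <= ch x" unfolding ch_def by (rule member_le_sum) (use n I boxbump_bounds in auto)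
  finally show ?thesis .
 qed
 show ?thesis
 proof (cases "K = {}")
  case True then show ?thesis using that[OF tf zero_less_one nn] by blast
 next
  case False
  obtain y where y: "y \<in> K" "\<forall>x\<in>K. ch y <= ch x"
   using continuous_attains_inf[OF assms(1) False] continuous_on_subset[OF smooth_on_continuous[OF sm]] by blast
  show ?thesis by (rule that[OF tf pos[OF y(1)] nn]) (use y in auto)
 qed
qed

subsection \<open>Slices of functions on space-time\<close>

lemma integrable_tensor:
 fixes f :: "'a::euclidean_space => real" and g :: "'d::euclidean_space => real"
 assumes "integrable lborel f" "integrable lborel g"
 shows "integrable lborel (f \<otimes> g)"
proof -
 have [measurable]: "f \<in> BM" "g \<in> BM" using assms by auto
 have "integrable (lborel \<Otimes>\<^sub>M lborel) (f \<otimes> g)"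
 proof (rule lborel_pair.Fubini_integrable)
  show "(f \<otimes> g) \<in> borel_measurable (lborel \<Otimes>\<^sub>M lborel)" by measurable
  have "integrable lborel (%x. \<bar>f x\<bar> * (LBINT y. \<bar>g y\<bar>))"
   using assms by (intro integrable_mult_left integrable_abs)
  then show "integrable lborel (%x. LBINT y. norm (f (fst (x, y)) * g (snd (x, y))))"
   by (simp add: abs_mult)
  show "AE x in lborel. integrable lborel (%y. f (fst (x, y)) * g (snd (x, y)))"
   using assms by (intro AE_I2) simp
 qed
 then show ?thesis by (simp add: lborel_prod)
qed

lemma sqi_tensor:
 fixes p :: "'a::euclidean_space => real" and q :: "'d::euclidean_space => real"
 assumes "sqi p" "sqi q" shows "sqi (p \<otimes> q)"
proof -
 have [measurable]: "p \<in> BM" "q \<in> BM" using assms by (simp_all add: sqi_def)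
 have "(p \<otimes> q) \<in> borel_measurable (borel \<Otimes>\<^sub>M borel)" by measurable
 moreover have "integrable lborel (%z. (norm (p (fst z)))\<^sup>2 * (norm (q (snd z)))\<^sup>2)"
  by (rule integrable_tensor[OF sqi_int[OF assms(1)] sqi_int[OF assms(2)]])
 ultimately show ?thesis by (simp add: sqi_def borel_prod power_mult_distrib)
qed

lemma integrable_slice_AE:
 fixes f :: "'a::euclidean_space \<times> 'd::euclidean_space => 'c::euclidean_space"
 assumes "integrable lborel f" shows "AE x in lborel. integrable lborel (%t. f (x, t))"
 using lborel_pair.AE_integrable_fst'[of f] assms by (simp add: lborel_prod)

lemma integral_slices:
 fixes f :: "'a::euclidean_space \<times> 'd::euclidean_space => 'c::euclidean_space"
 assumes "integrable lborel f"
 shows "(LBINT x. (LBINT t. f (x, t))) = (LBINT z. f z)"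
  "integrable lborel (%x. LBINT t. f (x, t))"
 using lborel_pair.integral_fst'[of f] lborel_pair.integrable_fst'[of f] assms by (simp_all add: lborel_prod)

lemma slice_meas [measurable (raw)]:
 fixes f :: "'a::euclidean_space \<times> 'd::euclidean_space => 'c::euclidean_space"
 assumes "f \<in> BM" shows "(%t. f (x, t)) \<in> BM"
proof -
 have "f \<in> borel_measurable (borel \<Otimes>\<^sub>M borel)" using assms by (simp add: borel_prod)
 then show ?thesis by measurable
qed

lemma sqi_slice_AE:
 fixes f :: "'a::euclidean_space \<times> 'd::euclidean_space => 'c::euclidean_space"
 assumes "sqi f" shows "AE x in lborel. sqi (%t. f (x, t))"
 using integrable_slice_AE[OF sqi_int[OF assms]] slice_meas[OF sqi_meas[OF assms]]
 by (auto simp: sqi_def)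

lemma AE_pair_slices:
 fixes P :: "'a::euclidean_space \<times> 'd::euclidean_space => bool"
 assumes "Measurable.pred borel P" "AE x in lborel. AE t in lborel. P (x, t)"
 shows "AE z in lborel. P z"
proof -
 have "{z \<in> space (lborel \<Otimes>\<^sub>M lborel). P z} \<in> sets (lborel \<Otimes>\<^sub>M lborel)"
  unfolding lborel_prod using assms(1) by (simp add: pred_def)
 then have "AE z in (lborel \<Otimes>\<^sub>M lborel). P z"
  using assms(2) by (intro lborel_pair.AE_pair_measure) auto
 then show ?thesis unfolding lborel_prod .
qed

lemma ip_slices:
 fixes f g :: "'a::euclidean_space \<times> 'd::euclidean_space => 'c::euclidean_space"
 assumes "sqi f" "sqi g"
 shows "ip f g = (LBINT x. ip (%t. f (x, t)) (%t. g (x, t)))"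
 unfolding ip_def using integral_slices(1)[OF ip_integrable[OF assms]] by simp

lemma box_Pair_eq: "box (a1, a2) (b1, b2) = box a1 b1 \<times> box a2 b2"
 for a1 b1 :: "'a::euclidean_space" and a2 b2 :: "'d::euclidean_space"
 by (auto simp: box_def Basis_prod_def ball_Un)

text \<open>A box in the product space is a product of boxes, and the bumps of the two factors
  multiply to an approximation of its indicator. Hence products of smooth functions of x and of t
  generate L^2 of the product set.\<close>

lemma L2_induct_tensor:
 fixes P :: "('a::euclidean_space \<times> 'd::euclidean_space => real) => bool"
 assumes Q: "open V" "open W" and h: "sqi h" "!!z. z \<notin> V \<times> W ==> h z = 0"
  and tensor: "!!p q. test_fun V p ==> test_fun W q ==> P (p \<otimes> q)"
  and add: "!!f g. sqi f ==> sqi g ==> P f ==> P g ==> P (%z. f z + g z)"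
  and scale: "!!f c. sqi f ==> P f ==> P (%z. c * f z)"
  and lim: "!!F f. (!!n::nat. sqi (F n)) ==> (!!n. P (F n)) ==> sqi f ==>
    (%n. ip (%z. F n z - f z) (%z. F n z - f z)) ~~> 0 ==> P f"
 shows "P h"
proof (rule L2_induct[OF open_Times[OF Q] h])
 fix a b :: "'a \<times> 'd" assume ab: "cbox a b \<subseteq> V \<times> W"
 obtain a1 a2 b1 b2 where [simp]: "a = (a1, a2)" "b = (b1, b2)" by (cases a, cases b) auto
 show "P (ind (box a b))"
 proof (cases "cbox a1 b1 = {} \<or> cbox a2 b2 = {}")
  case True
  then have "cbox a b = {}" by (auto simp: cbox_Pair_eq)
  then have "box a b = {}" using box_subset_cbox by blast
  have "test_fun V (%x. 0)" "test_fun W (%x. 0)"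
   by (auto intro!: test_funI[where K="{}"] smooth_on_const)
  then have "P (%z. 0 * 0)" by (rule tensor)
  then show ?thesis using \<open>box a b = {}\<close> by (simp add: indicator_def[abs_def])
 next
  case False
  then have c: "cbox a1 b1 \<subseteq> V" "cbox a2 b2 \<subseteq> W" using ab by (auto simp: cbox_Pair_eq)
  have m: "boxbump n a1 b1 \<in> BM" "boxbump n a2 b2 \<in> BM" for n
   using test_fun_meas[OF test_fun_boxbump[OF c(1)]] test_fun_meas[OF test_fun_boxbump[OF c(2)]] by auto
  have sq: "sqi (%z. boxbump n a1 b1 (fst z) * boxbump n a2 b2 (snd z))" for n
   by (rule sqi_tensor[OF test_fun_sqi[OF test_fun_boxbump[OF c(1)]] test_fun_sqi[OF test_fun_boxbump[OF c(2)]]])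
  have ibox: "ind (box a b) z = ind (box a1 b1) (fst z) * ind (box a2 b2) (snd z)" for z
   by (cases z) (simp add: box_Pair_eq indicator_def)
  have sqb: "sqi (ind (box a b))" by (rule indicator_sqi[OF _ emeasure_lborel_box_finite]) simp
  show ?thesis
  proof (rule lim[OF sq])
   show "P (%z. boxbump n a1 b1 (fst z) * boxbump n a2 b2 (snd z))" for n
    by (intro tensor test_fun_boxbump c)
   show "sqi (ind (box a b))" by (rule sqb)
   show "(%n. ip (%z. boxbump n a1 b1 (fst z) * boxbump n a2 b2 (snd z) - ind (box a b) z)
       (%z. boxbump n a1 b1 (fst z) * boxbump n a2 b2 (snd z) - ind (box a b) z)) ~~> 0"
   proof (rule L2_dominated_convergence[OF sqi_meas[OF sq] sqi_meas[OF sqb] sqb])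
    show "(%n. boxbump n a1 b1 (fst z) * boxbump n a2 b2 (snd z)) ~~> ind (box a b) z" for z
     unfolding ibox by (intro tendsto_mult boxbump_tendsto)
    fix n z
    let ?s = "boxbump n a1 b1 (fst z)" and ?t = "boxbump n a2 b2 (snd z)"
    show "norm (?s * ?t - ind (box a b) z) <= norm (ind (box a b) z)"
    proof (cases "z \<in> box a b")
     case True
     have "0 <= ?s * ?t" "?s * ?t <= 1" by (auto intro: mult_nonneg_nonneg mult_le_one simp: boxbump_bounds)
     then show ?thesis using True by simp
    next
     case False
     then have "?s = 0 \<or> ?t = 0" by (cases z) (auto simp: box_Pair_eq boxbump_eq_0_iff)
     then show ?thesis using False by auto
    qed
   qed
  qed
 qed
next
 fix z assume "z \<notin> V \<times> W" then show "z \<notin> V \<times> W" .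
qed (fact add scale lim)+

subsection \<open>Integral operators in the time variable\<close>

text \<open>The bounds on row and column integrals are the hypotheses of Schur's test. Boundedness
  makes each row integrable against L^2 functions, and the support condition makes every image
  vanish outside (0, T).\<close>

definition kern :: "real => real => (real \<times> real => real) => bool" where
 "kern T C k \<longleftrightarrow> k \<in> BM \<and> (\<forall>z. 0 <= k z) \<and> (\<exists>B. \<forall>z. k z <= B)
   \<and> (\<forall>r t. k (r, t) \<noteq> 0 --> 0 < r \<and> r < T \<and> 0 < t \<and> t < T)
   \<and> 0 <= C \<and> (\<forall>r. (LBINT t. k (r, t)) <= C) \<and> (\<forall>t. (LBINT r. k (r, t)) <= C)"

definition kT :: "(real \<times> real => real) => real \<times> real => real" where
 "kT k z = k (snd z, fst z)"

definition tk1 :: "(real \<times> real => real) => (real => 'c::euclidean_space) => real => 'c" where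
 "tk1 k h r = (LBINT t. k (r, t) *\<^sub>R h t)"

text \<open>The kernel acts along each line x = const. On lines where the integrand is not
  integrable the Bochner integral is 0 by convention, which is why some identities below hold only
  almost everywhere.\<close>

definition tk :: "(real \<times> real => real) => ('a \<times> real => 'c::euclidean_space) => 'a \<times> real => 'c" where
 "tk k h z = (LBINT t. k (snd z, t) *\<^sub>R h (fst z, t))"

lemma tk_slice: "tk k h (x, r) = tk1 k (%t. h (x, t)) r"
 by (simp add: tk_def tk1_def)

lemma kT_kT [simp]: "kT (kT k) = k" by (auto simp: kT_def)

lemma kern_kT: "kern T C k ==> kern T C (kT k)"
proof -
 assume k: "kern T C k"
 have "k \<in> borel_measurable (borel \<Otimes>\<^sub>M borel)" using k by (simp add: kern_def borel_prod)
 then have "(%z. k (snd z, fst z)) \<in> borel_measurable (borel \<Otimes>\<^sub>M borel)" by measurable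
 then have m: "kT k \<in> BM" by (simp add: kT_def[abs_def] borel_prod)
 obtain B where "!!z. k z <= B" using k unfolding kern_def by blast
 then have B: "\<exists>B. \<forall>z. kT k z <= B" by (auto simp: kT_def)
 show ?thesis using k m B unfolding kern_def by (simp add: kT_def)
qed

lemma kern_meas: "kern T C k ==> k \<in> BM" by (simp add: kern_def)
lemma kern_nonneg: "kern T C k ==> 0 <= k z" unfolding kern_def by blast
lemma kern_support: "kern T C k ==> k (r, t) \<noteq> 0 ==> 0 < r \<and> r < T \<and> 0 < t \<and> t < T" by (simp add: kern_def)

lemma kern_bound: assumes "kern T C k" obtains B where "B \<ge> 0"
 "!!r t. k (r, t) <= B * (ind {0<..<T} r * ind {0<..<T} t)"
proof -
 obtain B where B: "!!z. k z <= B" using assms unfolding kern_def by blast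
 have B0: "0 <= B" using B[of undefined] kern_nonneg[OF assms, of undefined] by linarith
 have "k (r, t) <= B * (ind {0<..<T} r * ind {0<..<T} t)" for r t
 proof (cases "k (r, t) = 0")
  case True then show ?thesis using B0 by simp
 next
  case False
  then show ?thesis using kern_support[OF assms False] B[of "(r, t)"] by simp
 qed
 then show ?thesis using that B0 by blast
qed

lemma sqi_ind_interval: "sqi (ind {a<..<b::real})"
 using indicator_sqi[of "box a b"] emeasure_lborel_box_finite[of a b] by simp

lemma integrable_ind_interval [simp]: "integrable lborel (ind {a<..<b::real})"
 using emeasure_lborel_box_finite[of a b] by (simp add: integrable_indicator_iff)

lemma kern_slice_meas: "kern T C k ==> (%t. k (r, t)) \<in> BM"
 by (rule slice_meas[OF kern_meas])

lemma kern_slice_integrable: "kern T C k ==> integrable lborel (%t. k (r, t))"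
proof -
 assume k: "kern T C k"
 obtain B where B: "B \<ge> 0" "!!r t. k (r, t) <= B * (ind {0<..<T} r * ind {0<..<T} t)"
  using kern_bound[OF k] by blast
 show ?thesis
 proof (rule Bochner_Integration.integrable_bound)
  show "integrable lborel (%t. B * (ind {0<..<T} r * ind {0<..<T} t))" by simp
  show "(%t. k (r, t)) \<in> borel_measurable lborel" using kern_slice_meas[OF k] by simp
  show "AE t in lborel. norm (k (r, t)) <= norm (B * (ind {0<..<T} r * ind {0<..<T} t))"
   using B kern_nonneg[OF k] by (intro AE_I2) (simp add: order_trans[OF B(2)])
 qed
qed

lemma kern_mult_integrable:
 assumes k: "kern T C k" and h: "sqi h" shows "integrable lborel (%t. k (r, t) *\<^sub>R h t)"
proof -
 obtain B where B: "B \<ge> 0" "!!r t. k (r, t) <= B * (ind {0<..<T} r * ind {0<..<T} t)"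
  using kern_bound[OF k] by blast
 have n: "sqi (%t. norm (h t))" by (rule sqi_bound[OF h, where c=1]) (use sqi_meas[OF h] in auto)
 show ?thesis
 proof (rule Bochner_Integration.integrable_bound)
  show "integrable lborel (%t. B * (ind {0<..<T} t * norm (h t)))"
   by (intro integrable_mult_right ip_integrable_real n sqi_ind_interval)
  have [measurable]: "(%t. k (r, t)) \<in> BM" "h \<in> BM"
   using kern_slice_meas[OF k] h by (auto simp: sqi_def)
  show "(%t. k (r, t) *\<^sub>R h t) \<in> borel_measurable lborel" by measurable
  have "norm (k (r, t) *\<^sub>R h t) <= B * (ind {0<..<T} t * norm (h t))" for t
  proof -
   have "k (r, t) <= B * ind {0<..<T} t" using B(1) B(2)[of r t] by (auto simp: indicator_def of_bool_def split: if_splits)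
   then have "k (r, t) * norm (h t) <= B * ind {0<..<T} t * norm (h t)" by (intro mult_right_mono) auto
   then show ?thesis using kern_nonneg[OF k, of "(r, t)"] by (simp add: mult.assoc)
  qed
  then show "AE t in lborel. norm (k (r, t) *\<^sub>R h t) <= norm (B * (ind {0<..<T} t * norm (h t)))"
   using B(1) by (intro AE_I2) (simp add: abs_mult)
 qed
qed

lemma kern_tensor_integrable:
 assumes k: "kern T C k" and g: "integrable lborel (g :: real => real)"
 shows "integrable lborel (%z. k z * g (snd z))" "integrable lborel (%z. k z * g (fst z))"
proof -
 obtain B where B: "B \<ge> 0" "!!r t. k (r, t) <= B * (ind {0<..<T} r * ind {0<..<T} t)"
  using kern_bound[OF k] by blast
 have [measurable]: "g \<in> BM" using g by auto
 have [measurable]: "k \<in> borel_measurable (borel \<Otimes>\<^sub>M borel)" using kern_meas[OF k] by (simp add: borel_prod)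
 have i: "integrable lborel (ind {0<..<T})" by simp
 have k0: "k (r, t) * \<bar>g s\<bar> <= B * (ind {0<..<T} r * \<bar>g s\<bar>)"
  "k (r, t) * \<bar>g s\<bar> <= B * (ind {0<..<T} t * \<bar>g s\<bar>)" for r t s
  using mult_right_mono[OF B(2)[of r t], of "\<bar>g s\<bar>"] B(1) by (auto simp: indicator_def of_bool_def split: if_splits intro: order.trans[OF _ mult_nonneg_nonneg[OF B(1) abs_ge_zero]])
 show "integrable lborel (%z. k z * g (snd z))"
 proof (rule Bochner_Integration.integrable_bound)
  show "integrable lborel (%z. B * (ind {0<..<T} (fst z) * g (snd z)))"
   by (intro integrable_mult_right integrable_tensor i g)
  have "(%z. k z * g (snd z)) \<in> borel_measurable (borel \<Otimes>\<^sub>M borel)" by measurable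
  then show "(%z. k z * g (snd z)) \<in> borel_measurable lborel" by (simp add: borel_prod)
  show "AE z in lborel. norm (k z * g (snd z)) <= norm (B * (ind {0<..<T} (fst z) * g (snd z)))"
  proof (rule AE_I2)
   fix z :: "real \<times> real"
   show "norm (k z * g (snd z)) <= norm (B * (ind {0<..<T} (fst z) * g (snd z)))"
    using k0(1)[of "fst z" "snd z" "snd z"] B(1) kern_nonneg[OF k, of z] by (simp add: abs_mult)
  qed
 qed
 show "integrable lborel (%z. k z * g (fst z))"
 proof (rule Bochner_Integration.integrable_bound)
  show "integrable lborel (%z. B * (g (fst z) * ind {0<..<T} (snd z)))"
   by (intro integrable_mult_right integrable_tensor i g)
  have "(%z. k z * g (fst z)) \<in> borel_measurable (borel \<Otimes>\<^sub>M borel)" by measurable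
  then show "(%z. k z * g (fst z)) \<in> borel_measurable lborel" by (simp add: borel_prod)
  show "AE z in lborel. norm (k z * g (fst z)) <= norm (B * (g (fst z) * ind {0<..<T} (snd z)))"
  proof (rule AE_I2)
   fix z :: "real \<times> real"
   show "norm (k z * g (fst z)) <= norm (B * (g (fst z) * ind {0<..<T} (snd z)))"
    using k0(2)[of "fst z" "snd z" "fst z"] B(1) kern_nonneg[OF k, of z] by (simp add: abs_mult mult.commute mult.left_commute)
  qed
 qed
qed

lemma tk1_meas:
 assumes "kern T C k" "h \<in> BM" shows "tk1 k h \<in> BM"
proof -
 have [measurable]: "k \<in> borel_measurable (borel \<Otimes>\<^sub>M borel)" using kern_meas[OF assms(1)] by (simp add: borel_prod)
 note assms(2)[measurable]
 have "(%r. LBINT t. k (r, t) *\<^sub>R h t) \<in> BM" by measurable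
 then show ?thesis by (simp add: tk1_def[abs_def])
qed

lemma tk_meas:
 fixes h :: "'a::euclidean_space \<times> real => 'c::euclidean_space"
 assumes "kern T C k" "h \<in> BM" shows "tk k h \<in> BM"
proof -
 have [measurable]: "k \<in> borel_measurable (borel \<Otimes>\<^sub>M borel)" using kern_meas[OF assms(1)] by (simp add: borel_prod)
 have [measurable]: "h \<in> borel_measurable (borel \<Otimes>\<^sub>M borel)" using assms(2) by (simp add: borel_prod)
 have "(%z. LBINT t. k (snd z, t) *\<^sub>R h (fst z, t)) \<in> borel_measurable (borel \<Otimes>\<^sub>M borel)" by measurable
 then show ?thesis by (simp add: tk_def[abs_def] borel_prod)
qed

text \<open>Schur's test: split the kernel into two square roots, apply Cauchy-Schwarz in each row,
  which costs one factor \<open>C\<close>, and integrate over the rows; Fubini and the column bound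
  give the second factor.\<close>

lemma tk1_schur:
 assumes k: "kern T C k" and h: "sqi h"
 shows "sqi (tk1 k h)" "ip (tk1 k h) (tk1 k h) <= C\<^sup>2 * ip h h"
proof -
 have C: "0 <= C" using k by (simp add: kern_def)
 have I: "integrable lborel (%z. k z * (norm (h (snd z)))\<^sup>2)"
  by (rule kern_tensor_integrable(1)[OF k sqi_int[OF h]])
 let ?J = "%r. LBINT t. k (r, t) * (norm (h t))\<^sup>2"
 have J: "integrable lborel ?J" using integral_slices(2)[OF I] by simp
 have pt: "(norm (tk1 k h r))\<^sup>2 <= C * ?J r" for r
 proof -
  let ?f = "%t. sqrt (k (r, t))" and ?g = "%t. sqrt (k (r, t)) * norm (h t)"
  have km [measurable]: "(%t. k (r, t)) \<in> BM" by (rule kern_slice_meas[OF k])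
  have hm [measurable]: "h \<in> BM" by (rule sqi_meas[OF h])
  have k0: "0 <= k (r, t)" for t by (rule kern_nonneg[OF k])
  have f: "sqi ?f" using kern_slice_integrable[OF k, of r] k0 by (simp add: sqi_def)
  obtain B where B: "B \<ge> 0" "!!r t. k (r, t) <= B * (ind {0<..<T} r * ind {0<..<T} t)"
   using kern_bound[OF k] by blast
  have kB: "k (r, t) <= B" for t using B(1) B(2)[of r t] by (auto simp: indicator_def of_bool_def split: if_splits)
  have g: "sqi ?g"
  proof (rule sqi_bound[OF h, where c="sqrt B"])
   show "norm (?g t) <= sqrt B * norm (h t)" for t
    using mult_right_mono[OF real_sqrt_le_mono[OF kB[of t]], of "norm (h t)"] k0[of t] by (simp add: abs_mult)
  qed measurable
  have "norm (tk1 k h r) <= (LBINT t. norm (k (r, t) *\<^sub>R h t))"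
   unfolding tk1_def by (rule integral_norm_bound)
  also have "\<dots> = ip ?f ?g"
   unfolding ip_def using k0 by (intro Bochner_Integration.integral_cong) (simp_all add: mult.assoc[symmetric])
  also have "\<dots> <= sqrt (ip ?f ?f) * sqrt (ip ?g ?g)"
   using ip_cauchy_schwarz[OF f g] by linarith
  finally have "(norm (tk1 k h r))\<^sup>2 <= (sqrt (ip ?f ?f) * sqrt (ip ?g ?g))\<^sup>2"
   by (intro power_mono) auto
  also have "\<dots> = ip ?f ?f * ip ?g ?g" by (simp add: power_mult_distrib ip_nonneg)
  also have "ip ?g ?g = ?J r"
   unfolding ip_norm using k0 by (intro Bochner_Integration.integral_cong) (simp_all add: power_mult_distrib)
  also have "ip ?f ?f * ?J r <= C * ?J r"
  proof (rule mult_right_mono)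
   show "ip ?f ?f <= C" using k k0 by (simp add: ip_norm kern_def)
   show "0 <= ?J r" using k0 by (intro integral_nonneg_AE AE_I2) simp
  qed
  finally show ?thesis .
 qed
 show s: "sqi (tk1 k h)"
  by (rule sqi_dominated[OF tk1_meas[OF k sqi_meas[OF h]] integrable_mult_right[OF J] pt])
 have "ip (tk1 k h) (tk1 k h) <= (LBINT r. C * ?J r)"
  unfolding ip_norm by (rule integral_mono[OF sqi_int[OF s] integrable_mult_right[OF J] pt])
 also have "\<dots> = C * (LBINT r. ?J r)" by simp
 also have "(LBINT r. ?J r) = (LBINT t. (LBINT r. k (r, t) * (norm (h t))\<^sup>2))"
 proof -
  have "integrable (lborel \<Otimes>\<^sub>M lborel) (%(r, t). k (r, t) * (norm (h t))\<^sup>2)"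
   using I by (simp add: lborel_prod case_prod_unfold)
  from lborel_pair.Fubini_integral[OF this] show ?thesis by simp
 qed
 also have "\<dots> <= (LBINT t. C * (norm (h t))\<^sup>2)"
 proof (rule integral_mono)
  have I2: "integrable lborel (%z. kT k z * (norm (h (fst z)))\<^sup>2)"
   by (rule kern_tensor_integrable(2)[OF kern_kT[OF k] sqi_int[OF h]])
  show "integrable lborel (%t. LBINT r. k (r, t) * (norm (h t))\<^sup>2)"
   using integral_slices(2)[OF I2] by (simp add: kT_def)
  show "integrable lborel (%t. C * (norm (h t))\<^sup>2)" using sqi_int[OF h] by simp
  show "(LBINT r. k (r, t) * (norm (h t))\<^sup>2) <= C * (norm (h t))\<^sup>2" for t
   using k by (simp add: kern_def mult_right_mono)
 qed
 also have "\<dots> = C * ip h h" by (simp add: ip_norm)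
 finally show "ip (tk1 k h) (tk1 k h) <= C\<^sup>2 * ip h h"
  using C by (simp add: power2_eq_square mult.assoc mult_left_mono)
qed

text \<open>Fubini. The double integral converges absolutely since
  \<open>|a \<bullet> b| \<le> |a|^2 + |b|^2\<close>, and each square is integrable against the
  kernel.\<close>

lemma tk1_adjoint:
 assumes k: "kern T C k" and h: "sqi h" and g: "sqi g"
 shows "ip (tk1 k h) g = ip h (tk1 (kT k) g)"
proof -
 have [measurable]: "k \<in> borel_measurable (borel \<Otimes>\<^sub>M borel)" using kern_meas[OF k] by (simp add: borel_prod)
 have [measurable]: "h \<in> BM" "g \<in> BM" using h g by (simp_all add: sqi_def)
 have I: "integrable lborel (%z. k z * (norm (h (snd z)))\<^sup>2 + k z * (norm (g (fst z)))\<^sup>2)"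
  by (intro Bochner_Integration.integrable_add kern_tensor_integrable[OF k] sqi_int h g)
 have "integrable lborel (%z. k z * (h (snd z) \<bullet> g (fst z)))"
 proof (rule Bochner_Integration.integrable_bound[OF I])
  have "(%z. k z * (h (snd z) \<bullet> g (fst z))) \<in> borel_measurable (borel \<Otimes>\<^sub>M borel)" by measurable
  then show "(%z. k z * (h (snd z) \<bullet> g (fst z))) \<in> borel_measurable lborel" by (simp add: borel_prod)
  have "\<bar>a \<bullet> b\<bar> <= (norm a)\<^sup>2 + (norm b)\<^sup>2" for a b :: 'a
  proof -
   have "\<bar>a \<bullet> b\<bar> <= norm a * norm b" by (rule Cauchy_Schwarz_ineq2)
   also have "\<dots> <= (norm a)\<^sup>2 + (norm b)\<^sup>2"
    using sum_squares_bound[of "norm a" "norm b"] mult_nonneg_nonneg[OF norm_ge_zero[of a] norm_ge_zero[of b]]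
    by (simp only: mult.assoc)
   finally show ?thesis .
  qed
  then have "\<bar>k z * (h (snd z) \<bullet> g (fst z))\<bar> <= k z * ((norm (h (snd z)))\<^sup>2 + (norm (g (fst z)))\<^sup>2)" for z
   using kern_nonneg[OF k, of z] by (simp add: abs_mult mult_left_mono)
  then show "AE z in lborel. norm (k z * (h (snd z) \<bullet> g (fst z)))
    <= norm (k z * (norm (h (snd z)))\<^sup>2 + k z * (norm (g (fst z)))\<^sup>2)"
   by (intro AE_I2) (simp add: distrib_left[symmetric] order_trans[OF _ abs_ge_self])
 qed
 then have F: "integrable (lborel \<Otimes>\<^sub>M lborel) (%(r, t). k (r, t) * (h t \<bullet> g r))"
  by (simp add: lborel_prod case_prod_unfold)
 have "ip (tk1 k h) g = (LBINT r. (LBINT t. k (r, t) * (h t \<bullet> g r)))"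
  unfolding ip_def tk1_def
  by (intro int_cong, subst integral_inner_left[symmetric])
    (auto intro!: kern_mult_integrable[OF k h])
 also have "\<dots> = (LBINT t. (LBINT r. k (r, t) * (h t \<bullet> g r)))"
  using lborel_pair.Fubini_integral[OF F] by simp
 also have "\<dots> = ip h (tk1 (kT k) g)"
  unfolding ip_def tk1_def
  by (intro int_cong, subst integral_inner_right[symmetric])
    (use kern_mult_integrable[OF kern_kT[OF k] g] in \<open>auto simp: kT_def\<close>)
 finally show ?thesis .
qed

lemma tk_schur:
 fixes h :: "'a::euclidean_space \<times> real => 'c::euclidean_space"
 assumes k: "kern T C k" and h: "sqi h"
 shows "sqi (tk k h)" "ip (tk k h) (tk k h) <= C\<^sup>2 * ip h h"
proof -
 have m [measurable]: "tk k h \<in> BM" by (rule tk_meas[OF k sqi_meas[OF h]])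
 have ae: "AE x in lborel. sqi (%t. h (x, t))" by (rule sqi_slice_AE[OF h])
 have I: "integrable lborel (%x. LBINT t. (norm (h (x, t)))\<^sup>2)"
  using integral_slices(2)[OF sqi_int[OF h]] by simp
 have le: "AE x in lborel. (LBINT r. (norm (tk k h (x, r)))\<^sup>2) <= C\<^sup>2 * (LBINT t. (norm (h (x, t)))\<^sup>2)"
  using ae
 proof eventually_elim
  case (elim x)
  show ?case using tk1_schur(2)[OF k elim] by (simp add: ip_norm tk_slice)
 qed
 have mm: "(%z. (norm (tk k h z))\<^sup>2) \<in> borel_measurable (lborel \<Otimes>\<^sub>M lborel)"
  using m by (simp add: lborel_prod)
 have m2: "(%x. LBINT r. (norm (tk k h (x, r)))\<^sup>2) \<in> borel_measurable lborel"
 proof -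
  have "tk k h \<in> borel_measurable (borel \<Otimes>\<^sub>M borel)" using m by (simp add: borel_prod)
  note this[measurable]
  show ?thesis by measurable
 qed
 have I2: "integrable lborel (%x. LBINT r. (norm (tk k h (x, r)))\<^sup>2)"
 proof (rule Bochner_Integration.integrable_bound[OF integrable_mult_right[OF I, of "C\<^sup>2"] m2])
  show "AE x in lborel. norm (LBINT r. (norm (tk k h (x, r)))\<^sup>2) <= norm (C\<^sup>2 * (LBINT t. (norm (h (x, t)))\<^sup>2))"
   using le by eventually_elim (simp add: integral_nonneg_AE)
 qed
 have "integrable (lborel \<Otimes>\<^sub>M lborel) (%z. (norm (tk k h z))\<^sup>2)"
 proof (rule lborel_pair.Fubini_integrable[OF mm])
  show "integrable lborel (%x. LBINT y. norm ((norm (tk k h (x, y)))\<^sup>2))" using I2 by simp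
  show "AE x in lborel. integrable lborel (%y. (norm (tk k h (x, y)))\<^sup>2)"
   using ae by eventually_elim (use tk1_schur(1)[OF k] in \<open>auto simp: sqi_def tk_slice\<close>)
 qed
 then have i: "integrable lborel (%z. (norm (tk k h z))\<^sup>2)" by (simp add: lborel_prod)
 then show "sqi (tk k h)" using m by (simp add: sqi_def)
 have "ip (tk k h) (tk k h) = (LBINT x. (LBINT r. (norm (tk k h (x, r)))\<^sup>2))"
  unfolding ip_norm using integral_slices(1)[OF i] by simp
 also have "\<dots> <= (LBINT x. C\<^sup>2 * (LBINT t. (norm (h (x, t)))\<^sup>2))"
  by (rule integral_mono_AE[OF I2 integrable_mult_right[OF I] le])
 also have "\<dots> = C\<^sup>2 * ip h h" unfolding ip_norm using integral_slices(1)[OF sqi_int[OF h]] by simp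
 finally show "ip (tk k h) (tk k h) <= C\<^sup>2 * ip h h" .
qed

lemma tk_adjoint:
 fixes h g :: "'a::euclidean_space \<times> real => 'c::euclidean_space"
 assumes k: "kern T C k" and h: "sqi h" and g: "sqi g"
 shows "ip (tk k h) g = ip h (tk (kT k) g)"
proof -
 have "AE x in lborel. ip (%r. tk k h (x, r)) (%t. g (x, t)) = ip (%t. h (x, t)) (%r. tk (kT k) g (x, r))"
  using sqi_slice_AE[OF h] sqi_slice_AE[OF g]
  by eventually_elim (use tk1_adjoint[OF k] in \<open>simp add: tk_slice\<close>)
 then have "(LBINT x. ip (%r. tk k h (x, r)) (%t. g (x, t))) = (LBINT x. ip (%t. h (x, t)) (%r. tk (kT k) g (x, r)))"
 proof (rule integral_cong_AE[rotated 2])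
  have i1: "integrable lborel (%z. tk k h z \<bullet> g z)" by (rule ip_integrable[OF tk_schur(1)[OF k h] g])
  have i2: "integrable lborel (%z. h z \<bullet> tk (kT k) g z)" by (rule ip_integrable[OF h tk_schur(1)[OF kern_kT[OF k] g]])
  show "(%x. ip (%r. tk k h (x, r)) (%t. g (x, t))) \<in> borel_measurable lborel"
   using integral_slices(2)[OF i1] by (simp add: ip_def)
  show "(%x. ip (%t. h (x, t)) (%r. tk (kT k) g (x, r))) \<in> borel_measurable lborel"
   using integral_slices(2)[OF i2] by (simp add: ip_def)
 qed
 then show ?thesis using ip_slices[OF tk_schur(1)[OF k h] g] ip_slices[OF h tk_schur(1)[OF kern_kT[OF k] g]] by simp
qed

lemma tk_tensor: "tk k (p \<otimes> q) z = p (fst z) * (tk1 k q (snd z) :: real)"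
 by (simp add: tk_def tk1_def mult.left_commute)

lemma tk_xmult: "tk k (%z. m (fst z) *\<^sub>R h z) z = m (fst z) *\<^sub>R tk k h z"
 by (simp only: tk_def scaleR_left_commute[of _ "m (fst z)"] fst_conv integral_scaleR_right)

lemma tk_xmult_real: "tk k (%z. m (fst z) * h z) z = m (fst z) * (tk k h z :: real)"
 using tk_xmult[of k m h z] by simp

text \<open>A vector-valued slice that is not integrable may still have an integrable component, so
  the inner product can be pulled out of the integral only on almost every line.\<close>

lemma tk_inner:
 fixes h :: "'a::euclidean_space \<times> real => 'c::euclidean_space"
 assumes k: "kern T C k" and h: "sqi h"
 shows "AE z in lborel. tk k (%z. h z \<bullet> i) z = tk k h z \<bullet> i"
proof (rule AE_pair_slices)
 have [measurable]: "tk k h \<in> BM" "tk k (%z. h z \<bullet> i) \<in> BM"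
  using tk_meas[OF k sqi_meas[OF h]] tk_meas[OF k sqi_meas[OF sqi_comp[OF h]]] by auto
 show "Measurable.pred borel (%z. tk k (%z. h z \<bullet> i) z = tk k h z \<bullet> i)" by measurable
 show "AE x in lborel. AE t in lborel. tk k (%z. h z \<bullet> i) (x, t) = tk k h (x, t) \<bullet> i"
  using sqi_slice_AE[OF h]
 proof eventually_elim
  case (elim x)
  show ?case
  proof (rule AE_I2)
   fix r
   show "tk k (%z. h z \<bullet> i) (x, r) = tk k h (x, r) \<bullet> i"
    unfolding tk_def using integral_inner_left[OF kern_mult_integrable[OF k elim, of r], of i] by simp
  qed
 qed
qed

subsection \<open>Borel representatives\<close>

lemma borel_representative:
 fixes v :: "'b::euclidean_space => 'c::euclidean_space"
 assumes S: "S \<in> sets borel" and v: "v \<in> borel_measurable (lebesgue_on S)"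
 shows "\<exists>v'. v' \<in> BM \<and> (\<forall>z. z \<notin> S --> v' z = 0) \<and> (AE z in lborel. z \<in> S --> v z = v' z)"
proof -
 have S': "S \<in> sets lebesgue" using S by simp
 define V where "V z = ind S z *\<^sub>R v z" for z
 have V: "V \<in> borel_measurable lebesgue"
  using v S' unfolding V_def[abs_def] by (subst (asm) borel_measurable_restrict_space_iff) auto
 have "\<forall>i\<in>Basis. \<exists>g\<in>borel_measurable lborel. AE z in lborel. V z \<bullet> i = g z"
  using V by (intro ballI completion_ex_borel_measurable_real borel_measurable_inner) auto
 then obtain g where g: "!!i. i \<in> Basis ==> g i \<in> borel_measurable lborel"
  "!!i. i \<in> Basis ==> AE z in lborel. V z \<bullet> i = g i z" by metis
 define v' where "v' z = ind S z *\<^sub>R (\<Sum>i\<in>Basis. g i z *\<^sub>R i)" for z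
 have "v' \<in> BM"
  unfolding v'_def[abs_def] using g(1) S by (intro borel_measurable_scaleR borel_measurable_sum) auto
 moreover have "AE z in lborel. \<forall>i\<in>Basis. V z \<bullet> i = g i z"
  using g(2) by (intro AE_finite_allI) auto
 then have "AE z in lborel. z \<in> S --> v z = v' z"
 proof eventually_elim
  case (elim z)
  have "(\<Sum>i\<in>Basis. g i z *\<^sub>R i) = (\<Sum>i\<in>Basis. (V z \<bullet> i) *\<^sub>R i)" using elim by (intro sum.cong) auto
  also have "\<dots> = V z" by (rule euclidean_representation)
  finally show ?case by (simp add: v'_def V_def)
 qed
 ultimately show ?thesis by (intro exI[of _ v']) (simp add: v'_def)
qed

lemma AE_measurable_lebesgue_on:
 fixes v v' :: "'b::euclidean_space => 'c::euclidean_space"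
 assumes S: "S \<in> sets borel" and v': "v' \<in> BM" "AE z in lborel. z \<in> S --> v z = v' z"
 shows "v \<in> borel_measurable (lebesgue_on S)"
proof -
 have "(%z. ind S z *\<^sub>R v' z) \<in> BM" using v'(1) S by auto
 then have m: "(%z. ind S z *\<^sub>R v' z) \<in> borel_measurable lebesgue"
  by (simp add: measurable_completion)
 have "AE z in lebesgue. ind S z *\<^sub>R v' z = ind S z *\<^sub>R v z"
  using AE_completion[OF v'(2)] by eventually_elim (auto simp: indicator_def)
 from borel_measurable_AE[OF m this] show ?thesis
  using S by (subst borel_measurable_restrict_space_iff) auto
qed

lemma lebesgue_on_integral_eq:
 fixes v v' :: "'b::euclidean_space => 'c::euclidean_space"
 assumes S: "S \<in> sets borel" and v': "v' \<in> BM" "AE z in lborel. z \<in> S --> v z = v' z"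
  and out: "!!z. z \<notin> S ==> v' z = 0"
 shows "integral\<^sup>L (lebesgue_on S) v = (LBINT z. v' z)"
  "integrable (lebesgue_on S) v \<longleftrightarrow> integrable lborel v'"
proof -
 have S': "S \<inter> space lebesgue \<in> sets lebesgue" using S by simp
 have v'': "v' = (%z. ind S z *\<^sub>R v' z)" using out by (auto simp: indicator_def)
 have ml: "v' \<in> borel_measurable lebesgue" using v'(1) by (simp add: measurable_completion)
 have ae: "AE z in lebesgue. v' z = ind S z *\<^sub>R v z"
  using AE_completion[OF v'(2)] by eventually_elim (auto simp: indicator_def out)
 have mr: "(%z. ind S z *\<^sub>R v z) \<in> borel_measurable lebesgue" by (rule borel_measurable_AE[OF ml ae])
 have ae2: "AE z in lebesgue. ind S z *\<^sub>R v z = v' z" using ae by eventually_elim simp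
 have "integral\<^sup>L (lebesgue_on S) v = integral\<^sup>L lebesgue (%z. ind S z *\<^sub>R v z)"
  by (rule integral_restrict_space[OF S'])
 also have "\<dots> = integral\<^sup>L lebesgue v'" by (rule integral_cong_AE[OF mr ml ae2])
 also have "\<dots> = integral\<^sup>L lborel v'" by (rule integral_completion) (use v' in simp)
 finally show "integral\<^sup>L (lebesgue_on S) v = (LBINT z. v' z)" .
 have "integrable (lebesgue_on S) v \<longleftrightarrow> integrable lebesgue (%z. ind S z *\<^sub>R v z)"
  by (rule integrable_restrict_space[OF S'])
 also have "\<dots> \<longleftrightarrow> integrable lebesgue v'" by (rule integrable_cong_AE[OF mr ml ae2])
 also have "\<dots> \<longleftrightarrow> integrable lborel v'" by (rule integrable_completion) (use v' in simp)
 finally show "integrable (lebesgue_on S) v \<longleftrightarrow> integrable lborel v'" .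
qed

text \<open>Bridge between two languages: the theorem speaks of Lebesgue-measurable functions on a
  set, the estimates of Borel functions on the whole space that vanish off that set.\<close>

definition rep :: "'b::euclidean_space set => ('b => 'c::euclidean_space) => ('b => 'c) => bool" where
 "rep S v v' \<longleftrightarrow> v' \<in> BM \<and> (\<forall>z. z \<notin> S --> v' z = 0) \<and> (AE z in lborel. z \<in> S --> v z = v' z)"

lemma rep_ex: "S \<in> sets borel ==> v \<in> borel_measurable (lebesgue_on S) ==> \<exists>v'. rep S v v'"
 unfolding rep_def by (rule borel_representative)

lemma rep_AE: "rep S v v' ==> AE z in lborel. z \<in> S --> v z = v' z" by (simp add: rep_def)
lemma rep_out: "rep S v v' ==> z \<notin> S ==> v' z = 0" by (simp add: rep_def)
lemma rep_meas: "rep S v v' ==> v' \<in> BM" by (simp add: rep_def)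

lemma L2v_iff_rep:
 assumes "S \<in> sets borel" "rep S v v'" shows "L2v S v \<longleftrightarrow> sqi v'"
proof -
 note r = rep_meas[OF assms(2)] rep_AE[OF assms(2)]
 have "v \<in> borel_measurable (lebesgue_on S)" by (rule AE_measurable_lebesgue_on[OF assms(1) r])
 moreover have "integrable (lebesgue_on S) (%z. (norm (v z))\<^sup>2) \<longleftrightarrow> integrable lborel (%z. (norm (v' z))\<^sup>2)"
  by (rule lebesgue_on_integral_eq(2)[OF assms(1)])
    (use r rep_out[OF assms(2)] in \<open>auto elim: eventually_mono\<close>)
 ultimately show ?thesis using r by (simp add: L2v_def sqi_def)
qed

lemma L2_iff_L2v: "L2 S v \<longleftrightarrow> L2v S v"
 by (simp add: L2_def L2v_def)

lemma L2_iff_rep: "S \<in> sets borel ==> rep S v v' ==> L2 S v \<longleftrightarrow> sqi v'"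
 by (simp add: L2_iff_L2v L2v_iff_rep)

lemma L2v_rep_ex: "S \<in> sets borel ==> L2v S v ==> \<exists>v'. rep S v v' \<and> sqi v'"
 using rep_ex[of S v] L2v_iff_rep[of S v] by (auto simp: L2v_def)

lemma L2_rep_ex: "S \<in> sets borel ==> L2 S v ==> \<exists>v'. rep S v v' \<and> sqi v'"
 using L2v_rep_ex by (simp add: L2_iff_L2v)

lemma rep_ip:
 assumes "S \<in> sets borel" "rep S v v'" "g \<in> BM" "AE z in lborel. z \<in> S --> h z = g z"
 shows "integral\<^sup>L (lebesgue_on S) (%z. v z \<bullet> h z) = ip v' g"
 unfolding ip_def
proof (rule lebesgue_on_integral_eq(1)[OF assms(1)])
 note [measurable] = rep_meas[OF assms(2)] assms(3)
 show "(%z. v' z \<bullet> g z) \<in> BM" by measurable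
 show "AE z in lborel. z \<in> S --> v z \<bullet> h z = v' z \<bullet> g z"
  using rep_AE[OF assms(2)] assms(4) by eventually_elim simp
 show "z \<notin> S ==> v' z \<bullet> g z = 0" for z using rep_out[OF assms(2)] by simp
qed

lemma rep_ip_real:
 fixes v v' g h :: "'b::euclidean_space => real"
 assumes "S \<in> sets borel" "rep S v v'" "g \<in> BM" "AE z in lborel. z \<in> S --> h z = g z"
 shows "integral\<^sup>L (lebesgue_on S) (%z. v z * h z) = ip v' g"
 using rep_ip[OF assms] by simp

lemma cyl_open: "open V ==> open (cyl V s T)"
 by (simp add: cyl_def open_Times)

lemma cyl_borel:
 fixes V :: "'a::euclidean_space set"
 assumes "V \<in> sets borel" shows "cyl V s T \<in> sets borel"
proof -
 have "V \<times> {s<..<T} \<in> sets (borel \<Otimes>\<^sub>M borel)" using assms by (intro pair_measureI) auto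
 then show ?thesis unfolding cyl_def borel_prod .
qed

subsection \<open>Spatial weak gradients\<close>

text \<open>The time factor \<open>q\<close> is an arbitrary L^2 function on the whole line.
  Kernels, multipliers and shifts in time that act on \<open>v\<close> and \<open>G\<close> can
  therefore be moved onto \<open>q\<close> by duality; extension by zero in time is harmless because
  only x-derivatives occur.\<close>

definition wgrad :: "'a::euclidean_space set => ('a \<times> real => real) => ('a \<times> real => 'a) => bool" where
 "wgrad V v G \<longleftrightarrow> (\<forall>p q i. test_fun V p --> sqi q --> i \<in> Basis -->
   ip v (%z. fder p (fst z) i * q (snd z)) + ip (%z. G z \<bullet> i) (p \<otimes> q) = 0)"

lemma wgradI:
 assumes "!!p q i. test_fun V p ==> sqi q ==> i \<in> Basis ==>
   ip v (%z. fder p (fst z) i * q (snd z)) + ip (%z. G z \<bullet> i) (p \<otimes> q) = 0"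
 shows "wgrad V v G"
 unfolding wgrad_def using assms by blast

lemma wgradD:
 "wgrad V v G ==> test_fun V p ==> sqi q ==> i \<in> Basis ==>
   ip v (%z. fder p (fst z) i * q (snd z)) + ip (%z. G z \<bullet> i) (p \<otimes> q) = 0"
 unfolding wgrad_def by blast

lemma test_tensor_sqi: "test_fun V p ==> sqi (q::real=>real) ==> sqi (p \<otimes> q)"
 by (rule sqi_tensor[OF test_fun_sqi])

lemma frechet_tensor_sqi: "test_fun V p ==> sqi (q::real=>real) ==> sqi (%z. fder p (fst z) i * q (snd z))"
 by (rule sqi_tensor[OF test_fun_sqi[OF test_fun_frechet]])

lemma wgrad_mono: "wgrad V v G ==> V' \<subseteq> V ==> wgrad V' v G"
 unfolding wgrad_def using test_fun_mono by blast

lemma wgrad_add: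
 assumes "wgrad V v G" "wgrad V v2 G2" "sqi v" "sqi G" "sqi v2" "sqi G2"
 shows "wgrad V (%z. v z + v2 z) (%z. G z + G2 z)"
proof (rule wgradI)
 fix p :: "'a => real" and q :: "real => real" and i :: 'a assume a: "test_fun V p" "sqi q" "i \<in> Basis"
 show "ip (%z. v z + v2 z) (%z. fder p (fst z) i * q (snd z))
   + ip (%z. (G z + G2 z) \<bullet> i) (p \<otimes> q) = 0"
  unfolding inner_add_left
  using wgradD[OF assms(1) a] wgradD[OF assms(2) a]
  by (simp add: ip_add_left[OF assms(3,5) frechet_tensor_sqi[OF a(1,2)]]
    ip_add_left[OF sqi_comp[OF assms(4)] sqi_comp[OF assms(6)] test_tensor_sqi[OF a(1,2)]])
qed

lemma wgrad_scale: "wgrad V v G ==> wgrad V (%z. c * v z) (%z. c *\<^sub>R G z)"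
proof (rule wgradI)
 fix p :: "'a => real" and q :: "real => real" and i :: 'a
 assume w: "wgrad V v G" and a: "test_fun V p" "sqi q" "i \<in> Basis"
 have "ip (%z. c *\<^sub>R G z \<bullet> i) (p \<otimes> q) = c * ip (%z. G z \<bullet> i) (p \<otimes> q)"
  by (simp add: ip_cmult_left)
 then show "ip (%z. c * v z) (%z. fder p (fst z) i * q (snd z))
   + ip (%z. c *\<^sub>R G z \<bullet> i) (p \<otimes> q) = 0"
  using wgradD[OF w a] by (simp add: ip_cmult_left distrib_left[symmetric] del: inner_scaleR_left)
qed

lemma wgrad_cong_AE:
 assumes w: "wgrad V v G" and s: "sqi v" "sqi G" "sqi v2" "sqi G2"
  and ae: "AE z in lborel. v z = v2 z" "AE z in lborel. G z = G2 z"
 shows "wgrad V v2 G2"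
proof (rule wgradI)
 fix p :: "'a => real" and q :: "real => real" and i :: 'a assume a: "test_fun V p" "sqi q" "i \<in> Basis"
 have 1: "ip v2 (%z. fder p (fst z) i * q (snd z)) = ip v (%z. fder p (fst z) i * q (snd z))"
  by (rule ip_cong_AE) (use s frechet_tensor_sqi[OF a(1,2)] ae in \<open>auto simp: sqi_def elim: eventually_mono\<close>)
 have 2: "ip (%z. G2 z \<bullet> i) (p \<otimes> q) = ip (%z. G z \<bullet> i) (p \<otimes> q)"
  by (rule ip_cong_AE) (use s test_tensor_sqi[OF a(1,2)] ae in \<open>auto simp: sqi_def elim: eventually_mono\<close>)
 show "ip v2 (%z. fder p (fst z) i * q (snd z)) + ip (%z. G2 z \<bullet> i) (p \<otimes> q) = 0"
  unfolding 1 2 by (rule wgradD[OF w a])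
qed

lemma wgrad_tk:
 assumes w: "wgrad V v G" and s: "sqi v" "sqi G" and k: "kern T C k"
 shows "wgrad V (tk k v) (tk k G)"
proof (rule wgradI)
 fix p :: "'a => real" and q :: "real => real" and i :: 'a assume a: "test_fun V p" "sqi q" "i \<in> Basis"
 note kT = kern_kT[OF k]
 have 1: "ip (tk k v) (%z. fder p (fst z) i * q (snd z))
   = ip v (%z. fder p (fst z) i * tk1 (kT k) q (snd z))"
  unfolding tk_adjoint[OF k s(1) frechet_tensor_sqi[OF a(1,2)]]
  by (rule arg_cong[of _ _ "ip v"], rule ext, rule tk_tensor)
 have "ip (%z. tk k G z \<bullet> i) (p \<otimes> q) = ip (tk k (%z. G z \<bullet> i)) (p \<otimes> q)"
 proof (rule ip_cong_AE)
  show "AE z in lborel. (tk k G z \<bullet> i) \<bullet> (p (fst z) * q (snd z)) = tk k (%z. G z \<bullet> i) z \<bullet> (p (fst z) * q (snd z))"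
   using tk_inner[OF k s(2), of i] by eventually_elim simp
 qed (use test_tensor_sqi[OF a(1,2)] sqi_comp[OF tk_schur(1)[OF k s(2)], of i] tk_schur(1)[OF k sqi_comp[OF s(2)], of i] in \<open>auto simp: sqi_def\<close>)
 also have "\<dots> = ip (%z. G z \<bullet> i) (%z. p (fst z) * tk1 (kT k) q (snd z))"
  unfolding tk_adjoint[OF k sqi_comp[OF s(2)] test_tensor_sqi[OF a(1,2)]]
  by (rule arg_cong[of _ _ "ip (%z. G z \<bullet> i)"], rule ext, rule tk_tensor)
 finally show "ip (tk k v) (%z. fder p (fst z) i * q (snd z)) + ip (%z. tk k G z \<bullet> i) (p \<otimes> q) = 0"
  using 1 wgradD[OF w a(1) tk1_schur(1)[OF kT a(2)] a(3)] by simp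
qed

lemma wgrad_tmult:
 assumes w: "wgrad V v G" and \<eta>: "\<eta> \<in> BM" "!!t. \<bar>\<eta> t\<bar> <= B"
 shows "wgrad V (%z. \<eta> (snd z) * v z) (%z. \<eta> (snd z) *\<^sub>R G z)"
proof (rule wgradI)
 fix p :: "'a => real" and q :: "real => real" and i :: 'a assume a: "test_fun V p" "sqi q" "i \<in> Basis"
 have "sqi (%t. \<eta> t * q t)" by (rule sqi_bmult_real[OF a(2) \<eta>])
 from wgradD[OF w a(1) this a(3)]
 show "ip (%z. \<eta> (snd z) * v z) (%z. fder p (fst z) i * q (snd z))
   + ip (%z. \<eta> (snd z) *\<^sub>R G z \<bullet> i) (p \<otimes> q) = 0"
  by (simp add: ip_def ac_simps)
qed

lemma wgrad_xmult:
 assumes w: "wgrad V v G" and s: "sqi v" "sqi G" and \<theta>: "smooth_on UNIV \<theta>"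
 shows "wgrad V (%z. \<theta> (fst z) * v z) (%z. \<theta> (fst z) *\<^sub>R G z + v z *\<^sub>R gradv \<theta> (fst z))"
proof (rule wgradI)
 fix p :: "'a => real" and q :: "real => real" and i :: 'a assume a: "test_fun V p" "sqi q" "i \<in> Basis"
 have tp: "test_fun V (%x. \<theta> x * p x)" by (rule test_fun_mult[OF a(1) \<theta>])
 have D: "fder (%x. \<theta> x * p x) x i = \<theta> x * fder p x i + fder \<theta> x i * p x" for x
  using frechet_derivative_eqI[OF has_derivative_mult[OF smooth_on_has_derivative[OF \<theta>] smooth_on_has_derivative[OF test_fun_smooth[OF a(1)]]], of x]
  by simp
 have t1: "sqi (%z. (\<theta> (fst z) * fder p (fst z) i) * q (snd z))"
  by (rule test_tensor_sqi[OF test_fun_mult[OF test_fun_frechet[OF a(1)] \<theta>] a(2)])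
 have t2: "sqi (%z. (fder \<theta> (fst z) i * p (fst z)) * q (snd z))"
  by (rule test_tensor_sqi[OF test_fun_mult[OF a(1) smooth_on_frechet[OF \<theta>]] a(2)])
 have t3: "sqi (%z. \<theta> (fst z) * p (fst z) * q (snd z))" by (rule test_tensor_sqi[OF tp a(2)])
 have "ip v (%z. fder (%x. \<theta> x * p x) (fst z) i * q (snd z))
  = ip v (%z. (\<theta> (fst z) * fder p (fst z) i) * q (snd z))
   + ip v (%z. (fder \<theta> (fst z) i * p (fst z)) * q (snd z))"
  unfolding D distrib_right by (rule ip_add_right[OF t1 t2 s(1)])
 moreover have "ip (%z. (\<theta> (fst z) *\<^sub>R G z + v z *\<^sub>R gradv \<theta> (fst z)) \<bullet> i) (p \<otimes> q)
  = ip (%z. G z \<bullet> i) (%z. \<theta> (fst z) * p (fst z) * q (snd z))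
   + ip v (%z. (fder \<theta> (fst z) i * p (fst z)) * q (snd z))"
  unfolding ip_def Bochner_Integration.integral_add[OF ip_integrable[OF sqi_comp[OF s(2)] t3] ip_integrable[OF s(1) t2], symmetric]
  using a(3) by (intro int_cong) (simp add: inner_add_left algebra_simps)
 moreover have "ip (%z. \<theta> (fst z) * v z) (%z. fder p (fst z) i * q (snd z))
  = ip v (%z. (\<theta> (fst z) * fder p (fst z) i) * q (snd z))"
  by (simp add: ip_def ac_simps)
 ultimately show "ip (%z. \<theta> (fst z) * v z) (%z. fder p (fst z) i * q (snd z))
   + ip (%z. (\<theta> (fst z) *\<^sub>R G z + v z *\<^sub>R gradv \<theta> (fst z)) \<bullet> i) (p \<otimes> q) = 0"
  using wgradD[OF w tp a(2,3)] by linarith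
qed

section \<open>Translation in time; smooth space-time test functions versus products\<close>

definition shift :: "real => ('a \<times> real => 'c) => 'a \<times> real => 'c" where
 "shift h f z = f (fst z, snd z + h)"

lemma shift_plus: "shift h f = (%z. f ((0, h) + z))" for f :: "'a::euclidean_space \<times> real => 'c"
 by (rule ext) (simp add: shift_def plus_prod_def add.commute)

lemma shift_meas: "f \<in> BM ==> shift h f \<in> BM"
 for f :: "'a::euclidean_space \<times> real => 'c::euclidean_space"
 unfolding shift_plus by (rule measurable_compose[of "(+) (0, h)" borel borel f]) simp_all

lemma integral_shift:
 fixes f :: "'a::euclidean_space \<times> real => 'c::euclidean_space"
 assumes f: "f \<in> BM"
 shows "(LBINT z. shift h f z) = (LBINT z. f z)" "integrable lborel (shift h f) \<longleftrightarrow> integrable lborel f"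
proof -
 have m: "(+) (0, h) \<in> measurable lborel (borel :: ('a \<times> real) measure)" by simp
 have "(LBINT z. f z) = (\<integral>z. f z \<partial>distr lborel borel ((+) (0, h)))" by (simp add: lborel_distr_plus)
 also have "\<dots> = (LBINT z. shift h f z)" unfolding shift_plus by (rule integral_distr[OF m f])
 finally show "(LBINT z. shift h f z) = (LBINT z. f z)" by simp
 have "integrable lborel f \<longleftrightarrow> integrable (distr lborel borel ((+) (0, h))) f" by (simp add: lborel_distr_plus)
 also have "\<dots> \<longleftrightarrow> integrable lborel (shift h f)" unfolding shift_plus by (rule integrable_distr_eq[OF m f])
 finally show "integrable lborel (shift h f) \<longleftrightarrow> integrable lborel f" by simp
qed

lemma sqi_shift: "sqi f ==> sqi (shift h f)"
 for f :: "'a::euclidean_space \<times> real => 'c::euclidean_space"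
proof -
 assume f: "sqi f"
 have [measurable]: "f \<in> BM" by (rule sqi_meas[OF f])
 have "(%z. (norm (f z))\<^sup>2) \<in> BM" by measurable
 then show ?thesis using integral_shift(2)[of "%z. (norm (f z))\<^sup>2" h] shift_meas[of f h] f
  by (simp add: sqi_def shift_def[abs_def])
qed

lemma ip_shift: "sqi f ==> sqi g ==> ip (shift h f) g = ip f (shift (-h) g)"
 for f :: "'a::euclidean_space \<times> real => 'c::euclidean_space"
proof -
 assume f: "sqi f" and g: "sqi g"
 have [measurable]: "f \<in> BM" "shift (-h) g \<in> BM"
  using f sqi_shift[OF g] by (auto simp: sqi_def)
 have "(%z. f z \<bullet> shift (-h) g z) \<in> BM" by measurable
 from integral_shift(1)[OF this, of h] show ?thesis by (simp add: ip_def shift_def)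
qed

lemma sqi_shift1: "sqi (q :: real => real) ==> sqi (%t. q (t + h))"
proof -
 assume q: "sqi q"
 have "integrable lborel (%t. (norm (q (h + 1 * t)))\<^sup>2)"
  using lborel_integrable_real_affine[OF sqi_int[OF q], of 1 h] by simp
 moreover have "(%t. q (t + h)) \<in> BM" using sqi_meas[OF q] by measurable
 ultimately show ?thesis by (simp add: sqi_def add.commute)
qed

lemma wgrad_shift:
 assumes w: "wgrad V v G" and s: "sqi v" "sqi G"
 shows "wgrad V (shift h v) (shift h G)"
proof (rule wgradI)
 fix p :: "'a => real" and q :: "real => real" and i :: 'a assume a: "test_fun V p" "sqi q" "i \<in> Basis"
 have 1: "ip (shift h v) (%z. fder p (fst z) i * q (snd z))
   = ip v (%z. fder p (fst z) i * q (snd z + (-h)))"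
  unfolding ip_shift[OF s(1) frechet_tensor_sqi[OF a(1,2)]] by (simp add: shift_def[abs_def])
 have "(%z. shift h G z \<bullet> i) = shift h (%z. G z \<bullet> i)" by (simp add: shift_def[abs_def])
 then have 2: "ip (%z. shift h G z \<bullet> i) (p \<otimes> q) = ip (%z. G z \<bullet> i) (%z. p (fst z) * q (snd z + (-h)))"
  using ip_shift[OF sqi_comp[OF s(2)] test_tensor_sqi[OF a(1,2)], of h i] by (simp add: shift_def[abs_def])
 show "ip (shift h v) (%z. fder p (fst z) i * q (snd z)) + ip (%z. shift h G z \<bullet> i) (p \<otimes> q) = 0"
  unfolding 1 2 by (rule wgradD[OF w a(1) sqi_shift1[OF a(2)] a(3)])
qed

lemma ip_tensor:
 fixes p p' :: "'a::euclidean_space => real" and q q' :: "'d::euclidean_space => real"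
 assumes "sqi p" "sqi p'" "sqi q" "sqi q'"
 shows "ip (p \<otimes> q) (p' \<otimes> q') = ip p p' * ip q q'"
proof -
 have "ip (p \<otimes> q) (p' \<otimes> q')
   = (LBINT x. ip (%t. p x * q t) (%t. p' x * q' t))"
  using ip_slices[OF sqi_tensor[OF assms(1,3)] sqi_tensor[OF assms(2,4)]] by simp
 also have "\<dots> = (LBINT x. (p x * p' x) * ip q q')"
  by (simp add: ip_cmult_left ip_cmult_right mult.assoc)
 finally show ?thesis by (simp add: ip_def)
qed

lemma L2_induct_test:
 fixes P :: "('b::euclidean_space => real) => bool"
 assumes Q: "open Q" and h: "sqi h" "!!z. z \<notin> Q ==> h z = 0"
  and test: "!!p. test_fun Q p ==> P p"
  and add: "!!f g. sqi f ==> sqi g ==> P f ==> P g ==> P (%z. f z + g z)"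
  and scale: "!!f c. sqi f ==> P f ==> P (%z. c * f z)"
  and lim: "!!F f. (!!n::nat. sqi (F n)) ==> (!!n. P (F n)) ==> sqi f ==>
    (%n. ip (%z. F n z - f z) (%z. F n z - f z)) ~~> 0 ==> P f"
 shows "P h"
proof (rule L2_induct[OF Q h])
 fix a b :: 'b assume ab: "cbox a b \<subseteq> Q"
 have sq: "sqi (boxbump n a b)" for n by (rule test_fun_sqi[OF test_fun_boxbump[OF ab]])
 have sqb: "sqi (ind (box a b))" by (rule indicator_sqi[OF _ emeasure_lborel_box_finite]) simp
 show "P (ind (box a b))"
 proof (rule lim[OF sq test[OF test_fun_boxbump[OF ab]] sqb])
  show "(%n. ip (%z. boxbump n a b z - ind (box a b) z) (%z. boxbump n a b z - ind (box a b) z)) ~~> 0"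
  proof (rule L2_dominated_convergence[OF sqi_meas[OF sq] sqi_meas[OF sqb] sqb _ boxbump_tendsto])
   show "norm (boxbump n a b z - ind (box a b) z) <= norm (ind (box a b) z)" for n z
    using boxbump_bounds[of n a b z] boxbump_eq_0_iff[of n a b z] by (cases "z \<in> box a b") auto
  qed
 qed
next
 fix z assume "z \<notin> Q" then show "z \<notin> Q" .
qed (fact add scale lim)+

lemma tensor_tendsto:
 fixes p :: "'a::euclidean_space => real" and q :: "'d::euclidean_space => real"
 assumes "sqi p" "!!n. sqi (F n)" "sqi q" "(%n. ip (%z. F n z - q z) (%z. F n z - q z)) ~~> 0" "sqi v"
 shows "(%n. ip v (%z. p (fst z) * F n (snd z))) ~~> ip v (p \<otimes> q)"
proof (rule ip_tendsto_strong[OF sqi_tensor[OF assms(1,2)] sqi_tensor[OF assms(1,3)] assms(5)])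
 have "ip (%z. p (fst z) * F n (snd z) - p (fst z) * q (snd z)) (%z. p (fst z) * F n (snd z) - p (fst z) * q (snd z))
   = ip p p * ip (%z. F n z - q z) (%z. F n z - q z)" for n
  using ip_tensor[OF assms(1,1) sqi_diff[OF assms(2,3)] sqi_diff[OF assms(2,3)], of n n]
  by (simp add: right_diff_distrib)
 then show "(%n. ip (%z. p (fst z) * F n (snd z) - p (fst z) * q (snd z)) (%z. p (fst z) * F n (snd z) - p (fst z) * q (snd z))) ~~> 0"
  using tendsto_mult[OF tendsto_const assms(4), of "ip p p"] by simp
qed

lemma frechet_pair_x:
 assumes "smooth_on UNIV p" "smooth_on UNIV q"
 shows "fder (p \<otimes> q) z (i, 0) = fder p (fst z) i * q (snd z)"
 using frechet_pair[OF assms, of z "(i, 0)"] linear_0[OF has_derivative_linear[OF smooth_on_has_derivative[OF assms(2), of "snd z"]]]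
 by simp

lemma frechet_pair_t:
 assumes "smooth_on UNIV p" "smooth_on UNIV q"
 shows "fder (p \<otimes> q) z (0, 1) = p (fst z) * fder q (snd z) 1"
 using frechet_pair[OF assms, of z "(0, 1)"] linear_0[OF has_derivative_linear[OF smooth_on_has_derivative[OF assms(1), of "fst z"]]]
 by simp

text \<open>For fixed \<open>p\<close> both pairings are linear and L^2-continuous in
  \<open>q\<close>, so the density of test functions in L^2(s, T) removes the smoothness of
  \<open>q\<close>. As \<open>v\<close> and \<open>G\<close> vanish at all other times,
  \<open>q\<close> may first be truncated to the interval.\<close>

lemma wgrad_of_weak:
 assumes w: "!!\<psi> i. test_fun (cyl V s T) \<psi> ==> i \<in> Basis ==>
    ip v (%z. fder \<psi> z (i, 0)) = - ip (%z. G z \<bullet> i) \<psi>"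
  and s: "sqi v" "sqi G" and out: "!!z. snd z \<notin> {s<..<T} ==> v z = 0 \<and> G z = 0"
 shows "wgrad V v G"
proof (rule wgradI)
 fix p :: "'a => real" and q :: "real => real" and i :: 'a assume a: "test_fun V p" "sqi q" "i \<in> Basis"
 let ?P = "%q. ip v (%z. fder p (fst z) i * q (snd z)) + ip (%z. G z \<bullet> i) (p \<otimes> q) = 0"
 have dp: "sqi (%x. fder p x i)" by (rule test_fun_sqi[OF test_fun_frechet[OF a(1)]])
 have sp: "sqi p" by (rule test_fun_sqi[OF a(1)])
 define q' where "q' t = ind {s<..<T} t * q t" for t
 have q': "sqi q'" unfolding q'_def[abs_def] using sqi_indicator[OF a(2), of "{s<..<T}"] by simp
 have "?P q'"
 proof (rule L2_induct_test[OF open_greaterThanLessThan[of s T] q'])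
  fix q :: "real => real" assume q: "test_fun {s<..<T} q"
  have "test_fun (cyl V s T) (p \<otimes> q)" unfolding cyl_def by (rule test_fun_pair[OF a(1) q])
  from w[OF this a(3)] show "?P q"
   by (simp add: frechet_pair_x[OF test_fun_smooth[OF a(1)] test_fun_smooth[OF q]])
 next
  fix f g :: "real => real" assume fg: "sqi f" "sqi g" "?P f" "?P g"
  show "?P (%t. f t + g t)"
   unfolding distrib_left
   using ip_add_right[OF frechet_tensor_sqi[OF a(1) fg(1)] frechet_tensor_sqi[OF a(1) fg(2)] s(1), of i i]
    ip_add_right[OF test_tensor_sqi[OF a(1) fg(1)] test_tensor_sqi[OF a(1) fg(2)] sqi_comp[OF s(2), of i]] fg(3,4) by linarith
 next
  fix f c assume f: "sqi f" "?P f"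
  have "ip v (%z. fder p (fst z) i * (c * f (snd z))) = c * ip v (%z. fder p (fst z) i * f (snd z))"
   "ip (%z. G z \<bullet> i) (%z. p (fst z) * (c * f (snd z))) = c * ip (%z. G z \<bullet> i) (p \<otimes> f)"
   by (simp_all only: mult.left_commute[of _ c] ip_cmult_right)
  then show "?P (%t. c * f t)" using f(2) by (simp add: distrib_left[symmetric])
 next
  fix F :: "nat => real => real" and f :: "real => real"
  assume F: "!!n. sqi (F n)" "!!n. ?P (F n)" "sqi f" "(%n. ip (%z. F n z - f z) (%z. F n z - f z)) ~~> 0"
  have "(%n. ip v (%z. fder p (fst z) i * F n (snd z)) + ip (%z. G z \<bullet> i) (%z. p (fst z) * F n (snd z)))
    ~~> ip v (%z. fder p (fst z) i * f (snd z)) + ip (%z. G z \<bullet> i) (p \<otimes> f)"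
   by (intro tendsto_add tensor_tendsto[OF dp F(1,3,4) s(1)] tensor_tendsto[OF sp F(1,3,4) sqi_comp[OF s(2)]])
  from LIMSEQ_unique[OF this[unfolded F(2)] tendsto_const] show "?P f" by simp
 qed (simp add: q'_def)
 moreover have "ip v (%z. fder p (fst z) i * q' (snd z)) = ip v (%z. fder p (fst z) i * q (snd z))"
  unfolding ip_def
 proof (rule int_cong)
  fix z show "v z \<bullet> (fder p (fst z) i * q' (snd z)) = v z \<bullet> (fder p (fst z) i * q (snd z))"
   using out[of z] by (cases "snd z \<in> {s<..<T}") (simp_all add: q'_def)
 qed
 moreover have "ip (%z. G z \<bullet> i) (p \<otimes> q') = ip (%z. G z \<bullet> i) (p \<otimes> q)"
  unfolding ip_def
 proof (rule int_cong)
  fix z show "(G z \<bullet> i) \<bullet> (p (fst z) * q' (snd z)) = (G z \<bullet> i) \<bullet> (p (fst z) * q (snd z))"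
   using out[of z] by (cases "snd z \<in> {s<..<T}") (simp_all add: q'_def)
 qed
 ultimately show "?P q" by simp
qed

lemma test_fun_time_slice:
 fixes V :: "'a::euclidean_space set"
 assumes "test_fun (V \<times> W) \<psi>" shows "test_fun V (%x. \<psi> (x, c))"
  "fder (%x. \<psi> (x, c)) x i = fder \<psi> (x, c) (i, 0)"
proof -
 let ?K = "closure {z. \<psi> z \<noteq> 0}"
 show "test_fun V (%x. \<psi> (x, c))"
 proof (rule test_funI)
  have "linear (%x::'a. (x, 0::'b))" by (auto intro!: linearI)
  from smooth_on_affine_comp[OF test_fun_smooth[OF assms] this, of "(0, c)"]
  show "smooth_on UNIV (%x. \<psi> (x, c))" by simp
  show "compact (fst ` ?K)" using assms by (intro compact_continuous_image continuous_on_fst continuous_on_id) (auto simp: test_fun_def)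
  show "fst ` ?K \<subseteq> V" using assms by (auto simp: test_fun_def)
  show "\<psi> (x, c) \<noteq> 0 ==> x \<in> fst ` ?K" for x using closure_subset[of "{z. \<psi> z \<noteq> 0}"] by (force simp: image_iff)
 qed
 have "((%x. (x, c)) has_derivative (%v. (v, 0))) (at x)" by (intro has_derivative_Pair has_derivative_ident has_derivative_const)
 from has_derivative_compose[OF this smooth_on_has_derivative[OF test_fun_smooth[OF assms]]]
 show "fder (%x. \<psi> (x, c)) x i = fder \<psi> (x, c) (i, 0)"
  by (simp add: frechet_derivative_eqI)
qed

text \<open>A test function is approximated by functions that are piecewise constant in time.\<close>

lemma time_step_tendsto:
 fixes V :: "'a::euclidean_space set"
 assumes \<psi>: "test_fun (V \<times> {s<..<T}) \<psi>" and v: "sqi v"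
 shows "(%n. \<Sum>k\<in>{\<lfloor>real (Suc n) * s\<rfloor>..\<lceil>real (Suc n) * T\<rceil>}. ip v (%z. \<psi> (fst z, of_int k / real (Suc n))
       * ind {t. \<lfloor>real (Suc n) * t\<rfloor> = k} (snd z))) ~~> ip v \<psi>"
  "sqi (ind {t. \<lfloor>real (Suc n) * t\<rfloor> = k})"
proof -
 \<comment> \<open>Time rounded down to the grid of mesh 1/(n + 1).\<close>
 define \<sigma> where "\<sigma> n t = of_int \<lfloor>real (Suc n) * t\<rfloor> / real (Suc n)" for n t
 have \<sigma>: "\<sigma> n t <= t" "t - \<sigma> n t < 1 / real (Suc n)" for n t
 proof -
  have "of_int \<lfloor>real (Suc n) * t\<rfloor> <= real (Suc n) * t" by (rule of_int_floor_le)
  then show "\<sigma> n t <= t" by (simp add: \<sigma>_def divide_le_eq mult.commute)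
  have "real (Suc n) * t < of_int \<lfloor>real (Suc n) * t\<rfloor> + 1" by linarith
  then have "t < (of_int \<lfloor>real (Suc n) * t\<rfloor> + 1) / real (Suc n)" by (simp add: less_divide_eq mult.commute)
  then show "t - \<sigma> n t < 1 / real (Suc n)" by (simp add: \<sigma>_def add_divide_distrib)
 qed
 have \<sigma>lim: "(%n. \<sigma> n t) ~~> t" for t
 proof (rule LIM_zero_cancel, rule Lim_null_comparison)
  show "\<forall>\<^sub>F n in sequentially. norm (\<sigma> n t - t) <= 1 / real (Suc n)"
  proof (intro always_eventually allI)
   fix n show "norm (\<sigma> n t - t) <= 1 / real (Suc n)" using \<sigma>(1)[of n t] \<sigma>(2)[of t n] unfolding real_norm_def by linarith
  qed
  show "(%n. 1 / real (Suc n)) ~~> 0" using LIMSEQ_inverse_real_of_nat by (simp add: inverse_eq_divide)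
 qed
 have fm: "(%t. \<sigma> n t) \<in> BM" for n unfolding \<sigma>_def by measurable
 have sets: "{t. \<lfloor>real (Suc n) * t\<rfloor> = k} \<in> sets borel" for n k
 proof -
  have "{t. \<lfloor>real (Suc n) * t\<rfloor> = k} = {of_int k / real (Suc n)..<(of_int k + 1) / real (Suc n)}"
   by (auto simp: floor_eq_iff divide_le_eq less_divide_eq mult.commute)
  then show ?thesis by simp
 qed
 show sqI: "sqi (ind {t. \<lfloor>real (Suc n) * t\<rfloor> = k})" for n k
 proof (rule indicator_sqi[OF sets])
  have "{t. \<lfloor>real (Suc n) * t\<rfloor> = k} = {of_int k / real (Suc n)..<(of_int k + 1) / real (Suc n)}"
   by (auto simp: floor_eq_iff divide_le_eq less_divide_eq mult.commute)
  then show "emeasure lborel {t. \<lfloor>real (Suc n) * t\<rfloor> = k} < \<infinity>"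
   by (simp only:) (subst emeasure_lborel_Ico, auto intro: divide_right_mono)
 qed
 let ?f = "%n z. \<psi> (fst z, \<sigma> n (snd z))"
 have eq: "?f n z = (\<Sum>k\<in>{\<lfloor>real (Suc n) * s\<rfloor>..\<lceil>real (Suc n) * T\<rceil>}. \<psi> (fst z, of_int k / real (Suc n))
       * ind {t. \<lfloor>real (Suc n) * t\<rfloor> = k} (snd z))" for n z
 proof -
  let ?k = "\<lfloor>real (Suc n) * snd z\<rfloor>" and ?I = "{\<lfloor>real (Suc n) * s\<rfloor>..\<lceil>real (Suc n) * T\<rceil>}"
  have "(\<Sum>k\<in>?I. \<psi> (fst z, of_int k / real (Suc n)) * ind {t. \<lfloor>real (Suc n) * t\<rfloor> = k} (snd z))
    = (\<Sum>k\<in>?I. if k = ?k then ?f n z else 0)"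
   by (rule sum.cong) (auto simp: indicator_def \<sigma>_def)
  also have "\<dots> = (if ?k \<in> ?I then ?f n z else 0)" by simp
  also have "\<dots> = ?f n z"
  proof (cases "?k \<in> ?I")
   case False
   \<comment> \<open>Cells outside the index range are rounded to times where \<open>\<psi>\<close>
     vanishes, so the finite sum misses nothing.\<close>
   have "\<sigma> n (snd z) \<notin> {s<..<T}"
   proof
    assume "\<sigma> n (snd z) \<in> {s<..<T}"
    then have "real (Suc n) * s < of_int ?k" "of_int ?k < real (Suc n) * T"
     by (auto simp: \<sigma>_def less_divide_eq divide_less_eq mult.commute)
    then show False using False by (auto simp: floor_le_iff less_ceiling_iff) linarith+
   qed
   then have "?f n z = 0" using test_fun_outside[OF \<psi>, of "(fst z, \<sigma> n (snd z))"] by auto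
   then show ?thesis by simp
  qed auto
  finally show ?thesis by simp
 qed
 obtain B where B: "!!z. \<bar>\<psi> z\<bar> <= B" "B > 0" using test_fun_bounded[OF \<psi>] by blast
 have bK: "bounded (fst ` closure {z. \<psi> z \<noteq> 0})"
  using \<psi> by (intro bounded_fst compact_imp_bounded) (auto simp: test_fun_def)
 \<comment> \<open>Rounding down moves a time by less than 1, so all approximants are supported
   before T + 1.\<close>
 let ?S = "fst ` closure {z. \<psi> z \<noteq> 0} \<times> {s..T + 1}"
 have bS: "bounded ?S" using bK by (intro bounded_Times) auto
 obtain a :: "'a \<times> real" where a: "?S \<subseteq> cbox (-a) a" using bounded_subset_cbox_symmetric[OF bS] by blast
 have supp: "\<psi> (x, c) \<noteq> 0 ==> x \<in> fst ` closure {z. \<psi> z \<noteq> 0} \<and> s < c \<and> c < T" for x c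
  using closure_subset[of "{z. \<psi> z \<noteq> 0}"] test_fun_outside[OF \<psi>, of "(x, c)"] by (force simp: image_iff)
 have supp1: "z \<in> ?S" if "\<psi> z \<noteq> 0" for z using supp[of "fst z" "snd z"] that by (cases z) auto
 have supp2: "z \<in> ?S" if "?f n z \<noteq> 0" for n z
 proof -
  have "s < \<sigma> n (snd z)" "\<sigma> n (snd z) < T" "fst z \<in> fst ` closure {z. \<psi> z \<noteq> 0}" using supp[OF that] by auto
  moreover have "1 / real (Suc n) <= 1" by simp
  ultimately have "s <= snd z" "snd z <= T + 1" "fst z \<in> fst ` closure {z. \<psi> z \<noteq> 0}"
   using \<sigma>(1)[of n "snd z"] \<sigma>(2)[of "snd z" n] by linarith+
  then show ?thesis by (simp add: mem_Times_iff)
 qed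
 have \<psi>m: "\<psi> \<in> BM" by (rule test_fun_meas[OF \<psi>])
 have fmm: "?f n \<in> BM" for n
 proof -
  have [measurable]: "\<sigma> n \<in> BM" using fm by simp
  have "\<psi> \<in> borel_measurable (borel \<Otimes>\<^sub>M borel)" using \<psi>m by (simp add: borel_prod)
  note this[measurable]
  have "(%z. \<psi> (fst z, \<sigma> n (snd z))) \<in> borel_measurable (borel \<Otimes>\<^sub>M borel)" by measurable
  then show ?thesis by (simp add: borel_prod)
 qed
 have fsq: "sqi (?f n)" for n
  by (rule bounded_support_sqi[OF fmm, of n B ?S]) (use B bS supp2 in auto)
 have dom: "sqi (%z. 2 * B * ind (cbox (-a) a) z)"
  by (intro sqi_cmult indicator_sqi) (auto simp: emeasure_lborel_cbox_eq)
 have "(%n. ip (%z. ?f n z - \<psi> z) (%z. ?f n z - \<psi> z)) ~~> 0"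
 proof (rule L2_dominated_convergence[OF fmm \<psi>m dom])
  show "norm (?f n z - \<psi> z) <= norm (2 * B * ind (cbox (-a) a) z)" for n z
  proof (cases "z \<in> cbox (-a) a")
   case True
   then show ?thesis using B(1)[of "(fst z, \<sigma> n (snd z))"] B(1)[of z] B(2) by auto
  next
   case False
   then have "?f n z = 0" "\<psi> z = 0" using supp1 supp2 a by blast+
   then show ?thesis by simp
  qed
  show "(%n. ?f n z) ~~> \<psi> z" for z
  proof -
   have "isCont \<psi> z" using smooth_on_continuous[OF test_fun_smooth[OF \<psi>]] continuous_on_eq_continuous_at[OF open_UNIV, of \<psi>] by blast
   moreover have "(%n. (fst z, \<sigma> n (snd z))) ~~> z" using tendsto_Pair[OF tendsto_const \<sigma>lim] by (metis prod.collapse)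
   ultimately show ?thesis by (rule isCont_tendsto_compose)
  qed
 qed
 from ip_tendsto_strong[OF fsq test_fun_sqi[OF \<psi>] v this]
 have lim: "(%n. ip v (?f n)) ~~> ip v \<psi>" .
 have tsq: "sqi (%z. \<psi> (fst z, of_int k / real (Suc n)) * ind {t. \<lfloor>real (Suc n) * t\<rfloor> = k} (snd z))" for n k
  by (rule test_tensor_sqi[OF test_fun_time_slice(1)[OF \<psi>] sqI])
 show "(%n. \<Sum>k\<in>{\<lfloor>real (Suc n) * s\<rfloor>..\<lceil>real (Suc n) * T\<rceil>}. ip v (%z. \<psi> (fst z, of_int k / real (Suc n))
       * ind {t. \<lfloor>real (Suc n) * t\<rfloor> = k} (snd z))) ~~> ip v \<psi>"
  using lim unfolding eq ip_sum_right[OF tsq v] .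
qed

text \<open>On each cell the step approximation is a smooth function of x times an indicator in t,
  hence admissible for \<open>wgrad\<close>. The same grid is used for \<open>\<psi>\<close> and for
  its x-derivative, so the identity holds summand by summand.\<close>

lemma weak_of_wgrad:
 assumes w: "wgrad V v G" and s: "sqi v" "sqi G" and \<psi>: "test_fun (cyl V s T) \<psi>" and i: "i \<in> Basis"
 shows "ip v (%z. fder \<psi> z (i, 0)) = - ip (%z. G z \<bullet> i) \<psi>"
proof -
 have \<psi>': "test_fun (V \<times> {s<..<T}) \<psi>" using \<psi> by (simp add: cyl_def)
 have l1: "(%n. \<Sum>k\<in>{\<lfloor>real (Suc n) * s\<rfloor>..\<lceil>real (Suc n) * T\<rceil>}. ip v (%z. fder \<psi> (fst z, of_int k / real (Suc n)) (i, 0)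
       * ind {t. \<lfloor>real (Suc n) * t\<rfloor> = k} (snd z))) ~~> ip v (%z. fder \<psi> z (i, 0))"
  by (rule time_step_tendsto(1)[OF test_fun_frechet[OF \<psi>'] s(1)])
 have l2: "(%n. \<Sum>k\<in>{\<lfloor>real (Suc n) * s\<rfloor>..\<lceil>real (Suc n) * T\<rceil>}. ip (%z. G z \<bullet> i) (%z. \<psi> (fst z, of_int k / real (Suc n))
       * ind {t. \<lfloor>real (Suc n) * t\<rfloor> = k} (snd z))) ~~> ip (%z. G z \<bullet> i) \<psi>"
  by (rule time_step_tendsto(1)[OF \<psi>' sqi_comp[OF s(2)]])
 have e: "ip v (%z. fder \<psi> (fst z, of_int k / real (Suc n)) (i, 0) * ind {t. \<lfloor>real (Suc n) * t\<rfloor> = k} (snd z))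
   = - ip (%z. G z \<bullet> i) (%z. \<psi> (fst z, of_int k / real (Suc n)) * ind {t. \<lfloor>real (Suc n) * t\<rfloor> = k} (snd z))" for n k
  using wgradD[OF w test_fun_time_slice(1)[OF \<psi>', of "of_int k / real (Suc n)"] time_step_tendsto(2)[OF \<psi>' s(1), of n k] i]
  by (simp only: test_fun_time_slice(2)[OF \<psi>'] add_eq_0_iff2)
 show ?thesis
  using LIMSEQ_unique[OF l1[unfolded e sum_negf] tendsto_minus[OF l2]] .
qed

section \<open>Vanishing and weak convergence tested on dense classes\<close>

lemma ip_zero_tensor:
 fixes X :: "'a::euclidean_space \<times> real => real"
 assumes Q: "open V" "open W" and X: "sqi X" and h: "sqi h" "!!z. z \<notin> V \<times> W ==> h z = 0"
  and t: "!!p q. test_fun V p ==> test_fun W q ==> ip X (p \<otimes> q) = 0"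
 shows "ip X h = 0"
proof (rule L2_induct_tensor[where P="%h. ip X h = 0", OF Q h])
 fix p q assume "test_fun V p" "test_fun W q" then show "ip X (p \<otimes> q) = 0" by (rule t)
next
 fix f g assume "sqi f" "sqi g" "ip X f = 0" "ip X g = 0"
 then show "ip X (%z. f z + g z) = 0" using ip_add_right[OF _ _ X, of f g] by simp
next
 fix f c assume "ip X f = 0" then show "ip X (%z. c * f z) = 0" by (simp add: ip_cmult_right)
next
 fix F :: "nat => 'a \<times> real => real" and f
 assume F: "!!n. sqi (F n)" "!!n. ip X (F n) = 0" "sqi f" "(%n. ip (%z. F n z - f z) (%z. F n z - f z)) ~~> 0"
 from LIMSEQ_unique[OF ip_tendsto_strong[OF F(1,3) X F(4), unfolded F(2)] tendsto_const] show "ip X f = 0" by simp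
qed

lemma ip_zero_test:
 fixes X :: "'b::euclidean_space => real"
 assumes Q: "open Q" and X: "sqi X" and h: "sqi h" "!!z. z \<notin> Q ==> h z = 0"
  and t: "!!p. test_fun Q p ==> ip X p = 0"
 shows "ip X h = 0"
proof (rule L2_induct_test[where P="%h. ip X h = 0", OF Q h])
 fix p assume "test_fun Q p" then show "ip X p = 0" by (rule t)
next
 fix f g assume "sqi f" "sqi g" "ip X f = 0" "ip X g = 0"
 then show "ip X (%z. f z + g z) = 0" using ip_add_right[OF _ _ X, of f g] by simp
next
 fix f c assume "ip X f = 0" then show "ip X (%z. c * f z) = 0" by (simp add: ip_cmult_right)
next
 fix F :: "nat => 'b => real" and f
 assume F: "!!n. sqi (F n)" "!!n. ip X (F n) = 0" "sqi f" "(%n. ip (%z. F n z - f z) (%z. F n z - f z)) ~~> 0"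
 from LIMSEQ_unique[OF ip_tendsto_strong[OF F(1,3) X F(4), unfolded F(2)] tendsto_const] show "ip X f = 0" by simp
qed

text \<open>The uniform bound on the sequence makes the error of replacing \<open>h\<close> by an
  approximant independent of \<open>n\<close>; convergence on a class with dense span therefore
  suffices.\<close>

lemma weak_tendsto_tensor:
 fixes X :: "nat => 'a::euclidean_space \<times> real => real"
 assumes Q: "open V" "open W" and X: "!!n. sqi (X n)" "!!n. ip (X n) (X n) <= B" and x: "sqi x"
  and h: "sqi h" "!!z. z \<notin> V \<times> W ==> h z = 0"
  and t: "!!p q. test_fun V p ==> test_fun W q ==>
    (%n. ip (X n) (p \<otimes> q)) ~~> ip x (p \<otimes> q)"
 shows "(%n. ip (X n) h) ~~> ip x h"
proof (rule L2_induct_tensor[where P="%h. (%n. ip (X n) h) ~~> ip x h", OF Q h])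
 fix p q assume "test_fun V p" "test_fun W q"
 then show "(%n. ip (X n) (p \<otimes> q)) ~~> ip x (p \<otimes> q)" by (rule t)
next
 fix f g assume f: "sqi f" "sqi g" "(%n. ip (X n) f) ~~> ip x f" "(%n. ip (X n) g) ~~> ip x g"
 show "(%n. ip (X n) (%z. f z + g z)) ~~> ip x (%z. f z + g z)"
  unfolding ip_add_right[OF f(1,2) X(1)] ip_add_right[OF f(1,2) x] by (rule tendsto_add[OF f(3,4)])
next
 fix f c assume "(%n. ip (X n) f) ~~> ip x f"
 then show "(%n. ip (X n) (%z. c * f z)) ~~> ip x (%z. c * f z)"
  unfolding ip_cmult_right by (rule tendsto_mult[OF tendsto_const])
next
 fix F :: "nat => 'a \<times> real => real" and f
 assume F: "!!n. sqi (F n)" "!!m. (%n. ip (X n) (F m)) ~~> ip x (F m)" "sqi f" "(%n. ip (%z. F n z - f z) (%z. F n z - f z)) ~~> 0"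
 show "(%n. ip (X n) f) ~~> ip x f"
 proof (rule LIMSEQ_I)
  fix e :: real assume e: "e > 0"
  let ?d = "%m. ip (%z. F m z - f z) (%z. F m z - f z)"
  have B: "0 <= B" using ip_nonneg[of "X 0"] X(2)[of 0] by linarith
  have "(%m. (sqrt B + sqrt (ip x x)) * sqrt (?d m)) ~~> (sqrt B + sqrt (ip x x)) * sqrt 0"
   by (intro tendsto_mult tendsto_const tendsto_real_sqrt F(4))
  note l = this
  have "\<forall>\<^sub>F m in sequentially. (sqrt B + sqrt (ip x x)) * sqrt (?d m) < e / 2"
   using order_tendstoD(2)[OF l, of "e / 2"] e by simp
  then obtain m where m: "(sqrt B + sqrt (ip x x)) * sqrt (?d m) < e / 2" by (auto simp: eventually_sequentially)
  obtain N where N: "!!n. n \<ge> N ==> \<bar>ip (X n) (F m) - ip x (F m)\<bar> < e / 2"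
   using LIMSEQ_D[OF F(2)[of m], of "e / 2"] e by auto
  show "\<exists>N. \<forall>n\<ge>N. norm (ip (X n) f - ip x f) < e"
  proof (intro exI[of _ N] allI impI)
   fix n assume "n \<ge> N"
   have d: "sqi (%z. F m z - f z)" using F by auto
   have 1: "\<bar>ip (X n) (%z. F m z - f z)\<bar> <= sqrt B * sqrt (?d m)"
    by (rule order_trans[OF ip_cauchy_schwarz[OF X(1) d]]) (intro mult_right_mono real_sqrt_le_mono X(2) real_sqrt_ge_zero ip_nonneg)
   have 2: "\<bar>ip x (%z. F m z - f z)\<bar> <= sqrt (ip x x) * sqrt (?d m)"
    by (rule ip_cauchy_schwarz[OF x d])
   have "ip (X n) f - ip x f = (ip (X n) (F m) - ip x (F m)) - ip (X n) (%z. F m z - f z) + ip x (%z. F m z - f z)"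
    unfolding ip_diff_right[OF F(1,3) X(1)] ip_diff_right[OF F(1,3) x] by simp
   then have "\<bar>ip (X n) f - ip x f\<bar> < e"
    using 1 2 m N[OF \<open>n \<ge> N\<close>] by (simp only: distrib_right)
   then show "norm (ip (X n) f - ip x f) < e" by simp
  qed
 qed
qed

lemma integral_slices_t:
 fixes f :: "'a::euclidean_space \<times> 'd::euclidean_space => 'c::euclidean_space"
 assumes "integrable lborel f"
 shows "(LBINT t. (LBINT x. f (x, t))) = (LBINT z. f z)"
  "integrable lborel (%t. LBINT x. f (x, t))"
proof -
 have i: "integrable (lborel \<Otimes>\<^sub>M lborel) (%(x, t). f (x, t))" using assms by (simp add: lborel_prod)
 show "(LBINT t. (LBINT x. f (x, t))) = (LBINT z. f z)"
  using lborel_pair.integral_snd[OF i] by (simp add: lborel_prod)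
 show "integrable lborel (%t. LBINT x. f (x, t))" using lborel_pair.integrable_snd[OF i] .
qed

subsection \<open>The kernels of integration and of forward averaging\<close>

text \<open>The operator with this kernel integrates from r to T; its transpose integrates from 0 to
  r.\<close>

definition kback :: "real => real \<times> real => real" where
 "kback T z = of_bool (0 < fst z \<and> fst z < snd z \<and> snd z < T)"

text \<open>The average over (r, r + h), with values beyond T counted as 0. By
  \<open>back_dquot\<close> it is the backward integral of a difference quotient, which makes it
  available for testing.\<close>

definition kavg :: "real => real => real \<times> real => real" where
 "kavg T h z = of_bool (0 < fst z \<and> fst z < snd z \<and> snd z < fst z + h \<and> snd z < T) / h"

lemma integral_le_interval:
 fixes g :: "real => real"
 assumes "!!t. g t <= c * ind {a<..<b} t" "0 <= c" "a <= b"
 shows "(LBINT t. g t) <= c * (b - a)"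
proof -
 have "(LBINT t. g t) <= (LBINT t. c * ind {a<..<b} t)"
  by (rule integral_mono') (use assms in auto)
 also have "\<dots> = c * (b - a)" using assms(3) by simp
 finally show ?thesis .
qed

lemma kern_kback: assumes T: "T > 0" shows "kern T T (kback T)"
 unfolding kern_def
proof (intro conjI allI)
 have "(%z::real\<times>real. of_bool (0 < fst z \<and> fst z < snd z \<and> snd z < T) :: real) \<in> borel_measurable (borel \<Otimes>\<^sub>M borel)" by measurable
 then show "kback T \<in> BM" unfolding borel_prod kback_def[abs_def] .
 show "\<exists>B. \<forall>z. kback T z <= B" by (intro exI[of _ 1]) (simp add: kback_def)
 show "(LBINT t. kback T (r, t)) <= T" for r
  using integral_le_interval[of "%t. kback T (r, t)" 1 0 T] T by (simp add: kback_def indicator_def)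
 show "(LBINT r. kback T (r, t)) <= T" for t
  using integral_le_interval[of "%r. kback T (r, t)" 1 0 T] T by (simp add: kback_def indicator_def)
qed (use T in \<open>auto simp: kback_def\<close>)

lemma kern_kavg: assumes h: "h > 0" shows "kern T 1 (kavg T h)"
 unfolding kern_def
proof (intro conjI allI)
 have "(%z::real\<times>real. of_bool (0 < fst z \<and> fst z < snd z \<and> snd z < fst z + h \<and> snd z < T) / h :: real) \<in> borel_measurable (borel \<Otimes>\<^sub>M borel)" by measurable
 then show "kavg T h \<in> BM" unfolding borel_prod kavg_def[abs_def] .
 show "\<exists>B. \<forall>z. kavg T h z <= B" by (intro exI[of _ "1/h"]) (use h in \<open>simp add: kavg_def\<close>)
 show "(LBINT t. kavg T h (r, t)) <= 1" for r
  using integral_le_interval[of "%t. kavg T h (r, t)" "1/h" r "r + h"] h by (simp add: kavg_def indicator_def)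
 show "(LBINT r. kavg T h (r, t)) <= 1" for t
  using integral_le_interval[of "%r. kavg T h (r, t)" "1/h" "t - h" t] h by (simp add: kavg_def indicator_def)
qed (use h in \<open>auto simp: kavg_def\<close>)

lemma kern_kfwd: "T > 0 ==> kern T T (kT (kback T))"
 by (rule kern_kT[OF kern_kback])

lemma tk_support:
 assumes "kern T C k" "r <= 0 \<or> T <= r" shows "tk k h (x, r) = 0" "tk1 k h1 r = 0"
proof -
 have "k (r, t) = 0" for t using kern_support[OF assms(1), of r t] assms(2) by force
 then show "tk k h (x, r) = 0" "tk1 k h1 r = 0" by (simp_all add: tk_def tk1_def)
qed

lemma tk_zero_slice: "(!!t. h (x, t) = 0) ==> tk k h (x, r) = 0"
 by (simp add: tk_def)

lemma tk_out:
 fixes h :: "'a::euclidean_space \<times> real => 'c::euclidean_space"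
 assumes "kern T C k" "!!z. z \<notin> cyl V 0 T ==> h z = 0" "z \<notin> cyl V 0 T" shows "tk k h z = 0"
proof (cases z)
 case (Pair x r)
 show ?thesis
 proof (cases "x \<in> V")
  case False
  then have "h (x, t) = 0" for t using assms(2) by (simp add: cyl_def)
  then show ?thesis unfolding Pair by (rule tk_zero_slice)
 next
  case True
  then have "r <= 0 \<or> T <= r" using assms(3) Pair by (auto simp: cyl_def not_less)
  then show ?thesis unfolding Pair by (rule tk_support(1)[OF assms(1)])
 qed
qed

lemma test_fun_real_support:
 fixes q :: "real => real"
 assumes q: "test_fun {a<..<b} q" and ab: "a < b"
 obtains a' b' where "a < a'" "b' < b" "a' <= b'" "!!t. q t \<noteq> 0 ==> a' <= t \<and> t <= b'"
proof -
 \<comment> \<open>The midpoint keeps the compact set nonempty when \<open>q\<close> vanishes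
   identically.\<close>
 let ?K = "insert ((a + b) / 2) (closure {t. q t \<noteq> 0})"
 have K: "compact ?K" "?K \<subseteq> {a<..<b}" "?K \<noteq> {}" using q ab by (auto simp: test_fun_def)
 obtain l where l: "l \<in> ?K" "\<forall>t\<in>?K. l <= t" using compact_attains_inf[OF K(1,3)] by blast
 obtain u where u: "u \<in> ?K" "\<forall>t\<in>?K. t <= u" using compact_attains_sup[OF K(1,3)] by blast
 have "q t \<noteq> 0 ==> t \<in> ?K" for t using closure_subset[of "{t. q t \<noteq> 0}"] by auto
 then show ?thesis using that[of l u] l u K(2) by (meson greaterThanLessThan_iff subsetD)
qed

lemma antiderivative:
 fixes q :: "real => real"
 assumes "continuous_on UNIV q" "!!t. t <= 0 ==> q t = 0"
 shows "\<exists>F. (\<forall>t. (F has_real_derivative q t) (at t)) \<and> (\<forall>t\<le>0. F t = 0)"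
proof -
 \<comment> \<open>Starting at -1 keeps every t \<ge> 0 in the interior of the interval on which the
   fundamental theorem is applied.\<close>
 define F where "F t = integral {-1..t} q" for t
 have z: "F t = 0" if "t <= 0" for t
 proof -
  have "integral {-1..t} q = integral {-1..t} (%_. 0)" by (rule Henstock_Kurzweil_Integration.integral_cong) (use assms(2) that in auto)
  then show ?thesis by (simp add: F_def)
 qed
 have "(F has_real_derivative q t) (at t)" for t
 proof (cases "t < 0")
  case True
  have "((%t. 0) has_real_derivative q t) (at t)" using assms(2)[of t] True by simp
  then show ?thesis
   by (rule has_field_derivative_transform_within_open[of _ _ _ "{..<0}"]) (use True z in auto)
 next
  case False
  have "((%x. integral {-1..x} q) has_real_derivative q t) (at t within {-1..t+1})"
   by (rule integral_has_real_derivative) (use assms(1) False in \<open>auto intro: continuous_on_subset\<close>)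
  moreover have "at t within {-1..t+1} = at t"
   by (rule at_within_interior) (use False in auto)
  ultimately show ?thesis by (simp add: F_def[abs_def])
 qed
 then show ?thesis using z by blast
qed

lemma integral_FTC_test:
 fixes q F :: "real => real"
 assumes "continuous_on UNIV q" "!!t. (F has_real_derivative q t) (at t)" "a <= b"
 shows "(LBINT t. of_bool (a < t \<and> t < b) * q t) = F b - F a"
proof -
 have "(LBINT t. of_bool (a < t \<and> t < b) * q t) = (LBINT t. ind {a..b} t *\<^sub>R q t)"
 proof (rule integral_cong_AE)
  have qm [measurable]: "q \<in> BM" by (rule borel_measurable_continuous_onI[OF assms(1)])
  show "(%t. of_bool (a < t \<and> t < b) * q t) \<in> borel_measurable lborel" by measurable
  show "(%t. ind {a..b} t *\<^sub>R q t) \<in> borel_measurable lborel" by measurable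
  have "AE t in lborel. t \<noteq> a" "AE t in lborel. t \<noteq> b" by (rule AE_lborel_singleton)+
  then show "AE t in lborel. of_bool (a < t \<and> t < b) * q t = ind {a..b} t *\<^sub>R q t"
   by eventually_elim (auto simp: indicator_def)
 qed
 also have "\<dots> = F b - F a"
  by (rule integral_FTC_atLeastAtMost[OF assms(3)])
    (use assms in \<open>auto simp: has_real_derivative_iff_has_vector_derivative[symmetric] intro: has_field_derivative_at_within continuous_on_subset\<close>)
 finally show ?thesis .
qed

text \<open>One smooth primitive, zero before 0 and constant after T, describes all three time
  operators on a test function, so that smoothness and supports can be read off from it.\<close>

lemma test_primitive:
 fixes q :: "real => real"
 assumes q: "test_fun {0<..<T} q" and T: "T > 0"
 obtains F where "smooth_on UNIV F" "!!t. (F has_real_derivative q t) (at t)" "!!t. t <= 0 ==> F t = 0"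
  "!!t. T <= t ==> F t = F T"
  "!!r. 0 < r ==> r < T ==> tk1 (kback T) q r = F T - F r"
  "!!r. 0 < r ==> r < T ==> tk1 (kT (kback T)) q r = F r"
  "!!r h. 0 < r ==> r < T ==> 0 < h ==> tk1 (kavg T h) q r = (F (r + h) - F r) / h"
proof -
 have c: "continuous_on UNIV q" by (rule smooth_on_continuous[OF test_fun_smooth[OF q]])
 have z0: "q t = 0" if "t <= 0" for t using test_fun_outside[OF q, of t] that by auto
 have zT: "q t = 0" if "T <= t" for t using test_fun_outside[OF q, of t] that by auto
 obtain F where F: "!!t. (F has_real_derivative q t) (at t)" "!!t. t <= 0 ==> F t = 0"
  using antiderivative[OF c z0] by blast
 have FT: "F t = F T" if "T <= t" for t
 proof -
  have "F t - F T = (LBINT s. of_bool (T < s \<and> s < t) * q s)" by (rule integral_FTC_test[OF c F(1) that, symmetric])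
  also have "\<dots> = (\<integral>s. 0 \<partial>(lborel :: real measure))" by (rule Bochner_Integration.integral_cong) (use zT in auto)
  finally show ?thesis by simp
 qed
 show ?thesis
 proof
  show "smooth_on UNIV F" by (rule smooth_on_real_derivI[OF F(1) test_fun_smooth[OF q]])
  show "(F has_real_derivative q t) (at t)" for t by (rule F(1))
  show "F t = 0" if "t <= 0" for t by (rule F(2)[OF that])
  show "F t = F T" if "T <= t" for t by (rule FT[OF that])
  fix r :: real assume r: "0 < r" "r < T"
  show "tk1 (kback T) q r = F T - F r"
   using integral_FTC_test[OF c F(1), of r T] r by (simp add: tk1_def kback_def)
  have "tk1 (kT (kback T)) q r = (LBINT t. of_bool (0 < t \<and> t < r) * q t)"
   using r by (simp add: tk1_def kback_def kT_def)
  then show "tk1 (kT (kback T)) q r = F r"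
   using integral_FTC_test[OF c F(1), of 0 r] r F(2)[of 0] by simp
  fix h :: real assume h: "0 < h"
  have "tk1 (kavg T h) q r = (LBINT t. (of_bool (r < t \<and> t < r + h) * q t) / h)"
   unfolding tk1_def
  proof (rule int_cong)
   fix t show "kavg T h (r, t) *\<^sub>R q t = of_bool (r < t \<and> t < r + h) * q t / h"
    using zT[of t] r by (cases "t < T") (auto simp: kavg_def)
  qed
  also have "\<dots> = (F (r + h) - F r) / h" using integral_FTC_test[OF c F(1), of r "r + h"] h by simp
  finally show "tk1 (kavg T h) q r = (F (r + h) - F r) / h" .
 qed
qed

text \<open>By duality the averages act on \<open>g\<close>, where Schur's test bounds them
  uniformly by the norm of \<open>g\<close>. Hence products p(x) q(t) suffice as tests, and for
  those the average is a difference quotient of a primitive of \<open>q\<close>, which even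
  converges strongly.\<close>

lemma kavg_weak_real:
 fixes g \<zeta> :: "'a::euclidean_space \<times> real => real"
 assumes T: "T > 0" and g: "sqi g" and \<zeta>: "sqi \<zeta>" "!!z. z \<notin> UNIV \<times> {0<..<T} ==> \<zeta> z = 0"
  and hn: "!!n. h n > 0" "h ~~> 0"
 shows "(%n. ip g (tk (kavg T (h n)) \<zeta>)) ~~> ip g \<zeta>"
proof -
 define X where "X n = tk (kT (kavg T (h n))) g" for n
 note k = kern_kavg[OF hn(1), of T]
 have eq: "ip g (tk (kavg T (h n)) f) = ip (X n) f" if "sqi f" for n f
  unfolding X_def using tk_adjoint[OF kern_kT[OF k] g that, of n] by simp
 have X: "sqi (X n)" "ip (X n) (X n) <= ip g g" for n
  using tk_schur[OF kern_kT[OF k] g, of n] by (auto simp: X_def)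
 have "(%n. ip (X n) \<zeta>) ~~> ip g \<zeta>"
 proof (rule weak_tendsto_tensor[OF open_UNIV open_greaterThanLessThan X g \<zeta>])
  fix p :: "'a => real" and q :: "real => real" assume pq: "test_fun UNIV p" "test_fun {0<..<T} q"
  have sq: "sqi q" by (rule test_fun_sqi[OF pq(2)])
  obtain F where F: "!!t. (F has_real_derivative q t) (at t)"
   "!!r h. 0 < r ==> r < T ==> 0 < h ==> tk1 (kavg T h) q r = (F (r + h) - F r) / h"
   using test_primitive[OF pq(2) T] by metis
  obtain B where B: "B > 0" "!!t. \<bar>q t\<bar> <= B" using test_fun_bounded[OF pq(2)] by blast
  have q0: "q r = 0" if "r \<notin> {0<..<T}" for r using test_fun_outside[OF pq(2) that] .
  have tz: "tk1 (kavg T (h n)) q r = 0" if "r \<notin> {0<..<T}" for n r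
   by (rule tk_support(2)[OF k]) (use that in auto)
  have lim: "(%n. ip (%t. tk1 (kavg T (h n)) q t - q t) (%t. tk1 (kavg T (h n)) q t - q t)) ~~> 0"
  proof (rule L2_dominated_convergence)
   show "tk1 (kavg T (h n)) q \<in> BM" for n by (rule tk1_meas[OF k sqi_meas[OF sq]])
   show "q \<in> BM" by (rule sqi_meas[OF sq])
   show "sqi (%t. 2 * B * ind {0<..<T} t)" by (intro sqi_cmult sqi_ind_interval)
   show "(%n. tk1 (kavg T (h n)) q r) ~~> q r" for r
   proof (cases "r \<in> {0<..<T}")
    case False
    then show ?thesis using q0[OF False] tz[OF False] by simp
   next
    case True
    have "((%h. (F (r + h) - F r) / h) \<longlongrightarrow> q r) (at 0)" using F(1)[of r] by (simp add: DERIV_def)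
    then have "(%n. (F (r + h n) - F r) / h n) ~~> q r"
     by (rule filterlim_compose) (use hn in \<open>auto simp: filterlim_at less_imp_neq[symmetric]\<close>)
    then show ?thesis using F(2) hn(1) True by simp
   qed
   show "norm (tk1 (kavg T (h n)) q r - q r) <= norm (2 * B * ind {0<..<T} r)" for n r
   proof (cases "r \<in> {0<..<T}")
    case False
    then show ?thesis using q0[OF False] tz[OF False] by simp
   next
    case True
    have "norm (tk1 (kavg T (h n)) q r) <= (LBINT t. norm (kavg T (h n) (r, t) *\<^sub>R q t))"
     unfolding tk1_def by (rule integral_norm_bound)
    also have "\<dots> <= (LBINT t. B * kavg T (h n) (r, t))"
    proof (rule integral_mono)
     show "integrable lborel (%t. norm (kavg T (h n) (r, t) *\<^sub>R q t))" by (intro integrable_norm kern_mult_integrable[OF k sq])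
     show "integrable lborel (%t. B * kavg T (h n) (r, t))" by (intro integrable_mult_right kern_slice_integrable[OF k])
     show "norm (kavg T (h n) (r, t) *\<^sub>R q t) <= B * kavg T (h n) (r, t)" for t
      using mult_left_mono[OF B(2)[of t] kern_nonneg[OF k, of n "(r, t)"]] kern_nonneg[OF k, of n "(r, t)"] by (simp add: abs_mult mult.commute)
    qed
    also have "\<dots> <= B * 1" using k[of n] B(1) by (simp add: kern_def)
    finally show ?thesis using B(2)[of r] True B(1) by auto
   qed
  qed
  have s: "sqi (tk1 (kavg T (h n)) q)" for n by (rule tk1_schur(1)[OF k sq])
  from tensor_tendsto[OF test_fun_sqi[OF pq(1)] s sq lim g]
  have "(%n. ip g (%z. p (fst z) * tk1 (kavg T (h n)) q (snd z))) ~~> ip g (p \<otimes> q)" .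
  moreover have "ip (X n) (p \<otimes> q) = ip g (%z. p (fst z) * tk1 (kavg T (h n)) q (snd z))" for n
   unfolding eq[OF test_tensor_sqi[OF pq(1) sq], symmetric]
   by (rule arg_cong[of _ _ "ip g"], rule ext, rule tk_tensor)
  ultimately show "(%n. ip (X n) (p \<otimes> q)) ~~> ip g (p \<otimes> q)" by simp
 qed
 then show ?thesis by (simp add: eq[OF \<zeta>(1)])
qed

lemma ip_components:
 assumes "sqi f" "sqi g" shows "ip f g = (\<Sum>i\<in>Basis. ip (%z. f z \<bullet> i) (%z. g z \<bullet> i))"
proof -
 have "ip f g = (LBINT z. (\<Sum>i\<in>Basis. (f z \<bullet> i) * (g z \<bullet> i)))"
  unfolding ip_def by (simp add: euclidean_inner[of "f _" "g _"])
 also have "\<dots> = (\<Sum>i\<in>Basis. (LBINT z. (f z \<bullet> i) * (g z \<bullet> i)))"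
  by (rule Bochner_Integration.integral_sum) (use assms in auto)
 finally show ?thesis by (simp add: ip_def)
qed

lemma kavg_weak:
 fixes g \<zeta> :: "'a::euclidean_space \<times> real => 'c::euclidean_space"
 assumes T: "T > 0" and g: "sqi g" and \<zeta>: "sqi \<zeta>" "!!z. z \<notin> UNIV \<times> {0<..<T} ==> \<zeta> z = 0"
  and hn: "!!n. h n > 0" "h ~~> 0"
 shows "(%n. ip g (tk (kavg T (h n)) \<zeta>)) ~~> ip g \<zeta>"
proof -
 note k = kern_kavg[OF hn(1), of T]
 have "ip g (tk (kavg T (h n)) \<zeta>) = (\<Sum>i\<in>Basis. ip (%z. g z \<bullet> i) (tk (kavg T (h n)) (%z. \<zeta> z \<bullet> i)))" for n
  unfolding ip_components[OF g tk_schur(1)[OF k \<zeta>(1)]]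
 proof (rule sum.cong[OF refl], rule ip_cong_AE)
  fix i :: 'c
  show "AE z in lborel. (g z \<bullet> i) \<bullet> (tk (kavg T (h n)) \<zeta> z \<bullet> i) = (g z \<bullet> i) \<bullet> tk (kavg T (h n)) (%z. \<zeta> z \<bullet> i) z"
   using tk_inner[OF k \<zeta>(1), of n i] by eventually_elim simp
  show "(%z. tk (kavg T (h n)) \<zeta> z \<bullet> i) \<in> BM" using sqi_meas[OF sqi_comp[OF tk_schur(1)[OF k \<zeta>(1)]]] .
  show "tk (kavg T (h n)) (%z. \<zeta> z \<bullet> i) \<in> BM" using sqi_meas[OF tk_schur(1)[OF k sqi_comp[OF \<zeta>(1)]]] .
 qed (rule sqi_meas[OF sqi_comp[OF g]])+
 moreover have "(%n. \<Sum>i\<in>Basis. ip (%z. g z \<bullet> i) (tk (kavg T (h n)) (%z. \<zeta> z \<bullet> i))) ~~> (\<Sum>i\<in>Basis. ip (%z. g z \<bullet> i) (%z. \<zeta> z \<bullet> i))"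
  by (intro tendsto_sum kavg_weak_real[OF T sqi_comp[OF g] sqi_comp[OF \<zeta>(1)] _ hn]) (use \<zeta>(2) in auto)
 ultimately show ?thesis by (simp add: ip_components[OF g \<zeta>(1)])
qed

subsection \<open>Smooth cut-offs at the initial time\<close>

text \<open>Zero up to t = 1/(n + 1) and convergent to 1 for every t > 0. As \<open>bexp\<close>
  never reaches 1, the derivative \<open>detan\<close> is not supported near 0; in its place there
  are nonnegativity, total mass at most 1 on (0, T), and uniform decay away from 0.\<close>

definition etan :: "nat => real => real" where
 "etan n t = bexp ((real (Suc n))\<^sup>2 * t + (- real (Suc n)))"

definition detan :: "nat => real => real" where
 "detan n t = (real (Suc n))\<^sup>2 * hexp 2 ((real (Suc n))\<^sup>2 * t + (- real (Suc n)))"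

lemma etan_smooth: "smooth_on UNIV (etan n)"
 unfolding etan_def[abs_def] by (rule smooth_on_affine_comp[OF smooth_hexp]) (auto intro!: linearI simp: algebra_simps)

lemma etan_deriv: "(etan n has_real_derivative detan n t) (at t)"
proof -
 have "((%t. (real (Suc n))\<^sup>2 * t + (- real (Suc n))) has_real_derivative (real (Suc n))\<^sup>2) (at t)"
  by (auto intro!: derivative_eq_intros)
 from DERIV_chain2[OF hexp_deriv[of 0] this] show ?thesis
  unfolding etan_def[abs_def] detan_def by (simp add: mult.commute numeral_2_eq_2)
qed

lemma etan_bounds: "0 <= etan n t" "etan n t <= 1" "\<bar>etan n t\<bar> <= 1"
 by (auto simp: etan_def bexp_bounds)

lemma etan_zero: "t <= 1 / real (Suc n) ==> etan n t = 0" and detan_zero: "t <= 1 / real (Suc n) ==> detan n t = 0"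
proof -
 assume t: "t <= 1 / real (Suc n)"
 define N where "N = real (Suc n)"
 have N: "N > 0" "N * t <= 1" using t by (simp_all add: N_def le_divide_eq mult.commute del: of_nat_Suc)
 have "N * (N * t) <= N * 1" using N by (intro mult_left_mono) auto
 then have "N\<^sup>2 * t + (- N) <= 0" by (simp add: power2_eq_square mult.assoc)
 then show "etan n t = 0" "detan n t = 0" by (simp_all add: etan_def detan_def hexp_def N_def[symmetric] del: of_nat_Suc)
qed

lemma hexp2_le: "0 <= hexp 2 s" "hexp 2 s <= 2" "s > 0 ==> hexp 2 s <= 1 / s\<^sup>2"
proof -
 show "0 <= hexp 2 s" by (simp add: hexp_def)
 show "hexp 2 s <= 2"
 proof (cases "s <= 0")
  case False
  define y where "y = inverse s"
  have y: "y > 0" using False by (simp add: y_def)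
  have "y\<^sup>2 / 2 <= exp y" using exp_lower_Taylor_quadratic[of y] y by linarith
  then have "exp (- y) * y\<^sup>2 <= 2" by (simp add: exp_minus field_simps)
  then show ?thesis using False by (simp add: hexp_def y_def)
 qed (simp add: hexp_def)
 assume s: "s > 0"
 have "exp (- inverse s) * inverse s ^ 2 <= 1 * inverse s ^ 2" using s by (intro mult_right_mono) auto
 moreover have "hexp 2 s = exp (- inverse s) * inverse s ^ 2" using s by (simp add: hexp_def)
 moreover have "1 / s\<^sup>2 = inverse s ^ 2" by (simp add: power_one_over inverse_eq_divide)
 ultimately show "hexp 2 s <= 1 / s\<^sup>2" by simp
qed

lemma detan_nonneg: "0 <= detan n t" by (simp add: detan_def hexp2_le)
lemma detan_bound: "detan n t <= (real (Suc n))\<^sup>2 * 2" by (simp add: detan_def hexp2_le mult_left_mono)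
lemma detan_abs_bound: "\<bar>detan n t\<bar> <= (real (Suc n))\<^sup>2 * 2" using detan_bound detan_nonneg by simp

lemma etan_meas [measurable]: "etan n \<in> BM"
 by (rule borel_measurable_continuous_onI[OF smooth_on_continuous[OF etan_smooth]])

lemma hexp_cont: "continuous_on UNIV (hexp n)"
 by (rule smooth_on_continuous[OF smooth_hexp])

lemma detan_cont: "continuous_on UNIV (detan n)"
 unfolding detan_def[abs_def]
 by (intro continuous_on_mult continuous_on_const continuous_on_compose2[OF hexp_cont] continuous_on_add continuous_on_id) auto

lemma detan_meas [measurable]: "detan n \<in> BM"
 by (rule borel_measurable_continuous_onI[OF detan_cont])

lemma etan_tendsto: "t > 0 ==> (%n. etan n t) ~~> 1"
proof -
 assume t: "t > 0"
 have f: "filterlim (%n. (real (Suc n))\<^sup>2 * t + (- real (Suc n))) at_top sequentially"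
 proof -
  have N: "filterlim (%n. real (Suc n)) at_top sequentially"
   by (rule filterlim_compose[OF filterlim_real_sequentially filterlim_Suc])
  have "\<forall>\<^sub>F n in sequentially. 2 / t <= real (Suc n)" using N by (simp add: filterlim_at_top)
  then have "\<forall>\<^sub>F n in sequentially. real (Suc n) <= (real (Suc n))\<^sup>2 * t + (- real (Suc n))"
  proof eventually_elim
   case (elim n)
   define M where "M = real (Suc n)"
   have "2 <= M * t" using elim t by (simp add: M_def divide_le_eq)
   then have "M * 2 <= M * (M * t)" by (intro mult_left_mono) (auto simp: M_def)
   then have "M <= M\<^sup>2 * t + (- M)" by (simp add: power2_eq_square mult.assoc)
   then show ?case by (simp add: M_def)
  qed
  from filterlim_at_top_mono[OF N this] show ?thesis .
 qed
 have i: "((%s::real. inverse s) \<longlongrightarrow> 0) at_top" by (rule tendsto_inverse_0_at_top[OF filterlim_ident])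
 have "((%s::real. exp (- inverse s)) \<longlongrightarrow> 1) at_top" using tendsto_exp[OF tendsto_minus[OF i]] by simp
 moreover have "\<forall>\<^sub>F s in at_top. exp (- inverse s) = bexp s"
  using eventually_gt_at_top[of 0] by eventually_elim (simp add: hexp_def)
 ultimately have "(bexp \<longlongrightarrow> 1) at_top" by (rule Lim_transform_eventually)
 from filterlim_compose[OF this f] show ?thesis by (simp add: etan_def)
qed

text \<open>Write N = n + 1. Once 1/N is below \<tau>/2, the argument of \<open>hexp 2\<close> is at
  least N^2 \<tau>/2, and \<open>hexp 2 s \<le> 1 / s^2\<close> turns the prefactor N^2 into a bound
  of order 1/N^2.\<close>

lemma detan_far: assumes "\<tau> > 0" "e > 0" shows "\<forall>\<^sub>F n in sequentially. \<forall>t\<ge>\<tau>. detan n t <= e"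
proof -
 have l1: "(%n. 1 / real (Suc n)) ~~> 0" using LIMSEQ_inverse_real_of_nat by (simp add: inverse_eq_divide)
 have l2: "(%n. (1 / real (Suc n)) * (1 / real (Suc n)) * (4 / \<tau>\<^sup>2)) ~~> 0 * 0 * (4 / \<tau>\<^sup>2)"
  by (intro tendsto_mult l1 tendsto_const)
 have e1: "\<forall>\<^sub>F n in sequentially. 1 / real (Suc n) < \<tau> / 2" using order_tendstoD(2)[OF l1, of "\<tau>/2"] assms by simp
 have e2: "\<forall>\<^sub>F n in sequentially. (1 / real (Suc n)) * (1 / real (Suc n)) * (4 / \<tau>\<^sup>2) < e"
  using order_tendstoD(2)[OF l2, of e] assms by simp
 show ?thesis using e1 e2
 proof eventually_elim
  case (elim n)
  define N where "N = real (Suc n)"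
  have N: "N > 0" "1 < N * (\<tau> / 2)" "(1 / N) * (1 / N) * (4 / \<tau>\<^sup>2) < e"
   using elim by (auto simp: N_def divide_less_eq mult.commute)
  show ?case
  proof (intro allI impI)
   fix t assume t: "\<tau> <= t"
   let ?s = "N\<^sup>2 * t + (- N)"
   have "N * 1 <= N * (N * (\<tau> / 2))" using N by (intro mult_left_mono) auto
   moreover have "N\<^sup>2 * \<tau> <= N\<^sup>2 * t" using t by (intro mult_left_mono) auto
   ultimately have s: "N\<^sup>2 * \<tau> / 2 <= ?s" by (simp add: power2_eq_square algebra_simps)
   have s0: "0 < N\<^sup>2 * \<tau> / 2" using N assms by simp
   have "hexp 2 ?s <= 1 / ?s\<^sup>2" using s s0 by (intro hexp2_le) linarith
   also have "\<dots> <= 1 / (N\<^sup>2 * \<tau> / 2)\<^sup>2" using s s0 by (intro divide_left_mono power_mono mult_pos_pos zero_less_power) auto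
   finally have "N\<^sup>2 * hexp 2 ?s <= N\<^sup>2 * (1 / (N\<^sup>2 * \<tau> / 2)\<^sup>2)" by (intro mult_left_mono) auto
   also have "\<dots> = (1 / N) * (1 / N) * (4 / \<tau>\<^sup>2)" using N assms by (simp add: field_simps power2_eq_square)
   finally show "detan n t <= e" using N(3) by (simp add: detan_def N_def)
  qed
 qed
qed

lemma detan_integral: "T > 0 ==> (LBINT t. of_bool (0 < t \<and> t < T) * detan n t) <= 1"
 using integral_FTC_test[OF detan_cont etan_deriv, of 0 T n] etan_bounds[of n T] etan_bounds[of n 0] by linarith

lemma etan_cutoff_weak:
 fixes g h :: "'a::euclidean_space \<times> real => 'c::euclidean_space"
 assumes g: "sqi g" and h: "sqi h" "!!z. snd z <= 0 ==> h z = 0"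
 shows "(%n. ip g (%z. etan n (snd z) *\<^sub>R h z)) ~~> ip g h"
proof (rule ip_tendsto_strong[OF _ h(1) g])
 have em: "(%z::'a\<times>real. etan n (snd z)) \<in> BM" for n
 proof -
  have "(%z::'a\<times>real. etan n (snd z)) \<in> borel_measurable (borel \<Otimes>\<^sub>M borel)" by measurable
  then show ?thesis by (simp add: borel_prod)
 qed
 show s: "sqi (%z. etan n (snd z) *\<^sub>R h z)" for n by (rule sqi_bmult[OF h(1) em etan_bounds(3)])
 show "(%n. ip (%z. etan n (snd z) *\<^sub>R h z - h z) (%z. etan n (snd z) *\<^sub>R h z - h z)) ~~> 0"
 proof (rule L2_dominated_convergence[OF sqi_meas[OF s] sqi_meas[OF h(1)] h(1)])
  show "norm (etan n (snd z) *\<^sub>R h z - h z) <= norm (h z)" for n z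
  proof -
   have "etan n (snd z) *\<^sub>R h z - h z = (etan n (snd z) - 1) *\<^sub>R h z" by (simp add: scaleR_left_diff_distrib)
   moreover have "\<bar>etan n (snd z) - 1\<bar> <= 1" using etan_bounds[of n "snd z"] by auto
   ultimately show ?thesis using mult_right_mono[of "\<bar>etan n (snd z) - 1\<bar>" 1 "norm (h z)"] by simp
  qed
  show "(%n. etan n (snd z) *\<^sub>R h z) ~~> h z" for z
  proof (cases "snd z <= 0")
   case True then show ?thesis using h(2) by simp
  next
   case False
   then have "(%n. etan n (snd z) *\<^sub>R h z) ~~> 1 *\<^sub>R h z" by (intro tendsto_scaleR etan_tendsto tendsto_const) auto
   then show ?thesis by simp
  qed
 qed
qed

text \<open>Split the times: on \<open>N\<close> the slices of \<open>v\<close> are small and the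
  weights have mass at most 1; off \<open>N\<close> the weights are small and \<open>v\<close> has
  finite norm. With a general set \<open>N\<close> the argument serves both ends of the time
  interval.\<close>

lemma weight_tendsto_0:
 fixes v :: "'a::euclidean_space \<times> real => real" and m :: "nat => real => real"
 assumes v: "sqi v" "!!z. snd z \<notin> {0<..<T} ==> v z = 0"
  and m: "!!n. m n \<in> BM" "!!n t. 0 <= m n t" "!!n t. m n t <= B n"
   "!!n. (LBINT t. of_bool (0 < t \<and> t < T) * m n t) <= 1"
  and near: "!!e. e > 0 ==> \<exists>N. (AE t in lborel. t \<in> N --> (LBINT x. (v (x, t))\<^sup>2) <= e)
    \<and> (\<forall>\<^sub>F n in sequentially. \<forall>t. 0 < t \<and> t < T \<and> t \<notin> N --> m n t <= e)"
 shows "(%n. LBINT z. m n (snd z) * (v z)\<^sup>2) ~~> 0"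
proof -
 let ?g = "%t. LBINT x. (v (x, t))\<^sup>2"
 have iv: "integrable lborel (%z. (v z)\<^sup>2)" using sqi_int[OF v(1)] by simp
 have ig: "integrable lborel ?g" "(LBINT t. ?g t) = ip v v"
  using integral_slices_t[OF iv] by (simp_all add: ip_norm)
 have g0: "0 <= ?g t" for t by simp
 have im: "integrable lborel (%t. of_bool (0 < t \<and> t < T) * m n t)" for n
 proof (rule Bochner_Integration.integrable_bound)
  show "integrable lborel (%t. B n * ind {0<..<T} t)" by simp
  have [measurable]: "m n \<in> BM" by (rule m(1))
  show "(%t. of_bool (0 < t \<and> t < T) * m n t) \<in> borel_measurable lborel" by measurable
  show "AE t in lborel. norm (of_bool (0 < t \<and> t < T) * m n t) <= norm (B n * ind {0<..<T} t)"
  proof (rule AE_I2)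
   fix t show "norm (of_bool (0 < t \<and> t < T) * m n t) <= norm (B n * ind {0<..<T} t)"
    using m(2)[of n t] m(3)[of n t] by (auto simp: indicator_def)
  qed
 qed
 have imv: "integrable lborel (%z. m n (snd z) * (v z)\<^sup>2)" for n
 proof (rule Bochner_Integration.integrable_bound)
  show "integrable lborel (%z. B n * (v z)\<^sup>2)" using iv by simp
  have [measurable]: "m n \<in> BM" by (rule m(1))
  have [measurable]: "v \<in> borel_measurable (borel \<Otimes>\<^sub>M borel)" using sqi_meas[OF v(1)] by (simp add: borel_prod)
  have "(%z. m n (snd z) * (v z)\<^sup>2) \<in> borel_measurable (borel \<Otimes>\<^sub>M borel)" by measurable
  then show "(%z. m n (snd z) * (v z)\<^sup>2) \<in> borel_measurable lborel" by (simp add: borel_prod)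
  show "AE z in lborel. norm (m n (snd z) * (v z)\<^sup>2) <= norm (B n * (v z)\<^sup>2)"
  proof (rule AE_I2)
   fix z show "norm (m n (snd z) * (v z)\<^sup>2) <= norm (B n * (v z)\<^sup>2)"
    using m(2)[of n "snd z"] m(3)[of n "snd z"] by (simp add: abs_mult mult_right_mono)
  qed
 qed
 have eq: "(LBINT z. m n (snd z) * (v z)\<^sup>2) = (LBINT t. m n t * ?g t)" "integrable lborel (%t. m n t * ?g t)" for n
  using integral_slices_t[OF imv[of n]] by simp_all
 have gout: "?g t = 0" if "t \<notin> {0<..<T}" for t using v(2)[of "(_, t)"] that by simp
 show ?thesis
 proof (rule LIMSEQ_I)
  fix e :: real assume e: "e > 0"
  \<comment> \<open>The two contributions are at most \<open>d\<close> and
    \<open>d * ip v v\<close>, together \<open>d * c\<close>.\<close>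
  define c where "c = ip v v + 1"
  define d where "d = e / (2 * c)"
  have pos: "c > 0" using ip_nonneg[of v] by (simp add: c_def)
  have d: "d > 0" "d * c < e" using e pos by (simp_all add: d_def)
  obtain N n0 where N: "AE t in lborel. t \<in> N --> ?g t <= d" "!!n t. n \<ge> n0 ==> 0 < t \<and> t < T \<and> t \<notin> N ==> m n t <= d"
   using near[OF d(1)] by (auto simp: eventually_sequentially)
  have "norm ((LBINT z. m n (snd z) * (v z)\<^sup>2) - 0) < e" if n: "n \<ge> n0" for n
  proof -
   have "(LBINT t. m n t * ?g t) <= (LBINT t. d * (of_bool (0 < t \<and> t < T) * m n t) + d * ?g t)"
   proof (rule integral_mono_AE)
    show "integrable lborel (%t. m n t * ?g t)" by (rule eq(2))
    show "integrable lborel (%t. d * (of_bool (0 < t \<and> t < T) * m n t) + d * ?g t)"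
     by (intro Bochner_Integration.integrable_add integrable_mult_right im ig)
    show "AE t in lborel. m n t * ?g t <= d * (of_bool (0 < t \<and> t < T) * m n t) + d * ?g t"
     using N(1)
    proof eventually_elim
     case (elim t)
     show ?case
     proof (cases "0 < t \<and> t < T")
      case False then show ?thesis using gout[of t] by auto
     next
      case True
      show ?thesis
      proof (cases "t \<in> N")
       case True
       then have "m n t * ?g t <= m n t * d" using elim m(2) by (intro mult_left_mono) auto
       moreover have "0 <= d * ?g t" using d g0 by simp
       ultimately show ?thesis using \<open>0 < t \<and> t < T\<close> by (simp add: mult.commute)
      next
       case False
       then have "m n t * ?g t <= d * ?g t" using N(2)[OF n] True g0 by (intro mult_right_mono) auto
       moreover have "0 <= d * m n t" using d m(2) by simp
       ultimately show ?thesis using True by simp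
      qed
     qed
    qed
   qed
   also have "\<dots> = d * (LBINT t. of_bool (0 < t \<and> t < T) * m n t) + d * ip v v"
    using im[of n] ig by simp
   also have "\<dots> <= d * 1 + d * ip v v" using m(4)[of n] d by (intro add_right_mono mult_left_mono) auto
   also have "\<dots> < e" using d(2) by (simp add: c_def algebra_simps)
   finally have "(LBINT z. m n (snd z) * (v z)\<^sup>2) < e" by (simp add: eq)
   moreover have "0 <= (LBINT z. m n (snd z) * (v z)\<^sup>2)" using m(2) by simp
   ultimately show ?thesis by simp
  qed
  then show "\<exists>no. \<forall>n\<ge>no. norm ((LBINT z. m n (snd z) * (v z)\<^sup>2) - 0) < e" by blast
 qed
qed

lemma snd_meas:
 fixes \<eta> :: "real => 'c::euclidean_space"
 assumes "\<eta> \<in> BM" shows "(%z::'a::euclidean_space\<times>real. \<eta> (snd z)) \<in> BM"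
proof -
 note assms[measurable]
 have "(%z::'a\<times>real. \<eta> (snd z)) \<in> borel_measurable (borel \<Otimes>\<^sub>M borel)" by measurable
 then show ?thesis unfolding borel_prod .
qed

lemma fst_meas:
 fixes \<theta> :: "'a::euclidean_space => 'c::euclidean_space"
 assumes "\<theta> \<in> BM" shows "(%z::'a\<times>real. \<theta> (fst z)) \<in> BM"
proof -
 note assms[measurable]
 have "(%z::'a\<times>real. \<theta> (fst z)) \<in> borel_measurable (borel \<Otimes>\<^sub>M borel)" by measurable
 then show ?thesis unfolding borel_prod .
qed

lemma sqi_tmult:
 fixes f :: "'a::euclidean_space \<times> real => 'c::euclidean_space"
 assumes "sqi f" "\<eta> \<in> BM" "!!t. \<bar>\<eta> t\<bar> <= B"
 shows "sqi (%z. \<eta> (snd z) *\<^sub>R f z)"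
 by (rule sqi_bmult[OF assms(1) snd_meas[OF assms(2)] assms(3)])

lemma sqi_tmult_real:
 fixes f :: "'a::euclidean_space \<times> real => real"
 assumes "sqi f" "\<eta> \<in> BM" "!!t. \<bar>\<eta> t\<bar> <= B"
 shows "sqi (%z. \<eta> (snd z) * f z)"
 by (rule sqi_bmult_real[OF assms(1) snd_meas[OF assms(2)] assms(3)])

lemma sqi_xmult:
 fixes f :: "'a::euclidean_space \<times> real => 'c::euclidean_space"
 assumes "sqi f" "\<theta> \<in> BM" "!!x. \<bar>\<theta> x\<bar> <= B"
 shows "sqi (%z. \<theta> (fst z) *\<^sub>R f z)"
 by (rule sqi_bmult[OF assms(1) fst_meas[OF assms(2)] assms(3)])

lemma sqi_xmult_real:
 fixes f :: "'a::euclidean_space \<times> real => real"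
 assumes "sqi f" "\<theta> \<in> BM" "!!x. \<bar>\<theta> x\<bar> <= B"
 shows "sqi (%z. \<theta> (fst z) * f z)"
 by (rule sqi_bmult_real[OF assms(1) fst_meas[OF assms(2)] assms(3)])

lemma sqi_xvec:
 fixes f :: "'a::euclidean_space \<times> real => real" and m :: "'a => 'c::euclidean_space"
 assumes "sqi f" "m \<in> BM" "!!x. norm (m x) <= B"
 shows "sqi (%z. f z *\<^sub>R m (fst z))"
 by (rule sqi_scal_vec[OF assms(1) fst_meas[OF assms(2)] assms(3)])

lemma sqi_xinner:
 fixes f :: "'a::euclidean_space \<times> real => 'c::euclidean_space"
 assumes "sqi f" "m \<in> BM" "!!x. norm (m x) <= B"
 shows "sqi (%z. f z \<bullet> m (fst z))"
 by (rule sqi_inner_bounded[OF assms(1) fst_meas[OF assms(2)] assms(3)])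

subsection \<open>Integration by parts in time\<close>

text \<open>The product of a cutoff with a time integral of \<open>\<Xi>\<close> has the derivative
  \<open>\<eta>' * tk k \<Xi> + \<sigma> * \<eta> * \<Xi>\<close>, with \<open>\<sigma> = -1\<close>
  for the backward and \<open>\<sigma> = 1\<close> for the forward integral. For products p(x) q(t)
  this is an admissible test function; general \<open>\<Xi>\<close> follow by density.\<close>

lemma ibp:
 fixes v D \<Xi> :: "'a::euclidean_space \<times> real => real"
 assumes V: "open V" and v: "sqi v" and D: "sqi D" and k: "kern T C k"
  and wdt: "!!p q. test_fun V p ==> test_fun {s<..<T} q ==>
    ip v (%z. p (fst z) * fder q (snd z) 1) = - ip D (p \<otimes> q)"
  and \<eta>: "\<eta> \<in> BM" "!!t. \<bar>\<eta> t\<bar> <= B" "\<eta>' \<in> BM" "!!t. \<bar>\<eta>' t\<bar> <= B'"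
  and cut: "!!q. test_fun {0<..<T} q ==> test_fun {s<..<T} (%t. \<eta> t * tk1 k q t)"
   "!!q t. test_fun {0<..<T} q ==> fder (%t. \<eta> t * tk1 k q t) t 1 = \<eta>' t * tk1 k q t + \<sigma> * (\<eta> t * q t)"
  and \<Xi>: "sqi \<Xi>" "!!z. z \<notin> cyl V 0 T ==> \<Xi> z = 0"
 shows "ip v (%z. \<eta>' (snd z) * tk k \<Xi> z) + \<sigma> * ip v (%z. \<eta> (snd z) * \<Xi> z) = - ip D (%z. \<eta> (snd z) * tk k \<Xi> z)"
proof -
 note kT = kern_kT[OF k]
 have s1: "sqi (%z. \<eta>' (snd z) * v z)" by (rule sqi_tmult_real[OF v \<eta>(3,4)])
 have s2: "sqi (%z. \<eta> (snd z) * v z)" by (rule sqi_tmult_real[OF v \<eta>(1,2)])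
 have s3: "sqi (%z. \<eta> (snd z) * D z)" by (rule sqi_tmult_real[OF D \<eta>(1,2)])
 \<comment> \<open>All operators are moved onto \<open>v\<close> and \<open>D\<close>: the defect of
   the identity becomes the pairing of one L^2 function with \<open>\<Xi>\<close>, to which density
   applies.\<close>
 define X where "X z = (tk (kT k) (%z. \<eta>' (snd z) * v z) z + \<sigma> * (\<eta> (snd z) * v z)) + tk (kT k) (%z. \<eta> (snd z) * D z) z" for z
 have t1: "sqi (tk (kT k) (%z. \<eta>' (snd z) * v z))" by (rule tk_schur(1)[OF kT s1])
 have t2: "sqi (%z. \<sigma> * (\<eta> (snd z) * v z))" by (rule sqi_cmult[OF s2])
 have t3: "sqi (tk (kT k) (%z. \<eta> (snd z) * D z))" by (rule tk_schur(1)[OF kT s3])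
 have X: "sqi X" unfolding X_def[abs_def] by (intro sqi_add t1 t2 t3)
 have e: "ip X h = (ip v (%z. \<eta>' (snd z) * tk k h z) + \<sigma> * ip v (%z. \<eta> (snd z) * h z)) + ip D (%z. \<eta> (snd z) * tk k h z)"
  if h: "sqi h" for h
 proof -
  have "ip X h = (ip (tk (kT k) (%z. \<eta>' (snd z) * v z)) h + ip (%z. \<sigma> * (\<eta> (snd z) * v z)) h) + ip (tk (kT k) (%z. \<eta> (snd z) * D z)) h"
   unfolding X_def[abs_def] ip_add_left[OF sqi_add[OF t1 t2] t3 h] ip_add_left[OF t1 t2 h] ..
  also have "ip (tk (kT k) (%z. \<eta>' (snd z) * v z)) h = ip v (%z. \<eta>' (snd z) * tk k h z)"
   unfolding tk_adjoint[OF kT s1 h] by (simp add: ip_def mult.assoc mult.left_commute)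
  also have "ip (tk (kT k) (%z. \<eta> (snd z) * D z)) h = ip D (%z. \<eta> (snd z) * tk k h z)"
   unfolding tk_adjoint[OF kT s3 h] by (simp add: ip_def mult.assoc mult.left_commute)
  also have "ip (%z. \<sigma> * (\<eta> (snd z) * v z)) h = \<sigma> * ip v (%z. \<eta> (snd z) * h z)"
   unfolding ip_cmult_left by (simp add: ip_def mult.assoc mult.left_commute)
  finally show ?thesis .
 qed
 have "ip X \<Xi> = 0"
 proof (rule ip_zero_tensor[OF V open_greaterThanLessThan X \<Xi>(1) \<Xi>(2)[unfolded cyl_def]])
  fix p q assume p: "test_fun V p" and q: "test_fun {0<..<T} q"
  have sp: "sqi p" and sq: "sqi q" by (rule test_fun_sqi[OF p], rule test_fun_sqi[OF q])
  have sk: "sqi (tk1 k q)" by (rule tk1_schur(1)[OF k sq])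
  have tk: "tk k (p \<otimes> q) = (%z. p (fst z) * tk1 k q (snd z))"
   by (rule ext, rule tk_tensor)
  have a: "sqi (%z. p (fst z) * (\<eta>' (snd z) * tk1 k q (snd z)))"
   by (rule sqi_tensor[OF sp sqi_bmult_real[OF sk \<eta>(3,4)]])
  have b: "sqi (%z. p (fst z) * (\<sigma> * (\<eta> (snd z) * q (snd z))))"
   by (rule sqi_tensor[OF sp sqi_cmult[OF sqi_bmult_real[OF sq \<eta>(1,2)]]])
  have "ip v (%z. p (fst z) * (\<eta>' (snd z) * tk1 k q (snd z))) + ip v (%z. p (fst z) * (\<sigma> * (\<eta> (snd z) * q (snd z))))
   = - ip D (%z. p (fst z) * (\<eta> (snd z) * tk1 k q (snd z)))"
   unfolding ip_add_right[OF a b v, symmetric] distrib_left[symmetric] cut(2)[OF q, symmetric]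
   by (rule wdt[OF p cut(1)[OF q]])
  moreover have "ip v (%z. p (fst z) * (\<sigma> * (\<eta> (snd z) * q (snd z)))) = \<sigma> * ip v (%z. \<eta> (snd z) * (p (fst z) * q (snd z)))"
   unfolding ip_cmult_right[symmetric] by (simp add: ac_simps)
  ultimately show "ip X (p \<otimes> q) = 0"
   unfolding e[OF test_tensor_sqi[OF p sq]] tk by (simp add: ac_simps)
 qed
 then show ?thesis using e[OF \<Xi>(1)] by simp
qed

text \<open>On (0, T) the backward integral is \<open>F T - F\<close>. Before 0 the two differ, but
  there the cutoff vanishes; near T the integral vanishes by itself because \<open>q\<close> has
  compact support. So the product is smooth with compact support.\<close>

lemma cut_back:
 assumes T: "T > 0" and s: "0 <= s" "s < 1 / real (Suc n)" and q: "test_fun {0<..<T} q"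
 shows "test_fun {s<..<T} (%t. etan n t * tk1 (kback T) q t)"
  "fder (%t. etan n t * tk1 (kback T) q t) t 1 = detan n t * tk1 (kback T) q t + (-1) * (etan n t * q t)"
proof -
 obtain F where F: "smooth_on UNIV F" "!!t. (F has_real_derivative q t) (at t)" "!!t. T <= t ==> F t = F T"
  "!!r. 0 < r ==> r < T ==> tk1 (kback T) q r = F T - F r"
  using test_primitive[OF q T] by metis
 obtain b where b: "b < T" "!!t. q t \<noteq> 0 ==> t <= b" using test_fun_real_support[OF q T] by metis
 have n0: "0 < 1 / real (Suc n)" by simp
 have tkT: "tk1 (kback T) q t = 0" if "T <= t" for t
  by (rule tk_support(2)[OF kern_kback[OF T]]) (use that in simp)
 have e: "etan n t * tk1 (kback T) q t = etan n t * (F T - F t)" "detan n t * tk1 (kback T) q t = detan n t * (F T - F t)" for t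
 proof -
  consider "t <= 0" | "0 < t" "t < T" | "T <= t" by linarith
  then have "etan n t * tk1 (kback T) q t = etan n t * (F T - F t) \<and> detan n t * tk1 (kback T) q t = detan n t * (F T - F t)"
  proof cases
   case 1 then have "t <= 1 / real (Suc n)" using n0 by linarith
   then show ?thesis by (simp add: etan_zero detan_zero)
  next
   case 2 then show ?thesis using F(4) by simp
  next
   case 3 then show ?thesis using F(3)[OF 3] tkT[OF 3] by simp
  qed
  then show "etan n t * tk1 (kback T) q t = etan n t * (F T - F t)" "detan n t * tk1 (kback T) q t = detan n t * (F T - F t)" by auto
 qed
 show "test_fun {s<..<T} (%t. etan n t * tk1 (kback T) q t)"
 proof (rule test_funI)
  have "smooth_on UNIV (%t. etan n t * (F T + (-1) * F t))"
   by (intro smooth_on_mult etan_smooth smooth_on_add smooth_on_const F(1))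
  then show "smooth_on UNIV (%t. etan n t * tk1 (kback T) q t)" unfolding e by simp
  show "compact {1 / real (Suc n)..b}" by simp
  show "{1 / real (Suc n)..b} \<subseteq> {s<..<T}" using s b(1) by auto
  fix t assume nz: "etan n t * tk1 (kback T) q t \<noteq> 0"
  have "1 / real (Suc n) <= t" using nz etan_zero[of t n] by (cases "t <= 1 / real (Suc n)") auto
  moreover have "t <= b"
  proof (rule ccontr)
   assume "\<not> t <= b"
   then have "kback T (t, r) *\<^sub>R q r = 0" for r using b(2)[of r] by (cases "q r = 0") (auto simp: kback_def)
   then have "(%r. kback T (t, r) *\<^sub>R q r) = (%r. 0)" by (rule ext)
   then have "tk1 (kback T) q t = 0" unfolding tk1_def by (simp only: Bochner_Integration.integral_zero)
   then show False using nz by simp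
  qed
  ultimately show "t \<in> {1 / real (Suc n)..b}" by simp
 qed
 have "((%t. etan n t * (F T - F t)) has_real_derivative (detan n t * (F T - F t) + (0 - q t) * etan n t)) (at t)"
  by (intro DERIV_mult etan_deriv DERIV_diff DERIV_const F(2))
 then have "fder (%t. etan n t * (F T - F t)) t = (*) (detan n t * (F T - F t) + (0 - q t) * etan n t)"
  by (intro frechet_derivative_eqI) (simp add: has_field_derivative_def)
 then show "fder (%t. etan n t * tk1 (kback T) q t) t 1 = detan n t * tk1 (kback T) q t + (-1) * (etan n t * q t)"
  unfolding e by simp
qed

text \<open>Mirror image of \<open>cut_back\<close>: now the primitive vanishes near 0 and the
  reflected cutoff acts at T.\<close>

lemma cut_fwd:
 assumes T: "T > 0" and q: "test_fun {0<..<T} q"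
 shows "test_fun {0<..<T} (%t. etan n (T - t) * tk1 (kT (kback T)) q t)"
  "fder (%t. etan n (T - t) * tk1 (kT (kback T)) q t) t 1
    = (- detan n (T - t)) * tk1 (kT (kback T)) q t + 1 * (etan n (T - t) * q t)"
proof -
 obtain F where F: "smooth_on UNIV F" "!!t. (F has_real_derivative q t) (at t)" "!!t. t <= 0 ==> F t = 0"
  "!!r. 0 < r ==> r < T ==> tk1 (kT (kback T)) q r = F r"
  using test_primitive[OF q T] by metis
 obtain a where a: "0 < a" "!!t. q t \<noteq> 0 ==> a <= t" using test_fun_real_support[OF q T] by metis
 have n0: "0 < 1 / real (Suc n)" by simp
 have tk0: "tk1 (kT (kback T)) q t = 0" if "t <= 0" for t
  by (rule tk_support(2)[OF kern_kfwd[OF T]]) (use that in simp)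
 have e: "etan n (T - t) * tk1 (kT (kback T)) q t = etan n (T - t) * F t" "detan n (T - t) * tk1 (kT (kback T)) q t = detan n (T - t) * F t" for t
 proof -
  consider "t <= 0" | "0 < t" "t < T" | "T <= t" by linarith
  then have "etan n (T - t) * tk1 (kT (kback T)) q t = etan n (T - t) * F t \<and> detan n (T - t) * tk1 (kT (kback T)) q t = detan n (T - t) * F t"
  proof cases
   case 3 then have "T - t <= 1 / real (Suc n)" using n0 by linarith
   then show ?thesis by (simp add: etan_zero detan_zero)
  next
   case 2 then show ?thesis using F(4) by simp
  next
   case 1 then show ?thesis using F(3)[OF 1] tk0[OF 1] by simp
  qed
  then show "etan n (T - t) * tk1 (kT (kback T)) q t = etan n (T - t) * F t" "detan n (T - t) * tk1 (kT (kback T)) q t = detan n (T - t) * F t" by auto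
 qed
 have d: "((%t. etan n (T - t)) has_real_derivative - detan n (T - t)) (at t)" for t
  using DERIV_chain2[OF etan_deriv DERIV_diff[OF DERIV_const DERIV_ident], of n T t] by simp
 have sm: "smooth_on UNIV (%t. etan n (T - t))"
  using smooth_on_affine_comp[OF etan_smooth[of n], of "%t. - t" T] by (simp add: linear_uminus)
 show "test_fun {0<..<T} (%t. etan n (T - t) * tk1 (kT (kback T)) q t)"
 proof (rule test_funI)
  show "smooth_on UNIV (%t. etan n (T - t) * tk1 (kT (kback T)) q t)" unfolding e by (rule smooth_on_mult[OF sm F(1)])
  show "compact {a..T - 1 / real (Suc n)}" by simp
  show "{a..T - 1 / real (Suc n)} \<subseteq> {0<..<T}"
  proof
   fix x assume "x \<in> {a..T - 1 / real (Suc n)}"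
   then have "a <= x" "x <= T - 1 / real (Suc n)" by simp_all
   then have "0 < x" "x < T" using a(1) n0 by linarith+
   then show "x \<in> {0<..<T}" by simp
  qed
  fix t assume nz: "etan n (T - t) * tk1 (kT (kback T)) q t \<noteq> 0"
  have "\<not> T - t <= 1 / real (Suc n)" using nz etan_zero[of "T - t" n] by auto
  then have "t <= T - 1 / real (Suc n)" by linarith
  moreover have "a <= t"
  proof (rule ccontr)
   assume "\<not> a <= t"
   then have "kT (kback T) (t, r) *\<^sub>R q r = 0" for r using a(2)[of r] by (cases "q r = 0") (auto simp: kback_def kT_def)
   then have "(%r. kT (kback T) (t, r) *\<^sub>R q r) = (%r. 0)" by (rule ext)
   then have "tk1 (kT (kback T)) q t = 0" unfolding tk1_def by (simp only: Bochner_Integration.integral_zero)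
   then show False using nz by simp
  qed
  ultimately show "t \<in> {a..T - 1 / real (Suc n)}" by simp
 qed
 have "((%t. etan n (T - t) * F t) has_real_derivative (- detan n (T - t) * F t + q t * etan n (T - t))) (at t)"
  by (intro DERIV_mult d F(2))
 then have "fder (%t. etan n (T - t) * F t) t = (*) (- detan n (T - t) * F t + q t * etan n (T - t))"
  by (intro frechet_derivative_eqI) (simp add: has_field_derivative_def)
 then show "fder (%t. etan n (T - t) * tk1 (kT (kback T)) q t) t 1
    = (- detan n (T - t)) * tk1 (kT (kback T)) q t + 1 * (etan n (T - t) * q t)"
  using e(2)[of t] unfolding e(1) by auto
qed

section \<open>Time integrals against concentrating weights\<close>

lemma tk_pointwise_bound:
 fixes h :: "'a::euclidean_space \<times> real => real"
 assumes T: "T > 0" and k: "kern T T k" "!!z. k z <= 1" and h: "sqi h"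
 shows "AE x in lborel. \<forall>r. (tk k h (x, r))\<^sup>2 <= T * (LBINT t. (h (x, t))\<^sup>2)"
 using sqi_slice_AE[OF h]
proof eventually_elim
 case (elim x)
 let ?h = "%t. h (x, t)"
 show ?case
 proof
  fix r
  have kr: "sqi (%t. k (r, t))"
  proof (rule sqi_bound[OF sqi_ind_interval[of 0 T], where c=1])
   show "(%t. k (r, t)) \<in> BM" by (rule kern_slice_meas[OF k(1)])
   show "norm (k (r, t)) <= 1 * norm (ind {0<..<T} t)" for t
    using k(2)[of "(r, t)"] kern_nonneg[OF k(1), of "(r, t)"] kern_support[OF k(1), of r t]
    by (cases "k (r, t) = 0") auto
  qed
  have kk: "ip (%t. k (r, t)) (%t. k (r, t)) <= T"
  proof -
   have "ip (%t. k (r, t)) (%t. k (r, t)) <= (LBINT t. k (r, t))"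
    unfolding ip_def
   proof (rule integral_mono)
    show "integrable lborel (%t. k (r, t) \<bullet> k (r, t))" by (rule ip_integrable[OF kr kr])
    show "integrable lborel (%t. k (r, t))" by (rule kern_slice_integrable[OF k(1)])
    show "k (r, t) \<bullet> k (r, t) <= k (r, t)" for t
     using mult_left_mono[OF k(2)[of "(r, t)"] kern_nonneg[OF k(1), of "(r, t)"]] by simp
   qed
   also have "\<dots> <= T" using k(1) by (simp add: kern_def)
   finally show ?thesis .
  qed
  have "tk k h (x, r) = ip (%t. k (r, t)) ?h" by (simp add: tk_def ip_def)
  then have "\<bar>tk k h (x, r)\<bar> <= sqrt (ip (%t. k (r, t)) (%t. k (r, t))) * sqrt (ip ?h ?h)"
   using ip_cauchy_schwarz[OF kr elim] by simp
  also have "\<dots> <= sqrt T * sqrt (ip ?h ?h)"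
   using kk by (intro mult_right_mono real_sqrt_le_mono) (auto simp: ip_nonneg)
  finally have "(\<bar>tk k h (x, r)\<bar>)\<^sup>2 <= (sqrt T * sqrt (ip ?h ?h))\<^sup>2" by (rule power_mono) simp
  also have "\<dots> = T * ip ?h ?h" using T by (simp add: power_mult_distrib ip_nonneg)
  finally show "(tk k h (x, r))\<^sup>2 <= T * (LBINT t. (h (x, t))\<^sup>2)" by (simp add: ip_norm)
 qed
qed

text \<open>A time integral is bounded at every instant by the L^2 norm along its line, so only the
  mass of the weight enters the estimate and not its height \<open>B\<close>, which is not bounded
  along the cutoffs.\<close>

lemma weighted_tk_bound:
 fixes h :: "'a::euclidean_space \<times> real => real"
 assumes T: "T > 0" and k: "kern T T k" "!!z. k z <= 1" and h: "sqi h"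
  and m: "m \<in> BM" "!!t. 0 <= m t" "!!t. m t <= B" "(LBINT t. of_bool (0 < t \<and> t < T) * m t) <= 1"
 shows "(LBINT z. m (snd z) * (tk k h z)\<^sup>2) <= T * ip h h"
proof -
 have B: "0 <= B" using m(2)[of 0] m(3)[of 0] by linarith
 have ih: "integrable lborel (%x. LBINT t. (h (x, t))\<^sup>2)" "(LBINT x. (LBINT t. (h (x, t))\<^sup>2)) = ip h h"
  using integral_slices[of "%z. (h z)\<^sup>2"] sqi_int[OF h] by (simp_all add: ip_norm)
 have s: "sqi (%z. sqrt (m (snd z)) * tk k h z)"
 proof (rule sqi_tmult_real[OF tk_schur(1)[OF k(1) h]])
  show "(%t. sqrt (m t)) \<in> BM" using m(1) by measurable
  show "\<bar>sqrt (m t)\<bar> <= sqrt B" for t using m(2,3) by simp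
 qed
 have i: "integrable lborel (%z. m (snd z) * (tk k h z)\<^sup>2)"
  using sqi_int[OF s] m(2) by (simp add: power_mult_distrib)
 have im: "integrable lborel (%t. of_bool (0 < t \<and> t < T) * m t)"
 proof (rule Bochner_Integration.integrable_bound)
  show "integrable lborel (%t. B * ind {0<..<T} t)" by simp
  show "(%t. of_bool (0 < t \<and> t < T) * m t) \<in> borel_measurable lborel" using m(1) by measurable
  show "AE t in lborel. norm (of_bool (0 < t \<and> t < T) * m t) <= norm (B * ind {0<..<T} t)"
  proof (rule AE_I2)
   fix t show "norm (of_bool (0 < t \<and> t < T) * m t) <= norm (B * ind {0<..<T} t)"
    using m(2)[of t] m(3)[of t] B by (auto simp: indicator_def)
  qed
 qed
 have "(LBINT z. m (snd z) * (tk k h z)\<^sup>2) = (LBINT x. (LBINT t. m t * (tk k h (x, t))\<^sup>2))"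
  using integral_slices(1)[OF i] by simp
 also have "\<dots> <= (LBINT x. T * (LBINT t. (h (x, t))\<^sup>2))"
 proof (rule integral_mono_AE)
  show "integrable lborel (%x. LBINT t. m t * (tk k h (x, t))\<^sup>2)" using integral_slices(2)[OF i] by simp
  show "integrable lborel (%x. T * (LBINT t. (h (x, t))\<^sup>2))" using ih by simp
  show "AE x in lborel. (LBINT t. m t * (tk k h (x, t))\<^sup>2) <= T * (LBINT t. (h (x, t))\<^sup>2)"
   using tk_pointwise_bound[OF T k h]
  proof eventually_elim
   case (elim x)
   let ?J = "T * (LBINT t. (h (x, t))\<^sup>2)"
   have J: "0 <= ?J" using T by simp
   have "(LBINT t. m t * (tk k h (x, t))\<^sup>2) <= (LBINT t. (of_bool (0 < t \<and> t < T) * m t) * ?J)"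
   proof (rule integral_mono')
    show "integrable lborel (%t. (of_bool (0 < t \<and> t < T) * m t) * ?J)" by (rule integrable_mult_left[OF im])
    show "m t * (tk k h (x, t))\<^sup>2 <= (of_bool (0 < t \<and> t < T) * m t) * ?J" for t
    proof (cases "0 < t \<and> t < T")
     case True
     then show ?thesis using mult_left_mono[OF elim[rule_format, of t] m(2)[of t]] by simp
    next
     case False
     have "tk k h (x, t) = 0" by (rule tk_support(1)[OF k(1)]) (use False in auto)
     then show ?thesis using False by auto
    qed
    show "0 <= (of_bool (0 < t \<and> t < T) * m t) * ?J" for t by (intro mult_nonneg_nonneg m(2) J) simp
   qed
   also have "\<dots> = (LBINT t. of_bool (0 < t \<and> t < T) * m t) * ?J" by (rule integral_mult_left_zero)
   also have "\<dots> <= 1 * ?J" by (rule mult_right_mono[OF m(4) J])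
   finally show ?case by simp
  qed
 qed
 also have "\<dots> = T * ip h h" by (simp add: ih)
 finally show ?thesis .
qed

text \<open>The Cauchy--Schwarz inequality turns smallness of one weighted norm into smallness of the pairing.\<close>

lemma weighted_pairing_tendsto_0:
 fixes v h :: "'a::euclidean_space \<times> real => real" and m :: "nat => real => real"
 assumes T: "T > 0" and k: "kern T T k" "!!z. k z <= 1" and h: "sqi h" and v: "sqi v"
  and m: "!!n. m n \<in> BM" "!!n t. 0 <= m n t" "!!n t. m n t <= B n"
   "!!n. (LBINT t. of_bool (0 < t \<and> t < T) * m n t) <= 1"
  and lim: "(%n. LBINT z. m n (snd z) * (v z)\<^sup>2) ~~> 0"
 shows "(%n. ip v (%z. m n (snd z) * tk k h z)) ~~> 0"
proof (rule Lim_null_comparison)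
 have sm: "(%t. sqrt (m n t)) \<in> BM" "\<bar>sqrt (m n t)\<bar> <= sqrt (B n)" for n t
 proof -
  show "(%t. sqrt (m n t)) \<in> BM" using m(1)[of n] by measurable
  show "\<bar>sqrt (m n t)\<bar> <= sqrt (B n)" using m(2,3) by simp
 qed
 have "norm (ip v (%z. m n (snd z) * tk k h z)) <= sqrt (LBINT z. m n (snd z) * (v z)\<^sup>2) * sqrt (T * ip h h)" for n
 proof -
  let ?f = "%z. sqrt (m n (snd z)) * v z" and ?g = "%z. sqrt (m n (snd z)) * tk k h z"
  have f: "sqi ?f" by (rule sqi_tmult_real[OF v sm])
  have g: "sqi ?g" by (rule sqi_tmult_real[OF tk_schur(1)[OF k(1) h] sm])
  have e: "sqrt (m n t) * a * (sqrt (m n t) * b) = a * (m n t * b)" for t a b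
  proof -
   have "sqrt (m n t) * a * (sqrt (m n t) * b) = (sqrt (m n t) * sqrt (m n t)) * (a * b)" by (simp only: ac_simps)
   then show ?thesis using m(2)[of n t] by simp
  qed
  have "ip v (%z. m n (snd z) * tk k h z) = ip ?f ?g" by (simp add: ip_def e)
  then have "norm (ip v (%z. m n (snd z) * tk k h z)) <= sqrt (ip ?f ?f) * sqrt (ip ?g ?g)"
   using ip_cauchy_schwarz[OF f g] by simp
  also have "ip ?f ?f = (LBINT z. m n (snd z) * (v z)\<^sup>2)" using m(2) by (simp add: ip_norm power_mult_distrib)
  also have "ip ?g ?g = (LBINT z. m n (snd z) * (tk k h z)\<^sup>2)" using m(2) by (simp add: ip_norm power_mult_distrib)
  also have "sqrt (LBINT z. m n (snd z) * (v z)\<^sup>2) * sqrt (LBINT z. m n (snd z) * (tk k h z)\<^sup>2)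
    <= sqrt (LBINT z. m n (snd z) * (v z)\<^sup>2) * sqrt (T * ip h h)"
   using m(2) by (intro mult_left_mono real_sqrt_le_mono weighted_tk_bound[OF T k h m(1,2,3,4)]) auto
  finally show ?thesis .
 qed
 then show "\<forall>\<^sub>F n in sequentially. norm (ip v (%z. m n (snd z) * tk k h z))
   <= sqrt (LBINT z. m n (snd z) * (v z)\<^sup>2) * sqrt (T * ip h h)" by simp
 show "(%n. sqrt (LBINT z. m n (snd z) * (v z)\<^sup>2) * sqrt (T * ip h h)) ~~> 0"
  using tendsto_mult[OF tendsto_real_sqrt[OF lim] tendsto_const, of "sqrt (T * ip h h)"] by simp
qed

lemma kback_le_1: "kback T z <= 1" by (simp add: kback_def)
lemma kfwd_le_1: "kT (kback T) z <= 1" by (simp add: kback_def kT_def)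

text \<open>Both time-ordered halves of the square of the time integral are equal, hence nonnegative.\<close>

lemma back_nonneg:
 fixes H :: "'a::euclidean_space \<times> real => 'c::euclidean_space"
 assumes T: "T > 0" and H: "sqi H" "!!z. snd z \<notin> {0<..<T} ==> H z = 0"
 shows "0 <= ip H (tk (kback T) H)"
proof -
 note k = kern_kback[OF T] and kf = kern_kfwd[OF T]
 have s: "0 <= ip h (tk1 (kback T) h) + ip h (tk1 (kT (kback T)) h)" if h: "sqi h" "!!t. t \<notin> {0<..<T} ==> h t = 0" for h :: "real => 'c"
 proof -
  have ih: "integrable lborel h"
  proof -
   have "integrable lborel (%t. ind {0<..<T} t * norm (h t))"
    by (intro ip_integrable_real sqi_ind_interval sqi_bound[OF h(1), where c=1]) (use sqi_meas[OF h(1)] in auto)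
   then show ?thesis
    by (rule Bochner_Integration.integrable_bound) (use sqi_meas[OF h(1)] h(2) in \<open>auto simp: indicator_def\<close>)
  qed
  let ?m = "LBINT t. h t"
  \<comment> \<open>The backward and the forward kernel add up to 1 on the square over (0, T),
    except on the diagonal.\<close>
  have p: "h r \<bullet> (tk1 (kback T) h r + tk1 (kT (kback T)) h r) = h r \<bullet> ?m" for r
  proof (cases "r \<in> {0<..<T}")
   case True
   have "tk1 (kback T) h r + tk1 (kT (kback T)) h r = (LBINT t. kback T (r, t) *\<^sub>R h t + kT (kback T) (r, t) *\<^sub>R h t)"
    unfolding tk1_def by (rule Bochner_Integration.integral_add[symmetric]) (rule kern_mult_integrable[OF k h(1)] kern_mult_integrable[OF kf h(1)])+
   also have "\<dots> = ?m"
   proof (rule integral_cong_AE)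
    show "(%t. kback T (r, t) *\<^sub>R h t + kT (kback T) (r, t) *\<^sub>R h t) \<in> borel_measurable lborel"
     by (intro borel_measurable_add borel_measurable_integrable[OF kern_mult_integrable[OF k h(1)]] borel_measurable_integrable[OF kern_mult_integrable[OF kf h(1)]])
    show "h \<in> borel_measurable lborel" using sqi_meas[OF h(1)] by simp
    have "AE t in lborel. t \<noteq> r" by (rule AE_lborel_singleton)
    then show "AE t in lborel. kback T (r, t) *\<^sub>R h t + kT (kback T) (r, t) *\<^sub>R h t = h t"
    proof eventually_elim
     case (elim t)
     show ?case using elim True h(2)[of t] by (cases "t \<in> {0<..<T}") (auto simp: kback_def kT_def)
    qed
   qed
   finally show ?thesis by simp
  qed (use h(2) in simp)
  have "ip h (tk1 (kback T) h) + ip h (tk1 (kT (kback T)) h) = ip h (%r. tk1 (kback T) h r + tk1 (kT (kback T)) h r)"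
   by (rule ip_add_right[OF tk1_schur(1)[OF k h(1)] tk1_schur(1)[OF kf h(1)] h(1), symmetric])
  also have "\<dots> = (LBINT r. h r \<bullet> ?m)" unfolding ip_def p ..
  also have "\<dots> = ?m \<bullet> ?m" by (rule integral_inner_left) (use ih in simp)
  finally show ?thesis by simp
 qed
 have "ip H (tk (kback T) H) + ip H (tk (kT (kback T)) H)
   = (LBINT x. ip (%t. H (x, t)) (%t. tk (kback T) H (x, t)) + ip (%t. H (x, t)) (%t. tk (kT (kback T)) H (x, t)))"
 proof -
  have i: "integrable lborel (%x. ip (%t. H (x, t)) (%t. tk kk H (x, t)))" if "kern T T kk" for kk
   using integral_slices(2)[OF ip_integrable[OF H(1) tk_schur(1)[OF that H(1)]]] by (simp add: ip_def)
  show ?thesis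
   unfolding Bochner_Integration.integral_add[OF i[OF k] i[OF kf]]
    ip_slices[OF H(1) tk_schur(1)[OF k H(1)]] ip_slices[OF H(1) tk_schur(1)[OF kf H(1)]] ..
 qed
 also have "\<dots> \<ge> 0"
 proof (rule integral_nonneg_AE)
  show "AE x in lborel. 0 <= ip (%t. H (x, t)) (%t. tk (kback T) H (x, t)) + ip (%t. H (x, t)) (%t. tk (kT (kback T)) H (x, t))"
   using sqi_slice_AE[OF H(1)] by eventually_elim (use s H(2) in \<open>simp add: tk_slice\<close>)
 qed
 finally have "0 <= ip H (tk (kback T) H) + ip H (tk (kT (kback T)) H)" .
 moreover have "ip H (tk (kT (kback T)) H) = ip H (tk (kback T) H)"
  using tk_adjoint[OF k H(1) H(1)] ip_commute[of "tk (kback T) H" H] by simp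
 ultimately show ?thesis by simp
qed

section \<open>Difference quotients in time and their backward integrals\<close>

definition dquot :: "real => real => ('a \<times> real => 'c::real_vector) => 'a \<times> real => 'c" where
 "dquot T h \<zeta> z = (of_bool (0 < snd z \<and> snd z < T) / h) *\<^sub>R (\<zeta> z - shift h \<zeta> z)"

lemma dquot_sqi:
 fixes \<zeta> :: "'a::euclidean_space \<times> real => 'c::euclidean_space"
 assumes "sqi \<zeta>" "h > 0" shows "sqi (dquot T h \<zeta>)"
proof -
 have "(%t::real. of_bool (0 < t \<and> t < T) / h) \<in> BM" by measurable
 from sqi_tmult[OF sqi_diff[OF assms(1) sqi_shift[OF assms(1)]] this, of "1/h" h] assms(2)
 show ?thesis by (simp add: dquot_def[abs_def])
qed

text \<open>Integrating (\<zeta>(t) - \<zeta>(t + h))/h from r to T telescopes to the average of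
  \<zeta> over (r, r + h), since \<zeta> vanishes beyond T.\<close>

lemma back_dquot:
 fixes \<zeta> :: "'a::euclidean_space \<times> real => 'c::euclidean_space"
 assumes T: "T > 0" and h: "h > 0" and \<zeta>: "sqi \<zeta>" "!!z. snd z \<notin> {0<..<T} ==> \<zeta> z = 0"
 shows "AE z in lborel. tk (kback T) (dquot T h \<zeta>) z = tk (kavg T h) \<zeta> z"
proof (rule AE_pair_slices)
 note k = kern_kback[OF T] and ka = kern_kavg[OF h, of T]
 have [measurable]: "tk (kback T) (dquot T h \<zeta>) \<in> BM" "tk (kavg T h) \<zeta> \<in> BM"
  using tk_meas[OF k sqi_meas[OF dquot_sqi[OF \<zeta>(1) h]]] tk_meas[OF ka sqi_meas[OF \<zeta>(1)]] by auto
 show "Measurable.pred borel (%z. tk (kback T) (dquot T h \<zeta>) z = tk (kavg T h) \<zeta> z)" by measurable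
 show "AE x in lborel. AE t in lborel. tk (kback T) (dquot T h \<zeta>) (x, t) = tk (kavg T h) \<zeta> (x, t)"
  using sqi_slice_AE[OF \<zeta>(1)]
 proof eventually_elim
  case (elim x)
  let ?q = "%t. \<zeta> (x, t)"
  have q0: "?q t = 0" if "t \<notin> {0<..<T}" for t using \<zeta>(2)[of "(x, t)"] that by simp
  have iq: "integrable lborel ?q"
  proof -
   have "integrable lborel (%t. ind {0<..<T} t * norm (?q t))"
    by (intro ip_integrable_real sqi_ind_interval sqi_bound[OF elim, where c=1]) (use sqi_meas[OF elim] in auto)
   then show ?thesis
    by (rule Bochner_Integration.integrable_bound) (use sqi_meas[OF elim] q0 in \<open>auto simp: indicator_def\<close>)
  qed
  have qm: "?q \<in> BM" by (rule sqi_meas[OF elim])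
  note qm[measurable]
  have I: "integrable lborel (%t. of_bool (a < t \<and> t < b) *\<^sub>R ?q t)" for a b :: real
   by (rule Bochner_Integration.integrable_bound[OF iq]) auto
  show ?case
  proof (rule AE_I2)
   fix r
   show "tk (kback T) (dquot T h \<zeta>) (x, r) = tk (kavg T h) \<zeta> (x, r)"
   proof (cases "r \<in> {0<..<T}")
    case False
    have "tk (kback T) (dquot T h \<zeta>) (x, r) = 0" by (rule tk_support(1)[OF k]) (use False in auto)
    moreover have "tk (kavg T h) \<zeta> (x, r) = 0" by (rule tk_support(1)[OF ka]) (use False in auto)
    ultimately show ?thesis by simp
   next
    case True
    \<comment> \<open>Because \<open>\<zeta>\<close> vanishes after T, both integrals may run up to
      T + h, where they differ exactly by the piece over (r, r + h).\<close>
    let ?A = "%t. of_bool (r < t \<and> t < T + h) *\<^sub>R ?q t" and ?B = "%t. of_bool (r + h < t \<and> t < T + h) *\<^sub>R ?q t"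
    have sh: "(LBINT t. of_bool (r < t \<and> t < T) *\<^sub>R ?q (t + h)) = (LBINT t. ?B t)"
       "integrable lborel (%t. of_bool (r < t \<and> t < T) *\<^sub>R ?q (t + h))"
    proof -
     have e: "?B (h + 1 * t) = of_bool (r < t \<and> t < T) *\<^sub>R ?q (t + h)" for t by (simp add: add.commute)
     show "(LBINT t. of_bool (r < t \<and> t < T) *\<^sub>R ?q (t + h)) = (LBINT t. ?B t)"
      using lborel_integral_real_affine[of 1 ?B h] unfolding e by simp
     show "integrable lborel (%t. of_bool (r < t \<and> t < T) *\<^sub>R ?q (t + h))"
      using lborel_integrable_real_affine[OF I[of "r + h" "T + h"], of 1 h] unfolding e by simp
    qed
    have e1: "of_bool (r < t \<and> t < T) *\<^sub>R ?q t = ?A t" for t using q0[of t] h by (cases "t < T") auto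
    have "tk (kback T) (dquot T h \<zeta>) (x, r) = (LBINT t. (1/h) *\<^sub>R (?A t - of_bool (r < t \<and> t < T) *\<^sub>R ?q (t + h)))"
     unfolding tk_def
    proof (rule int_cong)
     fix t
     show "kback T (snd (x, r), t) *\<^sub>R dquot T h \<zeta> (fst (x, r), t) = (1/h) *\<^sub>R (?A t - of_bool (r < t \<and> t < T) *\<^sub>R ?q (t + h))"
      unfolding e1[symmetric] using True by (auto simp: kback_def dquot_def shift_def)
    qed
    also have "\<dots> = (1/h) *\<^sub>R ((LBINT t. ?A t) - (LBINT t. ?B t))"
     using Bochner_Integration.integral_diff[OF I[of r "T + h"] sh(2)] sh(1) by simp
    also have "\<dots> = (1/h) *\<^sub>R (LBINT t. ?A t - ?B t)"
     using Bochner_Integration.integral_diff[OF I[of r "T + h"] I[of "r + h" "T + h"]] by simp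
    also have "\<dots> = (LBINT t. (1/h) *\<^sub>R (?A t - ?B t))" by simp
    also have "\<dots> = (LBINT t. kavg T h (r, t) *\<^sub>R ?q t)"
    proof (rule integral_cong_AE)
     show "(%t. (1/h) *\<^sub>R (?A t - ?B t)) \<in> borel_measurable lborel" by measurable
     show "(%t. kavg T h (r, t) *\<^sub>R ?q t) \<in> borel_measurable lborel"
      by (rule borel_measurable_integrable[OF kern_mult_integrable[OF ka elim]])
     have "AE t in lborel. t \<noteq> r + h" by (rule AE_lborel_singleton)
     then show "AE t in lborel. (1/h) *\<^sub>R (?A t - ?B t) = kavg T h (r, t) *\<^sub>R ?q t"
     proof eventually_elim
      case (elim t)
      show ?case
      proof (cases "t < T")
       case False then show ?thesis using q0[of t] by simp
      next
       case True
       then show ?thesis using elim \<open>r \<in> {0<..<T}\<close> h by (auto simp: kavg_def)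
      qed
     qed
    qed
    also have "\<dots> = tk (kavg T h) \<zeta> (x, r)" by (simp add: tk_def)
    finally show ?thesis .
   qed
  qed
 qed
qed

subsection \<open>A priori estimates\<close>

text \<open>One solution, extended by zero. In the application the lower bound \<open>c\<close> is
  \<open>\<delta> n\<close> times a constant, so estimates meant to be uniform may involve only
  \<open>M\<close> and the data. The derivative \<open>D\<close> is square integrable only after
  each positive time, hence the truncations in the axioms.\<close>

locale heat_sol =
 fixes V :: "'a::euclidean_space set" and T :: real and c M :: real and \<beta> :: "'a => real"
  and f :: "'a \<times> real => real" and ub :: "'a => real"
  and u :: "'a \<times> real => real" and G :: "'a \<times> real => 'a" and D :: "'a \<times> real => real"
 assumes V: "open V" and T: "T > 0" and c: "0 < c"
  and \<beta>: "\<beta> \<in> BM" "!!x. c <= \<beta> x" "!!x. \<beta> x <= M"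
  and f: "sqi f" "!!z. z \<notin> cyl V 0 T ==> f z = 0"
  and ub: "sqi ub" "!!x. x \<notin> V ==> ub x = 0"
  and u: "sqi u" "!!z. z \<notin> cyl V 0 T ==> u z = 0"
  and G: "sqi G" "!!z. z \<notin> cyl V 0 T ==> G z = 0"
  and D: "D \<in> BM" "!!z. z \<notin> cyl V 0 T ==> D z = 0"
   "!!s. 0 < s ==> s < T ==> sqi (%z. ind {s<..} (snd z) * D z)"
  and wg: "wgrad V (%z. \<beta> (fst z) * u z) G"
  and wdt: "!!s p q. 0 < s ==> s < T ==> test_fun V p ==> test_fun {s<..<T} q ==>
    ip u (%z. p (fst z) * fder q (snd z) 1)
    = - ip (%z. ind {s<..} (snd z) * D z) (p \<otimes> q)"
  and weak: "!!\<phi> G\<phi> s. sqi \<phi> ==> sqi G\<phi> ==> (!!z. z \<notin> cyl V 0 T ==> \<phi> z = 0) ==>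
    (!!z. z \<notin> cyl V 0 T ==> G\<phi> z = 0) ==> wgrad V \<phi> G\<phi> ==> 0 < s ==> (!!z. snd z < s ==> \<phi> z = 0) ==>
    ip D \<phi> + ip G G\<phi> = ip f \<phi>"
  and init: "!!e. e > 0 ==> \<exists>\<tau>>0. AE t in lborel. 0 < t \<and> t < \<tau> --> (LBINT x. (u (x, t) - ub x)\<^sup>2) <= e"
begin

definition "ubT z = ub (fst z) * ind {0<..<T} (snd z)"
text \<open>Subtracting the initial value, kept constant in time, gives a function whose slices tend
  to 0 at t = 0; the removal of the cutoffs depends on this.\<close>

definition "v z = u z - ubT z"
definition "w z = \<beta> (fst z) * u z"
definition "Ds s z = ind {s<..} (snd z) * D z"

lemma \<beta>0: "0 < \<beta> x" using c \<beta>(2)[of x] by linarith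
lemma \<beta>_abs: "\<bar>\<beta> x\<bar> <= M" using \<beta>0[of x] \<beta>(3)[of x] by linarith
lemma M0: "0 < M" using c \<beta>(2,3)[of undefined] by linarith

lemma ubT_sqi: "sqi ubT"
 unfolding ubT_def[abs_def] by (rule sqi_tensor[OF ub(1) sqi_ind_interval])
lemma ubT_out: "z \<notin> cyl V 0 T ==> ubT z = 0"
 using ub(2)[of "fst z"] by (cases z) (auto simp: ubT_def cyl_def indicator_def)
lemma v_sqi: "sqi v" unfolding v_def[abs_def] by (intro sqi_diff u ubT_sqi)
lemma v_out: "z \<notin> cyl V 0 T ==> v z = 0" by (simp add: v_def u(2) ubT_out)
lemma w_sqi: "sqi w" unfolding w_def[abs_def] by (rule sqi_xmult_real[OF u(1) \<beta>(1) \<beta>_abs])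
lemma w_out: "z \<notin> cyl V 0 T ==> w z = 0" by (simp add: w_def u(2))
lemma wgw: "wgrad V w G" using wg by (simp add: w_def[abs_def])
lemma Ds_sqi: "0 < s ==> s < T ==> sqi (Ds s)" unfolding Ds_def[abs_def] by (rule D(3))
lemma Ds_out: "z \<notin> cyl V 0 T ==> Ds s z = 0" by (simp add: Ds_def D(2))

text \<open>The subtracted part is constant in time on (0, T), and the derivative of a test function
  has integral 0.\<close>

lemma wdt_v:
 assumes s: "0 < s" "s < T" and p: "test_fun V p" and q: "test_fun {s<..<T} q"
 shows "ip v (%z. p (fst z) * fder q (snd z) 1) = - ip (Ds s) (p \<otimes> q)"
proof -
 have q0: "test_fun {0<..<T} q" by (rule test_fun_mono[OF q]) (use s in auto)
 let ?q' = "%t. fder q t 1"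
 have q': "test_fun {s<..<T} ?q'" by (rule test_fun_frechet[OF q])
 have sp: "sqi p" and sq': "sqi ?q'" by (rule test_fun_sqi[OF p], rule test_fun_sqi[OF q'])
 have "ip ubT (p \<otimes> ?q') = ip ub p * ip (ind {0<..<T}) ?q'"
  unfolding ubT_def[abs_def] by (rule ip_tensor[OF ub(1) sp sqi_ind_interval sq'])
 also have "ip (ind {0<..<T}) ?q' = (LBINT t. of_bool (0 < t \<and> t < T) * ?q' t)"
  unfolding ip_def by (intro int_cong) (simp add: indicator_def)
 also have "\<dots> = q T - q 0"
  by (rule integral_FTC_test[OF smooth_on_continuous[OF test_fun_smooth[OF q']] smooth_on_real_has_deriv[OF test_fun_smooth[OF q]]]) (use T in simp)
 also have "\<dots> = 0" using test_fun_outside[OF q, of T] test_fun_outside[OF q, of 0] s by simp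
 finally have z: "ip ubT (p \<otimes> ?q') = 0" by simp
 show ?thesis
  unfolding v_def[abs_def] ip_diff_left[OF u(1) ubT_sqi test_tensor_sqi[OF p sq']] z
  using wdt[OF s p q] by (simp add: Ds_def[abs_def])
qed

lemma v_init:
 assumes "e > 0" shows "\<exists>\<tau>>0. AE t in lborel. 0 < t \<and> t < \<tau> --> (LBINT x. (v (x, t))\<^sup>2) <= e"
proof -
 obtain \<tau> where \<tau>: "\<tau> > 0" "AE t in lborel. 0 < t \<and> t < \<tau> --> (LBINT x. (u (x, t) - ub x)\<^sup>2) <= e"
  using init[OF assms] by blast
 show ?thesis
 proof (intro exI[of _ "min \<tau> T"] conjI)
  show "min \<tau> T > 0" using \<tau> T by simp
  show "AE t in lborel. 0 < t \<and> t < min \<tau> T --> (LBINT x. (v (x, t))\<^sup>2) <= e"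
   using \<tau>(2) by eventually_elim (auto simp: v_def ubT_def)
 qed
qed

lemma v_weight: "(%n. LBINT z. detan n (snd z) * (v z)\<^sup>2) ~~> 0"
proof (rule weight_tendsto_0[OF v_sqi])
 show "snd z \<notin> {0<..<T} ==> v z = 0" for z using v_out[of z] by (cases z) (auto simp: cyl_def)
 show "detan n \<in> BM" for n by (rule detan_meas)
 show "0 <= detan n t" for n t by (rule detan_nonneg)
 show "detan n t <= (real (Suc n))\<^sup>2 * 2" for n t by (rule detan_bound)
 show "(LBINT t. of_bool (0 < t \<and> t < T) * detan n t) <= 1" for n by (rule detan_integral[OF T])
 fix e :: real assume e: "e > 0"
 obtain \<tau> where \<tau>: "\<tau> > 0" "AE t in lborel. 0 < t \<and> t < \<tau> --> (LBINT x. (v (x, t))\<^sup>2) <= e"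
  using v_init[OF e] by blast
 show "\<exists>N. (AE t in lborel. t \<in> N --> (LBINT x. (v (x, t))\<^sup>2) <= e)
    \<and> (\<forall>\<^sub>F n in sequentially. \<forall>t. 0 < t \<and> t < T \<and> t \<notin> N --> detan n t <= e)"
 proof (intro exI[of _ "{0<..<\<tau>}"] conjI)
  show "AE t in lborel. t \<in> {0<..<\<tau>} --> (LBINT x. (v (x, t))\<^sup>2) <= e" using \<tau>(2) by eventually_elim auto
  show "\<forall>\<^sub>F n in sequentially. \<forall>t. 0 < t \<and> t < T \<and> t \<notin> {0<..<\<tau>} --> detan n t <= e"
   using detan_far[OF \<tau>(1) e] by eventually_elim auto
 qed
qed

lemma pairing_D_cut:
 assumes "!!z. snd z <= s ==> \<phi> z = 0" shows "ip D \<phi> = ip (Ds s) \<phi>"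
 unfolding ip_def
proof (rule int_cong)
 fix z show "D z \<bullet> \<phi> z = Ds s z \<bullet> \<phi> z" using assms[of z] by (cases "s < snd z") (auto simp: Ds_def)
qed

lemma ibp_back:
 assumes \<Psi>: "sqi \<Psi>" "!!z. z \<notin> cyl V 0 T ==> \<Psi> z = 0" and n: "1 / real (Suc n) < T"
 shows "ip D (%z. etan n (snd z) * tk (kback T) \<Psi> z)
   = ip v (%z. etan n (snd z) * \<Psi> z) - ip v (%z. detan n (snd z) * tk (kback T) \<Psi> z)"
proof -
 \<comment> \<open>Half the time up to which the cutoff vanishes: \<open>D\<close> is truncated
   strictly earlier, without effect on the pairing.\<close>
 define s where "s = 1 / real (Suc n) / 2"
 have n0: "0 < 1 / real (Suc n)" by simp
 have s1: "0 < s" unfolding s_def by simp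
 have half: "x / 2 < x" if "0 < x" for x :: real using that by linarith
 have s2: "s < 1 / real (Suc n)" unfolding s_def by (rule half[OF n0])
 have s3: "s < T" using s2 n by linarith
 note s = s1 s2 s3
 have "ip v (%z. detan n (snd z) * tk (kback T) \<Psi> z) + (-1) * ip v (%z. etan n (snd z) * \<Psi> z)
   = - ip (Ds s) (%z. etan n (snd z) * tk (kback T) \<Psi> z)"
  by (rule ibp[OF V v_sqi Ds_sqi[OF s(1,3)] kern_kback[OF T] wdt_v[OF s(1,3)] etan_meas etan_bounds(3) detan_meas detan_abs_bound
    cut_back[OF T less_imp_le[OF s(1)] s(2)] \<Psi>])
 moreover have "ip D (%z. etan n (snd z) * tk (kback T) \<Psi> z) = ip (Ds s) (%z. etan n (snd z) * tk (kback T) \<Psi> z)"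
 proof (rule pairing_D_cut)
  fix z :: "'a \<times> real" assume "snd z <= s"
  then have "etan n (snd z) = 0" using s(2) by (intro etan_zero) linarith
  then show "etan n (snd z) * tk (kback T) \<Psi> z = 0" by simp
 qed
 ultimately show ?thesis by simp
qed

lemma eventually_small: "0 < e ==> \<forall>\<^sub>F n in sequentially. 1 / real (Suc n) < e"
 using order_tendstoD(2)[OF LIMSEQ_inverse_real_of_nat, of e] by (simp add: inverse_eq_divide)

text \<open>The weak formulation is tested with \<open>etan n\<close> times the backward integral of
  \<open>\<Psi>\<close>. After integration by parts the term with \<open>detan n\<close> tends to 0
  by \<open>v_weight\<close>. That \<open>\<Phi>\<close> may be any version of the backward integral
  lets time averages take its place.\<close>

lemma integrated_eq:
 assumes \<Psi>: "sqi \<Psi>" "!!z. z \<notin> cyl V 0 T ==> \<Psi> z = 0"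
  and \<Phi>: "sqi \<Phi>" "AE z in lborel. \<Phi> z = tk (kback T) \<Psi> z"
  and G\<Phi>: "sqi G\<Phi>" "!!z. z \<notin> cyl V 0 T ==> G\<Phi> z = 0" "wgrad V \<Phi> G\<Phi>"
 shows "ip v \<Psi> + ip G G\<Phi> = ip f \<Phi>"
proof -
 let ?B = "tk (kback T) \<Psi>"
 note k = kern_kback[OF T]
 have B: "sqi ?B" by (rule tk_schur(1)[OF k \<Psi>(1)])
 have Bo: "?B z = 0" if "z \<notin> cyl V 0 T" for z by (rule tk_out[OF k \<Psi>(2) that])
 have wB: "wgrad V ?B G\<Phi>"
  by (rule wgrad_cong_AE[OF G\<Phi>(3) \<Phi>(1) G\<Phi>(1) B G\<Phi>(1) \<Phi>(2)]) simp
 have eq: "ip v (%z. etan n (snd z) *\<^sub>R \<Psi> z) - ip v (%z. detan n (snd z) * ?B z) + ip G (%z. etan n (snd z) *\<^sub>R G\<Phi> z)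
   = ip f (%z. etan n (snd z) *\<^sub>R ?B z)" if n: "1 / real (Suc n) < T" for n
 proof -
  have "ip D (%z. etan n (snd z) * ?B z) + ip G (%z. etan n (snd z) *\<^sub>R G\<Phi> z) = ip f (%z. etan n (snd z) * ?B z)"
  proof (rule weak)
   show "sqi (%z. etan n (snd z) * ?B z)" by (rule sqi_tmult_real[OF B etan_meas etan_bounds(3)])
   show "sqi (%z. etan n (snd z) *\<^sub>R G\<Phi> z)" by (rule sqi_tmult[OF G\<Phi>(1) etan_meas etan_bounds(3)])
   show "wgrad V (%z. etan n (snd z) * ?B z) (%z. etan n (snd z) *\<^sub>R G\<Phi> z)" by (rule wgrad_tmult[OF wB etan_meas etan_bounds(3)])
   show "0 < 1 / real (Suc n)" by simp
   show "snd z < 1 / real (Suc n) ==> etan n (snd z) * ?B z = 0" for z :: "'a \<times> real" using etan_zero[of "snd z" n] by simp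
  qed (use Bo G\<Phi>(2) in auto)
  then show ?thesis using ibp_back[OF \<Psi> n] by simp
 qed
 have t0: "snd z <= 0 ==> z \<notin> cyl V 0 T" for z :: "'a \<times> real" by (cases z) (simp add: cyl_def)
 have l1: "(%n. ip v (%z. etan n (snd z) *\<^sub>R \<Psi> z)) ~~> ip v \<Psi>"
  by (rule etan_cutoff_weak[OF v_sqi \<Psi>(1)]) (use \<Psi>(2) t0 in auto)
 have l2: "(%n. ip v (%z. detan n (snd z) * ?B z)) ~~> 0"
  by (rule weighted_pairing_tendsto_0[OF T k kback_le_1 \<Psi>(1) v_sqi detan_meas detan_nonneg detan_bound detan_integral[OF T] v_weight])
 have l3: "(%n. ip G (%z. etan n (snd z) *\<^sub>R G\<Phi> z)) ~~> ip G G\<Phi>"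
  by (rule etan_cutoff_weak[OF G(1) G\<Phi>(1)]) (use G\<Phi>(2) t0 in auto)
 have l4: "(%n. ip f (%z. etan n (snd z) *\<^sub>R ?B z)) ~~> ip f ?B"
  by (rule etan_cutoff_weak[OF f(1) B]) (use Bo t0 in auto)
 have "(%n. ip f (%z. etan n (snd z) *\<^sub>R ?B z)) ~~> ip v \<Psi> - 0 + ip G G\<Phi>"
 proof (rule Lim_transform_eventually[OF tendsto_add[OF tendsto_diff[OF l1 l2] l3]])
  show "\<forall>\<^sub>F n in sequentially. ip v (%z. etan n (snd z) *\<^sub>R \<Psi> z) - ip v (%z. detan n (snd z) * ?B z)
    + ip G (%z. etan n (snd z) *\<^sub>R G\<Phi> z) = ip f (%z. etan n (snd z) *\<^sub>R ?B z)"
   using eventually_small[OF T] by eventually_elim (rule eq)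
 qed
 from LIMSEQ_unique[OF this l4] have "ip v \<Psi> + ip G G\<Phi> = ip f ?B" by simp
 also have "ip f ?B = ip f \<Phi>"
  by (rule ip_cong_AE) (use f(1) B \<Phi> in \<open>auto simp: sqi_def elim: eventually_mono\<close>)
 finally show ?thesis .
qed

lemma time_out: "z \<notin> UNIV \<times> {0<..<T} ==> z \<notin> cyl V 0 T"
 by (auto simp: cyl_def)

lemma snd_out: "snd z \<notin> {0<..<T} ==> z \<notin> cyl V 0 T"
 by (auto simp: cyl_def)

text \<open>Two weights occur: the constant 1, for global estimates, and the square of a cutoff, for
  interior ones. Bounds in place of compact support cover both.\<close>

definition smooth_weight :: "('a => real) => bool" where
 "smooth_weight \<theta> \<longleftrightarrow> smooth_on UNIV \<theta> \<and> (\<forall>x. 0 <= \<theta> x) \<and> (\<exists>B. \<forall>x. \<bar>\<theta> x\<bar> <= B) \<and>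
   gradv \<theta> \<in> BM \<and> (\<exists>B. \<forall>x. norm (gradv \<theta> x) <= B)"

text \<open>Used twice: with \<open>y = w\<close> and the backward kernel, and with \<open>y\<close>
  a difference quotient of \<open>w\<close> and the averaging kernel. The third term stems from the
  gradient of the weight.\<close>

lemma weighted_eq:
 assumes \<theta>: "smooth_weight \<theta>" and k: "kern T C k" and y: "sqi y" "!!z. z \<notin> cyl V 0 T ==> y z = 0"
  and ae: "AE z in lborel. tk (kback T) y z = tk k w z"
 shows "ip v (%z. \<theta> (fst z) * y z) + ip (%z. \<theta> (fst z) *\<^sub>R G z) (tk k G) + ip (%z. G z \<bullet> gradv \<theta> (fst z)) (tk k w)
   = ip (%z. \<theta> (fst z) * f z) (tk k w)"
proof -
 obtain B B' where B: "!!x. \<bar>\<theta> x\<bar> <= B" "!!x. norm (gradv \<theta> x) <= B'" and sm: "smooth_on UNIV \<theta>" and gm: "gradv \<theta> \<in> BM"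
  using \<theta> unfolding smooth_weight_def by blast
 have tm: "\<theta> \<in> BM" by (rule borel_measurable_continuous_onI[OF smooth_on_continuous[OF sm]])
 have kw: "sqi (tk k w)" and kG: "sqi (tk k G)" by (rule tk_schur(1)[OF k w_sqi], rule tk_schur(1)[OF k G(1)])
 have s1: "sqi (%z. \<theta> (fst z) *\<^sub>R tk k G z)" by (rule sqi_xmult[OF kG tm B(1)])
 have s2: "sqi (%z. tk k w z *\<^sub>R gradv \<theta> (fst z))" by (rule sqi_xvec[OF kw gm B(2)])
 have ye: "tk (kback T) (%z. \<theta> (fst z) * y z) z = \<theta> (fst z) * tk (kback T) y z" for z by (rule tk_xmult_real)
 have "ip v (%z. \<theta> (fst z) * y z) + ip G (%z. \<theta> (fst z) *\<^sub>R tk k G z + tk k w z *\<^sub>R gradv \<theta> (fst z))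
   = ip f (%z. \<theta> (fst z) * tk k w z)"
 proof (rule integrated_eq)
  show "sqi (%z. \<theta> (fst z) * y z)" by (rule sqi_xmult_real[OF y(1) tm B(1)])
  show "sqi (%z. \<theta> (fst z) * tk k w z)" by (rule sqi_xmult_real[OF kw tm B(1)])
  show "sqi (%z. \<theta> (fst z) *\<^sub>R tk k G z + tk k w z *\<^sub>R gradv \<theta> (fst z))" by (rule sqi_add[OF s1 s2])
  show "wgrad V (%z. \<theta> (fst z) * tk k w z) (%z. \<theta> (fst z) *\<^sub>R tk k G z + tk k w z *\<^sub>R gradv \<theta> (fst z))"
   by (rule wgrad_xmult[OF wgrad_tk[OF wgw w_sqi G(1) k] kw kG sm])
  show "AE z in lborel. \<theta> (fst z) * tk k w z = tk (kback T) (%z. \<theta> (fst z) * y z) z"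
   using ae by eventually_elim (simp add: ye)
  fix z assume z: "z \<notin> cyl V 0 T"
  show "\<theta> (fst z) * y z = 0" using y(2)[OF z] by simp
  have "tk k w z = 0" "tk k G z = 0" by (rule tk_out[OF k w_out z], assumption, rule tk_out[OF k G(2) z], assumption)
  then show "\<theta> (fst z) *\<^sub>R tk k G z + tk k w z *\<^sub>R gradv \<theta> (fst z) = 0" by simp
 qed
 moreover have "ip G (%z. \<theta> (fst z) *\<^sub>R tk k G z + tk k w z *\<^sub>R gradv \<theta> (fst z))
   = ip (%z. \<theta> (fst z) *\<^sub>R G z) (tk k G) + ip (%z. G z \<bullet> gradv \<theta> (fst z)) (tk k w)"
  unfolding ip_add_right[OF s1 s2 G(1)] by (simp add: ip_def mult.commute)
 moreover have "ip f (%z. \<theta> (fst z) * tk k w z) = ip (%z. \<theta> (fst z) * f z) (tk k w)"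
  by (simp add: ip_def ac_simps)
 ultimately show ?thesis by simp
qed

lemma integrated_energy:
 assumes "smooth_weight \<theta>"
 shows "ip v (%z. \<theta> (fst z) * w z) + ip (%z. \<theta> (fst z) *\<^sub>R G z) (tk (kback T) G) + ip (%z. G z \<bullet> gradv \<theta> (fst z)) (tk (kback T) w)
   = ip (%z. \<theta> (fst z) * f z) (tk (kback T) w)"
 by (rule weighted_eq[OF assms kern_kback[OF T] w_sqi w_out]) simp_all

text \<open>Formally this is testing with \<open>\<theta> w\<close>: the time term equals half the
  final minus half the initial energy, and the final energy is dropped. Difference quotients of
  \<open>w\<close> make it rigorous, since no derivative up to t = 0 is at hand.\<close>

lemma energy_inequality:
 assumes \<theta>: "smooth_weight \<theta>"
 shows "ip (%z. \<theta> (fst z) *\<^sub>R G z) G + ip (%z. G z \<bullet> gradv \<theta> (fst z)) w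
   <= ip (%z. \<theta> (fst z) * f z) w + (1/2) * (LBINT x. \<theta> x * \<beta> x * (ub x)\<^sup>2)"
proof -
 let ?J = "LBINT x. \<theta> x * \<beta> x * (ub x)\<^sup>2"
 obtain B B' where B: "!!x. \<bar>\<theta> x\<bar> <= B" "!!x. norm (gradv \<theta> x) <= B'" and sm: "smooth_on UNIV \<theta>" and gm: "gradv \<theta> \<in> BM"
  and nn: "!!x. 0 <= \<theta> x"
  using \<theta> unfolding smooth_weight_def by blast
 have B0: "0 <= B" using B(1)[of undefined] by linarith
 have tm: "\<theta> \<in> BM" by (rule borel_measurable_continuous_onI[OF smooth_on_continuous[OF sm]])
 define \<gamma> where "\<gamma> x = \<theta> x * \<beta> x" for x
 have \<gamma>: "\<gamma> \<in> BM" "!!x. 0 <= \<gamma> x" "!!x. \<bar>\<gamma> x\<bar> <= B * M"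
 proof -
  show "\<gamma> \<in> BM" unfolding \<gamma>_def[abs_def] using tm \<beta>(1) by measurable
  show "0 <= \<gamma> x" for x using nn[of x] \<beta>0[of x] by (simp add: \<gamma>_def)
  show "\<bar>\<gamma> x\<bar> <= B * M" for x unfolding \<gamma>_def abs_mult by (intro mult_mono B \<beta>_abs) (use B0 in auto)
 qed
 have gv: "integrable lborel (%z. \<gamma> (fst z) * (h z)\<^sup>2)" if "sqi h" for h :: "'a \<times> real => real"
  using ip_integrable_real[OF sqi_xmult_real[OF that \<gamma>(1,3)] that] by (simp add: power2_eq_square mult.assoc)
 have gub: "integrable lborel (%x. \<gamma> x * (ub x)\<^sup>2)"
  using ip_integrable_real[OF sqi_bmult_real[OF ub(1) \<gamma>(1,3)] ub(1)] by (simp add: power2_eq_square mult.assoc)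
 \<comment> \<open>The time term is bounded below by three densities. The first two are translates
   of each other and cancel after integration; the third lives on the last \<open>h\<close> units of
   time and integrates to half the initial energy.\<close>
 have step: "- (1/2) * ?J <= ip v (%z. \<theta> (fst z) * dquot T h w z)" if h: "0 < h" "h < T" for h
 proof -
  let ?F1 = "%z. (1 / (2 * h)) * (\<gamma> (fst z) * (v z)\<^sup>2)"
  let ?F2 = "%z. (1 / (2 * h)) * (\<gamma> (fst z) * (shift h v z)\<^sup>2)"
  let ?F3 = "%z::'a\<times>real. (1 / (2 * h)) * ((\<gamma> (fst z) * (ub (fst z))\<^sup>2) * ind {T-h..<T} (snd z))"
  have i1: "integrable lborel ?F1" by (intro integrable_mult_right gv v_sqi)
  have i2: "integrable lborel ?F2" by (intro integrable_mult_right gv sqi_shift v_sqi)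
  have i3: "integrable lborel ?F3"
  proof -
   have "integrable lborel (ind {T-h..<T})" using h by (simp add: integrable_indicator_iff)
   from integrable_mult_right[OF integrable_tensor[OF gub this], of "1 / (2 * h)"] show ?thesis .
  qed
  have I12: "(LBINT z. ?F2 z) = (LBINT z. ?F1 z)"
  proof -
   have "(%z. (1 / (2 * h)) * (\<gamma> (fst z) * (v z)\<^sup>2)) \<in> BM" using i1 by auto
   from integral_shift(1)[OF this, of h] show ?thesis by (simp add: shift_def)
  qed
  have I3: "(LBINT z. ?F3 z) = (1/2) * ?J"
  proof -
   have "integrable lborel (ind {T-h..<T})" using h by (simp add: integrable_indicator_iff)
   note it = integrable_tensor[OF gub this]
   have "(LBINT z. (\<gamma> (fst z) * (ub (fst z))\<^sup>2) * ind {T-h..<T} (snd z))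
     = (LBINT x. (LBINT t. (\<gamma> x * (ub x)\<^sup>2) * ind {T-h..<T} t))"
    using integral_slices(1)[OF it] by simp
   also have "\<dots> = (LBINT x. (\<gamma> x * (ub x)\<^sup>2) * h)" using h by simp
   finally show ?thesis using h by (simp add: \<gamma>_def)
  qed
  have "- (1/2) * ?J <= (LBINT z. ?F1 z) - (LBINT z. ?F2 z) - (LBINT z. ?F3 z)" unfolding I12 I3 by simp
  also have "\<dots> = (LBINT z. ?F1 z - ?F2 z - ?F3 z)"
   using i1 i2 i3 by simp
  also have "\<dots> <= ip v (%z. \<theta> (fst z) * dquot T h w z)"
   unfolding ip_def
  proof (rule integral_mono)
   show "integrable lborel (%z. ?F1 z - ?F2 z - ?F3 z)" using i1 i2 i3 by (intro Bochner_Integration.integrable_diff)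
   show "integrable lborel (%z. v z \<bullet> (\<theta> (fst z) * dquot T h w z))"
    by (rule ip_integrable[OF v_sqi sqi_xmult_real[OF dquot_sqi[OF w_sqi h(1)] tm B(1)]])
   fix z :: "'a \<times> real"
   show "?F1 z - ?F2 z - ?F3 z <= v z \<bullet> (\<theta> (fst z) * dquot T h w z)"
   proof (cases "z \<in> cyl V 0 T")
    case False
    then have "v z = 0" by (rule v_out)
    then have "?F1 z = 0" "v z \<bullet> (\<theta> (fst z) * dquot T h w z) = 0" by simp_all
    moreover have "0 <= ?F2 z" "0 <= ?F3 z" using h \<gamma>(2)[of "fst z"] by simp_all
    ultimately show ?thesis by linarith
   next
    case True
    then have zt: "fst z \<in> V" "0 < snd z" "snd z < T" by (auto simp: cyl_def)
    let ?u = "u z" and ?up = "shift h u z" and ?a = "ub (fst z)"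
    have vz: "v z = ?u - ?a" using zt by (simp add: v_def ubT_def)
    have q: "(1/2) * (v z)\<^sup>2 - (1/2) * (shift h v z)\<^sup>2 - (1/2) * ?a\<^sup>2 * ind {T-h..<T} (snd z) <= v z * (?u - ?up)"
    proof (cases "snd z < T - h")
     case True
     then have sv: "shift h v z = ?up - ?a" using zt h by (simp add: v_def ubT_def shift_def)
     \<comment> \<open>This encodes a (a - b) \<ge> a^2/2 - b^2/2.\<close>
     have id: "v z * (v z - (?up - ?a)) - ((1/2) * (v z)\<^sup>2 - (1/2) * (?up - ?a)\<^sup>2) = (1/2) * (v z - (?up - ?a))\<^sup>2"
      by (simp add: power2_eq_square algebra_simps)
     have "0 <= (1/2) * (v z - (?up - ?a))\<^sup>2" by simp
     then have q1: "(1/2) * (v z)\<^sup>2 - (1/2) * (?up - ?a)\<^sup>2 <= v z * (v z - (?up - ?a))" using id by linarith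
     have e: "v z - (?up - ?a) = ?u - ?up" using vz by simp
     have i0: "ind {T-h..<T} (snd z) = 0" using True by simp
     show ?thesis using q1 unfolding sv i0 e by simp
    next
     \<comment> \<open>In the last \<open>h\<close> units of time the shifted functions vanish, so
       the initial value no longer cancels in the difference; the third density pays for it.\<close>
     case False
     have o: "(fst z, snd z + h) \<notin> cyl V 0 T" using False by (simp add: cyl_def)
     have sv: "?up = 0" "shift h v z = 0" using u(2)[OF o] v_out[OF o] by (simp_all add: shift_def)
     have id: "v z * ?u - ((1/2) * (v z)\<^sup>2 - (1/2) * ?a\<^sup>2) = (1/2) * ?u\<^sup>2" unfolding vz by (simp add: power2_eq_square algebra_simps)
     have "0 <= (1/2) * ?u\<^sup>2" by simp
     then have q1: "(1/2) * (v z)\<^sup>2 - (1/2) * ?a\<^sup>2 <= v z * ?u" using id by linarith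
     have i1: "ind {T-h..<T} (snd z) = 1" using False zt by simp
     show ?thesis using q1 unfolding sv i1 by simp
    qed
    have "(\<gamma> (fst z) / h) * ((1/2) * (v z)\<^sup>2 - (1/2) * (shift h v z)\<^sup>2 - (1/2) * ?a\<^sup>2 * ind {T-h..<T} (snd z))
      <= (\<gamma> (fst z) / h) * (v z * (?u - ?up))"
     using \<gamma>(2)[of "fst z"] h by (intro mult_left_mono q) auto
    moreover have "v z \<bullet> (\<theta> (fst z) * dquot T h w z) = (\<gamma> (fst z) / h) * (v z * (?u - ?up))"
     using zt by (simp add: dquot_def w_def shift_def \<gamma>_def algebra_simps)
    ultimately show ?thesis by (simp add: algebra_simps add_divide_distrib diff_divide_distrib)
   qed
  qed
  finally show ?thesis .
 qed
 define h where "h n = T / (real n + 2)" for n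
 have h: "0 < h n" "h n < T" for n using T by (auto simp: h_def divide_less_eq)
 have h0: "h ~~> 0"
 proof -
  have "filterlim (%n. real n + 2) at_top sequentially"
   using filterlim_tendsto_add_at_top[OF tendsto_const[of 2] filterlim_real_sequentially] by (simp add: add.commute)
  from tendsto_divide_0[OF tendsto_const[of T] filterlim_at_top_imp_at_infinity[OF this]] show ?thesis by (simp add: h_def[abs_def])
 qed
 have ineq: "ip (%z. \<theta> (fst z) *\<^sub>R G z) (tk (kavg T (h n)) G) + ip (%z. G z \<bullet> gradv \<theta> (fst z)) (tk (kavg T (h n)) w)
   <= ip (%z. \<theta> (fst z) * f z) (tk (kavg T (h n)) w) + (1/2) * ?J" for n
 proof -
  have "ip v (%z. \<theta> (fst z) * dquot T (h n) w z) + ip (%z. \<theta> (fst z) *\<^sub>R G z) (tk (kavg T (h n)) G) + ip (%z. G z \<bullet> gradv \<theta> (fst z)) (tk (kavg T (h n)) w)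
    = ip (%z. \<theta> (fst z) * f z) (tk (kavg T (h n)) w)"
  proof (rule weighted_eq[OF \<theta> kern_kavg[OF h(1)] dquot_sqi[OF w_sqi h(1)]])
   show "dquot T (h n) w z = 0" if "z \<notin> cyl V 0 T" for z
   proof (cases "0 < snd z \<and> snd z < T")
    case False then show ?thesis by (auto simp: dquot_def)
   next
    case True
    then have "fst z \<notin> V" using that by (cases z) (auto simp: cyl_def)
    then show ?thesis using w_out[OF that] w_out[of "(fst z, snd z + h n)"] by (simp add: dquot_def shift_def cyl_def)
   qed
   show "AE z in lborel. tk (kback T) (dquot T (h n) w) z = tk (kavg T (h n)) w z"
    by (rule back_dquot[OF T h(1) w_sqi w_out[OF snd_out]])
  qed
  then show ?thesis using step[OF h, of n] by linarith
 qed
 have sG: "sqi (%z. \<theta> (fst z) *\<^sub>R G z)" by (rule sqi_xmult[OF G(1) tm B(1)])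
 have sg: "sqi (%z. G z \<bullet> gradv \<theta> (fst z))" by (rule sqi_xinner[OF G(1) gm B(2)])
 have sf: "sqi (%z. \<theta> (fst z) * f z)" by (rule sqi_xmult_real[OF f(1) tm B(1)])
 show ?thesis
  by (rule LIMSEQ_le[OF tendsto_add[OF kavg_weak[OF T sG G(1) G(2)[OF time_out] h(1) h0] kavg_weak[OF T sg w_sqi w_out[OF time_out] h(1) h0]]
    tendsto_add[OF kavg_weak[OF T sf w_sqi w_out[OF time_out] h(1) h0] tendsto_const]])
    (use ineq in auto)
qed

lemma smooth_weight_1: "smooth_weight (%x. 1)" "gradv (%x. 1) = (%x::'a. 0)"
proof -
 show g: "gradv (%x. 1) = (%x::'a. 0)"
  by (rule ext) (simp add: gradv_def frechet_derivative_const)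
 show "smooth_weight (%x. 1)"
  unfolding smooth_weight_def g by (auto intro: smooth_on_const exI[of _ 1] exI[of _ 0])
qed

definition "Kf = T * ip f f + T * (T * ip f f) + ip ubT ubT"

text \<open>Pointwise w^2 = \<beta> u w. Only the upper bound on \<beta> enters, so the estimate
  survives the degeneration.\<close>

lemma w_norm: "ip w w <= M * ip u w"
proof -
 have "ip w w <= ip (%z. M * u z) w"
  unfolding ip_def
 proof (rule integral_mono)
  show "integrable lborel (%z. w z \<bullet> w z)" by (rule ip_integrable[OF w_sqi w_sqi])
  show "integrable lborel (%z. (M * u z) \<bullet> w z)" by (rule ip_integrable[OF sqi_cmult[OF u(1)] w_sqi])
  fix z
  have "\<beta> (fst z) * (\<beta> (fst z) * (u z)\<^sup>2) <= M * (\<beta> (fst z) * (u z)\<^sup>2)"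
   using \<beta>(3)[of "fst z"] \<beta>0[of "fst z"] by (intro mult_right_mono) auto
  then show "w z \<bullet> w z <= (M * u z) \<bullet> w z" by (simp add: w_def power2_eq_square ac_simps)
 qed
 then show ?thesis by (simp add: ip_cmult_left)
qed

lemma uw_nonneg: "0 <= ip u w"
 unfolding ip_def
proof (intro integral_nonneg_AE AE_I2)
 fix z
 have "0 <= \<beta> (fst z) * (u z)\<^sup>2" using \<beta>0[of "fst z"] by simp
 then show "0 <= u z \<bullet> w z" by (simp add: w_def power2_eq_square mult.left_commute)
qed

text \<open>The constants depend on the data only through \<open>M\<close>, \<open>T\<close> and the norms of \<open>f\<close> and \<open>ub\<close>.\<close>

lemma energy_1: "ip u w <= 4 * M * (ip ubT ubT + T\<^sup>2 * ip f f)"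
proof -
 let ?fw = "tk (kT (kback T)) f"
 have sfw: "sqi ?fw" by (rule tk_schur(1)[OF kern_kfwd[OF T] f(1)])
 have 1: "ip v w + ip G (tk (kback T) G) = ip f (tk (kback T) w)"
  using integrated_energy[OF smooth_weight_1(1)] by (simp add: smooth_weight_1(2))
 have 2: "ip f (tk (kback T) w) = ip ?fw w"
  using tk_adjoint[OF kern_kfwd[OF T] f(1) w_sqi] by simp
 have 3: "ip v w = ip u w - ip ubT w" unfolding v_def[abs_def] by (rule ip_diff_left[OF u(1) ubT_sqi w_sqi])
 have 4: "0 <= ip G (tk (kback T) G)" by (rule back_nonneg[OF T G(1) G(2)[OF snd_out]])
 \<comment> \<open>With this weight in Young's inequality the two terms in \<open>ip w w\<close>
   amount to at most \<open>ip u w\<close>, which \<open>2 * ip u w\<close> on the left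
   absorbs.\<close>
 have m: "1 / (2 * M) > 0" using M0 by simp
 have y1: "2 * \<bar>ip w ubT\<bar> <= 1 / (2 * M) * ip w w + ip ubT ubT / (1 / (2 * M))" by (rule ip_young[OF w_sqi ubT_sqi m])
 have y2: "2 * \<bar>ip w ?fw\<bar> <= 1 / (2 * M) * ip w w + ip ?fw ?fw / (1 / (2 * M))" by (rule ip_young[OF w_sqi sfw m])
 have ww: "1 / (2 * M) * ip w w <= ip u w / 2" using w_norm M0 by (simp add: field_simps)
 have ff: "ip ?fw ?fw <= T\<^sup>2 * ip f f" by (rule tk_schur(2)[OF kern_kfwd[OF T] f(1)])
 have "ip u w = ip w ubT + ip w ?fw - ip G (tk (kback T) G)" using 1 2 3 ip_commute[of w ubT] ip_commute[of w ?fw] by linarith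
 then have "2 * ip u w <= (ip u w / 2 + 2 * M * ip ubT ubT) + (ip u w / 2 + 2 * M * ip ?fw ?fw)"
  using y1 y2 ww 4 by (simp add: mult.commute)
 then have "ip u w <= 2 * M * ip ubT ubT + 2 * M * ip ?fw ?fw" by linarith
 also have "\<dots> <= 2 * M * ip ubT ubT + 2 * M * (T\<^sup>2 * ip f f)" using ff M0 by (intro add_left_mono mult_left_mono) auto
 also have "\<dots> <= 4 * M * (ip ubT ubT + T\<^sup>2 * ip f f)"
 proof -
  have "0 <= M * ip ubT ubT" "0 <= M * (T\<^sup>2 * ip f f)" using M0 by (auto intro!: mult_nonneg_nonneg ip_nonneg)
  then show ?thesis by (simp add: algebra_simps)
 qed
 finally show ?thesis .
qed

lemma energy_2: "ip G G <= ip f f + ip w w + M * (LBINT x. (ub x)\<^sup>2)"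
proof -
 have "ip G G <= ip f w + (1/2) * (LBINT x. \<beta> x * (ub x)\<^sup>2)"
  using energy_inequality[OF smooth_weight_1(1)] by (simp add: smooth_weight_1(2))
 moreover have "(LBINT x. \<beta> x * (ub x)\<^sup>2) <= (LBINT x. M * (ub x)\<^sup>2)"
 proof (rule integral_mono)
  show "integrable lborel (%x. \<beta> x * (ub x)\<^sup>2)"
   using ip_integrable_real[OF sqi_bmult_real[OF ub(1) \<beta>(1) \<beta>_abs] ub(1)] by (simp add: power2_eq_square mult.assoc)
  show "integrable lborel (%x. M * (ub x)\<^sup>2)" using sqi_int[OF ub(1)] by simp
  show "\<beta> x * (ub x)\<^sup>2 <= M * (ub x)\<^sup>2" for x using \<beta>(3)[of x] by (rule mult_right_mono) simp
 qed
 moreover have "0 <= M * (LBINT x. (ub x)\<^sup>2)" using M0 by simp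
 moreover have "2 * \<bar>ip f w\<bar> <= 1 * ip f f + ip w w / 1" by (rule ip_young[OF f(1) w_sqi]) simp
 moreover have "0 <= ip f f" "0 <= ip w w" by (rule ip_nonneg)+
 ultimately show ?thesis by simp
qed

end

lemma ip_abs_le:
 assumes "sqi f" "sqi g" "ip f f <= a\<^sup>2" "ip g g <= b\<^sup>2" "0 <= a" "0 <= b"
 shows "\<bar>ip f g\<bar> <= a * b"
proof -
 have "\<bar>ip f g\<bar> <= sqrt (ip f f) * sqrt (ip g g)" by (rule ip_cauchy_schwarz[OF assms(1,2)])
 also have "\<dots> <= a * b" using assms(3-6) by (intro mult_mono real_le_lsqrt real_sqrt_ge_zero ip_nonneg) auto
 finally show ?thesis .
qed

section \<open>The weighted estimate of the time derivative\<close>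

context heat_sol
begin

definition uquot :: "real => 'a \<times> real => real" where
 "uquot h z = (u z - shift (-h) u z) / h"

lemma wdt_u:
 "0 < s ==> s < T ==> test_fun V p ==> test_fun {s<..<T} q ==>
  ip u (%z. p (fst z) * fder q (snd z) 1) = - ip (Ds s) (p \<otimes> q)"
 using wdt[of s p q] by (simp add: Ds_def[abs_def])

text \<open>A shift moves the quotient from \<open>u\<close> onto \<open>\<zeta>\<close>; the
  backward integral of the quotient of \<open>\<zeta>\<close> is its forward average, and
  integration by parts produces the derivative of \<open>u\<close>. Everything happens after time
  s/2, where that derivative is square integrable.\<close>

lemma uquot_pairing:
 assumes \<zeta>: "sqi \<zeta>" "!!z. z \<notin> cyl V 0 T ==> \<zeta> z = 0" "!!z. snd z <= s ==> \<zeta> z = 0"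
  and h: "0 < h" "h <= s / 2" and s: "s < T"
 shows "ip (uquot h) \<zeta> = ip (Ds (s/2)) (tk (kavg T h) \<zeta>)"
proof -
 have s0: "0 < s" "0 < s / 2" "s / 2 < T" using h s by linarith+
 note k = kern_kback[OF T] and ka = kern_kavg[OF h(1), of T]
 let ?\<Psi> = "dquot T h \<zeta>" and ?\<Phi> = "tk (kavg T h) \<zeta>"
 have so: "\<zeta> z = 0" if "snd z \<notin> {0<..<T}" for z by (rule \<zeta>(2)[OF snd_out[OF that]])
 have \<Psi>: "sqi ?\<Psi>" by (rule dquot_sqi[OF \<zeta>(1) h(1)])
 have \<Psi>o: "?\<Psi> z = 0" if z: "z \<notin> cyl V 0 T" for z
 proof (cases "0 < snd z \<and> snd z < T")
  case False then show ?thesis by (auto simp: dquot_def)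
 next
  case True
  then have "fst z \<notin> V" using z by (cases z) (auto simp: cyl_def)
  then show ?thesis using \<zeta>(2)[OF z] \<zeta>(2)[of "(fst z, snd z + h)"] by (simp add: dquot_def shift_def cyl_def)
 qed
 have \<Phi>: "sqi ?\<Phi>" by (rule tk_schur(1)[OF ka \<zeta>(1)])
 have B: "sqi (tk (kback T) ?\<Psi>)" by (rule tk_schur(1)[OF k \<Psi>])
 have ae: "AE z in lborel. tk (kback T) ?\<Psi> z = ?\<Phi> z" by (rule back_dquot[OF T h(1) \<zeta>(1) so])
 \<comment> \<open>The average looks ahead by at most h \<le> s/2, and \<open>\<zeta>\<close> starts
   at s.\<close>
 have \<Phi>0: "?\<Phi> z = 0" if z: "snd z <= s / 2" for z
 proof -
  have "(%t. kavg T h (snd z, t) *\<^sub>R \<zeta> (fst z, t)) = (%t. 0)"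
  proof
   fix t show "kavg T h (snd z, t) *\<^sub>R \<zeta> (fst z, t) = 0"
    using \<zeta>(3)[of "(fst z, t)"] z h by (cases "t <= s") (auto simp: kavg_def)
  qed
  then show ?thesis unfolding tk_def by (simp only: Bochner_Integration.integral_zero)
 qed
 have eq: "ip (uquot h) \<zeta> = ip u ?\<Psi>"
 proof -
  have "ip (uquot h) \<zeta> = (1/h) * ip (%z. u z - shift (-h) u z) \<zeta>"
   unfolding ip_cmult_left[symmetric] by (simp add: uquot_def[abs_def])
  also have "\<dots> = (1/h) * (ip u \<zeta> - ip u (shift h \<zeta>))"
   unfolding ip_diff_left[OF u(1) sqi_shift[OF u(1)] \<zeta>(1)] ip_shift[OF u(1) \<zeta>(1)] by simp
  also have "\<dots> = ip u (%z. (1/h) * (\<zeta> z - shift h \<zeta> z))"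
   unfolding ip_cmult_right ip_diff_right[OF \<zeta>(1) sqi_shift[OF \<zeta>(1)] u(1)] ..
  also have "(%z. (1/h) * (\<zeta> z - shift h \<zeta> z)) = ?\<Psi>"
  proof
   fix z :: "'a \<times> real"
   show "(1/h) * (\<zeta> z - shift h \<zeta> z) = ?\<Psi> z"
   proof (cases "0 < snd z \<and> snd z < T")
    case True then show ?thesis by (simp add: dquot_def)
   next
    case False
    have "\<zeta> z = 0" by (rule so) (use False in auto)
    moreover have "shift h \<zeta> z = 0"
    proof (cases "snd z <= 0")
     case True then show ?thesis unfolding shift_def by (intro \<zeta>(3)) (use h in simp)
    next
     case F: False then show ?thesis unfolding shift_def by (intro so) (use h False in auto)
    qed
    ultimately show ?thesis using False by (simp add: dquot_def)
   qed
  qed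
  finally show ?thesis .
 qed
 have ibpu: "ip (Ds (s/2)) (%z. etan n (snd z) *\<^sub>R ?\<Phi> z) = ip u (%z. etan n (snd z) *\<^sub>R ?\<Psi> z) - ip u (%z. detan n (snd z) * ?\<Phi> z)"
  if n: "1 / real (Suc n) < T" for n
 proof -
  define s' where "s' = 1 / real (Suc n) / 2"
  have n0: "0 < 1 / real (Suc n)" by simp
  have half: "x / 2 < x" if "0 < x" for x :: real using that by linarith
  have s1: "0 < s'" unfolding s'_def by simp
  have s2: "s' < 1 / real (Suc n)" unfolding s'_def by (rule half[OF n0])
  have s3: "s' < T" using s2 n by linarith
  have 1: "ip u (%z. detan n (snd z) * tk (kback T) ?\<Psi> z) + (-1) * ip u (%z. etan n (snd z) * ?\<Psi> z)
    = - ip (Ds s') (%z. etan n (snd z) * tk (kback T) ?\<Psi> z)"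
   by (rule ibp[OF V u(1) Ds_sqi[OF s1 s3] kern_kback[OF T] wdt_u[OF s1 s3] etan_meas etan_bounds(3) detan_meas detan_abs_bound
     cut_back[OF T less_imp_le[OF s1] s2] \<Psi> \<Psi>o])
  have em: "(%z::'a\<times>real. etan n (snd z)) \<in> BM" "(%z::'a\<times>real. detan n (snd z)) \<in> BM"
   by (rule snd_meas[OF etan_meas], rule snd_meas[OF detan_meas])
  note [measurable] = em sqi_meas[OF B] sqi_meas[OF \<Phi>] sqi_meas[OF u(1)] sqi_meas[OF Ds_sqi[OF s1 s3]] D(1)
  have 2: "ip u (%z. detan n (snd z) * tk (kback T) ?\<Psi> z) = ip u (%z. detan n (snd z) * ?\<Phi> z)"
  proof (rule ip_cong_AE)
   show "AE z in lborel. u z \<bullet> (detan n (snd z) * tk (kback T) ?\<Psi> z) = u z \<bullet> (detan n (snd z) * ?\<Phi> z)"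
    using ae by eventually_elim simp
  qed measurable
  have 3: "ip (Ds s') (%z. etan n (snd z) * tk (kback T) ?\<Psi> z) = ip (Ds s') (%z. etan n (snd z) * ?\<Phi> z)"
  proof (rule ip_cong_AE)
   show "AE z in lborel. Ds s' z \<bullet> (etan n (snd z) * tk (kback T) ?\<Psi> z) = Ds s' z \<bullet> (etan n (snd z) * ?\<Phi> z)"
    using ae by eventually_elim simp
  qed measurable
  have 4: "ip (Ds s') (%z. etan n (snd z) * ?\<Phi> z) = ip D (%z. etan n (snd z) * ?\<Phi> z)"
  proof (rule pairing_D_cut[symmetric])
   fix z :: "'a \<times> real" assume "snd z <= s'"
   then have "etan n (snd z) = 0" using s2 by (intro etan_zero) linarith
   then show "etan n (snd z) * ?\<Phi> z = 0" by simp
  qed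
  have 5: "ip D (%z. etan n (snd z) * ?\<Phi> z) = ip (Ds (s/2)) (%z. etan n (snd z) * ?\<Phi> z)"
   by (rule pairing_D_cut) (simp add: \<Phi>0)
  show ?thesis using 1 2 3 4 5 by simp
 qed
 have l1: "(%n. ip u (%z. etan n (snd z) *\<^sub>R ?\<Psi> z)) ~~> ip u ?\<Psi>"
  by (rule etan_cutoff_weak[OF u(1) \<Psi>]) (simp add: dquot_def)
 have l2: "(%n. ip (Ds (s/2)) (%z. etan n (snd z) *\<^sub>R ?\<Phi> z)) ~~> ip (Ds (s/2)) ?\<Phi>"
  by (rule etan_cutoff_weak[OF Ds_sqi[OF s0(2,3)] \<Phi>]) (use \<Phi>0 s0 in simp)
 \<comment> \<open>\<open>?\<Phi>\<close> lives after time s/2, where \<open>detan n\<close> tends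
   to 0 uniformly; no smallness of slices of \<open>u\<close> is required.\<close>
 have l3: "(%n. ip u (%z. detan n (snd z) * ?\<Phi> z)) ~~> 0"
 proof (rule LIMSEQ_I)
  fix e :: real assume e: "e > 0"
  define R where "R = sqrt (ip u u) * sqrt (ip ?\<Phi> ?\<Phi>) + 1"
  have R: "R > 0" "sqrt (ip u u) * sqrt (ip ?\<Phi> ?\<Phi>) < R" using ip_nonneg[of u] ip_nonneg[of ?\<Phi>] by (auto simp: R_def add_nonneg_pos)
  define d where "d = e / R"
  have d: "d > 0" "d * R = e" using e R by (auto simp: d_def)
  obtain N where N: "!!n t. n \<ge> N ==> s / 2 <= t ==> detan n t <= d"
   using detan_far[OF s0(2) d(1)] by (auto simp: eventually_sequentially)
  have "norm (ip u (%z. detan n (snd z) * ?\<Phi> z) - 0) < e" if n: "n \<ge> N" for n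
  proof -
   have sm: "sqi (%z. detan n (snd z) * ?\<Phi> z)" by (rule sqi_tmult_real[OF \<Phi> detan_meas detan_abs_bound])
   have le: "norm (detan n (snd z) * ?\<Phi> z) <= d * norm (?\<Phi> z)" for z
   proof (cases "s / 2 <= snd z")
    case True
    show ?thesis using mult_right_mono[OF N[OF n True], of "norm (?\<Phi> z)"] detan_nonneg[of n "snd z"] by (simp add: abs_mult)
   next
    case False then show ?thesis using \<Phi>0[of z] by simp
   qed
   have "ip (%z. detan n (snd z) * ?\<Phi> z) (%z. detan n (snd z) * ?\<Phi> z) <= d\<^sup>2 * ip ?\<Phi> ?\<Phi>"
    by (rule ip_mono_scaled[OF \<Phi> sqi_meas[OF sm] le less_imp_le[OF d(1)]])
   then have "sqrt (ip (%z. detan n (snd z) * ?\<Phi> z) (%z. detan n (snd z) * ?\<Phi> z)) <= d * sqrt (ip ?\<Phi> ?\<Phi>)"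
    using real_sqrt_le_mono d(1) by (fastforce simp: real_sqrt_mult)
   then have "sqrt (ip u u) * sqrt (ip (%z. detan n (snd z) * ?\<Phi> z) (%z. detan n (snd z) * ?\<Phi> z)) <= sqrt (ip u u) * (d * sqrt (ip ?\<Phi> ?\<Phi>))"
    by (intro mult_left_mono) (auto simp: ip_nonneg)
   also have "\<dots> = d * (sqrt (ip u u) * sqrt (ip ?\<Phi> ?\<Phi>))" by simp
   also have "\<dots> < d * R" using d R by (intro mult_strict_left_mono)
   finally show ?thesis using ip_cauchy_schwarz[OF u(1) sm] d(2) by simp
  qed
  then show "\<exists>no. \<forall>n\<ge>no. norm (ip u (%z. detan n (snd z) * ?\<Phi> z) - 0) < e" by blast
 qed
 have "(%n. ip (Ds (s/2)) (%z. etan n (snd z) *\<^sub>R ?\<Phi> z)) ~~> ip u ?\<Psi> - 0"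
 proof (rule Lim_transform_eventually[OF tendsto_diff[OF l1 l3]])
  show "\<forall>\<^sub>F n in sequentially. ip u (%z. etan n (snd z) *\<^sub>R ?\<Psi> z) - ip u (%z. detan n (snd z) * ?\<Phi> z) = ip (Ds (s/2)) (%z. etan n (snd z) *\<^sub>R ?\<Phi> z)"
   using eventually_small[OF T] by eventually_elim (rule ibpu[symmetric])
 qed
 from LIMSEQ_unique[OF this l2] eq show ?thesis by simp
qed

lemma uquot_weak:
 assumes \<zeta>: "sqi \<zeta>" "!!z. z \<notin> cyl V 0 T ==> \<zeta> z = 0" "!!z. snd z <= s ==> \<zeta> z = 0"
  and h: "!!n. 0 < h n" "!!n. h n <= s / 2" "h ~~> 0" and s: "0 < s" "s < T"
 shows "(%n. ip (uquot (h n)) \<zeta>) ~~> ip (Ds (s/2)) \<zeta>"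
proof -
 have eq: "ip (uquot (h n)) \<zeta> = ip (Ds (s/2)) (tk (kavg T (h n)) \<zeta>)" for n
  by (rule uquot_pairing[OF \<zeta> h(1,2) s(2)])
 have sD: "sqi (Ds (s/2))" by (rule Ds_sqi) (use s in linarith)+
 show ?thesis unfolding eq
  by (rule kavg_weak[OF T sD \<zeta>(1) \<zeta>(2)[OF time_out] h(1,3)])
qed

text \<open>A time weight of slope 1 that vanishes up to \<open>t1\<close>, as admissible test
  functions must. Dropping to 0 at T keeps forward increments at most \<open>h\<close>.\<close>

definition ramp :: "real => real => real" where
 "ramp t1 t = of_bool (t < T) * max 0 (t - t1)"

lemma ramp: "ramp t1 \<in> BM" "0 <= ramp t1 t" "0 < t1 ==> ramp t1 t <= T" "t <= t1 ==> ramp t1 t = 0"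
  "0 < t1 ==> \<bar>ramp t1 t\<bar> <= T" "0 < h ==> ramp t1 (t + h) - ramp t1 t <= h" "T <= t ==> ramp t1 t = 0"
proof -
 show "ramp t1 \<in> BM" unfolding ramp_def[abs_def] by measurable
qed (use T in \<open>auto simp: ramp_def max_def\<close>)

text \<open>Formally: test with the ramp times the time derivative of w. In its place stands a
  difference quotient of \<open>w\<close>, which has a weak gradient. Both pairings that remain are
  linear in the quotient of \<open>u\<close>, so its weak convergence to the derivative suffices,
  and the quadratic term arises because \<open>\<zeta>1\<close> already contains the
  derivative.\<close>

lemma D_energy_ramp:
 assumes t1: "0 < t1" "t1 < T"
 shows "ip (Ds (t1/2)) (%z. ramp t1 (snd z) * (\<beta> (fst z) * Ds (t1/2) z)) <= M * T * ip f f + ip G G"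
proof -
 let ?D = "Ds (t1/2)"
 define h where "h n = t1 / (real n + 2)" for n
 have h: "0 < h n" "h n <= t1 / 2" for n
 proof -
  show "0 < h n" using t1 by (simp add: h_def)
  show "h n <= t1 / 2" unfolding h_def by (rule divide_left_mono) (use t1 in auto)
 qed
 have h0: "h ~~> 0"
 proof -
  have "filterlim (%n. real n + 2) at_top sequentially"
   using filterlim_tendsto_add_at_top[OF tendsto_const[of 2] filterlim_real_sequentially] by (simp add: add.commute)
  from tendsto_divide_0[OF tendsto_const[of t1] filterlim_at_top_imp_at_infinity[OF this]] show ?thesis by (simp add: h_def[abs_def])
 qed
 have sD: "sqi ?D" by (rule Ds_sqi) (use t1 in auto)
 define \<zeta>1 where "\<zeta>1 z = ramp t1 (snd z) * (\<beta> (fst z) * ?D z)" for z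
 define \<zeta>2 where "\<zeta>2 z = ramp t1 (snd z) * (\<beta> (fst z) * f z)" for z
 note r = ramp(1) ramp(5)[OF t1(1)]
 have z1: "sqi \<zeta>1" unfolding \<zeta>1_def[abs_def] by (rule sqi_tmult_real[OF sqi_xmult_real[OF sD \<beta>(1) \<beta>_abs] r])
 have z2: "sqi \<zeta>2" unfolding \<zeta>2_def[abs_def] by (rule sqi_tmult_real[OF sqi_xmult_real[OF f(1) \<beta>(1) \<beta>_abs] r])
 have z1o: "z \<notin> cyl V 0 T ==> \<zeta>1 z = 0" and z2o: "z \<notin> cyl V 0 T ==> \<zeta>2 z = 0" for z
  by (simp_all add: \<zeta>1_def \<zeta>2_def Ds_out f(2))
 have z1s: "snd z <= t1 ==> \<zeta>1 z = 0" and z2s: "snd z <= t1 ==> \<zeta>2 z = 0" for z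
  by (simp_all add: \<zeta>1_def \<zeta>2_def ramp(4))
 have main: "ip (uquot (h n)) \<zeta>1 <= ip (uquot (h n)) \<zeta>2 + (1/2) * ip G G" for n
 proof -
  let ?h = "h n"
  let ?\<phi> = "%z. ramp t1 (snd z) * ((1/?h) * (w z + (-1) * shift (-?h) w z))"
  let ?G = "%z. ramp t1 (snd z) *\<^sub>R ((1/?h) *\<^sub>R (G z + (-1) *\<^sub>R shift (-?h) G z))"
  have sw: "sqi (%z. (-1) * shift (-?h) w z)" "sqi (%z. (-1) *\<^sub>R shift (-?h) G z)"
   by (intro sqi_cmult sqi_shift w_sqi, intro sqi_scaleR sqi_shift G)
  have wgd: "wgrad V (%z. w z + (-1) * shift (-?h) w z) (%z. G z + (-1) *\<^sub>R shift (-?h) G z)"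
   by (rule wgrad_add[OF wgw wgrad_scale[OF wgrad_shift[OF wgw w_sqi G(1)]] w_sqi G(1) sw])
  have sG: "sqi ?G" by (rule sqi_tmult[OF sqi_scaleR[OF sqi_add[OF G(1) sw(2)]] r])
  have eq: "ip D ?\<phi> + ip G ?G = ip f ?\<phi>"
  proof (rule weak)
   show "sqi ?\<phi>" by (rule sqi_tmult_real[OF sqi_cmult[OF sqi_add[OF w_sqi sw(1)]] r])
   show "sqi ?G" by (rule sG)
   show "wgrad V ?\<phi> ?G" by (rule wgrad_tmult[OF wgrad_scale[OF wgd] r])
   show "0 < t1" by (rule t1)
   show "snd z < t1 ==> ?\<phi> z = 0" for z :: "'a \<times> real" by (simp add: ramp(4))
   fix z :: "'a \<times> real" assume z: "z \<notin> cyl V 0 T"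
   have "ramp t1 (snd z) = 0 \<or> (fst z, snd z - ?h) \<notin> cyl V 0 T"
   proof (cases "snd z <= 0 \<or> T <= snd z")
    case True then show ?thesis using ramp(4)[of "snd z" t1] ramp(7)[of "snd z" t1] t1 by auto
   next
    case False then have "fst z \<notin> V" using z by (cases z) (auto simp: cyl_def)
    then show ?thesis by (simp add: cyl_def)
   qed
   then show "?\<phi> z = 0" "?G z = 0" using w_out[OF z] G(2)[OF z] w_out[of "(fst z, snd z - ?h)"] G(2)[of "(fst z, snd z - ?h)"]
    by (auto simp: shift_def)
  qed
  have \<phi>: "?\<phi> z = ramp t1 (snd z) * (\<beta> (fst z) * uquot ?h z)" for z
   by (simp add: w_def uquot_def shift_def algebra_simps diff_divide_distrib)
  have 1: "ip D ?\<phi> = ip (uquot ?h) \<zeta>1"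
  proof -
   have "ip D ?\<phi> = ip ?D ?\<phi>" by (rule pairing_D_cut) (use t1 in \<open>simp add: ramp(4)\<close>)
   also have "\<dots> = ip (uquot ?h) \<zeta>1" unfolding \<phi> \<zeta>1_def[abs_def] by (simp add: ip_def ac_simps)
   finally show ?thesis .
  qed
  have 2: "ip f ?\<phi> = ip (uquot ?h) \<zeta>2" unfolding \<phi> \<zeta>2_def[abs_def] by (simp add: ip_def ac_simps)
  \<comment> \<open>For the shifted gradient G' one has 2 G . (G - G') \<ge> |G|^2 - |G'|^2. Moving
    the shift onto the weight leaves increments of \<open>ramp\<close>, which are at most
    \<open>h\<close>.\<close>
  have 3: "- (1/2) * ip G G <= ip G ?G"
  proof -
   let ?g = "%z. (norm (G z))\<^sup>2"
   have ig: "integrable lborel ?g" by (rule sqi_int[OF G(1)])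
   have gr: "integrable lborel (%z. ramp t1 (snd z + a) * ?g z)" for a
   proof -
    have "(%t. ramp t1 (t + a)) \<in> BM" using ramp(1)[of t1] by measurable
    from ip_integrable[OF sqi_tmult[OF G(1) this ramp(5)[OF t1(1)]] G(1)] show ?thesis by (simp add: power2_norm_eq_inner)
   qed
   have gs: "integrable lborel (%z. ramp t1 (snd z) * (norm (shift (-?h) G z))\<^sup>2)"
    using ip_integrable[OF sqi_tmult[OF sqi_shift[OF G(1)] r] sqi_shift[OF G(1)], of "-?h" "-?h"] by (simp add: power2_norm_eq_inner)
   have sh: "(LBINT z. ramp t1 (snd z) * (norm (shift (-?h) G z))\<^sup>2) = (LBINT z. ramp t1 (snd z + ?h) * ?g z)"
   proof -
    have "(%z. ramp t1 (snd z) * (norm (shift (-?h) G z))\<^sup>2) \<in> BM" using gs by auto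
    from integral_shift(1)[OF this, of ?h] show ?thesis by (simp add: shift_def)
   qed
   have "- (1/2) * ip G G = (LBINT z. - (1/2) * ?g z)" by (simp add: ip_norm)
   also have "\<dots> <= (LBINT z. (1/(2*?h)) * (ramp t1 (snd z + 0) * ?g z - ramp t1 (snd z + ?h) * ?g z))"
   proof (rule integral_mono)
    show "integrable lborel (%z. - (1/2) * ?g z)" using ig by simp
    show "integrable lborel (%z. (1/(2*?h)) * (ramp t1 (snd z + 0) * ?g z - ramp t1 (snd z + ?h) * ?g z))"
     by (intro integrable_mult_right Bochner_Integration.integrable_diff gr)
    fix z :: "'a \<times> real"
    have "(ramp t1 (snd z + ?h) - ramp t1 (snd z)) * ?g z <= ?h * ?g z"
     by (rule mult_right_mono[OF ramp(6)[OF h(1)]]) simp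
    then have "(1/(2*?h)) * ((ramp t1 (snd z + ?h) - ramp t1 (snd z)) * ?g z) <= (1/(2*?h)) * (?h * ?g z)"
     using h(1)[of n] by (intro mult_left_mono) auto
    also have "\<dots> = (1/2) * ?g z" using h(1)[of n] by simp
    finally have a: "(1/(2*?h)) * ((ramp t1 (snd z + ?h) - ramp t1 (snd z)) * ?g z) <= (1/2) * ?g z" .
    have e: "(1/(2*?h)) * (ramp t1 (snd z + 0) * ?g z - ramp t1 (snd z + ?h) * ?g z)
      = - ((1/(2*?h)) * ((ramp t1 (snd z + ?h) - ramp t1 (snd z)) * ?g z))"
     by (simp add: algebra_simps)
    show "- (1/2) * ?g z <= (1/(2*?h)) * (ramp t1 (snd z + 0) * ?g z - ramp t1 (snd z + ?h) * ?g z)"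
     unfolding e using a by linarith
   qed
   also have "\<dots> = (LBINT z. (1/(2*?h)) * (ramp t1 (snd z) * ?g z - ramp t1 (snd z) * (norm (shift (-?h) G z))\<^sup>2))"
    using Bochner_Integration.integral_diff[OF gr[of 0] gr[of ?h]] Bochner_Integration.integral_diff[OF gr[of 0] gs] sh by simp
   also have "\<dots> <= ip G ?G"
    unfolding ip_def
   proof (rule integral_mono)
    show "integrable lborel (%z. (1/(2*?h)) * (ramp t1 (snd z) * ?g z - ramp t1 (snd z) * (norm (shift (-?h) G z))\<^sup>2))"
     using gr[of 0] gs by (intro integrable_mult_right Bochner_Integration.integrable_diff) simp_all
    show "integrable lborel (%z. G z \<bullet> ?G z)" by (rule ip_integrable[OF G(1) sG])
    fix z :: "'a \<times> real"
    let ?b = "shift (-?h) G z"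
    have "0 <= (norm (G z - ?b))\<^sup>2" by simp
    then have "(norm (G z))\<^sup>2 - (norm ?b)\<^sup>2 <= 2 * (G z \<bullet> (G z - ?b))"
     by (simp add: power2_norm_eq_inner inner_diff_left inner_diff_right inner_commute)
    then have "(ramp t1 (snd z) / (2*?h)) * ((norm (G z))\<^sup>2 - (norm ?b)\<^sup>2) <= (ramp t1 (snd z) / (2*?h)) * (2 * (G z \<bullet> (G z - ?b)))"
     using h(1)[of n] ramp(2)[of t1 "snd z"] by (intro mult_left_mono) auto
    also have "\<dots> = G z \<bullet> ?G z" using h(1)[of n] by simp
    finally show "(1/(2*?h)) * (ramp t1 (snd z) * ?g z - ramp t1 (snd z) * (norm ?b)\<^sup>2) <= G z \<bullet> ?G z"
     by (simp add: algebra_simps diff_divide_distrib)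
   qed
   finally show ?thesis .
  qed
  show ?thesis using eq 1 2 3 by linarith
 qed
 have lim: "ip ?D \<zeta>1 <= ip ?D \<zeta>2 + (1/2) * ip G G"
  by (rule LIMSEQ_le[OF uquot_weak[OF z1 z1o z1s h h0 t1] tendsto_add[OF uquot_weak[OF z2 z2o z2s h h0 t1] tendsto_const]])
    (use main in auto)
 have "ip ?D \<zeta>2 <= (1/2) * ip ?D \<zeta>1 + (1/2) * (M * T * ip f f)"
 proof -
  have "ip ?D \<zeta>2 <= (LBINT z. (1/2) * (?D z \<bullet> \<zeta>1 z) + (1/2) * (M * T * (norm (f z))\<^sup>2))"
   unfolding ip_def
  proof (rule integral_mono)
   show "integrable lborel (%z. ?D z \<bullet> \<zeta>2 z)" by (rule ip_integrable[OF sD z2])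
   show "integrable lborel (%z. (1/2) * (?D z \<bullet> \<zeta>1 z) + (1/2) * (M * T * (norm (f z))\<^sup>2))"
    by (intro Bochner_Integration.integrable_add integrable_mult_right ip_integrable sD z1 sqi_int f)
   fix z :: "'a \<times> real"
   define a where "a = ramp t1 (snd z) * \<beta> (fst z)"
   have a: "0 <= a" "a <= M * T"
   proof -
    show "0 <= a" using ramp(2)[of t1 "snd z"] \<beta>0[of "fst z"] by (simp add: a_def)
    have "a <= T * M" unfolding a_def using ramp(2,3)[of t1 "snd z"] \<beta>0[of "fst z"] \<beta>(3)[of "fst z"] t1 T by (intro mult_mono) auto
    then show "a <= M * T" by (simp add: mult.commute)
   qed
   have "2 * (?D z * f z) <= (?D z)\<^sup>2 + (f z)\<^sup>2" using sum_squares_bound[of "?D z" "f z"] by simp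
   then have "a * (2 * (?D z * f z)) <= a * ((?D z)\<^sup>2 + (f z)\<^sup>2)" by (rule mult_left_mono[OF _ a(1)])
   then have "2 * (a * (?D z * f z)) <= a * (?D z)\<^sup>2 + a * (f z)\<^sup>2" by (simp only: distrib_left mult.left_commute[of a 2])
   moreover have "a * (f z)\<^sup>2 <= M * T * (f z)\<^sup>2" by (rule mult_right_mono[OF a(2)]) simp
   moreover have e: "?D z \<bullet> \<zeta>2 z = a * (?D z * f z)" "?D z \<bullet> \<zeta>1 z = a * (?D z)\<^sup>2"
    by (simp_all only: \<zeta>1_def \<zeta>2_def a_def power2_eq_square inner_real_def ac_simps)
   ultimately show "?D z \<bullet> \<zeta>2 z <= (1/2) * (?D z \<bullet> \<zeta>1 z) + (1/2) * (M * T * (norm (f z))\<^sup>2)"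
    unfolding e real_norm_def power2_abs by linarith
  qed
  also have "\<dots> = (1/2) * ip ?D \<zeta>1 + (1/2) * (M * T * ip f f)"
  proof -
   have i1: "integrable lborel (%z. (1/2) * (?D z \<bullet> \<zeta>1 z))" by (intro integrable_mult_right ip_integrable sD z1)
   have i2: "integrable lborel (%z. (1/2) * (M * T * (norm (f z))\<^sup>2))" by (intro integrable_mult_right sqi_int f)
   show ?thesis unfolding Bochner_Integration.integral_add[OF i1 i2] by (simp add: ip_norm[of f] ip_def[of ?D])
  qed
  finally show ?thesis .
 qed
 then show ?thesis using lim unfolding \<zeta>1_def[abs_def, symmetric] by linarith
qed

text \<open>The start e of the ramp tends to 0. For t > 2 e one has t \<le> 2 (t - e), hence t^2
  \<le> 2 T (t - e), and Fatou's lemma yields integrability together with the bound. The lower bound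
  \<open>c\<close> enters only the first statement; the second keeps the weight \<beta> and is
  uniform.\<close>

lemma tD_estimate:
 "sqi (%z. snd z * D z)" (is ?A)
 "(LBINT z. \<beta> (fst z) * (snd z * D z)\<^sup>2) <= 2 * T * (M * T * ip f f + ip G G)" (is ?B)
proof -
 let ?K = "2 * T * (M * T * ip f f + ip G G)"
 let ?F = "%z. \<beta> (fst z) * (snd z * D z)\<^sup>2"
 have K0: "0 <= ?K" using T M0 ip_nonneg[of f] ip_nonneg[of G] by (intro mult_nonneg_nonneg add_nonneg_nonneg) auto
 have Fm: "?F \<in> BM"
 proof -
  have [measurable]: "(%z::'a\<times>real. \<beta> (fst z)) \<in> BM" "(%z::'a\<times>real. snd z) \<in> BM"
   using fst_meas[OF \<beta>(1)] snd_meas[of "%t. t"] by auto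
  note D(1)[measurable]
  show ?thesis by measurable
 qed
 have F0: "0 <= ?F z" for z using \<beta>0[of "fst z"] by simp
 define e where "e n = T / (real n + 3)" for n
 have e: "0 < e n" "e n < T" for n using T by (auto simp: e_def divide_less_eq)
 have e0: "e ~~> 0"
 proof -
  have "filterlim (%n. real n + 3) at_top sequentially"
   using filterlim_tendsto_add_at_top[OF tendsto_const[of 3] filterlim_real_sequentially] by (simp add: add.commute)
  from tendsto_divide_0[OF tendsto_const[of T] filterlim_at_top_imp_at_infinity[OF this]] show ?thesis by (simp add: e_def[abs_def])
 qed
 let ?Fn = "%n z. ind {2 * e n<..} (snd z) * ?F z"
 have Fnm: "?Fn n \<in> BM" for n
 proof -
  have [measurable]: "(%z::'a\<times>real. ind {2 * e n<..} (snd z)) \<in> BM" by (rule snd_meas) simp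
  note Fm[measurable]
  show ?thesis by measurable
 qed
 have bn: "(\<integral>\<^sup>+z. ennreal (?Fn n z) \<partial>lborel) <= ennreal ?K" for n
 proof -
  let ?D = "Ds (e n / 2)"
  let ?H = "%z. 2 * T * (?D z \<bullet> (ramp (e n) (snd z) * (\<beta> (fst z) * ?D z)))"
  have sD: "sqi ?D" by (rule Ds_sqi) (use e[of n] in linarith)+
  have sH: "sqi (%z. ramp (e n) (snd z) * (\<beta> (fst z) * ?D z))"
   by (rule sqi_tmult_real[OF sqi_xmult_real[OF sD \<beta>(1) \<beta>_abs] ramp(1) ramp(5)[OF e(1)]])
  have iH: "integrable lborel ?H" by (intro integrable_mult_right ip_integrable sD sH)
  have H0: "0 <= ?H z" for z
  proof -
   have "0 <= 2 * T * (ramp (e n) (snd z) * \<beta> (fst z) * (?D z)\<^sup>2)"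
    using T ramp(2)[of "e n" "snd z"] \<beta>0[of "fst z"] by simp
   then show ?thesis by (simp add: power2_eq_square ac_simps)
  qed
  have le: "?Fn n z <= ?H z" for z
  proof (cases "2 * e n < snd z \<and> snd z < T")
   case True
   have Dz: "?D z = D z" using True e(1)[of n] by (simp add: Ds_def)
   have rz: "ramp (e n) (snd z) = snd z - e n" using True e(1)[of n] by (simp add: ramp_def)
   have "snd z * snd z <= T * (2 * (snd z - e n))" using True e[of n] by (intro mult_mono) auto
   then have "(snd z * snd z) * (\<beta> (fst z) * (D z)\<^sup>2) <= (T * (2 * (snd z - e n))) * (\<beta> (fst z) * (D z)\<^sup>2)"
    using \<beta>0[of "fst z"] by (intro mult_right_mono) auto
   then show ?thesis using True by (simp add: Dz rz power2_eq_square ac_simps)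
  next
   case False
   have "?Fn n z = 0"
   proof (cases "2 * e n < snd z")
    case True then have "D z = 0" using False by (intro D(2)) (auto simp: cyl_def)
    then show ?thesis by simp
   qed simp
   then show ?thesis using H0[of z] by linarith
  qed
  have "(\<integral>\<^sup>+z. ennreal (?Fn n z) \<partial>lborel) <= (\<integral>\<^sup>+z. ennreal (?H z) \<partial>lborel)"
   by (intro nn_integral_mono ennreal_leI le)
  also have "\<dots> = ennreal (LBINT z. ?H z)" by (rule nn_integral_eq_integral[OF iH]) (use H0 in auto)
  also have "(LBINT z. ?H z) = 2 * T * ip ?D (%z. ramp (e n) (snd z) * (\<beta> (fst z) * ?D z))" by (simp add: ip_def)
  also have "ennreal (2 * T * ip ?D (%z. ramp (e n) (snd z) * (\<beta> (fst z) * ?D z))) <= ennreal ?K"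
   using D_energy_ramp[OF e] T by (intro ennreal_leI mult_left_mono) auto
  finally show ?thesis .
 qed
 have lim: "(%n. ennreal (?Fn n z)) ~~> ennreal (?F z)" for z
 proof (cases "0 < snd z")
  case True
  have l: "(%n. 2 * e n) ~~> 0" using tendsto_mult[OF tendsto_const e0, of 2] by simp
  have "\<forall>\<^sub>F n in sequentially. 2 * e n < snd z" by (rule order_tendstoD(2)[OF l True])
  then have "\<forall>\<^sub>F n in sequentially. ennreal (?Fn n z) = ennreal (?F z)" by eventually_elim simp
  then show ?thesis by (rule tendsto_eventually)
 next
  case False
  then have "D z = 0" by (intro D(2)) (auto simp: cyl_def)
  then show ?thesis by simp
 qed
 have "(\<integral>\<^sup>+z. ennreal (?F z) \<partial>lborel) = (\<integral>\<^sup>+z. liminf (%n. ennreal (?Fn n z)) \<partial>lborel)"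
  by (intro nn_integral_cong) (simp add: lim_imp_Liminf[OF _ lim])
 also have "\<dots> <= liminf (%n. \<integral>\<^sup>+z. ennreal (?Fn n z) \<partial>lborel)"
  by (rule nn_integral_liminf) (use Fnm in measurable)
 also have "\<dots> <= liminf (%n. ennreal ?K)" by (intro Liminf_mono always_eventually allI bn)
 also have "\<dots> = ennreal ?K" by (simp add: Liminf_const)
 finally have nn: "(\<integral>\<^sup>+z. ennreal (?F z) \<partial>lborel) <= ennreal ?K" .
 have iF: "integrable lborel ?F"
 proof (rule integrableI_nonneg)
  show "(\<integral>\<^sup>+z. ennreal (?F z) \<partial>lborel) < \<infinity>" using nn by (rule le_less_trans) simp
 qed (use Fm F0 in auto)
 have "ennreal (LBINT z. ?F z) <= ennreal ?K"
  using nn_integral_eq_integral[OF iF] F0 nn by simp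
 then show ?B using K0 by (simp add: ennreal_le_iff)
 show ?A
 proof (rule sqi_dominated)
  show "(%z. snd z * D z) \<in> BM"
  proof -
   have [measurable]: "(%z::'a\<times>real. snd z) \<in> BM" using snd_meas[of "%t. t"] by auto
   note D(1)[measurable]
   show ?thesis by measurable
  qed
  show "integrable lborel (%z. (1/c) * ?F z)" using iF by simp
  show "(norm (snd z * D z))\<^sup>2 <= (1/c) * ?F z" for z
  proof -
   have "c * (snd z * D z)\<^sup>2 <= ?F z" by (rule mult_right_mono[OF \<beta>(2)]) simp
   then show ?thesis using c by (simp add: field_simps)
  qed
 qed
qed

end

subsection \<open>Weak compactness of bounded sequences\<close>

lemma parallelogram:
 assumes "sqi f" "sqi g"
 shows "ip (%z. f z - g z) (%z. f z - g z) = 2 * ip f f + 2 * ip g g - 4 * ip (%z. (1/2) *\<^sub>R (f z + g z)) (%z. (1/2) *\<^sub>R (f z + g z))"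
proof -
 have 1: "ip (%z. f z - g z) (%z. f z - g z) = ip f f - 2 * ip f g + ip g g"
  using assms by (simp add: ip_diff_left ip_diff_right sqi_diff ip_commute[of g f])
 have 2: "ip (%z. f z + g z) (%z. f z + g z) = ip f f + 2 * ip f g + ip g g"
  using assms by (simp add: ip_add_left ip_add_right sqi_add ip_commute[of g f])
 show ?thesis unfolding ip_scaleR_left ip_scaleR_right 1 2 by (simp add: field_simps)
qed

text \<open>A rapidly Cauchy subsequence converges almost everywhere.\<close>

lemma L2_complete:
 fixes y :: "nat => 'b::euclidean_space => 'c::euclidean_space"
 assumes y: "!!n. sqi (y n)"
  and C: "!!e. e > 0 ==> \<exists>N. \<forall>m\<ge>N. \<forall>n\<ge>N. ip (%z. y m z - y n z) (%z. y m z - y n z) <= e"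
 shows "\<exists>g. sqi g \<and> (%n. ip (%z. y n z - g z) (%z. y n z - g z)) ~~> 0"
proof -
 have ym [measurable]: "y n \<in> BM" for n by (rule sqi_meas[OF y])
 have "\<forall>k. \<exists>N. \<forall>m\<ge>N. \<forall>n\<ge>N. ip (%z. y m z - y n z) (%z. y m z - y n z) <= (1/8)^k"
  using C by simp
 then obtain N where N: "!!k m n. m \<ge> N k ==> n \<ge> N k ==> ip (%z. y m z - y n z) (%z. y m z - y n z) <= (1/8)^k" by metis
 \<comment> \<open>The maximum makes the index sequence monotone, the summand \<open>k\<close> sends
   it to infinity.\<close>
 define r where "r k = Max (N ` {..k}) + k" for k
 have rN: "N k <= r k" for k unfolding r_def by (intro trans_le_add1 Max_ge) auto
 have rm: "r k <= r (Suc k)" for k unfolding r_def by (intro add_mono Max_mono) auto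
 have rk: "k <= r k" for k by (simp add: r_def)
 define d where "d k z = y (r (Suc k)) z - y (r k) z" for k z
 have dm [measurable]: "d k \<in> BM" for k unfolding d_def[abs_def] by measurable
 have dn: "(\<integral>\<^sup>+z. ennreal ((norm (d k z))\<^sup>2) \<partial>lborel) <= ennreal ((1/8)^k)" for k
 proof -
  have s: "sqi (d k)" unfolding d_def[abs_def] by (intro sqi_diff y)
  have "(\<integral>\<^sup>+z. ennreal ((norm (d k z))\<^sup>2) \<partial>lborel) = ennreal (ip (d k) (d k))"
   unfolding ip_norm by (rule nn_integral_eq_integral[OF sqi_int[OF s]]) simp
  also have "ip (d k) (d k) <= (1/8)^k"
   unfolding d_def[abs_def] by (rule N) (use rN[of k] rm[of k] in auto)
  finally show ?thesis by (simp add: ennreal_leI)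
 qed
 \<comment> \<open>Squared norms of at most 8^(-k) leave a convergent geometric series after
   multiplication by 4^k; where the sum is finite, the increments decay like 2^(-k).\<close>
 let ?S = "%z. \<Sum>k. ennreal (4^k * (norm (d k z))\<^sup>2)"
 have "(\<integral>\<^sup>+z. ?S z \<partial>lborel) = (\<Sum>k. \<integral>\<^sup>+z. ennreal (4^k * (norm (d k z))\<^sup>2) \<partial>lborel)"
  by (rule nn_integral_suminf) measurable
 also have "\<dots> <= (\<Sum>k. ennreal ((1/2)^k))"
 proof (rule suminf_le)
  fix k
  have "(\<integral>\<^sup>+z. ennreal (4^k * (norm (d k z))\<^sup>2) \<partial>lborel) = ennreal (4^k) * (\<integral>\<^sup>+z. ennreal ((norm (d k z))\<^sup>2) \<partial>lborel)"
   by (subst nn_integral_cmult[symmetric]) (measurable, simp add: ennreal_mult)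
  also have "\<dots> <= ennreal (4^k) * ennreal ((1/8)^k)" by (intro mult_left_mono dn) auto
  also have "\<dots> = ennreal ((1/2)^k)" by (simp add: ennreal_mult[symmetric] power_mult_distrib[symmetric])
  finally show "(\<integral>\<^sup>+z. ennreal (4^k * (norm (d k z))\<^sup>2) \<partial>lborel) <= ennreal ((1/2)^k)" .
 qed auto
 also have "\<dots> = ennreal (\<Sum>k. (1/2)^k)" by (rule suminf_ennreal2) (auto intro: summable_geometric)
 also have "\<dots> < \<infinity>" by simp
 finally have fin: "(\<integral>\<^sup>+z. ?S z \<partial>lborel) \<noteq> \<infinity>" by simp
 have "AE z in lborel. ?S z \<noteq> \<infinity>" by (rule nn_integral_PInf_AE[OF _ fin]) measurable
 then have conv: "AE z in lborel. convergent (%k. y (r k) z)"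
 proof eventually_elim
  case (elim z)
  define R where "R = enn2real (?S z)"
  have R: "?S z = ennreal R" "R \<ge> 0" using elim unfolding R_def by (simp_all only: ennreal_enn2real_if enn2real_nonneg infinity_ennreal_def if_False)
  have le: "norm (d k z) <= sqrt R * (1/2)^k" for k
  proof -
   let ?h = "%k. ennreal (4^k * (norm (d k z))\<^sup>2)"
   have one: "(\<Sum>j\<in>{k}. h j) = h k" for h :: "nat => ennreal" by simp
   have "(\<Sum>j\<in>{k}. ?h j) <= ?S z"
    by (rule sum_le_suminf[OF summableI]) (simp_all only: finite.emptyI finite_insert zero_le)
   then have "?h k <= ennreal R" unfolding one R(1) .
   then have "4^k * (norm (d k z))\<^sup>2 <= R" using R(2) by (simp only: ennreal_le_iff)
   then have "(2^k * norm (d k z))\<^sup>2 <= R" by (simp add: power_mult_distrib power_mult[symmetric] mult.commute[of k] power_mult)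
   then have "2^k * norm (d k z) <= sqrt R" by (rule real_le_rsqrt)
   then show ?thesis by (simp add: power_one_over field_simps)
  qed
  have "summable (%k. d k z)"
   by (rule summable_comparison_test'[where g="%k. sqrt R * (1/2)^k" and N=0]) (use le in \<open>auto intro: summable_mult summable_geometric\<close>)
  then have "convergent (%n. \<Sum>k<n. d k z)" by (simp add: summable_iff_convergent)
  moreover have "(\<Sum>k<n. d k z) = y (r n) z - y (r 0) z" for n unfolding d_def by (rule sum_lessThan_telescope)
  ultimately have "convergent (%n. (y (r n) z - y (r 0) z) + y (r 0) z)" by (intro convergent_add) (auto simp: convergent_const)
  then show ?case by simp
 qed
 define g where "g z = lim (%k. y (r k) z)" for z
 have gm [measurable]: "g \<in> BM" unfolding g_def[abs_def] by measurable
 \<comment> \<open>The Cauchy bound against late members passes to the pointwise limit; this gives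
   both the integrability of the limit and the convergence in norm.\<close>
 have Fatou: "(\<integral>\<^sup>+z. ennreal ((norm (y n z - g z))\<^sup>2) \<partial>lborel) <= ennreal e"
  if e: "!!k. k \<ge> K ==> ip (%z. y n z - y (r k) z) (%z. y n z - y (r k) z) <= e" for n K e
 proof -
  have "(\<integral>\<^sup>+z. ennreal ((norm (y n z - g z))\<^sup>2) \<partial>lborel) = (\<integral>\<^sup>+z. liminf (%k. ennreal ((norm (y n z - y (r k) z))\<^sup>2)) \<partial>lborel)"
  proof (rule nn_integral_cong_AE)
   show "AE z in lborel. ennreal ((norm (y n z - g z))\<^sup>2) = liminf (%k. ennreal ((norm (y n z - y (r k) z))\<^sup>2))"
    using conv
   proof eventually_elim
    case (elim z)
    then have "(%k. y (r k) z) ~~> g z" by (simp add: g_def convergent_LIMSEQ_iff)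
    then have "(%k. ennreal ((norm (y n z - y (r k) z))\<^sup>2)) ~~> ennreal ((norm (y n z - g z))\<^sup>2)"
     by (intro tendsto_ennrealI tendsto_power tendsto_norm tendsto_diff tendsto_const)
    then show ?case by (rule lim_imp_Liminf[OF sequentially_bot, symmetric])
   qed
  qed
  also have "\<dots> <= liminf (%k. \<integral>\<^sup>+z. ennreal ((norm (y n z - y (r k) z))\<^sup>2) \<partial>lborel)"
   by (rule nn_integral_liminf) measurable
  also have "\<dots> <= liminf (%k. ennreal e)"
  proof (rule Liminf_mono, rule eventually_sequentiallyI[of K])
   fix k assume k: "K <= k"
   have "(\<integral>\<^sup>+z. ennreal ((norm (y n z - y (r k) z))\<^sup>2) \<partial>lborel) = ennreal (ip (%z. y n z - y (r k) z) (%z. y n z - y (r k) z))"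
    unfolding ip_norm by (rule nn_integral_eq_integral[OF sqi_int[OF sqi_diff[OF y y]]]) simp
   then show "(\<integral>\<^sup>+z. ennreal ((norm (y n z - y (r k) z))\<^sup>2) \<partial>lborel) <= ennreal e" using e[OF k] by (simp add: ennreal_leI)
  qed
  also have "\<dots> = ennreal e" by (simp add: Liminf_const)
  finally show ?thesis .
 qed
 have sq: "sqi (%z. y n z - g z)" if "!!k. k \<ge> K ==> ip (%z. y n z - y (r k) z) (%z. y n z - y (r k) z) <= e" for n K e
 proof -
  have "integrable lborel (%z. (norm (y n z - g z))\<^sup>2)"
  proof (rule integrableI_nonneg)
   show "(\<integral>\<^sup>+z. ennreal ((norm (y n z - g z))\<^sup>2) \<partial>lborel) < \<infinity>" using Fatou[OF that] by (rule le_less_trans) simp_all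
  qed auto
  then show ?thesis by (simp add: sqi_def)
 qed
 have "sqi (%z. y (N 0) z - g z)"
  by (rule sq[where K=0 and e="(1/8)^0"]) (intro N, use rN in \<open>auto simp: r_def intro!: trans_le_add1 Max_ge\<close>)
 from sqi_diff[OF y this, of "N 0"] have sg: "sqi g" by simp
 have "(%n. ip (%z. y n z - g z) (%z. y n z - g z)) ~~> 0"
 proof (rule LIMSEQ_I)
  fix e :: real assume e: "e > 0"
  then have "e / 2 > 0" by simp
  from C[OF this] obtain M where M: "\<forall>m\<ge>M. \<forall>n\<ge>M. ip (%z. y m z - y n z) (%z. y m z - y n z) <= e / 2" by blast
  have "norm (ip (%z. y n z - g z) (%z. y n z - g z) - 0) < e" if n: "n \<ge> M" for n
  proof -
   have "(\<integral>\<^sup>+z. ennreal ((norm (y n z - g z))\<^sup>2) \<partial>lborel) <= ennreal (e/2)"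
   proof (rule Fatou[where K=M])
    fix k assume "k \<ge> M"
    then have "r k \<ge> M" using rk[of k] by linarith
    then show "ip (%z. y n z - y (r k) z) (%z. y n z - y (r k) z) <= e / 2" using M n by blast
   qed
   moreover have "(\<integral>\<^sup>+z. ennreal ((norm (y n z - g z))\<^sup>2) \<partial>lborel) = ennreal (ip (%z. y n z - g z) (%z. y n z - g z))"
    unfolding ip_norm by (rule nn_integral_eq_integral[OF sqi_int[OF sqi_diff[OF y sg]]]) simp
   ultimately have "ip (%z. y n z - g z) (%z. y n z - g z) <= e/2" using e by (simp add: ennreal_le_iff)
   then show ?thesis using ip_nonneg[of "%z. y n z - g z"] e by simp
  qed
  then show "\<exists>no. \<forall>n\<ge>no. norm (ip (%z. y n z - g z) (%z. y n z - g z) - 0) < e" by blast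
 qed
 then show ?thesis using sg by blast
qed

text \<open>Dyadic convex combinations of the members from \<open>n\<close> on. Closure under
  midpoints is exactly what the parallelogram identity uses.\<close>

inductive midhull :: "(nat => 'b::euclidean_space => 'c::euclidean_space) => nat => ('b => 'c) => bool"
 for x :: "nat => 'b => 'c" and n :: nat where
 base: "n <= k ==> midhull x n (x k)"
| mid: "midhull x n f ==> midhull x n g ==> midhull x n (%z. (1/2) *\<^sub>R (f z + g z))"

lemma midhull_mono: "midhull x m f ==> n <= m ==> midhull x n f"
 by (induction rule: midhull.induct) (auto intro: midhull.intros)

lemma midhull_sqi: "midhull x n f ==> (!!k. sqi (x k)) ==> sqi f"
 by (induction rule: midhull.induct) auto

lemma midhull_ip:
 assumes "midhull x n f" "!!k. sqi (x k)" "sqi h" "!!k. n <= k ==> \<bar>ip (x k) h - L\<bar> <= e"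
 shows "\<bar>ip f h - L\<bar> <= e"
 using assms(1)
proof (induction rule: midhull.induct)
 case (mid f g)
 have s: "sqi f" "sqi g" using midhull_sqi[OF mid(1) assms(2)] midhull_sqi[OF mid(2) assms(2)] by auto
 have "ip (%z. (1/2) *\<^sub>R (f z + g z)) h = (ip f h + ip g h) / 2"
  using s assms(3) by (simp add: ip_scaleR_left ip_add_left)
 then show ?case using mid(3,4) by (simp add: abs_le_iff)
qed (use assms(4) in auto)

text \<open>The approximate minimisers of the norm over the tails' hulls form a Cauchy sequence.\<close>

lemma mazur_limit:
 fixes x :: "nat => 'b::euclidean_space => 'c::euclidean_space"
 assumes x: "!!n. sqi (x n)" and B: "!!n. ip (x n) (x n) <= B"
 shows "\<exists>g y. sqi g \<and> (\<forall>n. midhull x n (y n)) \<and> (%n. ip (%z. y n z - g z) (%z. y n z - g z)) ~~> 0"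
proof -
 define S where "S n = (%f. ip f f) ` {f. midhull x n f}" for n
 define d where "d n = Inf (S n)" for n
 have S0: "S n \<noteq> {}" "bdd_below (S n)" for n
  unfolding S_def by (auto intro!: bdd_belowI[of _ 0] ip_nonneg midhull.base[of n n])
 have dle: "d n <= ip f f" if "midhull x n f" for n f
  unfolding d_def by (rule cInf_lower[OF _ S0(2)]) (use that in \<open>auto simp: S_def\<close>)
 have dB: "d n <= B" for n using order_trans[OF dle[OF midhull.base[of n n x]] B] by simp
 have dm: "d n <= d m" if "n <= m" for n m
  unfolding d_def by (rule cInf_superset_mono[OF S0(1) S0(2)]) (use midhull_mono[OF _ that] in \<open>auto simp: S_def\<close>)
 obtain L where L: "d ~~> L" "!!n. d n <= L"
  using incseq_convergent[of d B] dm dB by (auto simp: incseq_def)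
 have "\<exists>f. midhull x n f \<and> ip f f < d n + 1 / real (Suc n)" for n
 proof -
  have "Inf (S n) < d n + 1 / real (Suc n)" by (simp add: d_def)
  then obtain s where "s \<in> S n" "s < d n + 1 / real (Suc n)" using cInf_lessD[OF S0(1)] by blast
  then show ?thesis by (auto simp: S_def)
 qed
 then obtain y where y: "!!n. midhull x n (y n)" "!!n. ip (y n) (y n) < d n + 1 / real (Suc n)" by metis
 have sy: "sqi (y n)" for n by (rule midhull_sqi[OF y(1) x])
 define q where "q j = 1 / real (Suc j)" for j
 have qm: "q m <= q p" if "p <= m" for m p unfolding q_def using that by (intro divide_left_mono) auto
 have yq: "ip (y n) (y n) < d n + q n" for n using y(2)[of n] by (simp only: q_def)
 \<comment> \<open>The midpoint of two late near-minimisers lies in the hull of the tail from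
   \<open>p\<close>, so its squared norm is at least \<open>d p\<close>; the parallelogram identity
   then bounds their distance.\<close>
 have pair: "ip (%z. y m z - y n z) (%z. y m z - y n z) <= 4 * (L - d p) + 4 * q p" if "m \<ge> p" "n \<ge> p" for m n p
 proof -
  have "midhull x p (%z. (1/2) *\<^sub>R (y m z + y n z))"
   by (intro midhull.mid midhull_mono[OF y(1)] that)
  then have "d p <= ip (%z. (1/2) *\<^sub>R (y m z + y n z)) (%z. (1/2) *\<^sub>R (y m z + y n z))" by (rule dle)
  then show ?thesis
   unfolding parallelogram[OF sy sy] using yq[of m] yq[of n] L(2)[of m] L(2)[of n] qm[OF that(1)] qm[OF that(2)] by argo
 qed
 have C: "\<exists>N. \<forall>m\<ge>N. \<forall>n\<ge>N. ip (%z. y m z - y n z) (%z. y m z - y n z) <= e" if e: "e > 0" for e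
 proof -
  have l1: "q ~~> 0" using LIMSEQ_inverse_real_of_nat by (simp add: q_def[abs_def] inverse_eq_divide)
  have "(%p. 4 * (L - d p) + 4 * q p) ~~> 4 * (L - L) + 4 * 0"
   by (intro tendsto_intros L(1) l1)
  then have l: "(%p. 4 * (L - d p) + 4 * q p) ~~> 0" by simp
  have "\<forall>\<^sub>F p in sequentially. 4 * (L - d p) + 4 * q p < e" by (rule order_tendstoD(2)[OF l e])
  then obtain p where p: "4 * (L - d p) + 4 * q p < e" by (auto simp: eventually_sequentially)
  show ?thesis
  proof (intro exI[of _ p] allI impI)
   fix m n assume "p <= m" "p <= n"
   from pair[OF this] p show "ip (%z. y m z - y n z) (%z. y m z - y n z) <= e" by linarith
  qed
 qed
 obtain g where "sqi g" "(%n. ip (%z. y n z - g z) (%z. y n z - g z)) ~~> 0" using L2_complete[OF sy C] by blast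
 then show ?thesis using y(1) by blast
qed

text \<open>Convex combinations of late members have pairings close to the limit of the pairings, so
  the strong limit of such combinations represents every pairing limit that exists.\<close>

lemma mazur_limit_pairing:
 fixes x :: "nat => 'b::euclidean_space => 'c::euclidean_space"
 assumes x: "!!n. sqi (x n)" and g: "sqi g" and y: "!!n. midhull x n (y n)"
  "(%n. ip (%z. y n z - g z) (%z. y n z - g z)) ~~> 0"
  and h: "sqi h" "(%n. ip (x n) h) ~~> L"
 shows "ip g h = L"
proof -
 have sy: "sqi (y n)" for n by (rule midhull_sqi[OF y(1) x])
 have 1: "(%n. ip h (y n)) ~~> ip h g" by (rule ip_tendsto_strong[OF sy g h(1) y(2)])
 have 2: "(%n. ip h (y n)) ~~> L"
 proof (rule LIMSEQ_I)
  fix e :: real assume e: "e > 0"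
  obtain N where N: "!!n. n \<ge> N ==> \<bar>ip (x n) h - L\<bar> < e/2" using LIMSEQ_D[OF h(2), of "e/2"] e by auto
  have "norm (ip h (y n) - L) < e" if n: "n \<ge> N" for n
  proof -
   have "\<bar>ip (y n) h - L\<bar> <= e/2"
    by (rule midhull_ip[OF y(1) x h(1)]) (use N n in \<open>auto intro: less_imp_le\<close>)
   then show ?thesis using e by (simp add: ip_commute[of h])
  qed
  then show "\<exists>no. \<forall>n\<ge>no. norm (ip h (y n) - L) < e" by blast
 qed
 show ?thesis using LIMSEQ_unique[OF 1 2] by (simp add: ip_commute)
qed

lemma bounded_real_diagonal:
 fixes a :: "nat => nat => real"
 assumes "!!m. bounded (range (a m))"
 shows "\<exists>r. strict_mono r \<and> (\<forall>m. convergent (%n. a m (r n)))"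
proof -
 interpret subseqs "%m s. convergent (%n. a m (s n))"
 proof
  fix m and s :: "nat => nat" assume "strict_mono s"
  have "bounded (range (%n. a m (s n)))" by (rule bounded_subset[OF assms[of m]]) auto
  then obtain l r where "strict_mono r" "((%n. a m (s n)) \<circ> r) ~~> l" using bounded_imp_convergent_subsequence by blast
  then show "\<exists>r'. strict_mono r' \<and> convergent (%n. a m ((s \<circ> r') n))" by (auto simp: o_def convergent_def)
 qed
 have "convergent (%n. a m (diagseq n))" for m
 proof -
  have "convergent (%n. a m ((diagseq \<circ> (+) (Suc m)) n))"
  proof (rule diagseq_holds)
   fix r s n assume "strict_mono (r :: nat => nat)" "convergent (%k. a n (s k))"
   then show "convergent (%k. a n ((s \<circ> r) k))" using convergent_subseq_convergent[of "%k. a n (s k)" r] by (simp add: o_def)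
  qed
  then have "convergent (%n. a m (diagseq (n + Suc m)))" by (simp add: o_def add.commute)
  then show ?thesis using convergent_ignore_initial_segment[of "%n. a m (diagseq n)" "Suc m"] by simp
 qed
 then show ?thesis using subseq_diagseq by blast
qed

lemma midhull_orthogonal:
 assumes "midhull x n f" "!!k. sqi (x k)" "sqi e" "!!k. ip (x k) e = 0" shows "ip f e = 0"
 using midhull_ip[OF assms(1-3), of 0 0] assms(4) by simp

text \<open>The diagonal subsequence is made to converge only against the members \<open>X m\<close>
  themselves. If convergence failed for some \<open>h\<close>, a further subsequence would have a
  second Mazur limit with a different pairing. The difference of the two limits is orthogonal to all
  \<open>X m\<close>, hence to both limits, hence zero.\<close>

theorem weak_sequential_compactness:
 fixes X :: "nat => 'b::euclidean_space => 'c::euclidean_space"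
 assumes X: "!!n. sqi (X n)" and B: "!!n. ip (X n) (X n) <= B"
 shows "\<exists>r g. strict_mono r \<and> sqi g \<and> (\<forall>h. sqi h --> (%n. ip (X (r n)) h) ~~> ip g h)"
proof -
 have bd: "bounded (range (%n. ip (X n) h))" if h: "sqi h" for h
 proof (rule boundedI)
  fix t assume "t \<in> range (%n. ip (X n) h)"
  then obtain n where t: "t = ip (X n) h" by auto
  have "\<bar>ip (X n) h\<bar> <= sqrt (ip (X n) (X n)) * sqrt (ip h h)" by (rule ip_cauchy_schwarz[OF X h])
  also have "\<dots> <= sqrt B * sqrt (ip h h)" by (intro mult_right_mono real_sqrt_le_mono B) (simp add: ip_nonneg)
  finally show "norm t <= sqrt B * sqrt (ip h h)" by (simp add: t)
 qed
 obtain r where r: "strict_mono r" "!!m. convergent (%n. ip (X (r n)) (X m))"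
  using bounded_real_diagonal[of "%m n. ip (X n) (X m)"] bd[OF X] by blast
 define c where "c m = lim (%n. ip (X (r n)) (X m))" for m
 have c: "(%n. ip (X (r n)) (X m)) ~~> c m" for m
  using r(2)[of m] by (simp add: c_def convergent_LIMSEQ_iff)
 obtain g :: "'b => 'c" and y where g: "sqi g" "!!n. midhull (%n. X (r n)) n (y n)" "(%n. ip (%z. y n z - g z) (%z. y n z - g z)) ~~> 0"
  using mazur_limit[of "%n. X (r n)" B] X B by blast
 have gc: "ip g (X m) = c m" for m by (rule mazur_limit_pairing[OF X g(1,2,3) X c])
 have "(%n. ip (X (r n)) h) ~~> ip g h" if h: "sqi h" for h
 proof (rule ccontr)
  assume "\<not> (%n. ip (X (r n)) h) ~~> ip g h"
  then obtain e where e: "e > 0" "!!N. \<exists>n\<ge>N. \<bar>ip (X (r n)) h - ip g h\<bar> \<ge> e"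
   unfolding LIMSEQ_iff by (auto simp: not_less)
  define I where "I = {n. \<bar>ip (X (r n)) h - ip g h\<bar> \<ge> e}"
  have inf: "infinite I" unfolding infinite_nat_iff_unbounded_le using e(2) by (auto simp: I_def)
  have s: "strict_mono (enumerate I)" "!!n. enumerate I n \<in> I" using strict_mono_enumerate[OF inf] enumerate_in_set[OF inf] by auto
  have "bounded (range (%n. ip (X (r (enumerate I n))) h))" by (rule bounded_subset[OF bd[OF h]]) auto
  then obtain l q where q: "strict_mono q" "((%n. ip (X (r (enumerate I n))) h) \<circ> q) ~~> l"
   using bounded_imp_convergent_subsequence by blast
  define Z where "Z n = X (r (enumerate I (q n)))" for n
  have Zl: "(%n. ip (Z n) h) ~~> l" using q(2) by (simp add: Z_def o_def)
  have Zc: "(%n. ip (Z n) (X m)) ~~> c m" for m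
   using LIMSEQ_subseq_LIMSEQ[OF c[of m] strict_mono_o[OF s(1) q(1)]] by (simp add: Z_def o_def)
  obtain g' :: "'b => 'c" and y' where g': "sqi g'" "!!n. midhull Z n (y' n)" "(%n. ip (%z. y' n z - g' z) (%z. y' n z - g' z)) ~~> 0"
   using mazur_limit[of Z B] X B unfolding Z_def by blast
  have XZ: "sqi (Z n)" for n by (simp add: Z_def X)
  have gc': "ip g' (X m) = c m" for m by (rule mazur_limit_pairing[OF XZ g'(1,2,3) X Zc])
  let ?e = "%z. g z - g' z"
  have se: "sqi ?e" by (intro sqi_diff g g')
  have eX: "ip (X m) ?e = 0" for m
   using gc[of m] gc'[of m] by (simp add: ip_diff_right[OF g(1) g'(1) X] ip_commute[of "X m"])
  have "ip (y n) ?e = 0" for n by (rule midhull_orthogonal[OF g(2) X se eX])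
  moreover have "(%n. ip ?e (y n)) ~~> ip ?e g"
   by (rule ip_tendsto_strong[OF midhull_sqi[OF g(2) X] g(1) se g(3)])
  ultimately have z1: "ip ?e g = 0" by (simp add: ip_commute[of ?e] LIMSEQ_const_iff)
  have "ip (y' n) ?e = 0" for n by (rule midhull_orthogonal[OF g'(2) XZ se]) (simp add: Z_def eX)
  moreover have "(%n. ip ?e (y' n)) ~~> ip ?e g'"
   by (rule ip_tendsto_strong[OF midhull_sqi[OF g'(2) XZ] g'(1) se g'(3)])
  ultimately have z2: "ip ?e g' = 0" by (simp add: ip_commute[of ?e] LIMSEQ_const_iff)
  have "ip ?e ?e = ip ?e g - ip ?e g'" by (rule ip_diff_right[OF g(1) g'(1) se])
  then have ee: "ip ?e ?e = 0" using z1 z2 by simp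
  have "\<bar>ip ?e h\<bar> <= sqrt (ip ?e ?e) * sqrt (ip h h)" by (rule ip_cauchy_schwarz[OF se h])
  then have "ip g h = ip g' h" unfolding ee using ip_diff_left[OF g(1) g'(1) h] by simp
  moreover have "ip g' h = l" by (rule mazur_limit_pairing[OF XZ g'(1,2,3) h Zl])
  ultimately have "l = ip g h" by simp
  moreover have "e <= \<bar>l - ip g h\<bar>"
  proof (rule LIMSEQ_le_const)
   show "(%n. \<bar>ip (Z n) h - ip g h\<bar>) ~~> \<bar>l - ip g h\<bar>" by (intro tendsto_intros Zl)
   show "\<exists>N. \<forall>n\<ge>N. e <= \<bar>ip (Z n) h - ip g h\<bar>" using s(2) by (auto simp: Z_def I_def)
  qed
  ultimately show False using e(1) by simp
 qed
 then show ?thesis using r(1) g(1) by blast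
qed

context heat_sol
begin

subsection \<open>The interior estimate where the coefficient degenerates\<close>

text \<open>Both the energy inequality and the integrated identity are taken with the weight
  \<open>ch^2\<close>. \<open>A1\<close> and \<open>A2\<close> collect the terms of the former,
  \<open>A3\<close> and \<open>A4\<close> those of the latter. Every term carries the factor
  \<delta>, which cancels against the coercivity \<open>\<delta> * c0\<close>; what remains is a
  quadratic inequality for the norm of \<open>ch * u\<close>.\<close>

lemma interior_estimate:
 assumes \<chi>: "test_fun V1 ch" "V1 \<in> sets borel" "!!x. 0 <= ch x" "!!x. ch x <= B0" "!!x. norm (gradv ch x) <= B1"
  and \<delta>: "0 < \<delta>" "0 < c0" "!!x. x \<in> V1 ==> \<beta> x <= \<delta> * M" "!!x. x \<in> V1 ==> \<delta> * c0 <= \<beta> x"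
  and E: "ip u w <= E"
  and A: "A1 = 4 * B1\<^sup>2 * M * E + M * B0\<^sup>2 * (LBINT x. (ub x)\<^sup>2)" "A2 = 2 * B0 * sqrt (ip f f) * M"
   "A3 = B0 * sqrt (ip ubT ubT) * M + B0 * sqrt (ip f f) * T * M" "A4 = 2 * B1 * T * sqrt (M * E)"
 shows "ip (%z. ch (fst z) * u z) (%z. ch (fst z) * u z) <= ((A3 + A4 * A2) / c0)\<^sup>2 + 2 * (A4 * (1 + A1)) / c0"
proof -
 note k = kern_kback[OF T]
 let ?J = "LBINT x. (ub x)\<^sup>2"
 define F where "F = sqrt (ip f f)"
 define Ub where "Ub = sqrt (ip ubT ubT)"
 \<comment> \<open>Bound for the norm of \<open>w\<close> over \<open>V1\<close>, since there w^2 =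
   \<beta> u w \<le> \<delta> M u w.\<close>
 define R where "R = sqrt (\<delta> * (M * E))"
 have B0: "0 <= B0" using \<chi>(3,4) order_trans by blast
 have B1: "0 <= B1" using \<chi>(5) norm_ge_zero order_trans by blast
 have E0: "0 <= E" using uw_nonneg E by linarith
 have F: "0 <= F" "ip f f = F\<^sup>2" by (auto simp: F_def ip_nonneg)
 have Ub: "0 <= Ub" "ip ubT ubT = Ub\<^sup>2" by (auto simp: Ub_def ip_nonneg)
 have ME: "0 <= M * E" using M0 E0 by simp
 have R: "0 <= R" "R\<^sup>2 = \<delta> * (M * E)" using \<delta>(1) ME by (auto simp: R_def)
 have ca: "\<bar>ch x\<bar> <= B0" for x using \<chi>(3,4) by simp
 have cm: "ch \<in> BM" by (rule test_fun_meas[OF \<chi>(1)])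
 have sm: "smooth_on UNIV ch" by (rule test_fun_smooth[OF \<chi>(1)])
 have gm: "gradv ch \<in> BM" by (rule gradv_meas[OF \<chi>(1)])
 have cout: "ch x = 0" if "x \<notin> V1" for x by (rule test_fun_outside[OF \<chi>(1) that])
 have gout: "gradv ch x = 0" if "x \<notin> V1" for x
  unfolding gradv_def by (intro sum.neutral ballI) (simp add: test_fun_outside[OF test_fun_frechet[OF \<chi>(1)] that])
 define xu where "xu z = ch (fst z) * u z" for z
 define xw where "xw z = ch (fst z) * w z" for z
 define xf where "xf z = ch (fst z) * f z" for z
 define xb where "xb z = ch (fst z) * ubT z" for z
 define g where "g z = ch (fst z) *\<^sub>R G z" for z
 define w1 where "w1 z = ind V1 (fst z) * w z" for z
 define kk where "kk z = w1 z *\<^sub>R gradv ch (fst z)" for z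
 have im: "ind V1 \<in> BM" using \<chi>(2) by simp
 have sxu: "sqi xu" unfolding xu_def[abs_def] by (rule sqi_xmult_real[OF u(1) cm ca])
 have sxw: "sqi xw" unfolding xw_def[abs_def] by (rule sqi_xmult_real[OF w_sqi cm ca])
 have sxf: "sqi xf" unfolding xf_def[abs_def] by (rule sqi_xmult_real[OF f(1) cm ca])
 have sxb: "sqi xb" unfolding xb_def[abs_def] by (rule sqi_xmult_real[OF ubT_sqi cm ca])
 have sg: "sqi g" unfolding g_def[abs_def] by (rule sqi_xmult[OF G(1) cm ca])
 have sw1: "sqi w1" unfolding w1_def[abs_def] by (rule sqi_xmult_real[OF w_sqi im, where B=1]) (simp add: indicator_def)
 have skk: "sqi kk" unfolding kk_def[abs_def] by (rule sqi_xvec[OF sw1 gm \<chi>(5)])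
 define y where "y = sqrt (ip xu xu)"
 have y: "0 <= y" "ip xu xu = y\<^sup>2" by (auto simp: y_def ip_nonneg)
 define s where "s = sqrt (ip g g)"
 have s: "0 <= s" "ip g g = s\<^sup>2" by (auto simp: s_def ip_nonneg)
 have nxw: "ip xw xw <= (\<delta> * M * y)\<^sup>2"
 proof -
  have "ip xw xw <= (\<delta> * M)\<^sup>2 * ip xu xu"
  proof (rule ip_mono_scaled[OF sxu sqi_meas[OF sxw]])
   fix z
   show "norm (xw z) <= \<delta> * M * norm (xu z)"
   proof (cases "fst z \<in> V1")
    case True
    have "norm (xw z) = \<beta> (fst z) * norm (xu z)" using \<beta>0[of "fst z"] by (simp add: xw_def xu_def w_def abs_mult)
    also have "\<dots> <= \<delta> * M * norm (xu z)" by (rule mult_right_mono[OF \<delta>(3)[OF True]]) simp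
    finally show ?thesis .
   qed (simp add: xw_def xu_def cout)
  qed (use \<delta> M0 in simp)
  then show ?thesis by (simp add: y power_mult_distrib)
 qed
 have sc: "ip (%z. ch (fst z) * h z) (%z. ch (fst z) * h z) <= B0\<^sup>2 * ip h h" if "sqi h" for h :: "'a \<times> real => real"
  by (rule ip_mono_scaled[OF that sqi_meas[OF sqi_xmult_real[OF that cm ca]] _ B0]) (simp add: abs_mult ca mult_right_mono)
 have nxf: "ip xf xf <= (B0 * F)\<^sup>2" using sc[OF f(1)] F(2) by (simp add: xf_def[abs_def] power_mult_distrib)
 have nxb: "ip xb xb <= (B0 * Ub)\<^sup>2" using sc[OF ubT_sqi] Ub(2) by (simp add: xb_def[abs_def] power_mult_distrib)
 have nw1: "ip w1 w1 <= R\<^sup>2"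
 proof -
  have "ip w1 w1 <= (LBINT z. (\<delta> * M) * (u z \<bullet> w z))"
   unfolding ip_def
  proof (rule integral_mono)
   show "integrable lborel (%z. w1 z \<bullet> w1 z)" by (rule ip_integrable[OF sw1 sw1])
   show "integrable lborel (%z. (\<delta> * M) * (u z \<bullet> w z))" by (intro integrable_mult_right ip_integrable u w_sqi)
   fix z
   have nn: "0 <= \<beta> (fst z) * (u z)\<^sup>2" using \<beta>0[of "fst z"] by simp
   show "w1 z \<bullet> w1 z <= (\<delta> * M) * (u z \<bullet> w z)"
   proof (cases "fst z \<in> V1")
    case True
    have "\<beta> (fst z) * (\<beta> (fst z) * (u z)\<^sup>2) <= (\<delta> * M) * (\<beta> (fst z) * (u z)\<^sup>2)" by (rule mult_right_mono[OF \<delta>(3)[OF True] nn])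
    then show ?thesis using True by (simp add: w1_def w_def power2_eq_square ac_simps)
   next
    case False
    have "0 <= (\<delta> * M) * (\<beta> (fst z) * (u z)\<^sup>2)" using nn \<delta>(1) M0 by simp
    then show ?thesis using False by (simp add: w1_def w_def power2_eq_square ac_simps)
   qed
  qed
  also have "\<dots> = (\<delta> * M) * ip u w" by (simp add: ip_def)
  also have "\<dots> <= (\<delta> * M) * E" using E \<delta>(1) M0 by (intro mult_left_mono) auto
  finally show ?thesis by (simp add: R)
 qed
 have nkk: "ip kk kk <= (B1 * R)\<^sup>2"
 proof -
  have "ip kk kk <= B1\<^sup>2 * ip w1 w1"
  proof (rule ip_mono_scaled[OF sw1 sqi_meas[OF skk] _ B1])
   show "norm (kk z) <= B1 * norm (w1 z)" for z
    using mult_right_mono[OF \<chi>(5)[of "fst z"], of "\<bar>w1 z\<bar>"] by (simp add: kk_def mult.commute)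
  qed
  also have "\<dots> <= B1\<^sup>2 * R\<^sup>2" by (intro mult_left_mono nw1) simp
  finally show ?thesis by (simp add: power_mult_distrib)
 qed
 \<comment> \<open>The gradient of the square keeps one factor \<open>ch\<close>, so that it meets
   the localised gradient \<open>g\<close> and not \<open>G\<close> itself.\<close>
 let ?\<theta> = "%x. ch x * ch x"
 have g\<theta>: "gradv ?\<theta> x = (2 * ch x) *\<^sub>R gradv ch x" for x
  unfolding gradv_mult[OF sm sm] by (simp add: scaleR_2[symmetric] flip: scaleR_scaleR)
 have \<theta>: "smooth_weight ?\<theta>"
  unfolding smooth_weight_def
 proof (intro conjI allI)
  show "smooth_on UNIV ?\<theta>" by (rule smooth_on_mult[OF sm sm])
  show "0 <= ?\<theta> x" for x by simp
  show "\<exists>B. \<forall>x. \<bar>?\<theta> x\<bar> <= B"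
   by (rule exI[of _ "B0 * B0"], rule allI, simp only: abs_mult, rule mult_mono[OF ca ca B0 abs_ge_zero])
  show "gradv ?\<theta> \<in> BM" unfolding g\<theta>[abs_def] using cm gm by measurable
  show "\<exists>B. \<forall>x. norm (gradv ?\<theta> x) <= B"
  proof (intro exI[of _ "2 * B0 * B1"] allI)
   fix x show "norm (gradv ?\<theta> x) <= 2 * B0 * B1"
    unfolding g\<theta> using ca[of x] \<chi>(5)[of x] B0 B1 by (simp add: abs_mult mult_mono)
  qed
 qed
 have e1: "ip (%z. ?\<theta> (fst z) *\<^sub>R G z) G = ip g g" by (simp add: ip_def g_def mult.assoc)
 have e2: "ip (%z. G z \<bullet> gradv ?\<theta> (fst z)) w = 2 * ip g kk"
 proof -
  have "(G z \<bullet> gradv ?\<theta> (fst z)) \<bullet> w z = 2 * (g z \<bullet> kk z)" for z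
   by (cases "fst z \<in> V1") (simp_all add: g\<theta> g_def kk_def w1_def gout ac_simps)
  then show ?thesis by (simp add: ip_def)
 qed
 have e3: "ip (%z. ?\<theta> (fst z) * f z) w = ip xf xw" by (simp add: ip_def xf_def xw_def ac_simps)
 have e4: "(LBINT x. ?\<theta> x * \<beta> x * (ub x)\<^sup>2) <= \<delta> * M * B0\<^sup>2 * ?J"
 proof -
  have "(LBINT x. ?\<theta> x * \<beta> x * (ub x)\<^sup>2) <= (LBINT x. \<delta> * M * B0\<^sup>2 * (ub x)\<^sup>2)"
  proof (rule integral_mono')
   show "integrable lborel (%x. \<delta> * M * B0\<^sup>2 * (ub x)\<^sup>2)" using sqi_int[OF ub(1)] by simp
   show "0 <= \<delta> * M * B0\<^sup>2 * (ub x)\<^sup>2" for x using \<delta>(1) M0 by simp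
   show "?\<theta> x * \<beta> x * (ub x)\<^sup>2 <= \<delta> * M * B0\<^sup>2 * (ub x)\<^sup>2" for x
   proof (rule mult_right_mono)
    show "?\<theta> x * \<beta> x <= \<delta> * M * B0\<^sup>2"
    proof (cases "x \<in> V1")
     case True
     have "?\<theta> x * \<beta> x <= (B0 * B0) * (\<delta> * M)"
      by (intro mult_mono \<chi>(3,4) \<delta>(3)[OF True] B0 less_imp_le[OF \<beta>0]) (use B0 in auto)
     then show ?thesis by (simp add: power2_eq_square ac_simps)
    qed (use \<delta>(1) M0 in \<open>simp add: cout\<close>)
   qed simp
  qed
  then show ?thesis by simp
 qed
 have dMy: "0 <= \<delta> * M * y" using \<delta>(1) M0 y(1) by simp
 have p1: "\<bar>ip xf xw\<bar> <= (B0 * F) * (\<delta> * M * y)"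
  by (rule ip_abs_le[OF sxf sxw nxf nxw]) (use B0 F dMy in auto)
 \<comment> \<open>The weight 1/2 lets half of \<open>ip g g\<close> absorb the mixed term.\<close>
 have p2: "2 * \<bar>ip g kk\<bar> <= (1/2) * ip g g + ip kk kk / (1/2)" by (rule ip_young[OF sg skk]) simp
 have "s\<^sup>2 <= \<delta> * (A1 + A2 * y)"
 proof -
  have "s\<^sup>2 + 2 * ip g kk <= ip xf xw + (1/2) * (\<delta> * M * B0\<^sup>2 * ?J)"
   using energy_inequality[OF \<theta>] e4 unfolding e1 e2 e3 s(2) by linarith
  then have "s\<^sup>2 <= 2 * (2 * (B1 * R)\<^sup>2 + (B0 * F) * (\<delta> * M * y) + (1/2) * (\<delta> * M * B0\<^sup>2 * ?J))"
   using p1 p2 nkk s(2) by (simp add: abs_le_iff) linarith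
  also have "\<dots> = \<delta> * (A1 + A2 * y)"
   unfolding A F_def[symmetric] power_mult_distrib R(2) by (simp add: algebra_simps)
  finally show ?thesis .
 qed
 have A1: "0 <= A1" and A2: "0 <= A2" and A4: "0 <= A4"
 proof -
  have J0: "0 <= ?J" by simp
  show "0 <= A1" unfolding A using M0 E0 J0 by (intro add_nonneg_nonneg mult_nonneg_nonneg) auto
  show "0 <= A2" "0 <= A4" unfolding A using M0 B0 B1 T ME by (auto intro!: mult_nonneg_nonneg simp: ip_nonneg)
 qed
 \<comment> \<open>Each of \<open>s\<close> and \<open>R\<close> contributes a factor sqrt \<delta>.
   The inequality \<open>sqrt q \<le> 1 + q\<close> keeps the bound affine in
   \<open>y\<close>.\<close>
 have sR: "s * R <= \<delta> * sqrt (M * E) * (1 + A1 + A2 * y)"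
 proof -
  define q where "q = A1 + A2 * y"
  have q: "0 <= q" using A1 A2 y(1) by (simp add: q_def)
  have "s <= sqrt (\<delta> * q)" using \<open>s\<^sup>2 <= \<delta> * (A1 + A2 * y)\<close> by (simp add: q_def real_le_rsqrt)
  also have "\<dots> = sqrt \<delta> * sqrt q" by (rule real_sqrt_mult)
  also have "\<dots> <= sqrt \<delta> * (1 + q)"
  proof (intro mult_left_mono)
   have "q <= (1 + q)\<^sup>2" using q by (simp add: power2_eq_square algebra_simps)
   then show "sqrt q <= 1 + q" using q by (intro real_le_lsqrt) auto
  qed (use \<delta>(1) in simp)
  finally have "s * R <= (sqrt \<delta> * (1 + q)) * R" by (rule mult_right_mono) (rule R(1))
  also have "\<dots> = (sqrt \<delta> * sqrt \<delta>) * sqrt (M * E) * (1 + q)" by (simp add: R_def real_sqrt_mult ac_simps)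
  also have "sqrt \<delta> * sqrt \<delta> = \<delta>" using \<delta>(1) by simp
  finally show ?thesis by (simp add: q_def add.assoc)
 qed
 have f1: "ip v (%z. ?\<theta> (fst z) * w z) = ip u (%z. ?\<theta> (fst z) * w z) - ip xb xw"
 proof -
  have t: "sqi (%z. ?\<theta> (fst z) * w z)"
  proof (rule sqi_xmult_real[OF w_sqi])
   show "(%x. ?\<theta> x) \<in> BM" using cm by measurable
   show "\<bar>?\<theta> x\<bar> <= B0 * B0" for x by (simp only: abs_mult) (rule mult_mono[OF ca ca B0 abs_ge_zero])
  qed
  have "ip ubT (%z. ?\<theta> (fst z) * w z) = ip xb xw" by (simp add: ip_def xb_def xw_def ac_simps)
  then show ?thesis unfolding v_def[abs_def] ip_diff_left[OF u(1) ubT_sqi t] by simp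
 qed
 have f2: "\<delta> * c0 * y\<^sup>2 <= ip u (%z. ?\<theta> (fst z) * w z)"
 proof -
  have "\<delta> * c0 * y\<^sup>2 = (LBINT z. \<delta> * c0 * (xu z \<bullet> xu z))" unfolding y(2)[symmetric] by (simp add: ip_def)
  also have "\<dots> <= (LBINT z. xu z \<bullet> xw z)"
  proof (rule integral_mono)
   show "integrable lborel (%z. \<delta> * c0 * (xu z \<bullet> xu z))" by (intro integrable_mult_right ip_integrable sxu)
   show "integrable lborel (%z. xu z \<bullet> xw z)" by (rule ip_integrable[OF sxu sxw])
   fix z
   show "\<delta> * c0 * (xu z \<bullet> xu z) <= xu z \<bullet> xw z"
   proof (cases "fst z \<in> V1")
    case True
    have "\<delta> * c0 * (xu z)\<^sup>2 <= \<beta> (fst z) * (xu z)\<^sup>2" by (rule mult_right_mono[OF \<delta>(4)[OF True]]) simp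
    then show ?thesis by (simp add: xu_def xw_def w_def power2_eq_square ac_simps)
   qed (simp add: xu_def xw_def cout)
  qed
  also have "\<dots> = ip u (%z. ?\<theta> (fst z) * w z)" by (simp add: ip_def xu_def xw_def ac_simps)
  finally show ?thesis .
 qed
 have f3: "0 <= ip (%z. ?\<theta> (fst z) *\<^sub>R G z) (tk (kback T) G)"
 proof -
  have "tk (kback T) g z = ch (fst z) *\<^sub>R tk (kback T) G z" for z
   unfolding g_def[abs_def] by (rule tk_xmult)
  then have "ip (%z. ?\<theta> (fst z) *\<^sub>R G z) (tk (kback T) G) = ip g (tk (kback T) g)" by (simp add: ip_def g_def mult.assoc)
  also have "\<dots> \<ge> 0" by (rule back_nonneg[OF T sg]) (simp add: g_def G(2)[OF snd_out])
  finally show ?thesis .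
 qed
 have f4: "\<bar>ip (%z. G z \<bullet> gradv ?\<theta> (fst z)) (tk (kback T) w)\<bar> <= 2 * ((B1 * s) * (T * R))"
 proof -
  let ?a = "%z. g z \<bullet> gradv ch (fst z)"
  have sa: "sqi ?a" by (rule sqi_xinner[OF sg gm \<chi>(5)])
  have tw: "tk (kback T) w1 z = ind V1 (fst z) * tk (kback T) w z" for z
   unfolding w1_def[abs_def] by (rule tk_xmult_real)
  have "(G z \<bullet> gradv ?\<theta> (fst z)) \<bullet> tk (kback T) w z = 2 * (?a z \<bullet> tk (kback T) w1 z)" for z
   by (cases "fst z \<in> V1") (simp_all add: g\<theta> g_def tw gout)
  then have "ip (%z. G z \<bullet> gradv ?\<theta> (fst z)) (tk (kback T) w) = 2 * ip ?a (tk (kback T) w1)" by (simp add: ip_def)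
  moreover have "\<bar>ip ?a (tk (kback T) w1)\<bar> <= (B1 * s) * (T * R)"
  proof (rule ip_abs_le[OF sa tk_schur(1)[OF k sw1]])
   have "ip ?a ?a <= B1\<^sup>2 * ip g g"
   proof (rule ip_mono_scaled[OF sg sqi_meas[OF sa] _ B1])
    show "norm (?a z) <= B1 * norm (g z)" for z
     using Cauchy_Schwarz_ineq2[of "g z" "gradv ch (fst z)"] mult_left_mono[OF \<chi>(5)[of "fst z"] norm_ge_zero[of "g z"]] by (simp add: mult.commute)
   qed
   then show "ip ?a ?a <= (B1 * s)\<^sup>2" by (simp add: s(2) power_mult_distrib)
   have "ip (tk (kback T) w1) (tk (kback T) w1) <= T\<^sup>2 * ip w1 w1" by (rule tk_schur(2)[OF k sw1])
   also have "\<dots> <= T\<^sup>2 * R\<^sup>2" by (intro mult_left_mono nw1) simp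
   finally show "ip (tk (kback T) w1) (tk (kback T) w1) <= (T * R)\<^sup>2" by (simp add: power_mult_distrib)
  qed (use B1 s T R in auto)
  ultimately show ?thesis by (simp add: abs_mult)
 qed
 have f5: "\<bar>ip (%z. ?\<theta> (fst z) * f z) (tk (kback T) w)\<bar> <= (B0 * F) * (T * (\<delta> * M * y))"
 proof -
  have "tk (kback T) xw z = ch (fst z) * tk (kback T) w z" for z
   unfolding xw_def[abs_def] by (rule tk_xmult_real)
  then have "ip (%z. ?\<theta> (fst z) * f z) (tk (kback T) w) = ip xf (tk (kback T) xw)" by (simp add: ip_def xf_def ac_simps)
  moreover have "\<bar>ip xf (tk (kback T) xw)\<bar> <= (B0 * F) * (T * (\<delta> * M * y))"
  proof (rule ip_abs_le[OF sxf tk_schur(1)[OF k sxw] nxf])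
   have "ip (tk (kback T) xw) (tk (kback T) xw) <= T\<^sup>2 * ip xw xw" by (rule tk_schur(2)[OF k sxw])
   also have "\<dots> <= T\<^sup>2 * (\<delta> * M * y)\<^sup>2" by (intro mult_left_mono nxw) simp
   finally show "ip (tk (kback T) xw) (tk (kback T) xw) <= (T * (\<delta> * M * y))\<^sup>2" by (simp add: power_mult_distrib)
  qed (use B0 F T dMy in auto)
  ultimately show ?thesis by simp
 qed
 have f6: "\<bar>ip xb xw\<bar> <= (B0 * Ub) * (\<delta> * M * y)"
  by (rule ip_abs_le[OF sxb sxw nxb nxw]) (use B0 Ub dMy in auto)
 have "\<delta> * c0 * y\<^sup>2 <= (B0 * Ub) * (\<delta> * M * y) + (B0 * F) * (T * (\<delta> * M * y)) + 2 * ((B1 * s) * (T * R))"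
  using integrated_energy[OF \<theta>] f1 f2 f3 f4 f5 f6 by (simp add: abs_le_iff)
 also have "\<dots> = \<delta> * (A3 * y) + 2 * B1 * T * (s * R)"
  unfolding A F_def[symmetric] Ub_def[symmetric] by (simp add: algebra_simps)
 also have "\<dots> <= \<delta> * (A3 * y) + 2 * B1 * T * (\<delta> * sqrt (M * E) * (1 + A1 + A2 * y))"
  using B1 T by (intro add_left_mono mult_left_mono sR) auto
 also have "\<dots> = \<delta> * (A3 * y + A4 * (1 + A1 + A2 * y))" unfolding A(4) by (simp add: algebra_simps)
 finally have "\<delta> * (c0 * y\<^sup>2) <= \<delta> * (A3 * y + A4 * (1 + A1 + A2 * y))" by (simp add: mult.assoc)
 then have "c0 * y\<^sup>2 <= A3 * y + A4 * (1 + A1 + A2 * y)" using \<delta>(1) by simp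
 also have "\<dots> = (A3 + A4 * A2) * y + A4 * (1 + A1)" by (simp add: algebra_simps)
 finally have main: "c0 * y\<^sup>2 <= (A3 + A4 * A2) * y + A4 * (1 + A1)" .
 \<comment> \<open>From \<open>y^2 \<le> P y + Q\<close> and \<open>2 P y \<le> P^2 + y^2\<close>
   follows \<open>y^2 \<le> P^2 + 2 Q\<close>.\<close>
 define P where "P = (A3 + A4 * A2) / c0"
 define Q where "Q = A4 * (1 + A1) / c0"
 have "(c0 * y\<^sup>2) / c0 <= ((A3 + A4 * A2) * y + A4 * (1 + A1)) / c0"
  by (rule divide_right_mono[OF main less_imp_le[OF \<delta>(2)]])
 then have "y\<^sup>2 <= P * y + Q" using \<delta>(2) by (simp add: P_def Q_def add_divide_distrib distrib_right)
 moreover have "2 * (P * y) <= P\<^sup>2 + y\<^sup>2" using sum_squares_bound[of P y] by simp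
 ultimately have "y\<^sup>2 <= P\<^sup>2 + 2 * Q" by linarith
 then show ?thesis using y(2) by (simp add: P_def Q_def xu_def[abs_def])
qed

end

section \<open>Pairs of functions, and weak gradients of products\<close>

lemma sqi_pair:
 assumes "sqi f" "sqi g" shows "sqi (%z. (f z, g z))"
proof (rule sqi_dominated)
 have "f \<in> BM" "g \<in> BM" using assms by (auto simp: sqi_def)
 then show "(%z. (f z, g z)) \<in> BM" by (rule borel_measurable_Pair)
 show "integrable lborel (%z. (norm (f z))\<^sup>2 + (norm (g z))\<^sup>2)" using sqi_int[OF assms(1)] sqi_int[OF assms(2)] by simp
 show "(norm (f z, g z))\<^sup>2 <= (norm (f z))\<^sup>2 + (norm (g z))\<^sup>2" for z by (simp add: norm_Pair)
qed

lemma ip_pair: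
 assumes "sqi f" "sqi g" "sqi f'" "sqi g'"
 shows "ip (%z. (f z, g z)) (%z. (f' z, g' z)) = ip f f' + ip g g'"
 unfolding ip_def inner_Pair by (rule Bochner_Integration.integral_add) (use assms in auto)

lemma sqi_fst_snd:
 fixes f :: "_ => 'c::euclidean_space \<times> 'd::euclidean_space"
 assumes "sqi f" shows "sqi (%z. fst (f z))" "sqi (%z. snd (f z))"
proof -
 have m [measurable]: "f \<in> borel_measurable (borel)" by (rule sqi_meas[OF assms])
 have "f \<in> borel \<rightarrow>\<^sub>M (borel \<Otimes>\<^sub>M borel)" unfolding borel_prod by (rule m)
 note this[measurable]
 have m2: "(%z. fst (f z)) \<in> BM" "(%z. snd (f z)) \<in> BM" by measurable
 have n: "norm (fst y) <= norm y" "norm (snd y) <= norm y" for y :: "'c \<times> 'd"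
  by (cases y, simp add: norm_fst_le norm_snd_le)+
 show "sqi (%z. fst (f z))" "sqi (%z. snd (f z))"
  by (rule sqi_bound[OF assms m2(1), where c=1], simp only: mult_1 n)
    (rule sqi_bound[OF assms m2(2), where c=1], simp only: mult_1 n)
qed

lemma AE_fst:
 assumes "AE x in lborel. P x" shows "AE z in lborel. P (fst (z :: 'a::euclidean_space \<times> real))"
proof -
 obtain N where N: "N \<in> null_sets lborel" "{x. \<not> P x} \<subseteq> N" using assms by (auto simp: eventually_ae_filter)
 have "(%z::'a\<times>real. ind N (fst z)) \<in> BM" by (rule fst_meas) (use N(1) in auto)
 moreover have "{z::'a\<times>real. fst z \<notin> N} = (%z. ind N (fst z)) -` {0} \<inter> space borel"
  by (auto simp: indicator_def)
 ultimately have p: "Measurable.pred borel (%z::'a\<times>real. fst z \<notin> N)"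
  using measurable_sets[of "%z::'a\<times>real. ind N (fst z)" borel borel "{0}"] by (simp add: pred_def)
 have "AE x in lborel. AE t in lborel. fst (x, t::real) \<notin> N" using AE_not_in[OF N(1)] by eventually_elim simp
 from AE_pair_slices[OF p this] show ?thesis by eventually_elim (use N(2) in auto)
qed

text \<open>Difference quotients have integral 0 by translation invariance; the mean value theorem
  bounds them by the supremum of the derivative on one fixed box, so dominated convergence
  applies.\<close>

lemma test_fun_integral_deriv:
 fixes p :: "'a::euclidean_space => real"
 assumes p: "test_fun V p"
 shows "(LBINT x. fder p x i) = 0"
proof -
 let ?D = "%x. fder p x i"
 have ip: "integrable lborel p" if "test_fun V p" for p :: "'a => real"
 proof -
  have b: "bounded (closure {x. p x \<noteq> 0})" using that by (auto simp: test_fun_def compact_imp_bounded)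
  obtain a where a: "closure {x. p x \<noteq> 0} \<subseteq> cbox (-a) a" using bounded_subset_cbox_symmetric[OF b] by blast
  have "sqi (ind (cbox (-a) a))" by (rule indicator_sqi) (auto simp: emeasure_lborel_cbox_eq)
  from ip_integrable_real[OF test_fun_sqi[OF that] this]
  have "integrable lborel (%x. p x * ind (cbox (-a) a) x)" .
  moreover have "(%x. p x * ind (cbox (-a) a) x) = p"
   using a closure_subset[of "{x. p x \<noteq> 0}"] by (fastforce simp: indicator_def)
  ultimately show ?thesis by simp
 qed
 obtain B where B: "B > 0" "!!x. \<bar>?D x\<bar> <= B" using test_fun_bounded[OF test_fun_frechet[OF p]] by blast
 define h where "h n = 1 / real (Suc n)" for n
 have h: "0 < h n" "h n <= 1" for n by (auto simp: h_def)
 have h0: "h ~~> 0" using LIMSEQ_inverse_real_of_nat by (simp add: h_def[abs_def] inverse_eq_divide)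
 let ?q = "%n x. (p (x + h n *\<^sub>R i) - p x) / h n"
 have line: "((%s. p (x + s *\<^sub>R i)) has_real_derivative fder p (x + s *\<^sub>R i) i) (at s)" for x s
 proof -
  have "((%s. x + s *\<^sub>R i) has_derivative (%s. s *\<^sub>R i)) (at s)" by (auto intro!: derivative_eq_intros)
  from has_derivative_compose[OF this smooth_on_has_derivative[OF test_fun_smooth[OF p]]]
  have "((%s. p (x + s *\<^sub>R i)) has_derivative (%r. fder p (x + s *\<^sub>R i) (r *\<^sub>R i))) (at s)" .
  moreover have "fder p y (r *\<^sub>R i) = fder p y i * r" for y r
   using linear_scale[OF has_derivative_linear[OF smooth_on_has_derivative[OF test_fun_smooth[OF p]]], of y r i] by (simp add: mult.commute)
  ultimately show ?thesis by (simp add: has_field_derivative_def mult_commute_abs)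
 qed
 \<comment> \<open>The set contains all points that a step s i with 0 \<le> s \<le> 1 carries into
   the support.\<close>
 have "bounded ((%(x, y). x - y) ` (closure {x. p x \<noteq> 0} \<times> cball 0 (norm i)))"
  using p by (intro compact_imp_bounded compact_continuous_image compact_Times)
    (auto simp: test_fun_def split_def intro!: continuous_intros)
 then obtain a where a: "(%(x, y). x - y) ` (closure {x. p x \<noteq> 0} \<times> cball 0 (norm i)) \<subseteq> cbox (-a) a"
  using bounded_subset_cbox_symmetric by blast
 have supp: "p (x + s *\<^sub>R i) = 0" if "0 <= s" "s <= 1" "x \<notin> cbox (-a) a" for x s
 proof (rule ccontr)
  assume "p (x + s *\<^sub>R i) \<noteq> 0"
  then have "x + s *\<^sub>R i \<in> closure {x. p x \<noteq> 0}" using closure_subset[of "{x. p x \<noteq> 0}"] by auto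
  moreover have "s *\<^sub>R i \<in> cball 0 (norm i)" using that mult_right_mono[of s 1 "norm i"] by simp
  ultimately have "(x + s *\<^sub>R i) - s *\<^sub>R i \<in> cbox (-a) a" using a by (force simp: image_iff)
  then show False using that by simp
 qed
 have pm [measurable]: "p \<in> BM" by (rule test_fun_meas[OF p])
 have lim: "(%n. LBINT x. ?q n x) ~~> (LBINT x. ?D x)"
 proof (rule integral_dominated_convergence[where w="%x. B * ind (cbox (-a) a) x"])
  show "?D \<in> borel_measurable lborel" using test_fun_meas[OF test_fun_frechet[OF p]] by simp
  show "?q n \<in> borel_measurable lborel" for n by measurable
  show "integrable lborel (%x. B * ind (cbox (-a) a) x)"
   by (intro integrable_mult_right) (simp add: integrable_indicator_iff emeasure_lborel_cbox_eq)
  show "AE x in lborel. (%n. ?q n x) ~~> ?D x"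
  proof (rule AE_I2)
   fix x
   have "((%s. (p (x + s *\<^sub>R i) - p x) / s) \<longlongrightarrow> ?D x) (at 0)"
    using line[of x 0] by (simp add: DERIV_def)
   then show "(%n. ?q n x) ~~> ?D x"
    by (rule filterlim_compose) (use h h0 in \<open>auto simp: filterlim_at less_imp_neq[symmetric]\<close>)
  qed
  show "AE x in lborel. norm (?q n x) <= B * ind (cbox (-a) a) x" for n
  proof (rule AE_I2)
   fix x
   show "norm (?q n x) <= B * ind (cbox (-a) a) x"
   proof (cases "x \<in> cbox (-a) a")
    case False
    then show ?thesis using supp[of "h n" x] supp[of 0 x] h[of n] by simp
   next
    case True
    obtain t where "p (x + h n *\<^sub>R i) - p (x + 0 *\<^sub>R i) = (h n - 0) * fder p (x + t *\<^sub>R i) i"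
     using MVT2[OF h(1)[of n], of "%s. p (x + s *\<^sub>R i)" "%s. fder p (x + s *\<^sub>R i) i"] line by blast
    then have "?q n x = fder p (x + t *\<^sub>R i) i" using h(1)[of n] by simp
    then show ?thesis using B(2) True by simp
   qed
  qed
 qed
 have "(LBINT x. ?q n x) = 0" for n
 proof -
  have m: "(+) (h n *\<^sub>R i) \<in> measurable lborel borel" by simp
  have sh: "(LBINT x. p (h n *\<^sub>R i + x)) = (LBINT x. p x)" "integrable lborel (%x. p (h n *\<^sub>R i + x))"
   using integral_distr[OF m pm] integrable_distr_eq[OF m pm] ip[OF p] by (simp_all add: lborel_distr_plus)
  have "(LBINT x. ?q n x) = (LBINT x. p (h n *\<^sub>R i + x) - p x) / h n" by (simp add: add.commute)
  also have "(LBINT x. p (h n *\<^sub>R i + x) - p x) = 0"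
   using Bochner_Integration.integral_diff[OF sh(2) ip[OF p]] sh(1) by simp
  finally show ?thesis by simp
 qed
 then have "(%n. LBINT x. ?q n x) ~~> 0" by (simp only: tendsto_const)
 then show ?thesis by (rule LIMSEQ_unique[OF lim])
qed

text \<open>Integration by parts in space: the derivative of a product of two test functions has
  integral 0.\<close>

lemma wgrad_tensor:
 assumes P: "test_fun V P" and Q: "sqi Q"
 shows "wgrad V (P \<otimes> Q) (%z. Q (snd z) *\<^sub>R gradv P (fst z))"
proof (rule wgradI)
 fix p :: "'a => real" and q :: "real => real" and i :: 'a assume a: "test_fun V p" "sqi q" "i \<in> Basis"
 let ?DP = "%x. fder P x i" and ?Dp = "%x. fder p x i"
 have s: "sqi P" "sqi ?DP" "sqi p" "sqi ?Dp"
  using test_fun_sqi[OF P] test_fun_sqi[OF test_fun_frechet[OF P]] test_fun_sqi[OF a(1)] test_fun_sqi[OF test_fun_frechet[OF a(1)]] by auto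
 have "(%z. Q (snd z) *\<^sub>R gradv P (fst z) \<bullet> i) = (?DP \<otimes> Q)" using a(3) by auto
 then have "ip (P \<otimes> Q) (?Dp \<otimes> q) + ip (%z. Q (snd z) *\<^sub>R gradv P (fst z) \<bullet> i) (p \<otimes> q)
   = (ip P ?Dp + ip ?DP p) * ip Q q"
  using ip_tensor[OF s(1,4) Q a(2)] ip_tensor[OF s(2,3) Q a(2)] by (simp add: distrib_right)
 also have "ip P ?Dp + ip ?DP p = (LBINT x. P x * ?Dp x + ?DP x * p x)"
  unfolding ip_def using ip_integrable_real[OF s(1,4)] ip_integrable_real[OF s(2,3)] by simp
 also have "\<dots> = (LBINT x. fder (%x. P x * p x) x i)"
  using frechet_derivative_eqI[OF has_derivative_mult[OF smooth_on_has_derivative[OF test_fun_smooth[OF P]] smooth_on_has_derivative[OF test_fun_smooth[OF a(1)]]]]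
  by simp
 also have "\<dots> = 0" by (rule test_fun_integral_deriv[OF test_fun_mult[OF a(1) test_fun_smooth[OF P]]])
 finally show "ip (P \<otimes> Q) (?Dp \<otimes> q) + ip (%z. Q (snd z) *\<^sub>R gradv P (fst z) \<bullet> i) (p \<otimes> q) = 0"
  by simp
qed

subsection \<open>The degenerate limit\<close>

text \<open>The solutions along a sequence of parameters. As the frontier of \<open>V1\<close> is a
  null set, \<open>V1\<close> and its exterior part fill \<open>V\<close> up to a null set, and
  every pairing splits in two.\<close>

locale delta_family =
 fixes V V1 :: "'a::euclidean_space set" and T c0 M :: real and b :: "'a => real"
  and f :: "'a \<times> real => real" and ub :: "'a => real" and \<delta> :: "nat => real"
  and u :: "nat => 'a \<times> real => real" and G :: "nat => 'a \<times> real => 'a" and D :: "nat => 'a \<times> real => real"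
 assumes V: "open V" and V1: "open V1" "closure V1 \<subseteq> V" "frontier V1 \<in> null_sets lborel"
  and b: "b \<in> BM" "!!x. c0 <= b x" "!!x. b x <= M" and c0: "0 < c0" and T: "T > 0"
  and \<delta>: "!!n. 0 < \<delta> n" "!!n. \<delta> n <= 1" "\<delta> ~~> 0"
  and sol: "!!n. heat_sol V T (\<delta> n * c0) M (%x. if x \<in> V1 then \<delta> n * b x else b x) f ub (u n) (G n) (D n)"
begin

definition "V2 = V - closure V1"
definition "\<beta> n x = (if x \<in> V1 then \<delta> n * b x else b x)"
definition "uT z = ub (fst z) * ind {0<..<T} (snd z)"
definition "w n z = \<beta> n (fst z) * u n z"
definition "J = (LBINT x. (ub x)\<^sup>2)"
definition "E = 4 * M * (ip uT uT + T\<^sup>2 * ip f f)"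
definition "m z = ind (cyl V2 0 T) z"
definition "m1 z = ind (cyl V1 0 T) z"
definition "F z = uT z + tk (kT (kback T)) f z"
text \<open>The factor t is that of \<open>tD_estimate\<close>. Its weight \<beta> is bounded below
  independently of \<open>n\<close> only over \<open>V2\<close>, hence the restriction.\<close>

definition "xD n z = ind V2 (fst z) * (snd z * D n z)"

lemma hs: "heat_sol V T (\<delta> n * c0) M (\<beta> n) f ub (u n) (G n) (D n)"
 unfolding \<beta>_def[abs_def] by (rule sol)

lemma b0: "0 < b x" using c0 b(2)[of x] by linarith
lemma M0: "0 < M" using b0 b(3) order_less_le_trans by blast
lemma V2: "open V2" "V2 \<subseteq> V" "V1 \<subseteq> V" "V2 \<inter> V1 = {}"
 unfolding V2_def using V V1 closure_subset[of V1] by (auto intro: open_Diff)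
lemma cyl_mono: "A \<subseteq> B ==> z \<notin> cyl B s t ==> z \<notin> cyl A s t" by (auto simp: cyl_def)
lemma f: "sqi f" "z \<notin> cyl V 0 T ==> f z = 0" using heat_sol.f[OF hs[of 0]] by auto
lemma ub: "sqi ub" "x \<notin> V ==> ub x = 0" using heat_sol.ub[OF hs[of 0]] by auto
lemma u: "sqi (u n)" "z \<notin> cyl V 0 T ==> u n z = 0" using heat_sol.u[OF hs[of n]] by auto
lemma G: "sqi (G n)" "z \<notin> cyl V 0 T ==> G n z = 0" using heat_sol.G[OF hs[of n]] by auto
lemma uT_eq: "heat_sol.ubT T ub = uT"
 by (rule ext) (simp add: heat_sol.ubT_def[OF hs[of 0]] uT_def)
lemma w_eq: "heat_sol.w (\<beta> n) (u n) = w n"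
 by (rule ext) (simp add: heat_sol.w_def[OF hs[of n]] w_def)
lemma v_eq: "heat_sol.v T ub (u n) = (%z. u n z - uT z)"
 by (rule ext) (simp add: heat_sol.v_def[OF hs[of n]] uT_eq)
lemma w: "sqi (w n)" "z \<notin> cyl V 0 T ==> w n z = 0" "wgrad V (w n) (G n)"
 using heat_sol.w_sqi[OF hs[of n]] heat_sol.w_out[OF hs[of n]] heat_sol.wgw[OF hs[of n]] by (simp_all add: w_eq)
lemma uT: "sqi uT" "z \<notin> cyl V 0 T ==> uT z = 0"
 using heat_sol.ubT_sqi[OF hs[of 0]] heat_sol.ubT_out[OF hs[of 0]] by (simp_all add: uT_eq)
lemma uw: "ip (u n) (w n) <= E" using heat_sol.energy_1[OF hs[of n]] by (simp add: w_eq uT_eq E_def)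
lemma w_bound: "ip (w n) (w n) <= M * E"
 using heat_sol.w_norm[OF hs[of n]] mult_left_mono[OF uw[of n] less_imp_le[OF M0]] by (simp add: w_eq)
lemma G_bound: "ip (G n) (G n) <= ip f f + M * E + M * J"
 using heat_sol.energy_2[OF hs[of n]] w_bound[of n] by (simp add: w_eq J_def)
lemma integrated:
 assumes "sqi \<Psi>" "!!z. z \<notin> cyl V 0 T ==> \<Psi> z = 0" "sqi \<Phi>" "AE z in lborel. \<Phi> z = tk (kback T) \<Psi> z"
  "sqi G\<Phi>" "!!z. z \<notin> cyl V 0 T ==> G\<Phi> z = 0" "wgrad V \<Phi> G\<Phi>"
 shows "ip (u n) \<Psi> - ip uT \<Psi> + ip (G n) G\<Phi> = ip f \<Phi>"
 using heat_sol.integrated_eq[OF hs[of n] assms] ip_diff_left[OF u(1) uT(1) assms(1), of n] by (simp add: v_eq)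

lemma \<beta>_V2: "x \<notin> V1 ==> \<beta> n x = b x" by (simp add: \<beta>_def)
lemma \<beta>_V1: "x \<in> V1 ==> \<beta> n x = \<delta> n * b x" by (simp add: \<beta>_def)
lemma \<beta>_pos: "0 < \<beta> n x" using b0[of x] \<delta>(1)[of n] by (simp add: \<beta>_def)

lemma V2_borel: "V2 \<in> sets borel" using V2(1) by simp
lemma V1_borel: "V1 \<in> sets borel" using V1(1) by simp
lemma cyl2_borel: "cyl V2 0 T \<in> sets borel" by (rule cyl_borel[OF V2_borel])
lemma cyl1_borel: "cyl V1 0 T \<in> sets borel" by (rule cyl_borel[OF V1_borel])

lemma mult_m: "sqi h ==> sqi (%z. m z *\<^sub>R h z)"
 for h :: "'a \<times> real => 'c::euclidean_space"
 unfolding m_def by (rule sqi_indicator[OF _ cyl2_borel])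
lemma mult_m1: "sqi h ==> sqi (%z. m1 z *\<^sub>R h z)"
 for h :: "'a \<times> real => 'c::euclidean_space"
 unfolding m1_def by (rule sqi_indicator[OF _ cyl1_borel])
lemma mult_m_real: "sqi h ==> sqi (%z. m z * h z)" for h :: "'a \<times> real => real" using mult_m[of h] by simp
lemma mult_m1_real: "sqi h ==> sqi (%z. m1 z * h z)" for h :: "'a \<times> real => real" using mult_m1[of h] by simp

lemma AE_parts: "AE z in lborel. z \<in> cyl V 0 T --> m z + m1 z = 1"
proof -
 have "AE z in lborel. fst (z :: 'a \<times> real) \<notin> frontier V1" by (rule AE_fst[OF AE_not_in[OF V1(3)]])
 then show ?thesis
 proof eventually_elim
  case (elim z)
  show ?case
  proof
   assume z: "z \<in> cyl V 0 T"
   then have "fst z \<in> V" "0 < snd z" "snd z < T" by (auto simp: cyl_def)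
   moreover have "fst z \<in> V2 \<or> fst z \<in> V1"
    using elim \<open>fst z \<in> V\<close> V1(1) by (auto simp: V2_def frontier_def interior_open)
   moreover have "\<not> (fst z \<in> V2 \<and> fst z \<in> V1)" using V2(4) by blast
   ultimately show "m z + m1 z = 1" by (cases z) (auto simp: m_def m1_def cyl_def)
  qed
 qed
qed

lemma ip_split:
 fixes y h :: "'a \<times> real => 'c::euclidean_space"
 assumes y: "sqi y" "!!z. z \<notin> cyl V 0 T ==> y z = 0" and h: "sqi h"
 shows "ip y h = ip y (%z. m z *\<^sub>R h z) + ip y (%z. m1 z *\<^sub>R h z)"
proof -
 have "ip y h = ip y (%z. m z *\<^sub>R h z + m1 z *\<^sub>R h z)"
 proof (rule ip_cong_AE)
  show "AE z in lborel. y z \<bullet> h z = y z \<bullet> (m z *\<^sub>R h z + m1 z *\<^sub>R h z)"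
   using AE_parts
  proof eventually_elim
   case (elim z)
   show ?case
   proof (cases "z \<in> cyl V 0 T")
    case True then show ?thesis using elim by (simp add: scaleR_left_distrib[symmetric])
   qed (simp add: y(2))
  qed
 qed (use sqi_meas[OF y(1)] sqi_meas[OF h] sqi_meas[OF sqi_add[OF mult_m[OF h] mult_m1[OF h]]] in auto)
 then show ?thesis using ip_add_right[OF mult_m[OF h] mult_m1[OF h] y(1)] by simp
qed

text \<open>Over \<open>V2\<close> the coefficient does not depend on \<open>n\<close>, so weak
  limits of \<open>u\<close> can be read off from those of \<open>w\<close>.\<close>

lemma u_on_V2:
 assumes h: "sqi h" "!!z. z \<notin> cyl V2 0 T ==> h z = 0"
 shows "ip (u n) h = ip (w n) (%z. h z / b (fst z))"
 unfolding ip_def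
proof (rule int_cong)
 fix z
 show "u n z \<bullet> h z = w n z \<bullet> (h z / b (fst z))"
 proof (cases "z \<in> cyl V2 0 T")
  case True
  then have "fst z \<notin> V1" using V2(4) by (auto simp: cyl_def)
  then show ?thesis using b0[of "fst z"] by (simp add: w_def \<beta>_V2)
 qed (simp add: h(2))
qed

lemma div_b: "sqi h ==> sqi (%z. h z / b (fst z))" for h :: "'a \<times> real => real"
proof -
 assume h: "sqi h"
 have "(%x. 1 / b x) \<in> BM" using b(1) by measurable
 moreover have "\<bar>1 / b x\<bar> <= 1 / c0" for x using b0[of x] b(2)[of x] c0 by (simp add: frac_le)
 ultimately have "sqi (%z. (1 / b (fst z)) * h z)" by (rule sqi_xmult_real[OF h])
 then show ?thesis by simp
qed

lemma w_V1_bound: "\<bar>ip (w n) (%z. m1 z * h z)\<bar> <= sqrt (\<delta> n * (M * E)) * sqrt (ip h h)" if h: "sqi h"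
proof -
 have e: "ip (w n) (%z. m1 z * h z) = ip (%z. m1 z * w n z) h" by (simp add: ip_def ac_simps)
 have s: "sqi (%z. m1 z * w n z)" by (rule mult_m1_real[OF w(1)])
 have "ip (%z. m1 z * w n z) (%z. m1 z * w n z) <= (LBINT z. (\<delta> n * M) * (u n z \<bullet> w n z))"
  unfolding ip_def
 proof (rule integral_mono)
  show "integrable lborel (%z. (m1 z * w n z) \<bullet> (m1 z * w n z))" by (rule ip_integrable[OF s s])
  show "integrable lborel (%z. (\<delta> n * M) * (u n z \<bullet> w n z))" by (intro integrable_mult_right ip_integrable u w)
  fix z
  have nn: "0 <= \<beta> n (fst z) * (u n z)\<^sup>2" using \<beta>_pos[of n "fst z"] by simp
  show "(m1 z * w n z) \<bullet> (m1 z * w n z) <= (\<delta> n * M) * (u n z \<bullet> w n z)"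
  proof (cases "z \<in> cyl V1 0 T")
   case True
   then have "fst z \<in> V1" by (auto simp: cyl_def)
   then have "\<beta> n (fst z) <= \<delta> n * M" using b(3)[of "fst z"] \<delta>(1)[of n] by (simp add: \<beta>_V1)
   from mult_right_mono[OF this nn] show ?thesis using True by (simp add: m1_def w_def power2_eq_square ac_simps)
  next
   case False
   have "0 <= (\<delta> n * M) * (\<beta> n (fst z) * (u n z)\<^sup>2)" using nn \<delta>(1)[of n] M0 by simp
   then show ?thesis using False by (simp add: m1_def w_def power2_eq_square ac_simps)
  qed
 qed
 also have "\<dots> = (\<delta> n * M) * ip (u n) (w n)" by (simp add: ip_def)
 also have "\<dots> <= (\<delta> n * M) * E" using uw[of n] \<delta>(1)[of n] M0 by (intro mult_left_mono) auto
 finally have le: "ip (%z. m1 z * w n z) (%z. m1 z * w n z) <= \<delta> n * (M * E)" by (simp add: mult.assoc)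
 have "\<bar>ip (%z. m1 z * w n z) h\<bar> <= sqrt (ip (%z. m1 z * w n z) (%z. m1 z * w n z)) * sqrt (ip h h)"
  by (rule ip_cauchy_schwarz[OF s h])
 also have "\<dots> <= sqrt (\<delta> n * (M * E)) * sqrt (ip h h)" by (intro mult_right_mono real_sqrt_le_mono le) (simp add: ip_nonneg)
 finally show ?thesis unfolding e .
qed

lemma xD: "sqi (xD n)" "ip (xD n) (xD n) <= 2 * T * (M * T * ip f f + (ip f f + M * E + M * J)) / c0"
proof -
 have s: "sqi (%z. snd z * D n z)" by (rule heat_sol.tD_estimate(1)[OF hs])
 have im: "ind V2 \<in> BM" using V2_borel by simp
 show sx: "sqi (xD n)" unfolding xD_def[abs_def] by (rule sqi_xmult_real[OF s im, where B=1]) (simp add: indicator_def)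
 have \<beta>m: "\<beta> n \<in> BM" "!!x. \<bar>\<beta> n x\<bar> <= M"
  using heat_sol.\<beta>(1)[OF hs] heat_sol.\<beta>_abs[OF hs] by auto
 have i: "integrable lborel (%z. \<beta> n (fst z) * (snd z * D n z)\<^sup>2)"
  using ip_integrable_real[OF sqi_xmult_real[OF s \<beta>m] s] by (simp add: power2_eq_square mult.assoc)
 have "ip (xD n) (xD n) <= (LBINT z. (1/c0) * (\<beta> n (fst z) * (snd z * D n z)\<^sup>2))"
  unfolding ip_def
 proof (rule integral_mono)
  show "integrable lborel (%z. xD n z \<bullet> xD n z)" by (rule ip_integrable[OF sx sx])
  show "integrable lborel (%z. (1/c0) * (\<beta> n (fst z) * (snd z * D n z)\<^sup>2))" by (rule integrable_mult_right[OF i])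
  fix z
  show "xD n z \<bullet> xD n z <= (1/c0) * (\<beta> n (fst z) * (snd z * D n z)\<^sup>2)"
  proof (cases "fst z \<in> V2")
   case True
   then have "fst z \<notin> V1" using V2(4) by blast
   then have "c0 * (snd z * D n z)\<^sup>2 <= \<beta> n (fst z) * (snd z * D n z)\<^sup>2" using b(2) by (intro mult_right_mono) (auto simp: \<beta>_V2)
   then have "(snd z * D n z)\<^sup>2 <= (\<beta> n (fst z) * (snd z * D n z)\<^sup>2) / c0" using c0 by (simp add: le_divide_eq mult.commute)
   then show ?thesis using True by (simp add: xD_def power2_eq_square)
  next
   case False
   have "0 <= (1/c0) * (\<beta> n (fst z) * (snd z * D n z)\<^sup>2)" using c0 \<beta>_pos[of n "fst z"] by simp
   then show ?thesis using False by (simp add: xD_def)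
  qed
 qed
 also have "\<dots> = (LBINT z. \<beta> n (fst z) * (snd z * D n z)\<^sup>2) / c0" by simp
 also have "\<dots> <= (2 * T * (M * T * ip f f + ip (G n) (G n))) / c0"
  using heat_sol.tD_estimate(2)[OF hs] c0 by (intro divide_right_mono) auto
 also have "\<dots> <= 2 * T * (M * T * ip f f + (ip f f + M * E + M * J)) / c0"
  using G_bound[of n] c0 T by (intro divide_right_mono mult_left_mono add_left_mono) auto
 finally show "ip (xD n) (xD n) <= 2 * T * (M * T * ip f f + (ip f f + M * E + M * J)) / c0" .
qed

lemma F_sqi: "sqi F"
 unfolding F_def[abs_def] by (intro sqi_add uT tk_schur(1)[OF kern_kfwd[OF T] f(1)])

text \<open>The three bounded sequences are joined into one vector-valued sequence, so that a single
  extraction serves all of them.\<close>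

lemma subsequence_limit:
 "\<exists>r w' G' R'. strict_mono (r :: nat => nat) \<and> sqi w' \<and> sqi G' \<and> sqi R'
  \<and> (\<forall>h. sqi h --> (%n. ip (w (r n)) h) ~~> ip w' h)
  \<and> (\<forall>h. sqi h --> (%n. ip (G (r n)) h) ~~> ip G' h)
  \<and> (\<forall>h. sqi h --> (%n. ip (xD (r n)) h) ~~> ip R' h)"
proof -
 define X where "X n z = (w n z, (G n z, xD n z))" for n z
 have sX: "sqi (X n)" for n unfolding X_def[abs_def] by (intro sqi_pair w G xD)
 have ipX: "ip (X n) (%z. (h1 z, (h2 z, h3 z))) = ip (w n) h1 + (ip (G n) h2 + ip (xD n) h3)"
  if "sqi h1" "sqi h2" "sqi h3" for n h1 h2 h3
  unfolding X_def[abs_def] using that by (simp add: ip_pair sqi_pair w G xD)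
 have bX: "ip (X n) (X n) <= M * E + ((ip f f + M * E + M * J) + 2 * T * (M * T * ip f f + (ip f f + M * E + M * J)) / c0)" for n
 proof -
  have "ip (X n) (X n) = ip (w n) (w n) + (ip (G n) (G n) + ip (xD n) (xD n))"
   using ipX[OF w(1) G(1) xD(1)] by (simp add: X_def[abs_def])
  then show ?thesis using w_bound[of n] G_bound[of n] xD(2)[of n] by linarith
 qed
 obtain r g where r: "strict_mono (r :: nat => nat)" "sqi g" "!!h. sqi h ==> (%n. ip (X (r n)) h) ~~> ip g h"
  using weak_sequential_compactness[of X, OF sX bX] by blast
 define w' where "w' z = fst (g z)" for z
 define G' where "G' z = fst (snd (g z))" for z
 define R' where "R' z = snd (snd (g z))" for z
 have s: "sqi w'" "sqi G'" "sqi R'"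
  unfolding w'_def[abs_def] G'_def[abs_def] R'_def[abs_def]
  using sqi_fst_snd[OF r(2)] sqi_fst_snd[OF sqi_fst_snd(2)[OF r(2)]] by auto
 have g: "g = (%z. (w' z, (G' z, R' z)))" by (rule ext) (simp add: w'_def G'_def R'_def)
 have ipg: "ip g (%z. (h1 z, (h2 z, h3 z))) = ip w' h1 + (ip G' h2 + ip R' h3)"
  if "sqi h1" "sqi h2" "sqi h3" for h1 h2 h3
  unfolding g using that s by (simp add: ip_pair sqi_pair)
 have "(%n. ip (w (r n)) h) ~~> ip w' h" if "sqi h" for h
  using r(3)[of "%z. (h z, (0, 0))"] ipX[OF that sqi_zero sqi_zero] ipg[OF that sqi_zero sqi_zero] that
  by (simp add: sqi_pair)
 moreover have "(%n. ip (G (r n)) h) ~~> ip G' h" if "sqi h" for h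
  using r(3)[of "%z. (0, (h z, 0))"] ipX[OF sqi_zero that sqi_zero] ipg[OF sqi_zero that sqi_zero] that
  by (simp add: sqi_pair)
 moreover have "(%n. ip (xD (r n)) h) ~~> ip R' h" if "sqi h" for h
  using r(3)[of "%z. (0, (0, h z))"] ipX[OF sqi_zero sqi_zero that] ipg[OF sqi_zero sqi_zero that] that
  by (simp add: sqi_pair)
 ultimately show ?thesis using r(1) s by blast
qed

end

section \<open>Identification of the weak limits along the subsequence\<close>

locale delta_limit = delta_family +
 fixes r :: "nat => nat" and w' :: "'a::euclidean_space \<times> real => real" and G' :: "'a \<times> real => 'a" and R' :: "'a \<times> real => real"
 assumes r: "strict_mono r" and lim_sqi: "sqi w'" "sqi G'" "sqi R'"
  and w_lim: "!!h. sqi h ==> (%n. ip (w (r n)) h) ~~> ip w' h"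
  and G_lim: "!!h. sqi h ==> (%n. ip (G (r n)) h) ~~> ip G' h"
  and xD_lim: "!!h. sqi h ==> (%n. ip (xD (r n)) h) ~~> ip R' h"
begin

text \<open>The raw limits are cut to the cylinder over \<open>V2\<close>. The convergence lemmas
  that follow show that nothing is lost, because what the sequences do outside contributes nothing
  to the limits.\<close>

definition "wl z = m z * w' z"
definition "Gl z = m z *\<^sub>R G' z"
definition "Rl z = m z * R' z"
definition "ul z = wl z / b (fst z)"

lemma m_cases: "m z = 0 \<or> m z = 1" "z \<in> cyl V2 0 T ==> m z = 1" "z \<notin> cyl V2 0 T ==> m z = 0"
 by (auto simp: m_def indicator_def)

lemma l_sqi: "sqi wl" "sqi Gl" "sqi Rl" "sqi ul"
proof -
 show "sqi wl" unfolding wl_def[abs_def] by (rule mult_m_real[OF lim_sqi(1)])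
 then show "sqi ul" unfolding ul_def[abs_def] by (rule div_b)
 show "sqi Gl" unfolding Gl_def[abs_def] by (rule mult_m[OF lim_sqi(2)])
 show "sqi Rl" unfolding Rl_def[abs_def] by (rule mult_m_real[OF lim_sqi(3)])
qed

lemma l_out: "z \<notin> cyl V2 0 T ==> wl z = 0" "z \<notin> cyl V2 0 T ==> Gl z = 0"
  "z \<notin> cyl V2 0 T ==> Rl z = 0" "z \<notin> cyl V2 0 T ==> ul z = 0"
 by (simp_all add: wl_def Gl_def Rl_def ul_def m_cases(3))

lemma cyl2_V: "z \<notin> cyl V 0 T ==> z \<notin> cyl V2 0 T" using cyl_mono[OF V2(2)] .

lemma \<delta>_r: "(%n. \<delta> (r n)) ~~> 0"
 using LIMSEQ_subseq_LIMSEQ[OF \<delta>(3) r] by (simp add: comp_def)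

lemma w_tendsto:
 assumes h: "sqi h" shows "(%n. ip (w (r n)) h) ~~> ip wl h"
proof -
 have "(%n. ip (w (r n)) (%z. m1 z * h z)) ~~> 0"
 proof (rule Lim_null_comparison)
  have "(%n. sqrt (\<delta> (r n) * (M * E)) * sqrt (ip h h)) ~~> sqrt (0 * (M * E)) * sqrt (ip h h)"
   by (intro tendsto_intros \<delta>_r)
  then show "(%n. sqrt (\<delta> (r n) * (M * E)) * sqrt (ip h h)) ~~> 0" by simp
 qed (use w_V1_bound[OF h] in \<open>auto intro!: always_eventually\<close>)
 from tendsto_add[OF w_lim[OF mult_m_real[OF h]] this]
 have "(%n. ip (w (r n)) h) ~~> ip w' (%z. m z * h z)"
  using ip_split[OF w(1,2) h] by simp
 moreover have "ip w' (%z. m z * h z) = ip wl h" by (simp add: ip_def wl_def ac_simps)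
 ultimately show ?thesis by simp
qed

text \<open>The defining identity is linear and passes to weak limits. The weak gradient exists on
  all of \<open>V\<close>, across the interface, for a function that vanishes over
  \<open>V1\<close>: this is the form in which the boundary condition bu = 0 on Gamma is
  obtained.\<close>

lemma wgrad_wl: "wgrad V wl G'"
proof (rule wgradI)
 fix p :: "'a => real" and q :: "real => real" and i :: 'a assume a: "test_fun V p" "sqi q" "i \<in> Basis"
 let ?h = "%z. fder p (fst z) i * q (snd z)" and ?k = "%z. p (fst z) * q (snd z)"
 have s: "sqi ?h" "sqi ?k"
  using sqi_tensor[OF test_fun_sqi[OF test_fun_frechet[OF a(1)]] a(2)] sqi_tensor[OF test_fun_sqi[OF a(1)] a(2)] by auto
 have e: "ip (%z. g z \<bullet> i) ?k = ip g (%z. ?k z *\<^sub>R i)" for g :: "'a \<times> real => 'a" by (simp add: ip_def ac_simps)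
 have "sqi (%z. ?k z *\<^sub>R i)" by (rule sqi_scal_vec[OF s(2), where c="norm i"]) auto
 from tendsto_add[OF w_tendsto[OF s(1)] G_lim[OF this]]
 have "(%n. ip (w (r n)) ?h + ip (%z. G (r n) z \<bullet> i) ?k) ~~> ip wl ?h + ip (%z. G' z \<bullet> i) ?k" unfolding e .
 then have "(%n. 0::real) ~~> ip wl ?h + ip (%z. G' z \<bullet> i) ?k" unfolding wgradD[OF w(3) a] .
 then show "ip wl ?h + ip (%z. G' z \<bullet> i) ?k = 0" by (simp add: LIMSEQ_const_iff)
qed

lemma sqi_component: "sqi h ==> sqi (%z. h z \<bullet> i)" for h :: "'a \<times> real => 'c::euclidean_space"
 by (rule sqi_inner_bounded[where c="norm i"]) auto

text \<open>Over \<open>V1\<close> the function \<open>wl\<close> vanishes, so its weak gradient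
  pairs to 0 with products supported there, and by density with everything supported there.\<close>

lemma G'_V1:
 assumes h: "sqi h" "!!z. z \<notin> cyl V1 0 T ==> h z = 0" shows "ip G' h = 0"
proof -
 have "ip (%z. G' z \<bullet> i) (%z. h z \<bullet> i) = 0" if i: "i \<in> Basis" for i
 proof (rule ip_zero_tensor[OF V1(1), of "{0<..<T}"])
  show "sqi (%z. G' z \<bullet> i)" "sqi (%z. h z \<bullet> i)" using lim_sqi(2) h(1) by (auto intro: sqi_component)
  show "h z \<bullet> i = 0" if "z \<notin> V1 \<times> {0<..<T}" for z using h(2)[of z] that by (simp add: cyl_def)
  fix p :: "'a => real" and q :: "real => real" assume p: "test_fun V1 p" "test_fun {0<..<T} q"
  have "wl z * (fder p (fst z) i * q (snd z)) = 0" for z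
   using l_out(1)[of z] test_fun_outside[OF test_fun_frechet[OF p(1)], of "fst z" i] V2(4) by (cases z) (auto simp: cyl_def)
  then have "ip wl (%z. fder p (fst z) i * q (snd z)) = 0"
   by (simp only: ip_def inner_real_def Bochner_Integration.integral_zero)
  then show "ip (%z. G' z \<bullet> i) (p \<otimes> q) = 0"
   using wgradD[OF wgrad_wl test_fun_mono[OF p(1) V2(3)] test_fun_sqi[OF p(2)] i] by simp
 qed auto
 then show ?thesis using ip_components[OF lim_sqi(2) h(1)] by simp
qed

lemma G_tendsto:
 assumes h: "sqi h" shows "(%n. ip (G (r n)) h) ~~> ip Gl h"
proof -
 have "ip G' (%z. m1 z *\<^sub>R h z) = 0" by (rule G'_V1[OF mult_m1[OF h]]) (simp add: m1_def)
 with tendsto_add[OF G_lim[OF mult_m[OF h]] G_lim[OF mult_m1[OF h]]]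
 have "(%n. ip (G (r n)) h) ~~> ip G' (%z. m z *\<^sub>R h z)"
  using ip_split[OF G(1,2) h] by simp
 moreover have "ip G' (%z. m z *\<^sub>R h z) = ip Gl h" by (simp add: ip_def Gl_def)
 ultimately show ?thesis by simp
qed

lemma wgrad_l: "wgrad V wl Gl"
proof (rule wgradI)
 fix p :: "'a => real" and q :: "real => real" and i :: 'a assume a: "test_fun V p" "sqi q" "i \<in> Basis"
 let ?k = "%z. p (fst z) * q (snd z)"
 have e: "ip (%z. g z \<bullet> i) ?k = ip g (%z. ?k z *\<^sub>R i)" for g :: "'a \<times> real => 'a" by (simp add: ip_def ac_simps)
 have s: "sqi (%z. ?k z *\<^sub>R i)"
  by (rule sqi_scal_vec[OF sqi_tensor[OF test_fun_sqi[OF a(1)] a(2)], where c="norm i"]) auto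
 have "ip (%z. Gl z \<bullet> i) ?k = ip (%z. G' z \<bullet> i) ?k"
  unfolding e by (rule LIMSEQ_unique[OF G_tendsto[OF s] G_lim[OF s]])
 then show "ip wl (%z. fder p (fst z) i * q (snd z)) + ip (%z. Gl z \<bullet> i) ?k = 0"
  using wgradD[OF wgrad_wl a] by simp
qed

lemma xD_tendsto:
 assumes h: "sqi h" shows "(%n. ip (xD (r n)) h) ~~> ip Rl h"
proof -
 have "ip (xD n) (%z. m z * h z) = ip (xD n) h" for n
  unfolding ip_def
 proof (rule int_cong)
  fix z
  show "xD n z \<bullet> (m z * h z) = xD n z \<bullet> h z"
   using heat_sol.D(2)[OF hs[of n], of z] V2(2) by (cases z) (auto simp: xD_def m_def cyl_def indicator_def)
 qed
 with xD_lim[OF mult_m_real[OF h]] have "(%n. ip (xD (r n)) h) ~~> ip R' (%z. m z * h z)" by simp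
 moreover have "ip R' (%z. m z * h z) = ip Rl h" by (simp add: ip_def Rl_def ac_simps)
 ultimately show ?thesis by simp
qed

text \<open>As \<open>\<Psi>\<close> is supported over \<open>V2\<close>, where u = w/b, the weak
  limits of \<open>w\<close> and \<open>G\<close> suffice. The weak gradient of
  \<open>\<Phi>\<close> is still demanded on all of \<open>V\<close>, which amounts to a zero trace
  on Gamma.\<close>

lemma limit_eq:
 assumes \<Psi>: "sqi \<Psi>" "!!z. z \<notin> cyl V2 0 T ==> \<Psi> z = 0" and \<Phi>: "sqi \<Phi>" "AE z in lborel. \<Phi> z = tk (kback T) \<Psi> z"
  and G\<Phi>: "sqi G\<Phi>" "!!z. z \<notin> cyl V 0 T ==> G\<Phi> z = 0" "wgrad V \<Phi> G\<Phi>"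
 shows "ip ul \<Psi> - ip uT \<Psi> + ip Gl G\<Phi> = ip f \<Phi>"
proof -
 have "(%n. ip (w (r n)) (%z. \<Psi> z / b (fst z)) - ip uT \<Psi> + ip (G (r n)) G\<Phi>)
   ~~> ip wl (%z. \<Psi> z / b (fst z)) - ip uT \<Psi> + ip Gl G\<Phi>"
  by (intro tendsto_intros w_tendsto G_tendsto div_b \<Psi>(1) G\<Phi>(1))
 moreover have "ip (w (r n)) (%z. \<Psi> z / b (fst z)) - ip uT \<Psi> + ip (G (r n)) G\<Phi> = ip f \<Phi>" for n
  using integrated[OF \<Psi>(1) \<Psi>(2)[OF cyl2_V] \<Phi> G\<Phi>] u_on_V2[OF \<Psi>] by simp
 moreover have "ip wl (%z. \<Psi> z / b (fst z)) = ip ul \<Psi>" by (simp add: ip_def ul_def)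
 ultimately show ?thesis by (simp add: LIMSEQ_const_iff)
qed

lemma tk_back_f: "sqi h ==> ip f (tk (kback T) h) = ip (tk (kT (kback T)) f) h"
 by (rule tk_adjoint[OF kern_kfwd[OF T] f(1), unfolded kT_kT, symmetric])

text \<open>Minty's argument. Testing with \<open>w\<close> expresses \<open>ip u w\<close> through
  linear terms minus the quadratic form of the backward integral at \<open>G\<close>. Positivity of
  this form at \<open>G - Gl\<close> replaces it by an expression affine in \<open>G\<close>, so
  that \<open>Y n\<close> converges under weak convergence; the limit equation tested with
  \<open>wl\<close> identifies its limit.\<close>

lemma uw_limsup:
 "\<exists>Y. (\<forall>n. ip (u (r n)) (w (r n)) <= Y n) \<and> Y ~~> ip ul wl"
proof -
 note kb = kern_kback[OF T]
 let ?B = "tk (kback T)" and ?A = "tk (kT (kback T))"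
 define Y where "Y n = ip uT (w (r n)) + ip (?A f) (w (r n)) - ip (G (r n)) (?B Gl) - ip (G (r n)) (?A Gl) + ip Gl (?B Gl)" for n
 have s: "sqi (?B Gl)" "sqi (?A Gl)" "sqi (?A f)"
  using tk_schur(1)[OF kb l_sqi(2)] tk_schur(1)[OF kern_kfwd[OF T] l_sqi(2)] tk_schur(1)[OF kern_kfwd[OF T] f(1)] by auto
 have "ip (u (r n)) (w (r n)) <= Y n" for n
 proof -
  let ?w = "w (r n)" and ?G = "G (r n)"
  have sB: "sqi (?B ?G)" by (rule tk_schur(1)[OF kb G(1)])
  have "ip (u (r n)) ?w - ip uT ?w + ip ?G (?B ?G) = ip f (?B ?w)"
  proof (rule integrated)
   show "sqi ?w" "z \<notin> cyl V 0 T ==> ?w z = 0" for z using w by auto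
   show "sqi (?B ?w)" by (rule tk_schur(1)[OF kb w(1)])
   show "z \<notin> cyl V 0 T ==> ?B ?G z = 0" for z by (rule tk_out[OF kb G(2)])
   show "wgrad V (?B ?w) (?B ?G)" by (rule wgrad_tk[OF w(3) w(1) G(1) kb])
  qed (use sB in auto)
  moreover have "0 <= ip (%z. ?G z - Gl z) (?B (%z. ?G z - Gl z))"
   by (rule back_nonneg[OF T sqi_diff[OF G(1) l_sqi(2)]]) (use G(2) l_out(2) V2(2) in \<open>auto simp: cyl_def\<close>)
  moreover have "ip (%z. ?G z - Gl z) (?B (%z. ?G z - Gl z)) = ip ?G (?B ?G) - ip ?G (?B Gl) - (ip Gl (?B ?G) - ip Gl (?B Gl))"
  proof -
   have right: "ip h (?B (%z. ?G z - Gl z)) = ip h (?B ?G) - ip h (?B Gl)" if h: "sqi h" for h :: "'a \<times> real => 'a"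
    using tk_adjoint[OF kern_kfwd[OF T] h sqi_diff[OF G(1) l_sqi(2)]] tk_adjoint[OF kern_kfwd[OF T] h G(1)]
     tk_adjoint[OF kern_kfwd[OF T] h l_sqi(2)] ip_diff_right[OF G(1) l_sqi(2) tk_schur(1)[OF kern_kfwd[OF T] h]]
    by (simp add: kT_kT)
   show ?thesis
    using ip_diff_left[OF G(1) l_sqi(2) tk_schur(1)[OF kb sqi_diff[OF G(1) l_sqi(2)]]] right[OF G(1)] right[OF l_sqi(2)] by simp
  qed
  moreover have "ip Gl (?B ?G) = ip ?G (?A Gl)"
   using tk_adjoint[OF kern_kfwd[OF T] l_sqi(2) G(1)] ip_commute[of "?A Gl" ?G] by (simp add: kT_kT)
  moreover have "ip f (?B ?w) = ip (?A f) ?w" by (rule tk_back_f[OF w(1)])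
  ultimately show ?thesis unfolding Y_def by linarith
 qed
 moreover have "Y ~~> ip uT wl + ip (?A f) wl - ip Gl (?B Gl) - ip Gl (?A Gl) + ip Gl (?B Gl)"
 proof -
  have c: "(%n. ip g (w (r n))) ~~> ip g wl" if "sqi g" for g
   using w_tendsto[OF that] by (simp add: ip_commute[of g])
  show ?thesis unfolding Y_def[abs_def] by (intro tendsto_intros c G_tendsto uT s)
 qed
 moreover have "ip uT wl + ip (?A f) wl - ip Gl (?B Gl) - ip Gl (?A Gl) + ip Gl (?B Gl) = ip ul wl"
 proof -
  have "ip ul wl - ip uT wl + ip Gl (?B Gl) = ip f (?B wl)"
  proof (rule limit_eq[OF l_sqi(1) l_out(1)])
   show "sqi (?B wl)" by (rule tk_schur(1)[OF kb l_sqi(1)])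
   show "z \<notin> cyl V 0 T ==> ?B Gl z = 0" for z by (rule tk_out[OF kb l_out(2)[OF cyl2_V]])
   show "wgrad V (?B wl) (?B Gl)" by (rule wgrad_tk[OF wgrad_l l_sqi(1,2) kb])
  qed (use s in auto)
  moreover have "ip Gl (?B Gl) = ip Gl (?A Gl)"
   using tk_adjoint[OF kern_kfwd[OF T] l_sqi(2) l_sqi(2)] ip_commute[of "?A Gl" Gl] by (simp add: kT_kT)
  moreover have "ip f (?B wl) = ip (?A f) wl" by (rule tk_back_f[OF l_sqi(1)])
  ultimately show ?thesis by linarith
 qed
 ultimately show ?thesis by auto
qed

text \<open>Over \<open>V2\<close> the density u w - 2 w ul + ul wl equals b (u - ul)^2; elsewhere
  \<open>ul\<close> and \<open>wl\<close> vanish and u w is nonnegative. By \<open>uw_limsup\<close>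
  its integral is bounded above by a sequence that tends to 0.\<close>

lemma strong_u: "(%n. ip (%z. m z * (u (r n) z - ul z)) (%z. m z * (u (r n) z - ul z))) ~~> 0"
proof -
 obtain Y where Y: "!!n. ip (u (r n)) (w (r n)) <= Y n" "Y ~~> ip ul wl" using uw_limsup by blast
 define X where "X n = (Y n - 2 * ip (w (r n)) ul + ip ul wl) / c0" for n
 have "X ~~> (ip ul wl - 2 * ip wl ul + ip ul wl) / c0"
  unfolding X_def[abs_def] by (intro tendsto_intros Y(2) w_tendsto l_sqi) (use c0 in auto)
 then have X0: "X ~~> 0" by (simp add: ip_commute[of wl ul])
 have "ip (%z. m z * (u (r n) z - ul z)) (%z. m z * (u (r n) z - ul z)) <= X n" for n
 proof -
  let ?u = "u (r n)" and ?w = "w (r n)"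
  have s: "sqi (%z. m z * (?u z - ul z))" by (rule mult_m_real[OF sqi_diff[OF u(1) l_sqi(4)]])
  have i: "integrable lborel (%z. ?u z \<bullet> ?w z)" "integrable lborel (%z. ?w z \<bullet> ul z)" "integrable lborel (%z. ul z \<bullet> wl z)"
   by (intro ip_integrable u w l_sqi)+
  have "ip (%z. m z * (?u z - ul z)) (%z. m z * (?u z - ul z))
    <= (LBINT z. (1 / c0) * (?u z \<bullet> ?w z - 2 * (?w z \<bullet> ul z) + ul z \<bullet> wl z))"
   unfolding ip_def
  proof (rule integral_mono)
   show "integrable lborel (%z. (m z * (?u z - ul z)) \<bullet> (m z * (?u z - ul z)))" by (rule ip_integrable[OF s s])
   show "integrable lborel (%z. (1 / c0) * (?u z \<bullet> ?w z - 2 * (?w z \<bullet> ul z) + ul z \<bullet> wl z))"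
    by (intro integrable_mult_right Bochner_Integration.integrable_add Bochner_Integration.integrable_diff i)
   fix z
   show "(m z * (?u z - ul z)) \<bullet> (m z * (?u z - ul z)) <= (1 / c0) * (?u z \<bullet> ?w z - 2 * (?w z \<bullet> ul z) + ul z \<bullet> wl z)"
   proof (cases "z \<in> cyl V2 0 T")
    case True
    then have z: "fst z \<notin> V1" using V2(4) by (auto simp: cyl_def)
    have wl: "wl z = b (fst z) * ul z" using b0[of "fst z"] by (simp add: ul_def)
    have "c0 * (?u z - ul z)\<^sup>2 <= b (fst z) * (?u z - ul z)\<^sup>2" using b(2) by (intro mult_right_mono) auto
    also have "\<dots> = ?u z \<bullet> ?w z - 2 * (?w z \<bullet> ul z) + ul z \<bullet> wl z"
     using z by (simp add: wl w_def \<beta>_V2 power2_eq_square algebra_simps)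
    finally show ?thesis using c0 True by (simp add: m_cases(2) le_divide_eq power2_eq_square mult.commute)
   next
    case False
    have "?u z \<bullet> ?w z = \<beta> (r n) (fst z) * (?u z)\<^sup>2" by (simp add: w_def power2_eq_square)
    then have "0 <= ?u z \<bullet> ?w z" using \<beta>_pos[of "r n" "fst z"] by simp
    then show ?thesis using False c0 by (simp add: m_cases(3) l_out)
   qed
  qed
  also have "\<dots> = (ip ?u ?w - 2 * ip ?w ul + ip ul wl) / c0" using i by (simp add: ip_def)
  also have "\<dots> <= X n" unfolding X_def using Y(1)[of n] c0 by (intro divide_right_mono) auto
  finally show ?thesis .
 qed
 then show ?thesis by (intro tendsto_sandwich[OF _ _ tendsto_const X0]) (auto intro!: always_eventually ip_nonneg)
qed

text \<open>The interior estimate bounds \<open>ch * u\<close>, so products p(x) q(t) suffice as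
  tests. For these the integrated equation leaves, besides \<open>F\<close>, only a gradient term;
  its limit pairs \<open>Gl\<close>, which lives over \<open>V2\<close>, with a function that lives
  over \<open>V1\<close>, and is therefore 0.\<close>

lemma interior_weak:
 assumes K: "compact K" "K \<subseteq> V1" and h: "sqi h" "!!z. z \<notin> cyl K 0 T ==> h z = 0"
 shows "(%n. ip (u (r n)) h) ~~> ip F h"
proof -
 obtain ch k where ch: "test_fun V1 ch" "k > 0" "!!x. 0 <= ch x" "!!x. x \<in> K ==> k <= ch x"
  using compact_cutoff[OF K(1) V1(1) K(2)] by blast
 obtain B0 where B0: "!!x. \<bar>ch x\<bar> <= B0" using test_fun_bounded[OF ch(1)] by blast
 obtain B1 where B1: "!!x. norm (gradv ch x) <= B1" using gradv_bounded[OF ch(1)] by blast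
 have chm [measurable]: "ch \<in> BM" by (rule test_fun_meas[OF ch(1)])
 define y where "y n z = ch (fst z) * u (r n) z" for n z
 have sy: "sqi (y n)" for n unfolding y_def[abs_def] by (rule sqi_xmult_real[OF u(1) chm B0])
 have sF: "sqi (%z. ch (fst z) * F z)" by (rule sqi_xmult_real[OF F_sqi chm B0])
 \<comment> \<open>Dividing by the cutoff turns the convergence of \<open>ch * u\<close> against
   \<open>h'\<close> into that of \<open>u\<close> against \<open>h\<close>.\<close>
 define h' where "h' z = h z / ch (fst z)" for z
 have hm [measurable]: "h \<in> BM" by (rule sqi_meas[OF h(1)])
 have sh': "sqi h'"
 proof (rule sqi_bound[OF h(1), where c="1/k"])
  have "(%z::'a\<times>real. ch (fst z)) \<in> BM" by (rule fst_meas[OF chm])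
  then show "h' \<in> BM" unfolding h'_def[abs_def] by (intro borel_measurable_divide hm)
  fix z
  show "norm (h' z) <= (1/k) * norm (h z)"
  proof (cases "z \<in> cyl K 0 T")
   case True
   then have "k <= ch (fst z)" using ch(4) by (auto simp: cyl_def)
   then have "norm (h z) / \<bar>ch (fst z)\<bar> <= norm (h z) / k" using ch(2) by (intro divide_left_mono) auto
   then show ?thesis by (simp add: h'_def abs_divide)
  qed (simp add: h'_def h(2))
 qed
 have hh: "ch (fst z) * h' z = h z" for z
 proof (cases "z \<in> cyl K 0 T")
  case True
  then have "k <= ch (fst z)" using ch(4) by (auto simp: cyl_def)
  then show ?thesis using ch(2) by (simp add: h'_def)
 qed (simp add: h'_def h(2))
 obtain Bd where Bd: "!!n. ip (y n) (y n) <= Bd"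
 proof -
  have "ip (y n) (y n) <= (((B0 * sqrt (ip uT uT) * M + B0 * sqrt (ip f f) * T * M) + (2 * B1 * T * sqrt (M * E)) * (2 * B0 * sqrt (ip f f) * M)) / c0)\<^sup>2
    + 2 * ((2 * B1 * T * sqrt (M * E)) * (1 + (4 * B1\<^sup>2 * M * E + M * B0\<^sup>2 * (LBINT x. (ub x)\<^sup>2)))) / c0" for n
   unfolding y_def[abs_def]
  proof (rule heat_sol.interior_estimate[OF hs[of "r n"] ch(1) V1_borel ch(3) _ B1 \<delta>(1)[of "r n"] c0])
   show "ch x <= B0" for x using B0[of x] by simp
   show "\<beta> (r n) x <= \<delta> (r n) * M" "\<delta> (r n) * c0 <= \<beta> (r n) x" if "x \<in> V1" for x
    using that b(2,3)[of x] \<delta>(1)[of "r n"] by (simp_all add: \<beta>_V1)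
   show "ip (u (r n)) (heat_sol.w (\<beta> (r n)) (u (r n))) <= E" using uw by (simp add: w_eq)
  qed (simp_all add: uT_eq)
  then show ?thesis by (rule that)
 qed
 have "(%n. ip (y n) h') ~~> ip (%z. ch (fst z) * F z) h'"
 proof (rule weak_tendsto_tensor[OF V1(1) _ sy Bd sF sh', of "{0<..<T}"])
  show "h' z = 0" if "z \<notin> V1 \<times> {0<..<T}" for z using that h(2)[of z] K(2) by (auto simp: h'_def cyl_def)
  fix p :: "'a => real" and q :: "real => real" assume p: "test_fun V1 p" "test_fun {0<..<T} q"
  let ?P = "%x. ch x * p x" and ?Q = "tk1 (kback T) q"
  have P: "test_fun V1 ?P" by (rule test_fun_mult[OF p(1) test_fun_smooth[OF ch(1)]])
  define \<Psi> where "\<Psi> z = ?P (fst z) * q (snd z)" for z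
  define G\<Phi> where "G\<Phi> z = ?Q (snd z) *\<^sub>R gradv ?P (fst z)" for z
  have sQ: "sqi ?Q" by (rule tk1_schur(1)[OF kern_kback[OF T] test_fun_sqi[OF p(2)]])
  have s\<Psi>: "sqi \<Psi>" unfolding \<Psi>_def[abs_def] by (rule sqi_tensor[OF test_fun_sqi[OF P] test_fun_sqi[OF p(2)]])
  have \<Psi>0: "\<Psi> z = 0" if "z \<notin> cyl V1 0 T" for z
   using that test_fun_outside[OF P, of "fst z"] test_fun_outside[OF p(2), of "snd z"] by (cases z) (auto simp: \<Psi>_def cyl_def)
  have \<Psi>0': "z \<notin> cyl V 0 T ==> \<Psi> z = 0" for z using \<Psi>0 cyl_mono[OF V2(3)] by blast
  have tk: "tk (kback T) \<Psi> = (?P \<otimes> ?Q)"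
   unfolding \<Psi>_def[abs_def] by (rule ext) (rule tk_tensor)
  have P': "test_fun (closure {x. ?P x \<noteq> 0}) ?P" using P by (simp add: test_fun_def)
  have gP: "gradv ?P x = 0" if "x \<notin> V1" for x
   unfolding gradv_def using test_fun_outside[OF test_fun_frechet[OF P] that] by simp
  have sG: "sqi G\<Phi>"
  proof -
   obtain C where C: "!!x. norm (gradv ?P x) <= C" using gradv_bounded[OF P] by blast
   have sone: "sqi (%z. ind (closure {x. ?P x \<noteq> 0}) (fst z) * ?Q (snd z))"
   proof (rule sqi_tensor[OF indicator_sqi sQ])
    have "compact (closure {x. ?P x \<noteq> 0})" using P by (simp add: test_fun_def)
    then show "closure {x. ?P x \<noteq> 0} \<in> sets borel" "emeasure lborel (closure {x. ?P x \<noteq> 0}) < \<infinity>"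
     by (rule borel_closed[OF compact_imp_closed], rule emeasure_compact_finite)
   qed
   have "G\<Phi> = (%z. (ind (closure {x. ?P x \<noteq> 0}) (fst z) * ?Q (snd z)) *\<^sub>R gradv ?P (fst z))"
   proof
    fix z :: "'a \<times> real"
    show "G\<Phi> z = (ind (closure {x. ?P x \<noteq> 0}) (fst z) * ?Q (snd z)) *\<^sub>R gradv ?P (fst z)"
     using test_fun_outside[OF test_fun_frechet[OF P'], of "fst z"]
     by (auto simp: G\<Phi>_def gradv_def indicator_def intro!: sum.neutral)
   qed
   then show ?thesis using sqi_xvec[OF sone gradv_meas[OF P] C] by simp
  qed
  have gP0: "G\<Phi> z = 0" if "z \<notin> cyl V1 0 T" for z
   using that gP[of "fst z"] tk_support(2)[OF kern_kback[OF T], of "snd z" q] by (cases z) (auto simp: G\<Phi>_def cyl_def not_less)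
  have "ip (u (r n)) \<Psi> = ip F \<Psi> - ip (G (r n)) G\<Phi>" for n
  proof -
   have "ip (u (r n)) \<Psi> - ip uT \<Psi> + ip (G (r n)) G\<Phi> = ip f (tk (kback T) \<Psi>)"
   proof (rule integrated[OF s\<Psi> \<Psi>0' tk_schur(1)[OF kern_kback[OF T] s\<Psi>] _ sG])
    show "z \<notin> cyl V 0 T ==> G\<Phi> z = 0" for z using gP0 cyl_mono[OF V2(3)] by blast
    show "wgrad V (tk (kback T) \<Psi>) G\<Phi>"
     unfolding tk G\<Phi>_def[abs_def] by (rule wgrad_tensor[OF test_fun_mono[OF P V2(3)] sQ])
   qed auto
   moreover have "ip F \<Psi> = ip uT \<Psi> + ip f (tk (kback T) \<Psi>)"
    unfolding tk_back_f[OF s\<Psi>] F_def[abs_def] by (rule ip_add_left[OF uT(1) tk_schur(1)[OF kern_kfwd[OF T] f(1)] s\<Psi>])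
   ultimately show ?thesis by linarith
  qed
  moreover have "(%n. ip F \<Psi> - ip (G (r n)) G\<Phi>) ~~> ip F \<Psi> - ip Gl G\<Phi>"
   by (intro tendsto_intros G_tendsto sG)
  moreover have "ip Gl G\<Phi> = 0"
  proof -
   have "Gl z \<bullet> G\<Phi> z = 0" for z
   proof (cases "z \<in> cyl V2 0 T")
    case True
    then have "z \<notin> cyl V1 0 T" using V2(4) by (auto simp: cyl_def)
    then show ?thesis by (simp add: gP0)
   qed (simp add: l_out(2))
   then show ?thesis by (simp add: ip_def)
  qed
  ultimately have "(%n. ip (u (r n)) \<Psi>) ~~> ip F \<Psi>" by simp
  moreover have "ip (%z. ch (fst z) * g z) (p \<otimes> q) = ip g \<Psi>" for g
   by (simp add: ip_def \<Psi>_def ac_simps)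
  ultimately show "(%n. ip (y n) (p \<otimes> q)) ~~> ip (%z. ch (fst z) * F z) (p \<otimes> q)"
   unfolding y_def[abs_def] by simp
 qed auto
 moreover have "ip (%z. ch (fst z) * g z) h' = ip g h" for g
  unfolding hh[symmetric, abs_def] by (simp add: ip_def ac_simps)
 ultimately show ?thesis unfolding y_def[abs_def] by simp
qed

end

subsection \<open>Level sets of regular functions\<close>

text \<open>The frontier lies in the zero set of \<rho>. Let x0 be a zero with gradient n. Along
  rays from x0 - n the function \<rho> increases strictly inside a small ball about x0, so each ray
  meets the zero set there at most once. Sets of this starlike kind are negligible, and
  negligibility is a local property.\<close>

lemma smooth_bounded_domain_null_frontier:
 fixes D :: "'b::euclidean_space set"
 assumes "smooth_bounded_domain D" shows "frontier D \<in> null_sets lborel"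
proof -
 obtain \<rho> where D: "open D" and \<rho>: "smooth_on UNIV \<rho>" "D = {x. \<rho> x < 0}"
   "!!x. \<rho> x = 0 ==> fder \<rho> x \<noteq> (%v. 0)"
  using assms unfolding smooth_bounded_domain_def by blast
 have c: "continuous_on UNIV \<rho>" by (rule smooth_on_continuous[OF \<rho>(1)])
 have d: "(\<rho> has_derivative fder \<rho> x) (at x)" for x by (rule smooth_on_has_derivative[OF \<rho>(1)])
 have gr: "fder \<rho> x v = gradv \<rho> x \<bullet> v" for x v
 proof -
  have "fder \<rho> x v = fder \<rho> x (\<Sum>i\<in>Basis. (v \<bullet> i) *\<^sub>R i)" by (simp add: euclidean_representation)
  also have "\<dots> = (\<Sum>i\<in>Basis. (v \<bullet> i) * fder \<rho> x i)"
   using has_derivative_linear[OF d[of x]] by (simp add: linear_sum linear_scale)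
  finally show ?thesis by (simp add: gradv_def inner_sum_left inner_commute[of v] mult.commute)
 qed
 have gc: "continuous_on UNIV (gradv \<rho>)"
 proof -
  have "Ck_on (Suc 0) UNIV \<rho>" using \<rho>(1) by (simp only: smooth_on_def)
  then show ?thesis unfolding gradv_def by (auto intro!: continuous_intros)
 qed
 define Z where "Z = {x. \<rho> x = 0}"
 have Zc: "closed Z" unfolding Z_def by (rule closed_Collect_eq[OF c continuous_on_const])
 have "negligible Z"
 proof (rule locally_negligible_alt[THEN iffD2], intro ballI)
  fix x0 assume x0: "x0 \<in> Z"
  define n where "n = gradv \<rho> x0"
  have "n \<noteq> 0" using \<rho>(3)[of x0] x0 gr[of x0] by (auto simp: Z_def n_def fun_eq_iff)
  \<comment> \<open>Pairs of a point and a direction in which \<rho> has positive derivative.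
    Openness gives this for all points near x0 and all directions near n.\<close>
  define W where "W = {z :: 'b \<times> 'b. 0 < gradv \<rho> (fst z) \<bullet> snd z}"
  have "open W" unfolding W_def
   by (intro open_Collect_less continuous_intros continuous_on_compose2[OF gc]) auto
  moreover have "(x0, n) \<in> W" using \<open>n \<noteq> 0\<close> by (simp add: W_def n_def)
  ultimately obtain A B where AB: "open A" "open B" "x0 \<in> A" "n \<in> B" "A \<times> B \<subseteq> W"
   by (auto elim: open_prod_elim)
  obtain e1 where e1: "e1 > 0" "cball x0 e1 \<subseteq> A" using open_contains_cball[of A] AB by blast
  obtain e2 where e2: "e2 > 0" "cball n e2 \<subseteq> B" using open_contains_cball[of B] AB by blast
  define e where "e = min e1 e2"
  have e: "e > 0" "cball x0 e \<subseteq> A" "cball n e \<subseteq> B" using e1 e2 by (auto simp: e_def)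
  define S where "S = Z \<inter> cball x0 e"
  have "negligible S"
  proof (rule starlike_negligible[where a="x0 - n"])
   show "closed S" unfolding S_def using Zc by (intro closed_Int closed_cball)
   fix c x assume cx: "x0 - n + c *\<^sub>R x \<in> S" "0 <= c" "x0 - n + x \<in> S"
   show "c = 1"
   proof (rule ccontr)
    assume "c \<noteq> 1"
    define p where "p t = \<rho> (x0 - n + t *\<^sub>R x)" for t
    have dp: "(p has_derivative (%s. fder \<rho> (x0 - n + t *\<^sub>R x) (s *\<^sub>R x))) (at t)" for t
    proof -
     have "((%t. x0 - n + t *\<^sub>R x) has_derivative (%s. s *\<^sub>R x)) (at t)" by (auto intro!: derivative_eq_intros)
     from has_derivative_compose[OF this d] show ?thesis unfolding p_def[abs_def] .
    qed
    have dp': "(p has_real_derivative (gradv \<rho> (x0 - n + t *\<^sub>R x) \<bullet> x)) (at t)" for t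
     using dp[of t] by (simp add: gr has_field_derivative_def mult_commute_abs)
    \<comment> \<open>Two zeros on one ray would yield, by the mean value theorem, a point between
      them with derivative 0 along the ray. Convexity keeps this point in the ball, and the
      direction is near n because x0 - n + x is near x0.\<close>
    define l r where "l = min c 1" and "r = max c 1"
    have lr: "l < r" "p l = p r" using \<open>c \<noteq> 1\<close> cx(1,3) by (auto simp: l_def r_def p_def S_def Z_def min_def max_def)
    obtain t where t: "l < t" "t < r" "p r - p l = (r - l) * (gradv \<rho> (x0 - n + t *\<^sub>R x) \<bullet> x)"
     using MVT2[OF lr(1), of p "%t. gradv \<rho> (x0 - n + t *\<^sub>R x) \<bullet> x"] dp' by blast
    have z: "gradv \<rho> (x0 - n + t *\<^sub>R x) \<bullet> x = 0" using t(3) lr by simp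
    have "x0 - n + l *\<^sub>R x \<in> cball x0 e" "x0 - n + r *\<^sub>R x \<in> cball x0 e"
     using cx(1,3) by (auto simp: l_def r_def S_def min_def max_def)
    note seg = this
    define \<theta> where "\<theta> = (t - l) / (r - l)"
    have "\<theta> * (r - l) = t - l" using lr(1) by (simp add: \<theta>_def)
    then have "t = (1 - \<theta>) * l + \<theta> * r" by (simp add: algebra_simps)
    moreover have "0 <= \<theta>" "\<theta> <= 1" using t(1,2) lr(1) by (auto simp: \<theta>_def)
    ultimately have \<theta>: "0 <= \<theta>" "\<theta> <= 1" "t = (1 - \<theta>) * l + \<theta> * r" by auto
    from seg \<theta>(1,2) have "(1 - \<theta>) *\<^sub>R (x0 - n + l *\<^sub>R x) + \<theta> *\<^sub>R (x0 - n + r *\<^sub>R x) \<in> cball x0 e"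
     by (intro convexD[OF convex_cball]) auto
    also have "(1 - \<theta>) *\<^sub>R (x0 - n + l *\<^sub>R x) + \<theta> *\<^sub>R (x0 - n + r *\<^sub>R x) = x0 - n + t *\<^sub>R x"
     unfolding \<theta>(3) by (simp add: algebra_simps)
    finally have "x0 - n + t *\<^sub>R x \<in> A" using e(2) by blast
    moreover have "x \<in> B"
    proof -
     have "norm (x - n) <= e" using cx(3) by (simp add: S_def dist_norm norm_minus_commute algebra_simps)
     then have "x \<in> cball n e" by (simp add: dist_norm norm_minus_commute)
     then show ?thesis using e(3) by blast
    qed
    ultimately show False using AB(5) z by (auto simp: W_def)
   qed
  qed
  then show "\<exists>U. openin (top_of_set Z) U \<and> x0 \<in> U \<and> negligible U"
   using x0 e(1) by (intro exI[of _ "Z \<inter> ball x0 e"]) (auto simp: S_def intro: negligible_subset)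
 qed
 moreover have "closed {x. \<rho> x <= 0}" by (rule closed_Collect_le[OF c continuous_on_const])
 then have "closure D \<subseteq> {x. \<rho> x <= 0}" unfolding \<rho>(2) by (intro closure_minimal) auto
 then have "frontier D \<subseteq> Z" using D \<rho>(2) by (auto simp: frontier_def interior_open Z_def)
 ultimately have "negligible (frontier D)" by (rule negligible_subset)
 then have "frontier D \<in> null_sets lebesgue" by (simp add: negligible_iff_null_sets)
 moreover have "frontier D \<in> sets borel" using frontier_closed by (rule borel_closed)
 ultimately show ?thesis by (auto simp: null_sets_def)
qed

subsection \<open>Integrals over cylinders\<close>

lemma AE_slices:
 fixes P :: "'a::euclidean_space \<times> 'd::euclidean_space => bool"
 assumes "AE z in lborel. P z" shows "AE x in lborel. AE t in lborel. P (x, t)" "AE t in lborel. AE x in lborel. P (x, t)"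
proof -
 obtain N where N: "N \<in> null_sets lborel" "{x. \<not> P x} \<subseteq> N" using assms by (auto simp: eventually_ae_filter)
 have Ns [measurable]: "N \<in> sets (lborel \<Otimes>\<^sub>M lborel)" unfolding lborel_prod using N(1) by auto
 have "AE z in lborel \<Otimes>\<^sub>M lborel. z \<notin> N" unfolding lborel_prod by (rule AE_not_in[OF N(1)])
 then have x: "AE x in lborel. AE t in lborel. (x, t) \<notin> N" by (rule lborel_pair.AE_pair)
 have m: "{z \<in> space (lborel \<Otimes>\<^sub>M lborel). (fst z, snd z) \<notin> N} \<in> sets (lborel \<Otimes>\<^sub>M lborel)"
  by (rule back_subst[of "%A. A \<in> _", OF sets.compl_sets[OF Ns]]) auto
 from x show "AE x in lborel. AE t in lborel. P (x, t)"
 proof eventually_elim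
  case (elim x)
  then show ?case by eventually_elim (use N(2) in auto)
 qed
 have "AE t in lborel. AE x in lborel. (x, t) \<notin> N"
  by (rule iffD1[OF lborel_pair.AE_commute[where P="%x t. (x, t) \<notin> N", OF m] x])
 then show "AE t in lborel. AE x in lborel. P (x, t)"
 proof eventually_elim
  case (elim t)
  then show ?case by eventually_elim (use N(2) in auto)
 qed
qed

lemma integral_rep:
 fixes v v' g h :: "'b::euclidean_space => 'c::euclidean_space"
 assumes S: "S' \<in> sets borel" "S' \<subseteq> S" and v: "rep S v v'" and g: "g \<in> BM"
  "AE z in lborel. z \<in> S' --> h z = g z" "!!z. z \<notin> S' ==> g z = 0"
 shows "integral\<^sup>L (lebesgue_on S') (%z. v z \<bullet> h z) = ip v' g"
 unfolding ip_def
proof (rule lebesgue_on_integral_eq(1)[OF S(1)])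
 show "(%z. v' z \<bullet> g z) \<in> BM" using rep_meas[OF v] g(1) by measurable
 show "AE z in lborel. z \<in> S' --> v z \<bullet> h z = v' z \<bullet> g z"
  using rep_AE[OF v] g(2) by eventually_elim (use S(2) in auto)
qed (simp add: g(3))

lemma integral_rep_real:
 fixes v v' g h :: "'b::euclidean_space => real"
 assumes "S' \<in> sets borel" "S' \<subseteq> S" "rep S v v'" "g \<in> BM"
  "AE z in lborel. z \<in> S' --> h z = g z" "!!z. z \<notin> S' ==> g z = 0"
 shows "integral\<^sup>L (lebesgue_on S') (%z. v z * h z) = ip v' g"
 using integral_rep[OF assms] by simp

lemma rep_cong: "rep S v v' ==> (!!z. z \<in> S ==> v z = u z) ==> rep S u v'"
 unfolding rep_def by (auto elim: AE_mp)

lemma rep_sub: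
 assumes "rep S v v'" "S' \<in> sets borel" "S' \<subseteq> S" shows "rep S' v (%z. ind S' z *\<^sub>R v' z)"
 unfolding rep_def
proof (intro conjI allI impI)
 show "(%z. ind S' z *\<^sub>R v' z) \<in> BM"
  using rep_meas[OF assms(1)] assms(2) by (intro borel_measurable_scaleR borel_measurable_indicator) auto
 show "AE z in lborel. z \<in> S' --> v z = ind S' z *\<^sub>R v' z"
  using rep_AE[OF assms(1)] by eventually_elim (use assms(3) in auto)
qed simp

lemma grad_x_inner: "i \<in> Basis ==> grad_x \<psi> z \<bullet> i = fder \<psi> z (i, 0)"
 by (simp add: grad_x_def inner_sum_left inner_Basis if_distrib[of "%x. _ * x"] cong: if_cong)

lemma weak_grad_x_pairing:
 fixes V :: "'a::euclidean_space set"
 assumes V: "open V" and v: "rep (cyl V s T) v v'" and G: "rep (cyl V s T) G G'"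
  and \<psi>: "test_fun (cyl V s T) \<psi>" and i: "i \<in> Basis"
 shows "integral\<^sup>L (lebesgue_on (cyl V s T)) (%z. v z * (grad_x \<psi> z \<bullet> i)) = ip v' (%z. fder \<psi> z (i, 0))"
  "integral\<^sup>L (lebesgue_on (cyl V s T)) (%z. (G z \<bullet> i) * \<psi> z) = ip (%z. G' z \<bullet> i) \<psi>"
proof -
 have S: "cyl V s T \<in> sets borel" using cyl_open[OF V] by (rule borel_open)
 show "integral\<^sup>L (lebesgue_on (cyl V s T)) (%z. v z * (grad_x \<psi> z \<bullet> i)) = ip v' (%z. fder \<psi> z (i, 0))"
  by (rule rep_ip_real[OF S v test_fun_meas[OF test_fun_frechet[OF \<psi>]]]) (simp add: grad_x_inner[OF i])
 have "rep (cyl V s T) (%z. G z \<bullet> i) (%z. G' z \<bullet> i)"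
  unfolding rep_def
 proof (intro conjI allI impI)
  show "(%z. G' z \<bullet> i) \<in> BM" using rep_meas[OF G] by measurable
  show "AE z in lborel. z \<in> cyl V s T --> G z \<bullet> i = G' z \<bullet> i" using rep_AE[OF G] by eventually_elim auto
 qed (simp add: rep_out[OF G])
 then show "integral\<^sup>L (lebesgue_on (cyl V s T)) (%z. (G z \<bullet> i) * \<psi> z) = ip (%z. G' z \<bullet> i) \<psi>"
  by (rule rep_ip_real[OF S _ test_fun_meas[OF \<psi>]]) simp
qed

text \<open>On the left the tests are smooth in space and time with compact support in the cylinder,
  on the right products with an arbitrary L^2 factor in time; \<open>wgrad_of_weak\<close> and
  \<open>weak_of_wgrad\<close> connect them.\<close>

lemma L2H1x_iff:
 fixes V :: "'a::euclidean_space set"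
 assumes V: "open V" and v: "rep (cyl V 0 T) v v'" and G: "rep (cyl V 0 T) G G'"
 shows "L2H1x V 0 T v G \<longleftrightarrow> sqi v' \<and> sqi G' \<and> wgrad V v' G'"
proof -
 have S: "cyl V 0 T \<in> sets borel" using cyl_open[OF V] by (rule borel_open)
 have "weak_grad_x (cyl V 0 T) v G \<longleftrightarrow> wgrad V v' G'" if s: "sqi v'" "sqi G'"
 proof
  assume w: "weak_grad_x (cyl V 0 T) v G"
  show "wgrad V v' G'"
  proof (rule wgrad_of_weak[OF _ s])
   show "ip v' (%z. fder \<psi> z (i, 0)) = - ip (%z. G' z \<bullet> i) \<psi>"
    if "test_fun (cyl V 0 T) \<psi>" "i \<in> Basis" for \<psi> i
    using w weak_grad_x_pairing[OF V v G that] that unfolding weak_grad_x_def by simp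
   show "v' z = 0 \<and> G' z = 0" if "snd z \<notin> {0<..<T}" for z
    using that rep_out[OF v, of z] rep_out[OF G, of z] by (cases z) (auto simp: cyl_def)
  qed
 next
  assume w: "wgrad V v' G'"
  show "weak_grad_x (cyl V 0 T) v G"
   unfolding weak_grad_x_def
   using weak_grad_x_pairing[OF V v G] weak_of_wgrad[OF w s] by simp
 qed
 then show ?thesis using L2_iff_rep[OF S v] L2v_iff_rep[OF S G] unfolding L2H1x_def by blast
qed

lemma weak_dt_iff:
 fixes V :: "'a::euclidean_space set"
 assumes V: "open V" and s: "0 <= s" and v: "rep (cyl V 0 T) v v'" and w: "rep (cyl V s T) w w'"
 shows "weak_dt (cyl V s T) v w \<longleftrightarrow>
  (\<forall>\<psi>. test_fun (cyl V s T) \<psi> --> ip v' (%z. fder \<psi> z (0, 1)) = - ip w' \<psi>)"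
proof -
 have S: "cyl V s T \<in> sets borel" using cyl_open[OF V] by (rule borel_open)
 have sub: "cyl V s T \<subseteq> cyl V 0 T" using s by (auto simp: cyl_def)
 have "integral\<^sup>L (lebesgue_on (cyl V s T)) (%z. v z * d_t \<psi> z) = ip v' (%z. fder \<psi> z (0, 1))"
  "integral\<^sup>L (lebesgue_on (cyl V s T)) (%z. w z * \<psi> z) = ip w' \<psi>"
  if \<psi>: "test_fun (cyl V s T) \<psi>" for \<psi>
  by (rule integral_rep_real[OF S sub v test_fun_meas[OF test_fun_frechet[OF \<psi>]]])
    (simp_all add: d_t_def test_fun_outside[OF test_fun_frechet[OF \<psi>]] rep_ip_real[OF S w test_fun_meas[OF \<psi>]])
 then show ?thesis unfolding weak_dt_def by auto
qed

lemma weak_dt_tensor: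
 fixes V :: "'a::euclidean_space set"
 assumes V: "open V" and s: "0 <= s" and v: "rep (cyl V 0 T) v v'" and w: "rep (cyl V s T) w w'"
  and d: "weak_dt (cyl V s T) v w" and p: "test_fun V p" and q: "test_fun {s<..<T} q"
 shows "ip v' (%z. p (fst z) * fder q (snd z) 1) = - ip w' (p \<otimes> q)"
proof -
 have "test_fun (cyl V s T) (p \<otimes> q)" unfolding cyl_def by (rule test_fun_pair[OF p q])
 with d[unfolded weak_dt_iff[OF V s v w]]
 have "ip v' (%z. fder (p \<otimes> q) z (0, 1)) = - ip w' (p \<otimes> q)"
  by blast
 then show ?thesis unfolding frechet_pair_t[OF test_fun_smooth[OF p] test_fun_smooth[OF q]] .
qed

text \<open>Continuity in time concerns the given function \<open>v\<close>, whereas its Borel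
  version agrees with it only almost everywhere; the slices are therefore controlled for almost
  every t. \<open>g\<close> stands for the known trace at \<open>t0\<close>.\<close>

lemma cont_L2_time_near:
 fixes V :: "'a::euclidean_space set"
 assumes V: "V \<in> sets borel" and c: "cont_L2_time V T v" and v: "rep (cyl V 0 T) v v'" and t0: "t0 \<in> {0..T}"
  and g: "rep V g g'" "sqi g'" "integral\<^sup>L (lebesgue_on V) (%x. (v (x, t0) - g x)\<^sup>2) = 0" and e: "e > 0"
 shows "\<exists>\<tau>>0. AE t in lborel. 0 < t \<and> t < T \<and> \<bar>t - t0\<bar> < \<tau> --> (LBINT x. (v' (x, t) - g' x)\<^sup>2) <= e"
proof -
 have "L2 V (%x. v (x, t0))" using c t0 by (simp add: cont_L2_time_def)
 from L2_rep_ex[OF V this] obtain y where y: "rep V (%x. v (x, t0)) y" "sqi y" by blast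
 have yg: "AE x in lborel. y x = g' x"
 proof -
  have "integral\<^sup>L (lebesgue_on V) (%x. (v (x, t0) - g x)\<^sup>2) = (LBINT x. (y x - g' x)\<^sup>2)"
  proof (rule lebesgue_on_integral_eq(1)[OF V])
   show "(%x. (y x - g' x)\<^sup>2) \<in> BM" using rep_meas[OF y(1)] rep_meas[OF g(1)] by measurable
   show "AE x in lborel. x \<in> V --> (v (x, t0) - g x)\<^sup>2 = (y x - g' x)\<^sup>2"
    using rep_AE[OF y(1)] rep_AE[OF g(1)] by eventually_elim auto
  qed (simp add: rep_out[OF y(1)] rep_out[OF g(1)])
  then have "ip (%x. y x - g' x) (%x. y x - g' x) = 0" using g(3) by (simp add: ip_def power2_eq_square)
  then show ?thesis using ip_self_zero_iff[OF sqi_diff[OF y(2) g(2)]] by simp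
 qed
 let ?I = "%s. integral\<^sup>L (lebesgue_on V) (%x. (v (x, s) - v (x, t0))\<^sup>2)"
 have "(?I \<longlongrightarrow> 0) (at t0 within {0..T})" using c t0 by (simp add: cont_L2_time_def)
 then have "\<forall>\<^sub>F s in at t0 within {0..T}. ?I s < e" by (rule order_tendstoD) (rule e)
 then obtain \<tau> where \<tau>: "\<tau> > 0" "!!s. s \<in> {0..T} ==> s \<noteq> t0 ==> dist s t0 < \<tau> ==> ?I s < e"
  unfolding eventually_at by blast
 have "AE t in lborel. t \<noteq> t0" by (rule AE_lborel_singleton)
 moreover have "AE t in lborel. AE x in lborel. (x, t) \<in> cyl V 0 T --> v (x, t) = v' (x, t)"
  by (rule AE_slices(2)[OF rep_AE[OF v]])
 ultimately have "AE t in lborel. 0 < t \<and> t < T \<and> \<bar>t - t0\<bar> < \<tau> --> (LBINT x. (v' (x, t) - g' x)\<^sup>2) <= e"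
 proof eventually_elim
  case (elim t)
  show ?case
  proof
   assume t: "0 < t \<and> t < T \<and> \<bar>t - t0\<bar> < \<tau>"
   have "?I t = (LBINT x. (v' (x, t) - g' x)\<^sup>2)"
   proof (rule lebesgue_on_integral_eq(1)[OF V])
    have "(%x. v' (x, t)) \<in> BM"
     using rep_meas[OF v] by (intro measurable_compose[OF _ rep_meas[OF v]] borel_measurable_Pair) auto
    then show "(%x. (v' (x, t) - g' x)\<^sup>2) \<in> BM" using rep_meas[OF g(1)] by measurable
    show "AE x in lborel. x \<in> V --> (v (x, t) - v (x, t0))\<^sup>2 = (v' (x, t) - g' x)\<^sup>2"
     using elim(2) yg rep_AE[OF y(1)] by eventually_elim (use t in \<open>auto simp: cyl_def\<close>)
   qed (simp add: rep_out[OF v] rep_out[OF g(1)] cyl_def)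
   then show "(LBINT x. (v' (x, t) - g' x)\<^sup>2) <= e" using \<tau>(2)[of t] t elim(1) by (simp add: dist_real_def)
  qed
 qed
 then show ?thesis using \<tau>(1) by blast
qed

subsection \<open>Representation of functions with a trace at one end of the time interval\<close>

text \<open>Both ends are treated at once: \<open>\<sigma> = -1\<close> with the backward kernel and
  a cutoff at 0, \<open>\<sigma> = 1\<close> with the forward kernel and a cutoff at T. The cutoff
  has derivative \<open>- \<sigma> * m n\<close>, and its term disappears because the slices of
  \<open>v\<close> are small at the end in question.\<close>

lemma ibp_limit:
 fixes v D \<Xi> :: "'a::euclidean_space \<times> real => real"
 assumes V: "open V" and T: "T > 0" and v: "sqi v" "!!z. snd z \<notin> {0<..<T} ==> v z = 0" and D: "sqi D"
  and k: "kern T T k" "!!z. k z <= 1"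
  and wdt: "!!p q. test_fun V p ==> test_fun {0<..<T} q ==>
    ip v (%z. p (fst z) * fder q (snd z) 1) = - ip D (p \<otimes> q)"
  and \<eta>: "!!n. \<eta> n \<in> BM" "!!n t. 0 <= \<eta> n t" "!!n t. \<eta> n t <= 1"
   "!!t. 0 < t ==> t < T ==> (%n. \<eta> n t) ~~> 1"
  and m: "!!n. m n \<in> BM" "!!n t. 0 <= m n t" "!!n t. m n t <= B n"
   "!!n. (LBINT t. of_bool (0 < t \<and> t < T) * m n t) <= 1"
  and near: "!!e. e > 0 ==> \<exists>N. (AE t in lborel. t \<in> N --> (LBINT x. (v (x, t))\<^sup>2) <= e)
    \<and> (\<forall>\<^sub>F n in sequentially. \<forall>t. 0 < t \<and> t < T \<and> t \<notin> N --> m n t <= e)"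
  and \<sigma>: "\<bar>\<sigma>\<bar> = 1"
  and cut: "!!n q. test_fun {0<..<T} q ==> test_fun {0<..<T} (%t. \<eta> n t * tk1 k q t)"
   "!!n q t. test_fun {0<..<T} q ==>
    fder (%t. \<eta> n t * tk1 k q t) t 1 = (- \<sigma> * m n t) * tk1 k q t + \<sigma> * (\<eta> n t * q t)"
  and \<Xi>: "sqi \<Xi>" "!!z. z \<notin> cyl V 0 T ==> \<Xi> z = 0"
 shows "\<sigma> * ip v \<Xi> = - ip D (tk k \<Xi>)"
proof -
 have sk: "sqi (tk k \<Xi>)" by (rule tk_schur(1)[OF k(1) \<Xi>(1)])
 have k0: "tk k \<Xi> z = 0" if "snd z \<notin> {0<..<T}" for z
  using tk_support(1)[OF k(1), of "snd z" \<Xi> "fst z"] that by auto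
 have cutoff: "(%n. ip g (%z. \<eta> n (snd z) * h z)) ~~> ip g h"
  if g: "sqi g" and h: "sqi h" "!!z. snd z \<notin> {0<..<T} ==> h z = 0" for g h :: "'a \<times> real => real"
 proof (rule ip_tendsto_strong[OF _ h(1) g])
  have ab: "\<bar>\<eta> n t\<bar> <= 1" for n t using \<eta>(2,3)[of n t] by simp
  show s: "sqi (%z. \<eta> n (snd z) * h z)" for n by (rule sqi_tmult_real[OF h(1) \<eta>(1) ab])
  show "(%n. ip (%z. \<eta> n (snd z) * h z - h z) (%z. \<eta> n (snd z) * h z - h z)) ~~> 0"
  proof (rule L2_dominated_convergence[OF sqi_meas[OF s] sqi_meas[OF h(1)] h(1)])
   show "norm (\<eta> n (snd z) * h z - h z) <= norm (h z)" for n z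
   proof -
    have "\<eta> n (snd z) * h z - h z = (\<eta> n (snd z) - 1) * h z" by (simp add: algebra_simps)
    moreover have "\<bar>\<eta> n (snd z) - 1\<bar> <= 1" using \<eta>(2,3)[of n "snd z"] by auto
    ultimately show ?thesis using mult_right_mono[of "\<bar>\<eta> n (snd z) - 1\<bar>" 1 "\<bar>h z\<bar>"] by (simp add: abs_mult)
   qed
   show "(%n. \<eta> n (snd z) * h z) ~~> h z" for z
   proof (cases "snd z \<in> {0<..<T}")
    case True
    then have "(%n. \<eta> n (snd z) * h z) ~~> 1 * h z" by (intro tendsto_mult \<eta>(4) tendsto_const) auto
    then show ?thesis by simp
   qed (simp add: h(2))
  qed
 qed
 have eq: "- \<sigma> * ip v (%z. m n (snd z) * tk k \<Xi> z) + \<sigma> * ip v (%z. \<eta> n (snd z) * \<Xi> z) = - ip D (%z. \<eta> n (snd z) * tk k \<Xi> z)" for n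
 proof -
  have ab: "\<bar>\<eta> n t\<bar> <= 1" "\<bar>- \<sigma> * m n t\<bar> <= B n" for t using \<eta>(2,3)[of n t] m(2,3)[of n t] \<sigma> by (auto simp: abs_mult)
  have mm: "(%t. - \<sigma> * m n t) \<in> BM" using m(1)[of n] by measurable
  have "ip v (%z. (- \<sigma> * m n (snd z)) * tk k \<Xi> z) + \<sigma> * ip v (%z. \<eta> n (snd z) * \<Xi> z) = - ip D (%z. \<eta> n (snd z) * tk k \<Xi> z)"
   by (rule ibp[OF V v(1) D k(1) wdt \<eta>(1) ab(1) mm ab(2) cut \<Xi>])
  moreover have "ip v (%z. (- \<sigma> * m n (snd z)) * tk k \<Xi> z) = - \<sigma> * ip v (%z. m n (snd z) * tk k \<Xi> z)"
   by (simp add: ip_def mult.assoc mult.left_commute[of _ "\<sigma>"])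
  ultimately show ?thesis by simp
 qed
 have "(%n. ip v (%z. m n (snd z) * tk k \<Xi> z)) ~~> 0"
  by (rule weighted_pairing_tendsto_0[OF T k \<Xi>(1) v(1) m weight_tendsto_0[OF v m near]])
 moreover have "(%n. ip v (%z. \<eta> n (snd z) * \<Xi> z)) ~~> ip v \<Xi>"
  by (rule cutoff[OF v(1) \<Xi>(1)]) (use \<Xi>(2) in \<open>auto simp: cyl_def\<close>)
 ultimately have "(%n. - \<sigma> * ip v (%z. m n (snd z) * tk k \<Xi> z) + \<sigma> * ip v (%z. \<eta> n (snd z) * \<Xi> z)) ~~> - \<sigma> * 0 + \<sigma> * ip v \<Xi>"
  by (intro tendsto_intros)
 moreover have "(%n. - ip D (%z. \<eta> n (snd z) * tk k \<Xi> z)) ~~> - ip D (tk k \<Xi>)"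
  by (intro tendsto_intros cutoff[OF D sk k0])
 ultimately show ?thesis using LIMSEQ_unique unfolding eq by fastforce
qed

lemma initial_trace_zero:
 fixes v D \<Xi> :: "'a::euclidean_space \<times> real => real"
 assumes V: "open V" and T: "T > 0" and v: "sqi v" "!!z. snd z \<notin> {0<..<T} ==> v z = 0" and D: "sqi D"
  and wdt: "!!p q. test_fun V p ==> test_fun {0<..<T} q ==>
    ip v (%z. p (fst z) * fder q (snd z) 1) = - ip D (p \<otimes> q)"
  and near: "!!e. e > 0 ==> \<exists>\<tau>>0. AE t in lborel. 0 < t \<and> t < T \<and> \<bar>t - 0\<bar> < \<tau> --> (LBINT x. (v (x, t))\<^sup>2) <= e"
  and \<Xi>: "sqi \<Xi>" "!!z. z \<notin> cyl V 0 T ==> \<Xi> z = 0"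
 shows "ip v \<Xi> = ip D (tk (kback T) \<Xi>)"
proof -
 have "(-1) * ip v \<Xi> = - ip D (tk (kback T) \<Xi>)"
 proof (rule ibp_limit[OF V T v D kern_kback[OF T] kback_le_1 wdt, where \<eta>=etan and m=detan and B="%n. (real (Suc n))\<^sup>2 * 2"])
  fix e :: real assume e: "e > 0"
  obtain \<tau> where \<tau>: "\<tau> > 0" "AE t in lborel. 0 < t \<and> t < T \<and> \<bar>t - 0\<bar> < \<tau> --> (LBINT x. (v (x, t))\<^sup>2) <= e"
   using near[OF e] by blast
  show "\<exists>N. (AE t in lborel. t \<in> N --> (LBINT x. (v (x, t))\<^sup>2) <= e)
    \<and> (\<forall>\<^sub>F n in sequentially. \<forall>t. 0 < t \<and> t < T \<and> t \<notin> N --> detan n t <= e)"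
  proof (intro exI[of _ "{0<..<T} \<inter> {..<\<tau>}"] conjI)
   show "AE t in lborel. t \<in> {0<..<T} \<inter> {..<\<tau>} --> (LBINT x. (v (x, t))\<^sup>2) <= e" using \<tau>(2) by eventually_elim auto
   show "\<forall>\<^sub>F n in sequentially. \<forall>t. 0 < t \<and> t < T \<and> t \<notin> {0<..<T} \<inter> {..<\<tau>} --> detan n t <= e"
    using detan_far[OF \<tau>(1) e] by eventually_elim auto
  qed
 next
  fix n q assume q: "test_fun {0<..<T} q"
  have z: "0 <= (0::real)" "0 < 1 / real (Suc n)" by auto
  show "test_fun {0<..<T} (%t. etan n t * tk1 (kback T) q t)" by (rule cut_back(1)[OF T z q])
  show "fder (%t. etan n t * tk1 (kback T) q t) t 1 = (- (-1) * detan n t) * tk1 (kback T) q t + (-1) * (etan n t * q t)" for t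
   using cut_back(2)[OF T z q] by simp
 qed (use \<Xi> detan_integral[OF T] in \<open>auto simp: etan_bounds etan_tendsto detan_nonneg detan_bound simp del: of_nat_Suc\<close>)
 then show ?thesis by simp
qed

lemma final_trace_zero:
 fixes v D \<Xi> :: "'a::euclidean_space \<times> real => real"
 assumes V: "open V" and T: "T > 0" and v: "sqi v" "!!z. snd z \<notin> {0<..<T} ==> v z = 0" and D: "sqi D"
  and wdt: "!!p q. test_fun V p ==> test_fun {0<..<T} q ==>
    ip v (%z. p (fst z) * fder q (snd z) 1) = - ip D (p \<otimes> q)"
  and near: "!!e. e > 0 ==> \<exists>\<tau>>0. AE t in lborel. 0 < t \<and> t < T \<and> \<bar>t - T\<bar> < \<tau> --> (LBINT x. (v (x, t))\<^sup>2) <= e"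
  and \<Xi>: "sqi \<Xi>" "!!z. z \<notin> cyl V 0 T ==> \<Xi> z = 0"
 shows "ip v \<Xi> = - ip D (tk (kT (kback T)) \<Xi>)"
proof -
 \<comment> \<open>The substitution t -> T - t reduces the mass of the reflected weight to that of
   \<open>detan\<close>.\<close>
 have reflect: "(LBINT t. of_bool (0 < t \<and> t < T) * detan n (T - t)) <= 1" for n
 proof -
  have "(LBINT t. of_bool (0 < t \<and> t < T) * detan n t)
    = \<bar>-1::real\<bar> *\<^sub>R (LBINT t. of_bool (0 < T + (-1) * t \<and> T + (-1) * t < T) * detan n (T + (-1) * t))"
   by (rule lborel_integral_real_affine) simp
  also have "\<dots> = (LBINT t. of_bool (0 < t \<and> t < T) * detan n (T - t))"
   by (simp, intro int_cong) (auto simp: of_bool_def)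
  finally show ?thesis using detan_integral[OF T, of n] by simp
 qed
 have "1 * ip v \<Xi> = - ip D (tk (kT (kback T)) \<Xi>)"
 proof (rule ibp_limit[OF V T v D kern_kfwd[OF T] kfwd_le_1 wdt, where \<eta>="%n t. etan n (T - t)" and m="%n t. detan n (T - t)" and B="%n. (real (Suc n))\<^sup>2 * 2"])
  fix e :: real assume e: "e > 0"
  obtain \<tau> where \<tau>: "\<tau> > 0" "AE t in lborel. 0 < t \<and> t < T \<and> \<bar>t - T\<bar> < \<tau> --> (LBINT x. (v (x, t))\<^sup>2) <= e"
   using near[OF e] by blast
  show "\<exists>N. (AE t in lborel. t \<in> N --> (LBINT x. (v (x, t))\<^sup>2) <= e)
    \<and> (\<forall>\<^sub>F n in sequentially. \<forall>t. 0 < t \<and> t < T \<and> t \<notin> N --> detan n (T - t) <= e)"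
  proof (intro exI[of _ "{0<..<T} \<inter> {T - \<tau><..}"] conjI)
   show "AE t in lborel. t \<in> {0<..<T} \<inter> {T - \<tau><..} --> (LBINT x. (v (x, t))\<^sup>2) <= e" using \<tau>(2) by eventually_elim auto
   show "\<forall>\<^sub>F n in sequentially. \<forall>t. 0 < t \<and> t < T \<and> t \<notin> {0<..<T} \<inter> {T - \<tau><..} --> detan n (T - t) <= e"
    using detan_far[OF \<tau>(1) e]
   proof eventually_elim
    case (elim n)
    show ?case
    proof (intro allI impI)
     fix t assume "0 < t \<and> t < T \<and> t \<notin> {0<..<T} \<inter> {T - \<tau><..}"
     then have "T - t \<ge> \<tau>" by auto
     then show "detan n (T - t) <= e" using elim by blast
    qed
   qed
  qed
 next
  fix n q assume q: "test_fun {0<..<T} q"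
  show "test_fun {0<..<T} (%t. etan n (T - t) * tk1 (kT (kback T)) q t)" by (rule cut_fwd(1)[OF T q])
  show "fder (%t. etan n (T - t) * tk1 (kT (kback T)) q t) t 1
    = (- 1 * detan n (T - t)) * tk1 (kT (kback T)) q t + 1 * (etan n (T - t) * q t)" for t
   using cut_fwd(2)[OF T q] by simp
 next
  show "(%t. etan n (T - t)) \<in> BM" "(%t. detan n (T - t)) \<in> BM" for n
   by measurable
 qed (use \<Xi> reflect in \<open>auto simp: etan_bounds etan_tendsto detan_nonneg detan_bound simp del: of_nat_Suc\<close>)
 then show ?thesis by simp
qed

text \<open>The limit equation accepts only backward integrals. This lemma shows that every test
  function of the limit problem is one, namely of minus its time derivative, and that its initial
  trace is minus the integral of that derivative over (0, T).\<close>

lemma trace_representation: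
 fixes \<phi> D :: "'a::euclidean_space \<times> real => real"
 assumes V: "open V" and T: "T > 0" and \<phi>: "sqi \<phi>" "!!z. z \<notin> cyl V 0 T ==> \<phi> z = 0"
  and D: "sqi D" "!!z. z \<notin> cyl V 0 T ==> D z = 0" and y: "sqi y" "!!x. x \<notin> V ==> y x = 0"
  and wdt: "!!p q. test_fun V p ==> test_fun {0<..<T} q ==>
    ip \<phi> (%z. p (fst z) * fder q (snd z) 1) = - ip D (p \<otimes> q)"
  and near_0: "!!e. e > 0 ==> \<exists>\<tau>>0. AE t in lborel. 0 < t \<and> t < T \<and> \<bar>t - 0\<bar> < \<tau> --> (LBINT x. (\<phi> (x, t) - y x)\<^sup>2) <= e"
  and near_T: "!!e. e > 0 ==> \<exists>\<tau>>0. AE t in lborel. 0 < t \<and> t < T \<and> \<bar>t - T\<bar> < \<tau> --> (LBINT x. (\<phi> (x, t))\<^sup>2) <= e"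
 shows "AE z in lborel. \<phi> z = tk (kback T) (%z. - D z) z"
  "sqi g ==> ip y g = - ip D (%z. g (fst z) * ind {0<..<T} (snd z))"
proof -
 note kb = kern_kback[OF T]
 let ?B = "tk (kback T)" and ?A = "tk (kT (kback T))"
 have VB: "V \<in> sets borel" using V by (rule borel_open)
 have \<phi>t: "\<phi> z = 0" if "snd z \<notin> {0<..<T}" for z using that by (intro \<phi>(2)) (auto simp: cyl_def)
 have fwd: "ip \<phi> \<Xi> = - ip D (?A \<Xi>)" if "sqi \<Xi>" "!!z. z \<notin> cyl V 0 T ==> \<Xi> z = 0" for \<Xi>
  by (rule final_trace_zero[OF V T \<phi>(1) \<phi>t D(1) wdt near_T that])
 \<comment> \<open>By the zero final trace and the adjoint rule, pairing \<open>\<phi>\<close> and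
   \<open>?B D\<close> with the same function gives opposite values; so \<open>R\<close> is
   orthogonal to itself.\<close>
 define R where "R z = \<phi> z + ?B D z" for z
 have sB: "sqi (?B D)" by (rule tk_schur(1)[OF kb D(1)])
 have "?B D z = 0" if "z \<notin> cyl V 0 T" for z by (rule tk_out[OF kb D(2) that])
 then have R: "sqi R" "z \<notin> cyl V 0 T ==> R z = 0" for z
  unfolding R_def[abs_def] using sqi_add[OF \<phi>(1) sB] \<phi>(2) by auto
 have add: "ip R h = ip \<phi> h + ip (?B D) h" if "sqi h" for h
  unfolding R_def[abs_def] by (rule ip_add_left[OF \<phi>(1) sB that])
 have "ip R R = ip \<phi> R + ip (?B D) R" by (rule add[OF R(1)])
 also have "ip (?B D) R = ip D (?A R)" by (rule tk_adjoint[OF kb D(1) R(1)])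
 also have "ip \<phi> R = - ip D (?A R)" by (rule fwd[OF R])
 finally have "AE z in lborel. R z = 0" using ip_self_zero_iff[OF R(1)] by simp
 then show "AE z in lborel. \<phi> z = ?B (%z. - D z) z"
 proof eventually_elim
  case (elim z)
  have "?B (%z. - D z) z = - ?B D z" by (simp add: tk_def)
  then show ?case using elim by (simp add: R_def)
 qed
 assume g: "sqi g"
 define gV where "gV x = ind V x * g x" for x
 have sgV: "sqi gV" unfolding gV_def[abs_def] using sqi_indicator[OF g VB] by simp
 \<comment> \<open>A time factor of integral 1: its forward and backward integrals add up to 1 on
   (0, T), so the identities from the two ends combine to the pairing of \<open>D\<close> with
   \<open>g\<close> alone.\<close>
 define q where "q t = ind {0<..<T} t / T" for t
 have sq: "sqi q" unfolding q_def[abs_def] using sqi_cmult[OF sqi_ind_interval[of 0 T], of "1/T"] by simp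
 define \<Xi> where "\<Xi> z = gV (fst z) * q (snd z)" for z
 have s\<Xi>: "sqi \<Xi>" unfolding \<Xi>_def[abs_def] by (rule sqi_tensor[OF sgV sq])
 have "\<Xi> z = 0" if "z \<notin> cyl V 0 T" for z
  using that by (cases z) (auto simp: \<Xi>_def gV_def q_def cyl_def indicator_def)
 note \<Xi> = s\<Xi> this
 define Y where "Y z = y (fst z) * ind {0<..<T} (snd z)" for z
 have Y: "sqi Y" unfolding Y_def[abs_def] by (rule sqi_tensor[OF y(1) sqi_ind_interval])
 define v where "v z = \<phi> z - Y z" for z
 have sv: "sqi v" unfolding v_def[abs_def] by (rule sqi_diff[OF \<phi>(1) Y])
 have "ip v \<Xi> = ip D (?B \<Xi>)"
 proof (rule initial_trace_zero[OF V T sv _ D(1) _ _ \<Xi>])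
  show "v z = 0" if "snd z \<notin> {0<..<T}" for z using that \<phi>t[OF that] by (simp add: v_def Y_def)
  fix p :: "'a => real" and q assume p: "test_fun V p" and q: "test_fun {0<..<T} q"
  let ?q' = "%t. fder q t 1"
  have q': "test_fun {0<..<T} ?q'" by (rule test_fun_frechet[OF q])
  have sp: "sqi p" and sq': "sqi ?q'" by (rule test_fun_sqi[OF p], rule test_fun_sqi[OF q'])
  have "ip Y (p \<otimes> ?q') = ip y p * ip (ind {0<..<T}) ?q'"
   unfolding Y_def[abs_def] by (rule ip_tensor[OF y(1) sp sqi_ind_interval sq'])
  also have "ip (ind {0<..<T}) ?q' = (LBINT t. ?q' t)"
   unfolding ip_def by (intro int_cong) (use test_fun_outside[OF q'] in \<open>auto simp: indicator_def\<close>)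
  also have "\<dots> = 0" by (rule test_fun_integral_deriv[OF q])
  finally show "ip v (p \<otimes> ?q') = - ip D (p \<otimes> q)"
   unfolding v_def[abs_def] ip_diff_left[OF \<phi>(1) Y test_tensor_sqi[OF p sq']] using wdt[OF p q] by simp
 next
  fix e :: real assume "e > 0"
  then obtain \<tau> where \<tau>: "\<tau> > 0" "AE t in lborel. 0 < t \<and> t < T \<and> \<bar>t - 0\<bar> < \<tau> --> (LBINT x. (\<phi> (x, t) - y x)\<^sup>2) <= e"
   using near_0 by blast
  show "\<exists>\<tau>>0. AE t in lborel. 0 < t \<and> t < T \<and> \<bar>t - 0\<bar> < \<tau> --> (LBINT x. (v (x, t))\<^sup>2) <= e"
   by (intro exI[of _ \<tau>] conjI \<tau>(1)) (use \<tau>(2) in \<open>eventually_elim, auto simp: v_def Y_def\<close>)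
 qed
 moreover have "ip v \<Xi> = ip \<phi> \<Xi> - ip Y \<Xi>" unfolding v_def[abs_def] by (rule ip_diff_left[OF \<phi>(1) Y \<Xi>(1)])
 moreover have "ip \<phi> \<Xi> = - ip D (?A \<Xi>)" by (rule fwd[OF \<Xi>])
 moreover have "ip Y \<Xi> = ip y gV * ip (ind {0<..<T}) q"
  unfolding Y_def[abs_def] \<Xi>_def[abs_def] by (rule ip_tensor[OF y(1) sgV sqi_ind_interval sq])
 moreover have "ip (ind {0<..<T}) q = 1"
 proof -
  have "ip (ind {0<..<T}) q = (LBINT t. ind {0<..<T} t / T)"
   unfolding ip_def by (intro int_cong) (auto simp: q_def indicator_def)
  then show ?thesis using T by simp
 qed
 moreover have "ip y gV = ip y g"
  unfolding ip_def by (intro int_cong) (use y(2) in \<open>auto simp: gV_def indicator_def\<close>)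
 moreover have "ip D (?A \<Xi>) + ip D (?B \<Xi>) = ip D (%z. g (fst z) * ind {0<..<T} (snd z))"
 proof -
  have sA: "sqi (?A \<Xi>)" "sqi (?B \<Xi>)" using tk_schur(1)[OF kern_kfwd[OF T] \<Xi>(1)] tk_schur(1)[OF kb \<Xi>(1)] by auto
  have one: "tk1 (kT (kback T)) q t + tk1 (kback T) q t = 1" if t: "0 < t" "t < T" for t
  proof -
   have "tk1 (kT (kback T)) q t = (LBINT s. ind {0<..<t} s / T)"
    unfolding tk1_def by (intro int_cong) (use t in \<open>auto simp: kT_def kback_def q_def indicator_def\<close>)
   moreover have "tk1 (kback T) q t = (LBINT s. ind {t<..<T} s / T)"
    unfolding tk1_def by (intro int_cong) (use t in \<open>auto simp: kback_def q_def indicator_def\<close>)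
   ultimately show ?thesis using t T by (simp add: add_divide_distrib[symmetric])
  qed
  have "ip D (?A \<Xi>) + ip D (?B \<Xi>) = ip D (%z. ?A \<Xi> z + ?B \<Xi> z)" by (rule ip_add_right[OF sA D(1), symmetric])
  also have "\<dots> = ip D (%z. g (fst z) * ind {0<..<T} (snd z))"
   unfolding ip_def
  proof (rule int_cong)
   fix z
   show "D z \<bullet> (?A \<Xi> z + ?B \<Xi> z) = D z \<bullet> (g (fst z) * ind {0<..<T} (snd z))"
   proof (cases "z \<in> cyl V 0 T")
    case True
    then have z: "fst z \<in> V" "0 < snd z" "snd z < T" by (auto simp: cyl_def)
    have "?A \<Xi> z + ?B \<Xi> z = gV (fst z) * (tk1 (kT (kback T)) q (snd z) + tk1 (kback T) q (snd z))"
     unfolding \<Xi>_def[abs_def] tk_tensor by (simp add: distrib_left)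
    then show ?thesis using one[OF z(2,3)] z by (simp add: gV_def)
   qed (simp add: D(2))
  qed
  finally show ?thesis .
 qed
 ultimately show "ip y g = - ip D (%z. g (fst z) * ind {0<..<T} (snd z))" by simp
qed

text \<open>Formulated through pairings because the two gradients need not agree outside the
  cylinder. This allows a gradient known on a larger domain to be compared with one on a smaller
  domain.\<close>

lemma wgrad_unique:
 fixes G1 G2 :: "'a::euclidean_space \<times> real => 'a"
 assumes V: "open V" and w: "wgrad V v1 G1" "wgrad V v2 G2" and s: "sqi G1" "sqi G2"
  and v: "!!z. z \<in> cyl V 0 T ==> v1 z = v2 z" and h: "sqi h" "!!z. z \<notin> cyl V 0 T ==> h z = 0"
 shows "ip G1 h = ip G2 h"
proof -
 have "ip (%z. G1 z \<bullet> i) (%z. h z \<bullet> i) = ip (%z. G2 z \<bullet> i) (%z. h z \<bullet> i)" if i: "i \<in> Basis" for i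
 proof -
  note c = sqi_comp[OF s(1), of i] sqi_comp[OF s(2), of i] sqi_comp[OF h(1), of i]
  have "ip (%z. G1 z \<bullet> i - G2 z \<bullet> i) (%z. h z \<bullet> i) = 0"
  proof (rule ip_zero_tensor[OF V, of "{0<..<T}"])
   fix p :: "'a => real" and q :: "real => real" assume p: "test_fun V p" and q: "test_fun {0<..<T} q"
   have "ip v1 (%z. fder p (fst z) i * q (snd z)) = ip v2 (%z. fder p (fst z) i * q (snd z))"
    unfolding ip_def
   proof (rule int_cong)
    fix z
    show "v1 z \<bullet> (fder p (fst z) i * q (snd z)) = v2 z \<bullet> (fder p (fst z) i * q (snd z))"
     using v[of z] test_fun_outside[OF test_fun_frechet[OF p], of "fst z" i] test_fun_outside[OF q, of "snd z"]
     by (cases "fst z \<in> V \<and> snd z \<in> {0<..<T}") (auto simp: cyl_def mem_Times_iff)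
   qed
   then show "ip (%z. G1 z \<bullet> i - G2 z \<bullet> i) (p \<otimes> q) = 0"
    using wgradD[OF w(1) p test_fun_sqi[OF q] i] wgradD[OF w(2) p test_fun_sqi[OF q] i]
     ip_diff_left[OF c(1,2) test_tensor_sqi[OF p test_fun_sqi[OF q]]] by simp
  qed (use c h(2) sqi_diff[OF c(1,2)] in \<open>auto simp: cyl_def\<close>)
  then show ?thesis using ip_diff_left[OF c(1,2,3)] by simp
 qed
 then show ?thesis using ip_components[OF s(1) h(1)] ip_components[OF s(2) h(1)] by simp
qed

section \<open>From the weak solutions of the statement to the locales\<close>

lemma sqi_div_t:
 fixes h :: "'a::euclidean_space \<times> real => real"
 assumes h: "sqi h" "!!z. snd z <= s ==> h z = 0" and s: "0 < s" shows "sqi (%z. h z / snd z)"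
proof (rule sqi_bound[OF h(1), where c="1/s"])
 have "(%z::'a\<times>real. snd z) \<in> BM" by (rule snd_meas) simp
 then show "(%z. h z / snd z) \<in> BM" by (intro borel_measurable_divide sqi_meas[OF h(1)])
 fix z
 show "norm (h z / snd z) <= (1/s) * norm (h z)"
 proof (cases "snd z <= s")
  case False
  then have "norm (h z) / \<bar>snd z\<bar> <= norm (h z) / s" using s by (intro divide_left_mono) auto
  then show ?thesis by (simp add: abs_divide)
 qed (simp add: h(2))
qed

lemma rep_self: "v \<in> BM ==> (!!z. z \<notin> S ==> v z = 0) ==> rep S v v"
 by (simp add: rep_def)

text \<open>\<open>\<beta>\<close> is a Borel version of the coefficient whose bounds hold
  everywhere. The last conclusion keeps the weak time derivative against all smooth tests of the
  cylinder, while the locale records it only for products.\<close>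

lemma heat_sol_of_weak_sol:
 fixes V :: "'a::euclidean_space set"
 assumes V: "open V" and T: "T > 0" and c: "0 < c" and \<beta>: "\<beta> \<in> BM" "!!x. c <= \<beta> x" "!!x. \<beta> x <= M"
  and bd: "AE x in lborel. x \<in> V --> bd x = \<beta> x"
  and f: "rep (cyl V 0 T) f f'" "sqi f'" and ub: "rep V ub ub'" "sqi ub'" and sol: "weak_sol V T bd f ub u"
 shows "\<exists>u' G' D'. heat_sol V T c M \<beta> f' ub' u' G' D' \<and> rep (cyl V 0 T) u u' \<and>
  (\<forall>s \<psi>. 0 < s --> s < T --> test_fun (cyl V s T) \<psi> -->
    ip u' (%z. fder \<psi> z (0, 1)) = - ip (%z. ind {s<..} (snd z) * D' z) \<psi>)"
proof -
 let ?S = "cyl V 0 T"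
 have VB: "V \<in> sets borel" using V by (rule borel_open)
 have S: "cyl V s T \<in> sets borel" for s by (rule cyl_borel[OF VB])
 obtain Dt G where Dt: "!!s. 0 < s ==> s < T ==> L2 (cyl V s T) u \<and> L2 (cyl V s T) Dt \<and> weak_dt (cyl V s T) u Dt"
  and cont: "cont_L2_time V T u" and G: "L2H1x V 0 T (%z. bd (fst z) * u z) G"
  and weak: "!!\<phi> G\<phi>. L2H1x V 0 T \<phi> G\<phi> ==> (\<exists>t0>0. \<forall>z\<in>?S. snd z < t0 --> \<phi> z = 0) ==>
      integral\<^sup>L (lebesgue_on ?S) (%z. Dt z * \<phi> z + G z \<bullet> G\<phi> z) = integral\<^sup>L (lebesgue_on ?S) (%z. f z * \<phi> z)"
  and u0: "integral\<^sup>L (lebesgue_on V) (%x. (u (x, 0) - ub x)\<^sup>2) = 0"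
  using sol unfolding weak_sol_def by blast
 have \<beta>0: "0 < \<beta> x" for x using c \<beta>(2)[of x] by linarith
 obtain w' where w': "rep ?S (%z. bd (fst z) * u z) w'" "sqi w'" using L2_rep_ex[OF S] G unfolding L2H1x_def by blast
 obtain G' where G': "rep ?S G G'" "sqi G'" using L2v_rep_ex[OF S] G unfolding L2H1x_def by blast
 \<comment> \<open>Square integrability up to t = 0 is supplied for the product with the
   coefficient, so \<open>u'\<close> is its Borel version divided by \<open>\<beta>\<close>.\<close>
 define u' where "u' z = (1 / \<beta> (fst z)) * w' z" for z
 have w_u: "w' = (%z. \<beta> (fst z) * u' z)"
 proof
  fix z show "w' z = \<beta> (fst z) * u' z" using \<beta>0[of "fst z"] by (simp add: u'_def)
 qed
 have su: "sqi u'"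
 proof -
  have "(%x. 1 / \<beta> x) \<in> BM" using \<beta>(1) by measurable
  moreover have "\<bar>1 / \<beta> x\<bar> <= 1 / c" for x using \<beta>0[of x] \<beta>(2)[of x] c by (simp add: frac_le)
  ultimately show ?thesis unfolding u'_def[abs_def] by (rule sqi_xmult_real[OF w'(2)])
 qed
 have ru: "rep ?S u u'"
  unfolding rep_def
 proof (intro conjI allI impI)
  show "u' \<in> BM" by (rule sqi_meas[OF su])
  show "u' z = 0" if "z \<notin> ?S" for z using rep_out[OF w'(1) that] by (simp add: u'_def)
  show "AE z in lborel. z \<in> ?S --> u z = u' z"
   using rep_AE[OF w'(1)] AE_fst[OF bd]
  proof eventually_elim
   case (elim z)
   show ?case
   proof
    assume z: "z \<in> ?S"
    then have "fst z \<in> V" by (auto simp: cyl_def)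
    then show "u z = u' z" using elim z \<beta>0[of "fst z"] by (simp add: u'_def field_simps)
   qed
  qed
 qed
 \<comment> \<open>Measurability of \<open>Dt\<close> is known after each positive time; countably
   many such cylinders exhaust the whole one.\<close>
 have "Dt \<in> borel_measurable (lebesgue_on ?S)"
 proof (rule measurable_piecewise_restrict[where C="range (%n. cyl V (T / real (n + 2)) T)"])
  show "countable (range (%n. cyl V (T / real (n + 2)) T))" by (rule countable_image[OF countableI_type])
  show "space (lebesgue_on ?S) \<subseteq> \<Union> (range (%n. cyl V (T / real (n + 2)) T))"
  proof
   fix z assume "z \<in> space (lebesgue_on ?S)"
   then have z: "fst z \<in> V" "0 < snd z" "snd z < T" by (auto simp: cyl_def)
   obtain n :: nat where n: "T / snd z < real n" using reals_Archimedean2 by blast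
   then have "T < real n * snd z" using z by (simp add: divide_less_eq)
   also have "\<dots> <= real (n + 2) * snd z" using z by simp
   finally have "T / real (n + 2) < snd z" by (simp add: divide_less_eq mult.commute)
   then show "z \<in> \<Union> (range (%n. cyl V (T / real (n + 2)) T))" using z by (cases z) (auto simp: cyl_def)
  qed
  fix A assume "A \<in> range (%n. cyl V (T / real (n + 2)) T)"
  then obtain n where A: "A = cyl V (T / real (n + 2)) T" by blast
  have "T / x < T" if "1 < x" for x
   using mult_strict_left_mono[OF that T] that by (simp add: divide_less_eq)
  from this[of "real (n + 2)"] have s: "0 < T / real (n + 2)" "T / real (n + 2) < T" using T by auto
  have sub: "A \<subseteq> ?S" using s(1) by (auto simp: A cyl_def)
  have AS: "A \<in> sets borel" unfolding A by (rule S)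
  show "A \<inter> space (lebesgue_on ?S) \<in> sets (lebesgue_on ?S)"
   using AS S[of 0] sub by (simp add: sets_restrict_space_iff Int_absorb2)
  have "restrict_space (lebesgue_on ?S) A = lebesgue_on (?S \<inter> A)"
   by (rule restrict_restrict_space) (use AS S[of 0] in auto)
  then have e: "restrict_space (lebesgue_on ?S) A = lebesgue_on A" using sub by (simp add: Int_absorb1)
  have "Dt \<in> borel_measurable (lebesgue_on A)" using Dt[OF s] unfolding A L2_def by blast
  then show "Dt \<in> borel_measurable (restrict_space (lebesgue_on ?S) A)" unfolding e .
 qed
 from rep_ex[OF S this] obtain D' where D': "rep ?S Dt D'" by blast
 have cut: "rep (cyl V s T) Dt (%z. ind {s<..} (snd z) * D' z)" if "0 < s" for s
 proof -
  have "cyl V s T \<subseteq> ?S" using that by (auto simp: cyl_def)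
  moreover have "(%z. ind (cyl V s T) z *\<^sub>R D' z) = (%z. ind {s<..} (snd z) * D' z)"
  proof
   fix z show "ind (cyl V s T) z *\<^sub>R D' z = ind {s<..} (snd z) * D' z"
    using rep_out[OF D', of z] that by (cases z) (auto simp: cyl_def indicator_def)
  qed
  ultimately show ?thesis using rep_sub[OF D' S[of s]] by simp
 qed
 have cut_sqi: "sqi (%z. ind {s<..} (snd z) * D' z)" if "0 < s" "s < T" for s
  using L2_iff_rep[OF S cut[OF that(1)]] Dt[OF that] by simp
 have wdt: "ip u' (%z. fder \<psi> z (0, 1)) = - ip (%z. ind {s<..} (snd z) * D' z) \<psi>"
  if s: "0 < s" "s < T" and "test_fun (cyl V s T) \<psi>" for s \<psi>
  using weak_dt_iff[OF V less_imp_le[OF s(1)] ru cut[OF s(1)]] Dt[OF s] that by blast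
 have "heat_sol V T c M \<beta> f' ub' u' G' D'"
 proof
  show "open V" "0 < T" "0 < c" "\<beta> \<in> BM" "!!x. c <= \<beta> x" "!!x. \<beta> x <= M"
   "sqi f'" "sqi ub'" "sqi u'" "sqi G'" by (fact V T c \<beta> f ub su G')+
  show "f' z = 0" "u' z = 0" "G' z = 0" "D' z = 0" if "z \<notin> ?S" for z
   using that rep_out[OF f(1)] rep_out[OF ru] rep_out[OF G'(1)] rep_out[OF D'] by auto
  show "ub' x = 0" if "x \<notin> V" for x using rep_out[OF ub(1) that] .
  show "D' \<in> BM" by (rule rep_meas[OF D'])
  show "sqi (%z. ind {s<..} (snd z) * D' z)" if "0 < s" "s < T" for s by (rule cut_sqi[OF that])
  show "wgrad V (%z. \<beta> (fst z) * u' z) G'"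
   using G L2H1x_iff[OF V w'(1) G'(1)] unfolding w_u[symmetric] by simp
  fix s :: real and p :: "'a => real" and q :: "real => real" assume s: "0 < s" "s < T" and p: "test_fun V p" "test_fun {s<..<T} q"
  show "ip u' (%z. p (fst z) * fder q (snd z) 1)
    = - ip (%z. ind {s<..} (snd z) * D' z) (p \<otimes> q)"
   by (rule weak_dt_tensor[OF V less_imp_le[OF s(1)] ru cut[OF s(1)] _ p]) (use Dt[OF s] in simp)
 next
  fix \<phi> :: "'a \<times> real => real" and G\<phi> :: "'a \<times> real => 'a" and s :: real
  assume \<phi>: "sqi \<phi>" "sqi G\<phi>" "!!z. z \<notin> ?S ==> \<phi> z = 0" "!!z. z \<notin> ?S ==> G\<phi> z = 0" "wgrad V \<phi> G\<phi>"
   and s: "0 < s" "!!z. snd z < s ==> \<phi> z = 0"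
  have r\<phi>: "rep ?S \<phi> \<phi>" "rep ?S G\<phi> G\<phi>" using \<phi> sqi_meas by (auto intro!: rep_self)
  have "L2H1x V 0 T \<phi> G\<phi>" using L2H1x_iff[OF V r\<phi>] \<phi> by simp
  from weak[OF this] have eq: "integral\<^sup>L (lebesgue_on ?S) (%z. Dt z * \<phi> z + G z \<bullet> G\<phi> z) = integral\<^sup>L (lebesgue_on ?S) (%z. f z * \<phi> z)"
   using s by blast
  \<comment> \<open>A positive time below both \<open>s\<close> and T; truncating the derivative
    there does not change its pairing with \<open>\<phi>\<close>.\<close>
  define s' where "s' = min (s/2) (T/2)"
  have s': "0 < s'" "s' < T" "s' < s" using s(1) T by (auto simp: s'_def min_def)
  have D\<phi>: "D' z * \<phi> z = (ind {s'<..} (snd z) * D' z) \<bullet> \<phi> z" for z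
   using s(2)[of z] s'(3) by (cases "snd z <= s'") auto
  have i: "integrable lborel (%z. D' z * \<phi> z)" unfolding D\<phi> by (rule ip_integrable[OF cut_sqi[OF s'(1,2)] \<phi>(1)])
  have "integral\<^sup>L (lebesgue_on ?S) (%z. Dt z * \<phi> z + G z \<bullet> G\<phi> z) = (LBINT z. D' z * \<phi> z + G' z \<bullet> G\<phi> z)"
  proof (rule lebesgue_on_integral_eq(1)[OF S])
   have [measurable]: "D' \<in> BM" "\<phi> \<in> BM" "G' \<in> BM" "G\<phi> \<in> BM"
    using rep_meas[OF D'] sqi_meas \<phi> G' by auto
   show "(%z. D' z * \<phi> z + G' z \<bullet> G\<phi> z) \<in> BM" by measurable
   show "AE z in lborel. z \<in> ?S --> Dt z * \<phi> z + G z \<bullet> G\<phi> z = D' z * \<phi> z + G' z \<bullet> G\<phi> z"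
    using rep_AE[OF D'] rep_AE[OF G'(1)] by eventually_elim auto
  qed (simp add: \<phi>)
  also have "\<dots> = ip D' \<phi> + ip G' G\<phi>"
   unfolding ip_def using Bochner_Integration.integral_add[OF i ip_integrable[OF G'(2) \<phi>(2)]] by simp
  finally show "ip D' \<phi> + ip G' G\<phi> = ip f' \<phi>"
   using eq rep_ip_real[OF S f(1) sqi_meas[OF \<phi>(1)], of \<phi>] by simp
 next
  fix e :: real assume e: "e > 0"
  have "0 \<in> {0..T}" using T by simp
  from cont_L2_time_near[OF VB cont ru this ub u0 e] obtain \<tau> where \<tau>: "\<tau> > 0"
   "AE t in lborel. 0 < t \<and> t < T \<and> \<bar>t - 0\<bar> < \<tau> --> (LBINT x. (u' (x, t) - ub' x)\<^sup>2) <= e" by blast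
  have "AE t in lborel. 0 < t \<and> t < min \<tau> T --> (LBINT x. (u' (x, t) - ub' x)\<^sup>2) <= e"
   using \<tau>(2) by eventually_elim auto
  then show "\<exists>\<tau>>0. AE t in lborel. 0 < t \<and> t < \<tau> --> (LBINT x. (u' (x, t) - ub' x)\<^sup>2) <= e"
   using \<tau>(1) T by (intro exI[of _ "min \<tau> T"]) auto
 qed
 then show ?thesis using ru wdt by blast
qed

context delta_limit
begin

text \<open>\<open>Rl\<close> is the weak limit of t times the derivative. Against functions that
  vanish up to a positive time the division by t is harmless.\<close>

definition "Dl z = Rl z / snd z"

lemma D_tendsto:
 assumes s: "0 < s" and h: "sqi h" "!!z. z \<notin> cyl V2 s T ==> h z = 0"
 shows "(%n. ip (D (r n)) h) ~~> ip Dl h"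
proof -
 have "sqi (%z. h z / snd z)" by (rule sqi_div_t[OF h(1) _ s]) (rule h(2), auto simp: cyl_def)
 from xD_tendsto[OF this] have "(%n. ip (xD (r n)) (%z. h z / snd z)) ~~> ip Rl (%z. h z / snd z)" .
 moreover have "ip (xD n) (%z. h z / snd z) = ip (D n) h" for n
  unfolding ip_def
 proof (rule int_cong)
  fix z
  show "xD n z \<bullet> (h z / snd z) = D n z \<bullet> h z"
  proof (cases "z \<in> cyl V2 s T")
   case True
   then show ?thesis using s by (cases z) (auto simp: xD_def cyl_def)
  qed (simp add: h(2))
 qed
 moreover have "ip Rl (%z. h z / snd z) = ip Dl h" by (simp add: ip_def Dl_def)
 ultimately show ?thesis by simp
qed

lemma Dl_cut: "0 < s ==> sqi (%z. ind (cyl V2 s T) z * Dl z)"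
proof -
 assume s: "0 < s"
 have "sqi (%z. ind (cyl V2 s T) z * Rl z)"
  using sqi_indicator[OF l_sqi(3) cyl_borel[OF V2_borel, of s T]] by simp
 from sqi_div_t[OF this _ s] show ?thesis by (auto simp: Dl_def cyl_def)
qed

end

section \<open>Assembly of the limit statements for the original functions\<close>

theorem mainTheorem3:
  fixes \<Omega> \<Omega>1 :: "'a::euclidean_space set"
    and b :: "'a \<Rightarrow> real" and f :: "'a \<times> real \<Rightarrow> real" and ubar :: "'a \<Rightarrow> real"
    and T :: real and U :: "real \<Rightarrow> 'a \<times> real \<Rightarrow> real"
  assumes dim: "DIM('a) \<ge> 2"
    and dom: "smooth_bounded_domain \<Omega>"
    and dom1: "smooth_bounded_domain \<Omega>1" "closure \<Omega>1 \<subseteq> \<Omega>"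
    and T: "T > 0"
    and b_meas: "b \<in> borel_measurable (lebesgue_on \<Omega>)"
    and b_bdd: "\<exists>M. AE x in lebesgue_on \<Omega>. \<bar>b x\<bar> \<le> M"
    and b_pos: "\<exists>C>0. AE x in lebesgue_on \<Omega>. b x \<ge> C"
    and f: "L2 (cyl \<Omega> 0 T) f"
    and ubar: "L2 \<Omega> ubar"
    and sol: "\<forall>\<delta>. 0 < \<delta> \<and> \<delta> \<le> 1 \<longrightarrow> weak_sol \<Omega> T (bdelta \<Omega>1 b \<delta>) f ubar (U \<delta>)"
  shows "\<exists>\<delta>s u Gu Dtu.
     (\<forall>k. 0 < \<delta>s k \<and> \<delta>s k \<le> 1) \<and> \<delta>s \<longlonglongrightarrow> 0
   \<comment> \<open>strong convergence in L^2(Omega^2_T)\<close>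
   \<and> L2 (cyl (\<Omega> - closure \<Omega>1) 0 T) u
   \<and> (\<lambda>k. integral\<^sup>L (lebesgue_on (cyl (\<Omega> - closure \<Omega>1) 0 T)) (\<lambda>z. (U (\<delta>s k) z - u z)\<^sup>2))
       \<longlonglongrightarrow> 0
   \<comment> \<open>bu in L^2(0,T;H^1(Omega^2)) with gradient Gu, and weak convergence of gradients\<close>
   \<and> L2H1x (\<Omega> - closure \<Omega>1) 0 T (\<lambda>z. b (fst z) * u z) Gu
   \<and> (\<forall>Gs. (\<forall>k. L2H1x (\<Omega> - closure \<Omega>1) 0 T (\<lambda>z. b (fst z) * U (\<delta>s k) z) (Gs k)) \<longrightarrow>
        (\<forall>h. L2v (cyl (\<Omega> - closure \<Omega>1) 0 T) h \<longrightarrow>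
          (\<lambda>k. integral\<^sup>L (lebesgue_on (cyl (\<Omega> - closure \<Omega>1) 0 T)) (\<lambda>z. Gs k z \<bullet> h z))
          \<longlonglongrightarrow> integral\<^sup>L (lebesgue_on (cyl (\<Omega> - closure \<Omega>1) 0 T)) (\<lambda>z. Gu z \<bullet> h z)))
   \<comment> \<open>time derivatives: weak convergence in L^2(Omega^2 x (t0,T)) for every t0\<close>
   \<and> (\<forall>t0. 0 < t0 \<and> t0 < T \<longrightarrow>
        L2 (cyl (\<Omega> - closure \<Omega>1) t0 T) Dtu \<and> weak_dt (cyl (\<Omega> - closure \<Omega>1) t0 T) u Dtu \<and>
        (\<forall>Ds. (\<forall>k. L2 (cyl (\<Omega> - closure \<Omega>1) t0 T) (Ds k) \<and>
                    weak_dt (cyl (\<Omega> - closure \<Omega>1) t0 T) (U (\<delta>s k)) (Ds k)) \<longrightarrow>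
           (\<forall>h. L2 (cyl (\<Omega> - closure \<Omega>1) t0 T) h \<longrightarrow>
              (\<lambda>k. integral\<^sup>L (lebesgue_on (cyl (\<Omega> - closure \<Omega>1) t0 T)) (\<lambda>z. Ds k z * h z))
              \<longlonglongrightarrow> integral\<^sup>L (lebesgue_on (cyl (\<Omega> - closure \<Omega>1) t0 T)) (\<lambda>z. Dtu z * h z))))
   \<comment> \<open>weak convergence in L^2(0,T;L^2_loc(Omega^1))\<close>
   \<and> (\<forall>K. compact K \<and> K \<subseteq> \<Omega>1 \<longrightarrow>
        L2 (cyl K 0 T) u \<and>
        (\<forall>h. L2 (cyl K 0 T) h \<longrightarrow>
           (\<lambda>k. integral\<^sup>L (lebesgue_on (cyl K 0 T)) (\<lambda>z. U (\<delta>s k) z * h z))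
           \<longlonglongrightarrow> integral\<^sup>L (lebesgue_on (cyl K 0 T)) (\<lambda>z. u z * h z)))
   \<comment> \<open>(i): bu = 0 on Gamma x (0,T) (zero extension lies in L^2(0,T;H^1(Omega)))\<close>
   \<and> (\<exists>Ge. L2H1x \<Omega> 0 T (\<lambda>z. if fst z \<in> \<Omega> - closure \<Omega>1 then b (fst z) * u z else 0) Ge)
   \<comment> \<open>(i): weak formulation on Omega^2\<close>
   \<and> (\<forall>\<phi> D\<phi> G\<phi>.
        L2H1x (\<Omega> - closure \<Omega>1) 0 T \<phi> G\<phi>
        \<and> L2 (cyl (\<Omega> - closure \<Omega>1) 0 T) D\<phi> \<and> weak_dt (cyl (\<Omega> - closure \<Omega>1) 0 T) \<phi> D\<phi>
        \<and> cont_L2_time (\<Omega> - closure \<Omega>1) T \<phi>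
        \<and> integral\<^sup>L (lebesgue_on (\<Omega> - closure \<Omega>1)) (\<lambda>x. (\<phi> (x, T))\<^sup>2) = 0
        \<and> (\<exists>Ge. L2H1x \<Omega> 0 T (\<lambda>z. if fst z \<in> \<Omega> - closure \<Omega>1 then \<phi> z else 0) Ge)
      \<longrightarrow>
        integral\<^sup>L (lebesgue_on (cyl (\<Omega> - closure \<Omega>1) 0 T)) (\<lambda>z. - u z * D\<phi> z + Gu z \<bullet> G\<phi> z)
        = integral\<^sup>L (lebesgue_on (\<Omega> - closure \<Omega>1)) (\<lambda>x. ubar x * \<phi> (x, 0))
          + integral\<^sup>L (lebesgue_on (cyl (\<Omega> - closure \<Omega>1) 0 T)) (\<lambda>z. f z * \<phi> z))
   \<comment> \<open>(ii): u = F on Omega^1_T\<close>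
   \<and> (AE z in lebesgue_on (cyl \<Omega>1 0 T).
        u z = ubar (fst z) + integral\<^sup>L (lebesgue_on {0..snd z}) (\<lambda>\<tau>. f (fst z, \<tau>)))"
proof -
 define V2 where "V2 = \<Omega> - closure \<Omega>1"
 have op: "open \<Omega>" "open \<Omega>1" using dom dom1(1) by (auto simp: smooth_bounded_domain_def)
 have oV2: "open V2" unfolding V2_def by (intro open_Diff op closed_closure)
 have \<Omega>B: "\<Omega> \<in> sets borel" and V2B: "V2 \<in> sets borel" using op(1) oV2 by (auto intro: borel_open)
 have sub1: "\<Omega>1 \<subseteq> \<Omega>" using dom1(2) closure_subset by blast
 have sub2: "V2 \<subseteq> \<Omega>" "V2 \<inter> \<Omega>1 = {}" unfolding V2_def using closure_subset by auto
 have S: "cyl \<Omega> s T \<in> sets borel" "cyl V2 s T \<in> sets borel" for s by (rule cyl_borel, fact)+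
 have AE_\<Omega>: "(AE x in lebesgue_on \<Omega>. P x) \<longleftrightarrow> (AE x in lborel. x \<in> \<Omega> --> P x)" for P
  using \<Omega>B by (subst AE_restrict_space_iff) (auto simp: AE_completion_iff)
 obtain M0 where M0: "AE x in lborel. x \<in> \<Omega> --> \<bar>b x\<bar> <= M0" using b_bdd unfolding AE_\<Omega> by blast
 obtain C where C: "C > 0" "AE x in lborel. x \<in> \<Omega> --> C <= b x" using b_pos unfolding AE_\<Omega> by blast
 obtain b0 where b0: "rep \<Omega> b b0" using rep_ex[OF \<Omega>B b_meas] by blast
 \<comment> \<open>The bounds on \<open>b\<close> hold only almost everywhere, so its Borel version
   is clamped to the interval from C to M; the maximum guarantees C \<le> M.\<close>
 define M where "M = max C M0"
 define b' where "b' x = max C (min M (b0 x))" for x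
 have b'm: "b' \<in> BM" unfolding b'_def[abs_def] using rep_meas[OF b0] by measurable
 have b'b: "C <= b' x" "b' x <= M" "0 < b' x" for x using C(1) by (auto simp: b'_def M_def)
 have bb': "AE x in lborel. x \<in> \<Omega> --> b x = b' x"
  using M0 C(2) rep_AE[OF b0] by eventually_elim (auto simp: b'_def M_def)
 obtain f' where f': "rep (cyl \<Omega> 0 T) f f'" "sqi f'" using L2_rep_ex[OF S(1) f] by blast
 obtain ub' where ub': "rep \<Omega> ubar ub'" "sqi ub'" using L2_rep_ex[OF \<Omega>B ubar] by blast
 define \<delta> where "\<delta> n = inverse (real (Suc n))" for n
 have \<delta>: "0 < \<delta> n" "\<delta> n <= 1" for n by (auto simp: \<delta>_def inverse_eq_divide)
 have \<delta>0: "\<delta> ~~> 0" unfolding \<delta>_def[abs_def] by (rule LIMSEQ_inverse_real_of_nat)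
 define P where "P n u' G' D' \<longleftrightarrow> heat_sol \<Omega> T (\<delta> n * C) M (%x. if x \<in> \<Omega>1 then \<delta> n * b' x else b' x) f' ub' u' G' D' \<and> rep (cyl \<Omega> 0 T) (U (\<delta> n)) u' \<and>
  (\<forall>s \<psi>. 0 < s --> s < T --> test_fun (cyl \<Omega> s T) \<psi> -->
    ip u' (%z. fder \<psi> z (0, 1)) = - ip (%z. ind {s<..} (snd z) * D' z) \<psi>)" for n u' G' D'
 have "\<exists>u' G' D'. P n u' G' D'" for n
  unfolding P_def
 proof (rule heat_sol_of_weak_sol[OF op(1) T _ _ _ _ _ f' ub'])
  have "\<Omega>1 \<in> sets borel" using op(2) by (rule borel_open)
  then show "(%x. if x \<in> \<Omega>1 then \<delta> n * b' x else b' x) \<in> BM" using b'm by measurable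
  show "0 < \<delta> n * C" using \<delta> C by simp
  have 1: "\<delta> n * C <= 1 * C" "\<delta> n * b' x <= 1 * b' x" "\<delta> n * C <= \<delta> n * b' x" for x
   using \<delta>[of n] C(1) b'b[of x] by (auto intro!: mult_right_mono mult_left_mono)
  show "\<delta> n * C <= (if x \<in> \<Omega>1 then \<delta> n * b' x else b' x)" for x using 1 b'b[of x] by auto
  have "\<delta> n * b' x <= M" for x using 1(2)[of x] b'b(2)[of x] by linarith
  then show "(if x \<in> \<Omega>1 then \<delta> n * b' x else b' x) <= M" for x using b'b(2)[of x] by auto
  show "AE x in lborel. x \<in> \<Omega> --> bdelta \<Omega>1 b (\<delta> n) x = (if x \<in> \<Omega>1 then \<delta> n * b' x else b' x)"
   using bb' by eventually_elim (auto simp: bdelta_def)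
  show "weak_sol \<Omega> T (bdelta \<Omega>1 b (\<delta> n)) f ubar (U (\<delta> n))" using sol \<delta>[of n] by blast
 qed
 then obtain u' G' D' where P: "!!n. P n (u' n) (G' n) (D' n)" by metis
 have hs: "heat_sol \<Omega> T (\<delta> n * C) M (%x. if x \<in> \<Omega>1 then \<delta> n * b' x else b' x) f' ub' (u' n) (G' n) (D' n)"
  and ru: "rep (cyl \<Omega> 0 T) (U (\<delta> n)) (u' n)"
  and wdt: "0 < s ==> s < T ==> test_fun (cyl \<Omega> s T) \<psi> ==>
    ip (u' n) (%z. fder \<psi> z (0, 1)) = - ip (%z. ind {s<..} (snd z) * D' n z) \<psi>" for n s \<psi>
  using P[of n] by (simp_all add: P_def)
 have df: "delta_family \<Omega> \<Omega>1 T C M b' f' ub' \<delta> u' G' D'"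
  by (rule delta_family.intro[OF op dom1(2) smooth_bounded_domain_null_frontier[OF dom1(1)] b'm b'b(1,2) C(1) T \<delta> \<delta>0 hs])
 interpret F: delta_family \<Omega> \<Omega>1 T C M b' f' ub' \<delta> u' G' D' by (rule df)
 have V2eq: "F.V2 = V2" by (simp add: F.V2_def V2_def)
 obtain r w\<^sub>1 G\<^sub>1 R\<^sub>1 where lim: "strict_mono (r :: nat => nat) \<and> sqi w\<^sub>1 \<and> sqi G\<^sub>1 \<and> sqi R\<^sub>1
  \<and> (\<forall>h. sqi h --> (%n. ip (F.w (r n)) h) ~~> ip w\<^sub>1 h) \<and> (\<forall>h. sqi h --> (%n. ip (G' (r n)) h) ~~> ip G\<^sub>1 h)
  \<and> (\<forall>h. sqi h --> (%n. ip (F.xD (r n)) h) ~~> ip R\<^sub>1 h)"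
  using F.subsequence_limit by (elim exE)
 interpret L: delta_limit \<Omega> \<Omega>1 T C M b' f' ub' \<delta> u' G' D' r w\<^sub>1 G\<^sub>1 R\<^sub>1
  by (intro delta_limit.intro df delta_limit_axioms.intro) (use lim in simp_all)
 note l_out = L.l_out[unfolded V2eq] and Dlc = L.Dl_cut[unfolded V2eq]
 have cyl2: "cyl V2 s T \<subseteq> cyl V2 0 T" "cyl V2 s T \<subseteq> cyl \<Omega> s T" if "0 <= s" for s
  using that sub2 by (auto simp: cyl_def)
 \<comment> \<open>Two formulas define the limit: the weak limit over \<open>V2\<close>, and
   elsewhere the time integral \<open>F\<close>, which settles (ii) up to null sets.\<close>
 define u where "u z = (if fst z \<in> V2 then L.ul z else F.F z)" for z
 have ru2: "rep (cyl V2 0 T) u L.ul"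
  by (rule rep_cong[OF rep_self[OF sqi_meas[OF L.l_sqi(4)] l_out(4)]]) (auto simp: u_def cyl_def)
 have rG2: "rep (cyl V2 0 T) L.Gl L.Gl" by (rule rep_self[OF sqi_meas[OF L.l_sqi(2)] l_out(2)])
 have AEb: "AE z in lborel. fst (z :: 'a \<times> real) \<in> \<Omega> --> b (fst z) = b' (fst z)" by (rule AE_fst[OF bb'])
 have wl: "L.wl z = b' (fst z) * L.ul z" for z using b'b(3)[of "fst z"] by (simp add: L.ul_def)
 have rw2: "rep (cyl V2 0 T) (%z. b (fst z) * u z) L.wl"
  unfolding rep_def
 proof (intro conjI allI impI)
  show "L.wl \<in> BM" by (rule sqi_meas[OF L.l_sqi(1)])
  show "L.wl z = 0" if "z \<notin> cyl V2 0 T" for z by (rule l_out(1)[OF that])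
  show "AE z in lborel. z \<in> cyl V2 0 T --> b (fst z) * u z = L.wl z"
   using AEb rep_AE[OF ru2] by eventually_elim (use sub2 in \<open>auto simp: cyl_def wl\<close>)
 qed
 have rU2: "rep (cyl V2 0 T) (U (\<delta> n)) (%z. F.m z * u' n z)" for n
  using rep_sub[OF ru[of n] S(2) subset_trans[OF cyl2(2) ], of 0] by (simp add: F.m_def[abs_def] V2eq)
 have c3: "(%k. integral\<^sup>L (lebesgue_on (cyl V2 0 T)) (%z. (U (\<delta> (r k)) z - u z)\<^sup>2)) ~~> 0"
 proof -
  have "integral\<^sup>L (lebesgue_on (cyl V2 0 T)) (%z. (U (\<delta> n) z - u z)\<^sup>2) = ip (%z. F.m z * (u' n z - L.ul z)) (%z. F.m z * (u' n z - L.ul z))" for n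
   unfolding ip_def
  proof (rule lebesgue_on_integral_eq(1)[OF S(2)])
   have "sqi (%z. F.m z * (u' n z - L.ul z))" by (intro F.mult_m_real sqi_diff F.u L.l_sqi)
   from sqi_meas[OF this] have [measurable]: "(%z. F.m z * (u' n z - L.ul z)) \<in> BM" .
   show "(%z. (F.m z * (u' n z - L.ul z)) \<bullet> (F.m z * (u' n z - L.ul z))) \<in> BM" by measurable
   show "AE z in lborel. z \<in> cyl V2 0 T --> (U (\<delta> n) z - u z)\<^sup>2 = (F.m z * (u' n z - L.ul z)) \<bullet> (F.m z * (u' n z - L.ul z))"
    using rep_AE[OF rU2[of n]] rep_AE[OF ru2]
    by eventually_elim (simp add: L.m_cases(2)[unfolded V2eq] power2_eq_square)
  qed (simp add: F.m_def V2eq)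
  then show ?thesis using L.strong_u by simp
 qed
 have c4: "L2H1x V2 0 T (%z. b (fst z) * u z) L.Gl"
  using L2H1x_iff[OF oV2 rw2 rG2] L.l_sqi wgrad_mono[OF L.wgrad_l sub2(1)] by simp
 \<comment> \<open>Whatever weak gradients are supplied, uniqueness over \<open>V2\<close> replaces
   them in pairings by those of the solutions, for which weak convergence is known.\<close>
 have c5: "(%k. integral\<^sup>L (lebesgue_on (cyl V2 0 T)) (%z. Gs k z \<bullet> h z))
   ~~> integral\<^sup>L (lebesgue_on (cyl V2 0 T)) (%z. L.Gl z \<bullet> h z)"
  if Gs: "!!k. L2H1x V2 0 T (%z. b (fst z) * U (\<delta> (r k)) z) (Gs k)" and h: "L2v (cyl V2 0 T) h" for Gs h
 proof -
  obtain h' where h': "rep (cyl V2 0 T) h h'" "sqi h'" using L2v_rep_ex[OF S(2) h] by blast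
  have "integral\<^sup>L (lebesgue_on (cyl V2 0 T)) (%z. Gs k z \<bullet> h z) = ip (G' (r k)) h'" for k
  proof -
   have "L2v (cyl V2 0 T) (Gs k)" using Gs[of k] by (simp add: L2H1x_def)
   then obtain g where g: "rep (cyl V2 0 T) (Gs k) g" "sqi g" using L2v_rep_ex[OF S(2)] by blast
   have rbU: "rep (cyl V2 0 T) (%z. b (fst z) * U (\<delta> (r k)) z) (%z. F.m z * F.w (r k) z)"
    unfolding rep_def
   proof (intro conjI allI impI)
    show "(%z. F.m z * F.w (r k) z) \<in> BM" by (rule sqi_meas[OF F.mult_m_real[OF F.w(1)]])
    show "F.m z * F.w (r k) z = 0" if "z \<notin> cyl V2 0 T" for z using that by (simp add: F.m_def V2eq)
    show "AE z in lborel. z \<in> cyl V2 0 T --> b (fst z) * U (\<delta> (r k)) z = F.m z * F.w (r k) z"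
     using AEb rep_AE[OF rU2[of "r k"]]
    proof eventually_elim
     case (elim z)
     show ?case
     proof
      assume z: "z \<in> cyl V2 0 T"
      then have "fst z \<in> V2" by (auto simp: cyl_def)
      then have "fst z \<in> \<Omega>" "fst z \<notin> \<Omega>1" using sub2 by auto
      then show "b (fst z) * U (\<delta> (r k)) z = F.m z * F.w (r k) z"
       using elim z by (simp add: F.w_def F.\<beta>_V2)
     qed
    qed
   qed
   have "integral\<^sup>L (lebesgue_on (cyl V2 0 T)) (%z. Gs k z \<bullet> h z) = ip g h'"
    by (rule rep_ip[OF S(2) g(1) rep_meas[OF h'(1)] rep_AE[OF h'(1)]])
   also have "\<dots> = ip (G' (r k)) h'"
   proof (rule wgrad_unique[OF oV2 _ wgrad_mono[OF F.w(3) sub2(1)] g(2) F.G(1) _ h'(2) rep_out[OF h'(1)]])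
    show "wgrad V2 (%z. F.m z * F.w (r k) z) g" using L2H1x_iff[OF oV2 rbU g(1)] Gs[of k] by simp
    show "F.m z * F.w (r k) z = F.w (r k) z" if "z \<in> cyl V2 0 T" for z
     using L.m_cases(2)[of z] that by (simp add: V2eq)
   qed
   finally show ?thesis .
  qed
  moreover have "integral\<^sup>L (lebesgue_on (cyl V2 0 T)) (%z. L.Gl z \<bullet> h z) = ip L.Gl h'"
   by (rule rep_ip[OF S(2) rG2 rep_meas[OF h'(1)] rep_AE[OF h'(1)]])
  ultimately show ?thesis using L.G_tendsto[OF h'(2)] by simp
 qed
 \<comment> \<open>That \<open>L.Dl\<close> is the time derivative of the limit follows by passing
   to the limit in the identity for the solutions, with \<open>u\<close> expressed through
   \<open>w\<close>. Arbitrary supplied derivatives are identified with those of the solutions by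
   density of test functions in the cylinder.\<close>
 have c6: "L2 (cyl V2 t0 T) L.Dl \<and> weak_dt (cyl V2 t0 T) u L.Dl \<and>
    (\<forall>Ds. (\<forall>k. L2 (cyl V2 t0 T) (Ds k) \<and> weak_dt (cyl V2 t0 T) (U (\<delta> (r k))) (Ds k)) -->
      (\<forall>h. L2 (cyl V2 t0 T) h -->
       (%k. integral\<^sup>L (lebesgue_on (cyl V2 t0 T)) (%z. Ds k z * h z))
       ~~> integral\<^sup>L (lebesgue_on (cyl V2 t0 T)) (%z. L.Dl z * h z)))"
  if t0: "0 < t0" "t0 < T" for t0
 proof -
  let ?Q = "cyl V2 t0 T"
  let ?D = "%z. ind ?Q z * L.Dl z"
  have rD: "rep ?Q L.Dl ?D"
   unfolding rep_def using sqi_meas[OF Dlc[OF t0(1)]] by simp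
  have pair_D: "ip ?D h = ip L.Dl h" if "!!z. z \<notin> ?Q ==> h z = 0" for h
   unfolding ip_def by (intro int_cong) (use that in \<open>auto simp: indicator_def\<close>)
  have cutD: "ip (%z. ind {t0<..} (snd z) * D' n z) h = ip (D' n) h" if "!!z. z \<notin> ?Q ==> h z = 0" for h n
   unfolding ip_def by (intro int_cong) (use that in \<open>auto simp: indicator_def cyl_def\<close>)
  have wdt_n: "ip (u' n) (%z. fder \<psi> z (0, 1)) = - ip (D' n) \<psi>" if \<psi>: "test_fun ?Q \<psi>" for n \<psi>
   using wdt[OF t0 test_fun_mono[OF \<psi> cyl2(2)], of n] t0 cutD[of \<psi> n] test_fun_outside[OF \<psi>] by simp
  have wd: "weak_dt ?Q u L.Dl"
   unfolding weak_dt_iff[OF oV2 less_imp_le[OF t0(1)] ru2 rD]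
  proof (intro allI impI)
   fix \<psi> assume \<psi>: "test_fun ?Q \<psi>"
   let ?\<psi>' = "%z. fder \<psi> z (0, 1)"
   have \<psi>': "sqi ?\<psi>'" by (rule test_fun_sqi[OF test_fun_frechet[OF \<psi>]])
   have \<psi>'0: "?\<psi>' z = 0" if "z \<notin> cyl F.V2 0 T" for z
    by (rule test_fun_outside[OF test_fun_frechet[OF \<psi>]]) (use that cyl2(1)[OF less_imp_le[OF t0(1)]] in \<open>auto simp: V2eq\<close>)
   have "(%n. ip (F.w (r n)) (%z. ?\<psi>' z / b' (fst z))) ~~> ip L.wl (%z. ?\<psi>' z / b' (fst z))"
    by (rule L.w_tendsto[OF F.div_b[OF \<psi>']])
   moreover have "ip (F.w (r n)) (%z. ?\<psi>' z / b' (fst z)) = - ip (D' (r n)) \<psi>" for n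
    using F.u_on_V2[OF \<psi>' \<psi>'0, of "r n"] wdt_n[of \<psi> "r n", OF \<psi>] by simp
   moreover have "(%n. - ip (D' (r n)) \<psi>) ~~> - ip L.Dl \<psi>"
    by (intro tendsto_intros L.D_tendsto[OF t0(1) test_fun_sqi[OF \<psi>]]) (simp add: V2eq test_fun_outside[OF \<psi>])
   ultimately have "ip L.wl (%z. ?\<psi>' z / b' (fst z)) = - ip L.Dl \<psi>" using LIMSEQ_unique by simp
   moreover have "ip L.wl (%z. ?\<psi>' z / b' (fst z)) = ip L.ul ?\<psi>'" by (simp add: ip_def L.ul_def)
   ultimately show "ip L.ul ?\<psi>' = - ip ?D \<psi>" using pair_D[OF test_fun_outside[OF \<psi>]] by simp
  qed
  have "(%k. integral\<^sup>L (lebesgue_on ?Q) (%z. Ds k z * h z)) ~~> integral\<^sup>L (lebesgue_on ?Q) (%z. L.Dl z * h z)"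
   if Ds: "!!k. L2 ?Q (Ds k) \<and> weak_dt ?Q (U (\<delta> (r k))) (Ds k)" and h: "L2 ?Q h" for Ds h
  proof -
   obtain h' where h': "rep ?Q h h'" "sqi h'" using L2_rep_ex[OF S(2) h] by blast
   have "integral\<^sup>L (lebesgue_on ?Q) (%z. Ds k z * h z) = ip (D' (r k)) h'" for k
   proof -
    obtain d where d: "rep ?Q (Ds k) d" "sqi d" using L2_rep_ex[OF S(2)] Ds by blast
    let ?E = "%z. ind {t0<..} (snd z) * D' (r k) z"
    have sE: "sqi ?E" by (rule heat_sol.D(3)[OF hs t0])
    have "ip (%z. d z - ?E z) h' = 0"
    proof (rule ip_zero_test[OF cyl_open[OF oV2] sqi_diff[OF d(2) sE] h'(2) rep_out[OF h'(1)]])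
     fix \<psi> assume \<psi>: "test_fun ?Q \<psi>"
     let ?\<psi>' = "%z. fder \<psi> z (0, 1)"
     have "ip (%z. F.m z * u' (r k) z) ?\<psi>' = - ip d \<psi>"
      using weak_dt_iff[OF oV2 less_imp_le[OF t0(1)] rU2 d(1)] Ds \<psi> by blast
     moreover have "ip (%z. F.m z * u' (r k) z) ?\<psi>' = ip (u' (r k)) ?\<psi>'"
      unfolding ip_def
     proof (rule int_cong)
      fix z
      show "(F.m z * u' (r k) z) \<bullet> ?\<psi>' z = u' (r k) z \<bullet> ?\<psi>' z"
       using L.m_cases(2)[of z] test_fun_outside[OF test_fun_frechet[OF \<psi>], of z] cyl2(1)[of t0] t0
       by (cases "z \<in> ?Q") (auto simp: V2eq)
     qed
     moreover have "ip ?E \<psi> = ip (D' (r k)) \<psi>" by (rule cutD[OF test_fun_outside[OF \<psi>]])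
     ultimately show "ip (%z. d z - ?E z) \<psi> = 0"
      using wdt_n[of \<psi> "r k", OF \<psi>] ip_diff_left[OF d(2) sE test_fun_sqi[OF \<psi>]] by simp
    qed
    then have "ip d h' = ip (D' (r k)) h'"
     using ip_diff_left[OF d(2) sE h'(2)] cutD[of h' "r k", OF rep_out[OF h'(1)]] by simp
    then show ?thesis using rep_ip_real[OF S(2) d(1) rep_meas[OF h'(1)] rep_AE[OF h'(1)]] by simp
   qed
   moreover have "integral\<^sup>L (lebesgue_on ?Q) (%z. L.Dl z * h z) = ip L.Dl h'"
    using rep_ip_real[OF S(2) rD rep_meas[OF h'(1)] rep_AE[OF h'(1)]] pair_D[OF rep_out[OF h'(1)]] by simp
   ultimately show ?thesis using L.D_tendsto[OF t0(1) h'(2), unfolded V2eq, OF rep_out[OF h'(1)]] by simp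
  qed
  then show ?thesis using wd L2_iff_rep[OF S(2) rD] Dlc[OF t0(1)] by blast
 qed
 have c7: "L2 (cyl K 0 T) u \<and> (\<forall>h. L2 (cyl K 0 T) h -->
      (%k. integral\<^sup>L (lebesgue_on (cyl K 0 T)) (%z. U (\<delta> (r k)) z * h z))
      ~~> integral\<^sup>L (lebesgue_on (cyl K 0 T)) (%z. u z * h z))"
  if K: "compact K \<and> K \<subseteq> \<Omega>1" for K
 proof -
  have SK: "cyl K 0 T \<in> sets borel" using K by (intro cyl_borel borel_compact) auto
  have subK: "cyl K 0 T \<subseteq> cyl \<Omega> 0 T" using K sub1 by (auto simp: cyl_def)
  let ?F = "%z. ind (cyl K 0 T) z * F.F z"
  have sF: "sqi ?F" using sqi_indicator[OF F.F_sqi SK] by simp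
  have rF: "rep (cyl K 0 T) u ?F"
   unfolding rep_def
  proof (intro conjI allI impI AE_I2)
   show "?F \<in> BM" by (rule sqi_meas[OF sF])
   show "u z = ?F z" if "z \<in> cyl K 0 T" for z
   proof -
    have "fst z \<notin> V2" using that K sub2(2) by (auto simp: cyl_def)
    then show ?thesis using that by (simp add: u_def)
   qed
  qed simp
  have "(%k. integral\<^sup>L (lebesgue_on (cyl K 0 T)) (%z. U (\<delta> (r k)) z * h z))
    ~~> integral\<^sup>L (lebesgue_on (cyl K 0 T)) (%z. u z * h z)" if h: "L2 (cyl K 0 T) h" for h
  proof -
   obtain h' where h': "rep (cyl K 0 T) h h'" "sqi h'" using L2_rep_ex[OF SK h] by blast
   have "integral\<^sup>L (lebesgue_on (cyl K 0 T)) (%z. U (\<delta> n) z * h z) = ip (u' n) h'" for n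
    by (rule integral_rep_real[OF SK subK ru rep_meas[OF h'(1)] rep_AE[OF h'(1)] rep_out[OF h'(1)]])
   moreover have "integral\<^sup>L (lebesgue_on (cyl K 0 T)) (%z. u z * h z) = ip ?F h'"
    by (rule rep_ip_real[OF SK rF rep_meas[OF h'(1)] rep_AE[OF h'(1)]])
   moreover have "ip ?F h' = ip F.F h'"
    unfolding ip_def by (intro int_cong) (use rep_out[OF h'(1)] in \<open>auto simp: indicator_def\<close>)
   ultimately show ?thesis using L.interior_weak[OF conjunct1[OF K] conjunct2[OF K] h'(2) rep_out[OF h'(1)]] by simp
  qed
  then show ?thesis using L2_iff_rep[OF SK rF] sF by blast
 qed
 have rw: "rep (cyl \<Omega> 0 T) (%z. if fst z \<in> V2 then g z else 0) g'" if g: "rep (cyl V2 0 T) g g'" for g g' :: "'a \<times> real => real"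
  unfolding rep_def
 proof (intro conjI allI impI)
  show "g' \<in> BM" by (rule rep_meas[OF g])
  show "g' z = 0" if "z \<notin> cyl \<Omega> 0 T" for z using that sub2(1) by (intro rep_out[OF g]) (auto simp: cyl_def)
  show "AE z in lborel. z \<in> cyl \<Omega> 0 T --> (if fst z \<in> V2 then g z else 0) = g' z"
   using rep_AE[OF g]
  proof eventually_elim
   case (elim z)
   show ?case using elim rep_out[OF g, of z] by (cases z) (auto simp: cyl_def)
  qed
 qed
 \<comment> \<open>The zero extension has the weak gradient \<open>L.Gl\<close> on all of \<Omega>,
   so it has no jump across Gamma.\<close>
 have c8: "L2H1x \<Omega> 0 T (%z. if fst z \<in> V2 then b (fst z) * u z else 0) L.Gl"
 proof -
  have "rep (cyl \<Omega> 0 T) L.Gl L.Gl"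
   by (rule rep_self[OF sqi_meas[OF L.l_sqi(2)] l_out(2)]) (use sub2(1) in \<open>auto simp: cyl_def\<close>)
  then show ?thesis using L2H1x_iff[OF op(1) rw[OF rw2]] L.l_sqi L.wgrad_l by simp
 qed
 \<comment> \<open>The test function is the backward integral of \<open>- d\<close>, which therefore
   serves as \<Psi> in the limit equation; the trace formula turns the term with the initial value
   into an integral over \<open>V2\<close>. The gradient on \<Omega> that the equation needs comes
   from the zero extension of the test function, and over \<open>V2\<close> it acts like the given
   gradient.\<close>
 have c9: "integral\<^sup>L (lebesgue_on (cyl V2 0 T)) (%z. - u z * D\<phi> z + L.Gl z \<bullet> G\<phi> z)
    = integral\<^sup>L (lebesgue_on V2) (%x. ubar x * \<phi> (x, 0)) + integral\<^sup>L (lebesgue_on (cyl V2 0 T)) (%z. f z * \<phi> z)"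
  if a: "L2H1x V2 0 T \<phi> G\<phi>" "L2 (cyl V2 0 T) D\<phi>" "weak_dt (cyl V2 0 T) \<phi> D\<phi>" "cont_L2_time V2 T \<phi>"
   "integral\<^sup>L (lebesgue_on V2) (%x. (\<phi> (x, T))\<^sup>2) = 0" "L2H1x \<Omega> 0 T (%z. if fst z \<in> V2 then \<phi> z else 0) Ge"
  for \<phi> D\<phi> G\<phi> Ge
 proof -
  obtain \<phi>' where \<phi>': "rep (cyl V2 0 T) \<phi> \<phi>'" "sqi \<phi>'" using L2_rep_ex[OF S(2)] a(1) unfolding L2H1x_def by blast
  obtain g where g: "rep (cyl V2 0 T) G\<phi> g" "sqi g" using L2v_rep_ex[OF S(2)] a(1) unfolding L2H1x_def by blast
  obtain d where d: "rep (cyl V2 0 T) D\<phi> d" "sqi d" using L2_rep_ex[OF S(2) a(2)] by blast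
  obtain ge where ge: "rep (cyl \<Omega> 0 T) Ge ge" "sqi ge" using L2v_rep_ex[OF S(1)] a(6) unfolding L2H1x_def by blast
  have wg: "wgrad V2 \<phi>' g" using L2H1x_iff[OF oV2 \<phi>'(1) g(1)] a(1) by simp
  have wge: "wgrad \<Omega> \<phi>' ge" using L2H1x_iff[OF op(1) rw[OF \<phi>'(1)] ge(1)] a(6) by simp
  have in0T: "0 \<in> {0..T}" "T \<in> {0..T}" using T by auto
  have "L2 V2 (%x. \<phi> (x, 0))" using a(4) in0T by (simp add: cont_L2_time_def)
  then obtain y where y: "rep V2 (%x. \<phi> (x, 0)) y" "sqi y" using L2_rep_ex[OF V2B] by blast
  have wd: "ip \<phi>' (%z. p (fst z) * fder q (snd z) 1) = - ip d (p \<otimes> q)"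
   if "test_fun V2 p" "test_fun {0<..<T} q" for p q
   by (rule weak_dt_tensor[OF oV2 order_refl \<phi>'(1) d(1) a(3) that])
  have near_0: "\<exists>\<tau>>0. AE t in lborel. 0 < t \<and> t < T \<and> \<bar>t - 0\<bar> < \<tau> --> (LBINT x. (\<phi>' (x, t) - y x)\<^sup>2) <= e" if "e > 0" for e
   by (rule cont_L2_time_near[OF V2B a(4) \<phi>'(1) in0T(1) y _ that]) simp
  have near_T: "\<exists>\<tau>>0. AE t in lborel. 0 < t \<and> t < T \<and> \<bar>t - T\<bar> < \<tau> --> (LBINT x. (\<phi>' (x, t))\<^sup>2) <= e" if "e > 0" for e
  proof -
   have "rep V2 (%x. 0::real) (%x. 0)" by (simp add: rep_def)
   from cont_L2_time_near[OF V2B a(4) \<phi>'(1) in0T(2) this sqi_zero _ that] show ?thesis using a(5) by simp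
  qed
  have tr1: "AE z in lborel. \<phi>' z = tk (kback T) (%z. - d z) z"
   by (rule trace_representation(1)[OF oV2 T \<phi>'(2) rep_out[OF \<phi>'(1)] d(2) rep_out[OF d(1)] y(2) rep_out[OF y(1)] wd near_0 near_T])
  have tr2: "ip y ub' = - ip d (%z. ub' (fst z) * ind {0<..<T} (snd z))"
   by (rule trace_representation(2)[OF oV2 T \<phi>'(2) rep_out[OF \<phi>'(1)] d(2) rep_out[OF d(1)] y(2) rep_out[OF y(1)] wd near_0 near_T]) (use ub'(2) in simp_all)
  have sd: "sqi (%z. - d z)" by (rule sqi_minus[OF d(2)])
  have lq: "ip L.ul (%z. - d z) - ip F.uT (%z. - d z) + ip L.Gl ge = ip f' \<phi>'"
  proof (rule L.limit_eq[OF sd _ \<phi>'(2) tr1 ge(2) rep_out[OF ge(1)] wge])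
   show "- d z = 0" if "z \<notin> cyl F.V2 0 T" for z using that rep_out[OF d(1), of z] by (simp add: V2eq)
  qed
  have uT: "F.uT = (%z. ub' (fst z) * ind {0<..<T} (snd z))" by (rule ext) (simp add: F.uT_def)
  have gge: "ip L.Gl ge = ip L.Gl g"
   using wgrad_unique[OF oV2 wgrad_mono[OF wge sub2(1)] wg ge(2) g(2) _ L.l_sqi(2) l_out(2)]
    ip_commute[of ge L.Gl] ip_commute[of g L.Gl] by simp
  have "integral\<^sup>L (lebesgue_on (cyl V2 0 T)) (%z. - u z * D\<phi> z + L.Gl z \<bullet> G\<phi> z) = (LBINT z. L.ul z \<bullet> (- d z) + L.Gl z \<bullet> g z)"
  proof (rule lebesgue_on_integral_eq(1)[OF S(2)])
   have [measurable]: "L.ul \<in> BM" "d \<in> BM" "L.Gl \<in> BM" "g \<in> BM"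
    using sqi_meas L.l_sqi d g by auto
   show "(%z. L.ul z \<bullet> (- d z) + L.Gl z \<bullet> g z) \<in> BM" by measurable
   show "AE z in lborel. z \<in> cyl V2 0 T --> - u z * D\<phi> z + L.Gl z \<bullet> G\<phi> z = L.ul z \<bullet> (- d z) + L.Gl z \<bullet> g z"
    using rep_AE[OF ru2] rep_AE[OF d(1)] rep_AE[OF g(1)] by eventually_elim auto
  qed (simp add: l_out)
  also have "\<dots> = ip L.ul (%z. - d z) + ip L.Gl g"
   unfolding ip_def by (intro Bochner_Integration.integral_add ip_integrable L.l_sqi sd g)
  also have "\<dots> = ip F.uT (%z. - d z) + ip f' \<phi>'" using lq gge by simp
  also have "ip f' \<phi>' = integral\<^sup>L (lebesgue_on (cyl V2 0 T)) (%z. f z * \<phi> z)"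
   by (rule integral_rep_real[OF S(2) _ f'(1) rep_meas[OF \<phi>'(1)] rep_AE[OF \<phi>'(1)] rep_out[OF \<phi>'(1)], symmetric]) (use cyl2(2) in simp)
  also have "ip F.uT (%z. - d z) = ip y ub'"
   using tr2 ip_minus_right[of F.uT d] ip_commute[of d F.uT] by (simp add: uT)
  also have "ip y ub' = integral\<^sup>L (lebesgue_on V2) (%x. ubar x * \<phi> (x, 0))"
   using integral_rep_real[OF V2B sub2(1) ub'(1) rep_meas[OF y(1)] rep_AE[OF y(1)] rep_out[OF y(1)]] ip_commute[of y ub'] by simp
  finally show ?thesis .
 qed
 have c10: "AE z in lebesgue_on (cyl \<Omega>1 0 T). u z = ubar (fst z) + integral\<^sup>L (lebesgue_on {0..snd z}) (%\<tau>. f (fst z, \<tau>))"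
 proof -
  have S1: "cyl \<Omega>1 0 T \<in> sets borel" using op(2) by (intro cyl_borel borel_open)
  have "AE x in lborel. AE \<tau> in lborel. (x, \<tau>) \<in> cyl \<Omega> 0 T --> f (x, \<tau>) = f' (x, \<tau>)"
   by (rule AE_slices(1)[OF rep_AE[OF f'(1)]])
  from AE_fst[OF this]
  have "AE z in lborel. AE \<tau> in lborel. (fst (z :: 'a \<times> real), \<tau>) \<in> cyl \<Omega> 0 T --> f (fst z, \<tau>) = f' (fst z, \<tau>)" .
  moreover have "AE z in lborel. fst (z :: 'a \<times> real) \<in> \<Omega> --> ubar (fst z) = ub' (fst z)" by (rule AE_fst[OF rep_AE[OF ub'(1)]])
  ultimately have "AE z in lborel. z \<in> cyl \<Omega>1 0 T -->
    u z = ubar (fst z) + integral\<^sup>L (lebesgue_on {0..snd z}) (%\<tau>. f (fst z, \<tau>))"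
  proof eventually_elim
   case (elim z)
   show ?case
   proof
    assume "z \<in> cyl \<Omega>1 0 T"
    then have z: "fst z \<in> \<Omega>1" "0 < snd z" "snd z < T" by (auto simp: cyl_def)
    then have z': "fst z \<in> \<Omega>" "fst z \<notin> V2" using sub1 sub2 by auto
    \<comment> \<open>The open interval matches the kernel behind \<open>F\<close>; its two
      endpoints form a null set.\<close>
    let ?g = "%\<tau>. ind {0<..<snd z} \<tau> * f' (fst z, \<tau>)"
    have "integral\<^sup>L (lebesgue_on {0..snd z}) (%\<tau>. f (fst z, \<tau>)) = (LBINT \<tau>. ?g \<tau>)"
    proof (rule lebesgue_on_integral_eq(1))
     have "(%\<tau>. f' (fst z, \<tau>)) \<in> BM"
      by (intro measurable_compose[OF _ rep_meas[OF f'(1)]] borel_measurable_Pair) auto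
     then show "?g \<in> BM" by measurable
     show "AE \<tau> in lborel. \<tau> \<in> {0..snd z} --> f (fst z, \<tau>) = ?g \<tau>"
      using elim(1) AE_lborel_singleton[of 0] AE_lborel_singleton[of "snd z"]
      by eventually_elim (use z z' in \<open>auto simp: cyl_def indicator_def\<close>)
    qed (auto simp: indicator_def)
    also have "\<dots> = tk (kT (kback T)) f' z"
     unfolding tk_def by (intro int_cong) (use z in \<open>auto simp: kT_def kback_def indicator_def\<close>)
    finally show "u z = ubar (fst z) + integral\<^sup>L (lebesgue_on {0..snd z}) (%\<tau>. f (fst z, \<tau>))"
     using elim(2) z z' by (simp add: u_def F.F_def F.uT_def)
   qed
  qed
  then show ?thesis using S1 by (subst AE_restrict_space_iff) (auto simp: AE_completion_iff)
 qed
 have c2: "L2 (cyl V2 0 T) u" using L2_iff_rep[OF S(2) ru2] L.l_sqi by simp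
 show ?thesis
  unfolding V2_def[symmetric]
  by (rule exI[of _ "%k. \<delta> (r k)"], rule exI[of _ u], rule exI[of _ L.Gl], rule exI[of _ L.Dl], intro conjI)
    ((use \<delta> in blast), rule L.\<delta>_r, rule c2, rule c3, rule c4, (intro allI impI, rule c5, blast, assumption),
    (intro allI impI, elim conjE, rule c6, assumption, assumption), (intro allI impI, rule c7, assumption),
    (rule exI, rule c8), (intro allI impI, elim conjE exE, rule c9, assumption+), rule c10)
qed

end
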